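(* Let $S\subset C(\mathbf{k})$ be finite and let $F,G\in K[x_1,\dots,x_n]$ be a coprime pair of nonconstant polynomials. For any $\epsilon>0$ there exist an integer $m$ and positive reals $c_1,c_2,c_3,c_4$, depending only on $\epsilon$ (for the given $n,F,G$; in particular independent of $S$ and of the tuple below), such that for every $(g_1,\dots,g_n)\in(\mathcal{O}_S^* )^n$ with $$\max_{1\le i\le n}h(g_i)\ge c_1(\tilde h(F)+\tilde h(G))+c_2\max\{0,2\mathfrak g-2+|S|\},$$ either $$h(g_1^{m_1}\cdots g_n^{m_n})\le c_3(\tilde h(F)+\tilde h(G))+c_4\max\{0,2\mathfrak g-2+|S|\}$$ for some integers $m_1,\dots,m_n$, not all zero, with $\sum|m_i|\le 2m$, or the following both hold: (a) $N_{S,\gcd}(F(g_1,\dots,g_n),G(g_1,\dots,g_n))\le\epsilon\max_i h(g_i)$; (b) if moreover not both $F$ and $G$ vanish at $(0,\dots,0)$, then $h_{\gcd}(F(g_1,\dots,g_n),G(g_1,\dots,g_n))\le\epsilon\max_i h(g_i)$.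
   Context: $\mathbf{k}$ is an algebraically closed field of characteristic zero, $C$ a smooth projective curve over $\mathbf{k}$ of genus $\mathfrak g$, $K=\mathbf{k}(C)$; $v_{\mathfrak p}$ is the order-of-vanishing valuation at $\mathfrak p\in C(\mathbf{k})$. $\mathcal{O}_S^*=\{f\in K^*: v_{\mathfrak p}(f)=0\ \forall\mathfrak p\notin S\}$. For $f\in K^*$: $v^0_{\mathfrak p}(f)=\max\{0,v_{\mathfrak p}(f)\}$, $h(f)=\sum_{\mathfrak p}\max\{0,-v_{\mathfrak p}(f)\}$. For $f,g\in K$: $N_{S,\gcd}(f,g)=\sum_{\mathfrak p\notin S}\min\{v^0_{\mathfrak p}(f),v^0_{\mathfrak p}(g)\}$ and $h_{\gcd}(f,g)=\sum_{\mathfrak p\in C}\min\{v^0_{\mathfrak p}(f),v^0_{\mathfrak p}(g)\}$. For nonzero $F=\sum a_{\mathbf i}\mathbf{x}^{\mathbf i}$, $v_{\mathfrak p}(F)=\min_{a_{\mathbf i}\neq0}v_{\mathfrak p}(a_{\mathbf i})$ and $\tilde h(F)=-\sum_{\mathfrak p}\min\{0,v_{\mathfrak p}(F)\}$. *)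

theory Defs
  imports Complex_Main "HOL-Library.Poly_Mapping" "HOL-Library.Extended_Real"
    "HOL-Computational_Algebra.Polynomial"
begin

text \<open>The constant field k is a type 'k of class field_char_0, embedded into the
  field K (a type 'K) via a ring homomorphism iota.  A smooth projective curve C over
  the algebraically closed field k is determined by its function field K, which is a
  function field of one variable over k: it contains an element t transcendental over k
  and K is a finite-dimensional vector space over k(t).\<close>

definition ring_hom_fun :: "('k::field \<Rightarrow> 'K::field) \<Rightarrow> bool" where
  "ring_hom_fun \<iota> \<longleftrightarrow> (\<forall>a b. \<iota> (a + b) = \<iota> a + \<iota> b) \<and> (\<forall>a b. \<iota> (a * b) = \<iota> a * \<iota> b) \<and> \<iota> 1 = 1"

definition alg_closed_field :: "'k::field itself \<Rightarrow> bool" where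
  "alg_closed_field _ \<longleftrightarrow> (\<forall>p::'k poly. degree p \<ge> 1 \<longrightarrow> (\<exists>x. poly p x = 0))"

definition rat_fun_field :: "('k::field \<Rightarrow> 'K::field) \<Rightarrow> 'K \<Rightarrow> 'K set" where
  "rat_fun_field \<iota> t = {poly (map_poly \<iota> p) t / poly (map_poly \<iota> q) t | p q. q \<noteq> 0}"

definition function_field_one_var :: "('k::field \<Rightarrow> 'K::field) \<Rightarrow> bool" where
  "function_field_one_var \<iota> \<longleftrightarrow> (\<exists>t.
      (\<forall>q::'k poly. q \<noteq> 0 \<longrightarrow> poly (map_poly \<iota> q) t \<noteq> 0) \<and>
      (\<exists>B::'K list. \<forall>x. \<exists>cs. length cs = length B \<and> set cs \<subseteq> rat_fun_field \<iota> t \<and>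
            x = (\<Sum>i<length B. cs ! i * B ! i)))"

definition curve_function_field :: "('k::field_char_0 \<Rightarrow> 'K::field) \<Rightarrow> bool" where
  "curve_function_field \<iota> \<longleftrightarrow> ring_hom_fun \<iota> \<and> alg_closed_field TYPE('k) \<and> function_field_one_var \<iota>"

text \<open>Points of C(k) correspond bijectively to the places of K/k, i.e. to the normalized
  discrete valuations of K trivial on k.  A point p is represented by its order-of-vanishing
  valuation v_p :: 'K => int (convention: value 0 at 0, which is never used as a valuation
  value; the value at 0 is treated as +infinity separately below).\<close>

definition is_place :: "('k::field \<Rightarrow> 'K::field) \<Rightarrow> ('K \<Rightarrow> int) \<Rightarrow> bool" where
  "is_place \<iota> v \<longleftrightarrow> v 0 = 0 \<and>
     (\<forall>x y. x \<noteq> 0 \<longrightarrow> y \<noteq> 0 \<longrightarrow> v (x * y) = v x + v y) \<and>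
     (\<forall>x y. x \<noteq> 0 \<longrightarrow> y \<noteq> 0 \<longrightarrow> x + y \<noteq> 0 \<longrightarrow> min (v x) (v y) \<le> v (x + y)) \<and>
     (\<forall>c. c \<noteq> 0 \<longrightarrow> v (\<iota> c) = 0) \<and>
     (\<exists>t. t \<noteq> 0 \<and> v t = 1)"

definition places :: "('k::field \<Rightarrow> 'K::field) \<Rightarrow> ('K \<Rightarrow> int) set" where
  "places \<iota> = {v. is_place \<iota> v}"

section \<open>Genus (Riemann's definition: g = max (deg D - l(D) + 1))\<close>

definition is_divisor :: "('k::field \<Rightarrow> 'K::field) \<Rightarrow> (('K \<Rightarrow> int) \<Rightarrow> int) \<Rightarrow> bool" where
  "is_divisor \<iota> D \<longleftrightarrow> finite {p. D p \<noteq> 0} \<and> {p. D p \<noteq> 0} \<subseteq> places \<iota>"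

definition div_deg :: "(('K \<Rightarrow> int) \<Rightarrow> int) \<Rightarrow> int" where
  "div_deg D = (\<Sum>p\<in>{p. D p \<noteq> 0}. D p)"

definition riemann_roch_space :: "('k::field \<Rightarrow> 'K::field) \<Rightarrow> (('K \<Rightarrow> int) \<Rightarrow> int) \<Rightarrow> 'K set" where
  "riemann_roch_space \<iota> D = {f. f = 0 \<or> (\<forall>p\<in>places \<iota>. p f + D p \<ge> 0)}"

definition k_lin_indep :: "('k::field \<Rightarrow> 'K::field) \<Rightarrow> 'K set \<Rightarrow> bool" where
  "k_lin_indep \<iota> B \<longleftrightarrow> finite B \<and>
     (\<forall>a::'K \<Rightarrow> 'k. (\<Sum>b\<in>B. \<iota> (a b) * b) = 0 \<longrightarrow> (\<forall>b\<in>B. a b = 0))"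

definition ell :: "('k::field \<Rightarrow> 'K::field) \<Rightarrow> (('K \<Rightarrow> int) \<Rightarrow> int) \<Rightarrow> nat" where
  "ell \<iota> D = (GREATEST r. \<exists>B. B \<subseteq> riemann_roch_space \<iota> D \<and> k_lin_indep \<iota> B \<and> card B = r)"

definition genus :: "('k::field \<Rightarrow> 'K::field) \<Rightarrow> int" where
  "genus \<iota> = (GREATEST g. \<exists>D. is_divisor \<iota> D \<and> g = div_deg D - int (ell \<iota> D) + 1)"

definition height :: "('k::field \<Rightarrow> 'K::field) \<Rightarrow> 'K \<Rightarrow> real" where
  "height \<iota> f = real_of_int (\<Sum>p\<in>{p\<in>places \<iota>. p f < 0}. - p f)"

definition S_unit :: "('k::field \<Rightarrow> 'K::field) \<Rightarrow> ('K \<Rightarrow> int) set \<Rightarrow> 'K \<Rightarrow> bool" where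
  "S_unit \<iota> S f \<longleftrightarrow> f \<noteq> 0 \<and> (\<forall>p\<in>places \<iota> - S. p f = 0)"

definition vzero :: "('K::zero \<Rightarrow> int) \<Rightarrow> 'K \<Rightarrow> enat" where
  "vzero p f = (if f = 0 then \<infinity> else enat (nat (max 0 (p f))))"

definition ext_sum :: "('a \<Rightarrow> enat) \<Rightarrow> 'a set \<Rightarrow> enat" where
  "ext_sum \<phi> A = (if finite {x\<in>A. \<phi> x \<noteq> 0} then (\<Sum>x\<in>{x\<in>A. \<phi> x \<noteq> 0}. \<phi> x) else \<infinity>)"

definition N_S_gcd :: "('k::field \<Rightarrow> 'K::field) \<Rightarrow> ('K \<Rightarrow> int) set \<Rightarrow> 'K \<Rightarrow> 'K \<Rightarrow> enat" where
  "N_S_gcd \<iota> S f g = ext_sum (\<lambda>p. min (vzero p f) (vzero p g)) (places \<iota> - S)"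

definition h_gcd :: "('k::field \<Rightarrow> 'K::field) \<Rightarrow> 'K \<Rightarrow> 'K \<Rightarrow> enat" where
  "h_gcd \<iota> f g = ext_sum (\<lambda>p. min (vzero p f) (vzero p g)) (places \<iota>)"

type_synonym 'K mpoly_pm = "(nat \<Rightarrow>\<^sub>0 nat) \<Rightarrow>\<^sub>0 'K"

definition in_vars :: "nat \<Rightarrow> ('K::zero) mpoly_pm \<Rightarrow> bool" where
  "in_vars n F \<longleftrightarrow> (\<forall>m\<in>Poly_Mapping.keys F. Poly_Mapping.keys m \<subseteq> {..<n})"

definition nonconstant :: "('K::zero) mpoly_pm \<Rightarrow> bool" where
  "nonconstant F \<longleftrightarrow> \<not> Poly_Mapping.keys F \<subseteq> {0}"

definition mpoly_coprime :: "('K::field) mpoly_pm \<Rightarrow> 'K mpoly_pm \<Rightarrow> bool" where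
  "mpoly_coprime F G \<longleftrightarrow> (\<forall>D. D dvd F \<longrightarrow> D dvd G \<longrightarrow> Poly_Mapping.keys D \<subseteq> {0})"

definition mpoly_eval :: "('K::field) mpoly_pm \<Rightarrow> (nat \<Rightarrow> 'K) \<Rightarrow> 'K" where
  "mpoly_eval F g = (\<Sum>m\<in>Poly_Mapping.keys F. Poly_Mapping.lookup F m * (\<Prod>i\<in>Poly_Mapping.keys m. g i ^ Poly_Mapping.lookup m i))"

definition mpoly_val :: "('K \<Rightarrow> int) \<Rightarrow> ('K::field) mpoly_pm \<Rightarrow> int" where
  "mpoly_val p F = Min ((\<lambda>m. p (Poly_Mapping.lookup F m)) ` Poly_Mapping.keys F)"

definition mpoly_height :: "('k::field \<Rightarrow> 'K::field) \<Rightarrow> 'K mpoly_pm \<Rightarrow> real" where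
  "mpoly_height \<iota> F = - real_of_int (\<Sum>p\<in>{p\<in>places \<iota>. mpoly_val p F < 0}. mpoly_val p F)"

end

theory Submission
  imports Defs "HOL-Computational_Algebra.Formal_Laurent_Series" "Jordan_Normal_Form.Determinant"
begin

text \<open>Choose a divisor \<open>e\<close> whose Riemann--Roch space contains all coefficients in sight and look at the
  sums of \<open>c \<mu> g\<^sup>\<mu>\<close> over the exponents \<open>\<mu>\<close> bounded by \<open>d\<close>, with \<open>c \<mu>\<close> in the space of a multiple of \<open>e\<close>.
  If such a sum vanishes nontrivially, the Wronskian inequality for dependent units gives a monomial
  in the \<open>g i\<close> of small height. Otherwise eliminate the \<open>i\<close>-th variable from \<open>F\<close> and \<open>G\<close> for every \<open>i\<close>: the
  multiples of the eliminants \<open>R i\<close> span a space \<open>V\<close> of almost full dimension. Take the Wronskian of a basis of \<open>V\<close>.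
  Outside \<open>S\<close> every element of \<open>V\<close> vanishes at least to the common order of \<open>F(g)\<close> and \<open>G(g)\<close>. At a place of \<open>S\<close>
  change the basis to multiples of the \<open>R i\<close> with distinct leading monomials, so that almost all monomials \<open>g\<^sup>\<mu>\<close> in the box
  occur; since these are \<open>S\<close>-units, their valuations over \<open>S\<close> sum to zero. The product formula then bounds the common zeros
  outside \<open>S\<close> by the small defect in dimension times the maximal height plus the loss of the derivation.
  Zeros at places in \<open>S\<close> are controlled by the same inequality applied to the monomials of \<open>F\<close> or \<open>G\<close>. When
  all coefficients are constants and \<open>S\<close> has two points, no error term is available, and one uses
  the derivation \<open>u d/du\<close> for a generator \<open>u\<close> of the \<open>S\<close>-units, which loses nothing.\<close>

text \<open>The i-th eliminant does not contain the i-th variable, so multiplying it by monomials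
  costs room in the box only in the other directions. Hence a monomial of the box is lost as a
  leading monomial only if two of its exponents lie near the ends, a proportion O(1/d^2). This is
  decisive: each missing dimension is paid with a valuation of size d times the maximal height H, so
  a loss O(1/d^2) leaves an error O(H/d), below \<epsilon> H / 2 for large d, whereas a loss O(1/d)
  would leave O(H). The coefficient spaces must not spoil this: multiplying by an eliminant replaces
  r e by (r + 1) e, whose dimension exceeds that of r e by at most deg e; so r is taken of size (deg
  e) (d + 1)^2. All constants may depend on F and G and thus on the curve. The fixed part of the
  loss of the derivation is therefore absorbed by the heights of F and G, whose sum is at least 1
  once a coefficient is nonconstant, or by 2 genus - 2 + |S|, which is at least 1 once |S| \<ge> 3.
  For |S| < 2 every S-unit is constant by the product formula.\<close>

hide_const (open) Module.smult

section \<open>Elimination for coprime polynomials in several variables\<close>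

text \<open>Unique factorization in \<open>K[x\<^sub>i | i \<in> X]\<close>, seen as a subring of one big polynomial ring that is
  closed under taking factors; \<open>\<mu>\<close> is the total degree.\<close>

locale factorial_subring =
  fixes S :: "'r::idom set" and \<mu> :: "'r \<Rightarrow> nat"
  assumes S_one: "1 \<in> S"
    and S_diff: "\<And>a b. a \<in> S \<Longrightarrow> b \<in> S \<Longrightarrow> a - b \<in> S"
    and S_mult: "\<And>a b. a \<in> S \<Longrightarrow> b \<in> S \<Longrightarrow> a * b \<in> S"
    and S_factor: "\<And>a b. a * b \<in> S \<Longrightarrow> a * b \<noteq> 0 \<Longrightarrow> a \<in> S"
    and \<mu>_mult: "\<And>a b. a \<noteq> 0 \<Longrightarrow> b \<noteq> 0 \<Longrightarrow> \<mu> (a * b) = \<mu> a + \<mu> b"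
    and \<mu>_zero: "\<And>a. a \<in> S \<Longrightarrow> a \<noteq> 0 \<Longrightarrow> \<mu> a = 0 \<Longrightarrow> a dvd 1"
    and irred_prime: "\<And>p a b. p \<in> S \<Longrightarrow> irreducible p \<Longrightarrow> a \<in> S \<Longrightarrow> b \<in> S \<Longrightarrow>
          p dvd a * b \<Longrightarrow> p dvd a \<or> p dvd b"
begin

lemma S_zero: "0 \<in> S" using S_diff[OF S_one S_one] by simp
lemma S_add: "a \<in> S \<Longrightarrow> b \<in> S \<Longrightarrow> a + b \<in> S"
  using S_diff[OF _ S_diff[OF S_zero]] by fastforce
lemma S_sum: "(\<And>i. i \<in> I \<Longrightarrow> f i \<in> S) \<Longrightarrow> sum f I \<in> S"
  by (induction I rule: infinite_finite_induct) (auto simp: S_zero S_add)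

lemma S_factor2: "a * b \<in> S \<Longrightarrow> a * b \<noteq> 0 \<Longrightarrow> b \<in> S"
  using S_factor[of b a] by (simp add: mult.commute)

lemma ex_irreducible_factor:
  assumes "a \<in> S" "a \<noteq> 0" "\<not> a dvd 1"
  shows "\<exists>p\<in>S. irreducible p \<and> p dvd a"
  using assms
proof (induction "\<mu> a" arbitrary: a rule: less_induct)
  case less
  show ?case
  proof (cases "irreducible a")
    case False
    then obtain b c where bc: "a = b * c" "\<not> b dvd 1" "\<not> c dvd 1"
      using less.prems unfolding irreducible_def by blast
    have nz: "b \<noteq> 0" "c \<noteq> 0" using bc less.prems(2) by auto
    have bS: "b \<in> S" "c \<in> S"
      using S_factor[of b c] S_factor2[of b c] bc(1) less.prems(1,2) by simp_all
    have "\<mu> c \<noteq> 0" using \<mu>_zero bS nz bc by blast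
    hence "\<mu> b < \<mu> a" using bc \<mu>_mult nz by simp
    from less.hyps[OF this bS(1) nz(1) bc(2)] show ?thesis using bc by auto
  qed (use less.prems in auto)
qed

text \<open>The polynomial ring S[y] as a subset of polynomials over the ambient domain:
  divisibility is the ambient one, and \<open>PS_factor\<close> shows that quotients by nonzero
  elements stay inside.\<close>

definition PS :: "'r poly set" where "PS = {p. \<forall>i. coeff p i \<in> S}"

lemma PS_coeff: "p \<in> PS \<Longrightarrow> coeff p i \<in> S" by (simp add: PS_def)
lemma PS_zero: "0 \<in> PS" by (simp add: PS_def S_zero)
lemma PS_diff: "p \<in> PS \<Longrightarrow> q \<in> PS \<Longrightarrow> p - q \<in> PS" by (simp add: PS_def S_diff)
lemma PS_add: "p \<in> PS \<Longrightarrow> q \<in> PS \<Longrightarrow> p + q \<in> PS" by (simp add: PS_def S_add)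
lemma PS_mult: "p \<in> PS \<Longrightarrow> q \<in> PS \<Longrightarrow> p * q \<in> PS"
  by (auto simp: PS_def coeff_mult intro!: S_sum S_mult)
lemma PS_smult: "c \<in> S \<Longrightarrow> p \<in> PS \<Longrightarrow> smult c p \<in> PS" by (simp add: PS_def S_mult)
lemma PS_const: "c \<in> S \<Longrightarrow> [:c:] \<in> PS" by (auto simp: PS_def coeff_pCons S_zero split: nat.split)
lemma PS_monom: "c \<in> S \<Longrightarrow> monom c n \<in> PS" by (auto simp: PS_def S_zero)

text \<open>The leading coefficient of z is a factor of a nonzero element of S, hence lies in S.
  Subtracting the leading term of z lowers the degree.\<close>

lemma PS_factor:
  assumes "q \<in> PS" "q \<noteq> 0" "q * z \<in> PS"
  shows "z \<in> PS"
  using assms(3)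
proof (induction "degree z" arbitrary: z rule: less_induct)
  case less
  show ?case
  proof (cases "z = 0")
    case False
    have "lead_coeff q * lead_coeff z \<in> S"
      using PS_coeff[OF less.prems, of "degree q + degree z"] by (simp add: coeff_mult_degree_sum)
    hence lc: "lead_coeff z \<in> S" using S_factor2 False assms(2) by simp
    define z' where "z' = z - monom (lead_coeff z) (degree z)"
    have z: "z = z' + monom (lead_coeff z) (degree z)" by (simp add: z'_def)
    have "q * z' = q * z - q * monom (lead_coeff z) (degree z)" by (simp add: z'_def algebra_simps)
    hence qz': "q * z' \<in> PS" using PS_diff[OF less.prems PS_mult[OF assms(1) PS_monom[OF lc]]] by simp
    have "z' \<in> PS"
    proof (cases "degree z = 0")
      case True
      hence "z' = 0" by (auto simp: z'_def poly_eq_iff coeff_eq_0)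
      thus ?thesis by (simp add: PS_zero)
    next
      case False
      have "degree z' < degree z"
      proof (rule degree_lessI)
        show "z' \<noteq> 0 \<or> 0 < degree z" using False by simp
        show "\<forall>k\<ge>degree z. coeff z' k = 0" by (auto simp: z'_def coeff_eq_0)
      qed
      from less.hyps[OF this qz'] show ?thesis .
    qed
    thus ?thesis by (subst z) (intro PS_add PS_monom lc)
  qed (simp add: PS_zero)
qed

text \<open>Gauss's lemma. If i and j are the first indices at which p fails to divide the
  coefficients of a and b, the coefficient of a b at i + j is congruent modulo p to the product of
  these two.\<close>

lemma const_prime:
  assumes p: "p \<in> S" "irreducible p" and ab: "a \<in> PS" "b \<in> PS" and dvd: "[:p:] dvd a * b"
  shows "[:p:] dvd a \<or> [:p:] dvd b"
proof (rule ccontr)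
  assume "\<not> ?thesis"
  hence ea: "\<exists>i. \<not> p dvd coeff a i" and eb: "\<exists>i. \<not> p dvd coeff b i"
    by (auto simp: const_poly_dvd_iff)
  define i where "i = (LEAST i. \<not> p dvd coeff a i)"
  define j where "j = (LEAST i. \<not> p dvd coeff b i)"
  have i: "\<not> p dvd coeff a i" "\<And>k. k < i \<Longrightarrow> p dvd coeff a k"
    unfolding i_def using LeastI_ex[OF ea] not_less_Least[of _ "\<lambda>i. \<not> p dvd coeff a i"] by blast+
  have j: "\<not> p dvd coeff b j" "\<And>k. k < j \<Longrightarrow> p dvd coeff b k"
    unfolding j_def using LeastI_ex[OF eb] not_less_Least[of _ "\<lambda>i. \<not> p dvd coeff b i"] by blast+
  have "p dvd coeff (a * b) (i + j)" using dvd by (simp add: const_poly_dvd_iff)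
  also have "coeff (a * b) (i + j) = coeff a i * coeff b j
      + (\<Sum>k\<in>{..i+j} - {i}. coeff a k * coeff b (i + j - k))"
    by (simp add: coeff_mult sum.remove[of _ i])
  finally have "p dvd coeff a i * coeff b j + (\<Sum>k\<in>{..i+j} - {i}. coeff a k * coeff b (i + j - k))" .
  moreover have "p dvd (\<Sum>k\<in>{..i+j} - {i}. coeff a k * coeff b (i + j - k))"
  proof (rule dvd_sum)
    fix k assume k: "k \<in> {..i+j} - {i}"
    show "p dvd coeff a k * coeff b (i + j - k)"
    proof (cases "k < i")
      case False
      hence "i + j - k < j" using k by auto
      thus ?thesis using j(2) by simp
    qed (use i(2) in simp)
  qed
  ultimately have "p dvd coeff a i * coeff b j" by (simp add: dvd_add_left_iff)
  thus False using irred_prime[OF p PS_coeff[OF ab(1)] PS_coeff[OF ab(2)]] i(1) j(1) by blast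
qed

definition primitive :: "'r poly \<Rightarrow> bool" where
  "primitive q \<longleftrightarrow> (\<forall>p\<in>S. irreducible p \<longrightarrow> \<not> [:p:] dvd q)"

text \<open>The irreducible factors of c are removed one at a time: each divides the product of q
  with the cofactor z, but not the primitive q, so by Gauss's lemma it divides z and can be
  cancelled.\<close>

lemma primitive_dvd_smult:
  assumes q: "q \<in> PS" "q \<noteq> 0" "primitive q"
    and c: "c \<in> S" "c \<noteq> 0" and b: "b \<in> PS" and dvd: "q dvd smult c b"
  shows "q dvd b"
  using c dvd
proof (induction "\<mu> c" arbitrary: c rule: less_induct)
  case less
  obtain z where z: "smult c b = q * z" using less.prems by (auto elim: dvdE)
  show ?case
  proof (cases "c dvd 1")
    case True
    then obtain d where "1 = c * d" by (auto elim: dvdE)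
    hence "b = smult d (smult c b)" by (simp add: mult.commute)
    also have "\<dots> = q * smult d z" using z by simp
    finally show ?thesis by (metis dvd_triv_left)
  next
    case False
    then obtain p where p: "p \<in> S" "irreducible p" "p dvd c"
      using ex_irreducible_factor less.prems by blast
    then obtain c' where c': "c = p * c'" by (auto elim: dvdE)
    have zPS: "z \<in> PS" using PS_factor[OF q(1,2)] PS_smult[OF less.prems(1) b] z by simp
    have "q * z = [:p:] * smult c' b" unfolding z[symmetric] c' by (simp add: mult.commute)
    hence "[:p:] dvd q * z" by (metis dvd_triv_left)
    hence "[:p:] dvd z" using const_prime[OF p(1,2) q(1) zPS] q(3) p by (auto simp: primitive_def)
    then obtain z' where z': "z = [:p:] * z'" by (auto elim: dvdE)
    have pnz: "p \<noteq> 0" "\<not> p dvd 1" using p by (auto dest: irreducible_not_unit)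
    have "smult p (smult c' b) = smult p (q * z')" using z z' c' by simp
    hence "smult c' b = q * z'" using pnz by (simp add: smult_eq_iff smult_cancel)
    moreover have c'S: "c' \<in> S" "c' \<noteq> 0" using c' less.prems S_factor2 by auto
    moreover have "\<mu> c' < \<mu> c"
      using c' \<mu>_mult[of p c'] pnz c'S \<mu>_zero[OF p(1)] by auto
    ultimately show ?thesis using less.hyps[of c'] by auto
  qed
qed

text \<open>Every extracted irreducible constant strictly lowers \<mu> of the leading coefficient,
  so the extraction stops.\<close>

lemma primitive_part:
  assumes "h \<in> PS" "h \<noteq> 0"
  shows "\<exists>c h'. c \<in> S \<and> c \<noteq> 0 \<and> h' \<in> PS \<and> h = smult c h' \<and> primitive h'"
  using assms
proof (induction "\<mu> (lead_coeff h)" arbitrary: h rule: less_induct)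
  case less
  show ?case
  proof (cases "primitive h")
    case True
    thus ?thesis using less.prems S_one by (intro exI[of _ 1] exI[of _ h]) auto
  next
    case False
    then obtain p h1 where p: "p \<in> S" "irreducible p" and h: "h = [:p:] * h1"
      by (auto simp: primitive_def elim: dvdE)
    have pnz: "p \<noteq> 0" "\<not> p dvd 1" using p by (auto dest: irreducible_not_unit)
    have h1: "h1 \<in> PS" "h1 \<noteq> 0"
      using PS_factor[OF PS_const[OF p(1)]] pnz h less.prems by auto
    have "lead_coeff h = p * lead_coeff h1" using h by simp
    hence "\<mu> (lead_coeff h1) < \<mu> (lead_coeff h)"
      using \<mu>_mult[of p "lead_coeff h1"] pnz h1 \<mu>_zero[OF p(1)] by auto
    from less.hyps[OF this h1] obtain c h' where "c \<in> S" "c \<noteq> 0" "h' \<in> PS" "h1 = smult c h'" "primitive h'"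
      by blast
    thus ?thesis using p pnz h S_mult by (intro exI[of _ "c * p"] exI[of _ h']) auto
  qed
qed

lemma pseudo_division:
  assumes h: "h \<in> PS" "h \<noteq> 0" and f: "f \<in> PS"
  shows "\<exists>c q r. c \<in> S \<and> c \<noteq> 0 \<and> q \<in> PS \<and> r \<in> PS \<and> smult c f = q * h + r \<and> (r = 0 \<or> degree r < degree h)"
proof -
  have *: "\<exists>c q r. c \<in> S \<and> c \<noteq> 0 \<and> q \<in> PS \<and> r \<in> PS \<and> smult c f = q * h + r \<and> (r = 0 \<or> degree r < degree h)"
    if "f \<in> PS" "f = 0 \<or> degree f < n" for n f
    using that
  proof (induction n arbitrary: f)
    case (Suc n)
    show ?case
    proof (cases "f = 0 \<or> degree f < degree h")
      case True
      thus ?thesis using S_one PS_zero Suc.prems by - (rule exI[of _ 1], rule exI[of _ 0], rule exI[of _ f], auto)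
    next
      case False
      define m where "m = monom (lead_coeff f) (degree f - degree h)"
      define f1 where "f1 = smult (lead_coeff h) f - m * h"
      have m: "m \<in> PS" unfolding m_def by (intro PS_monom PS_coeff Suc.prems)
      have f1: "f1 \<in> PS" unfolding f1_def
        by (intro PS_diff PS_smult PS_mult m h PS_coeff Suc.prems)
      have "coeff f1 k = 0" if "k \<ge> degree f" for k
      proof (cases "k = degree f")
        case True
        thus ?thesis using False by (simp add: f1_def m_def coeff_monom_mult)
      next
        case F: False
        hence "coeff f k = 0" "coeff h (k - (degree f - degree h)) = 0"
          using that False by (auto intro!: coeff_eq_0)
        thus ?thesis by (simp add: f1_def m_def coeff_monom_mult)
      qed
      hence "f1 = 0 \<or> degree f1 < n"
      proof (cases "f1 = 0")
        case F: False
        have "degree f1 < degree f"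
        proof (rule ccontr)
          assume "\<not> degree f1 < degree f"
          hence "lead_coeff f1 = 0" using \<open>\<And>k. k \<ge> degree f \<Longrightarrow> coeff f1 k = 0\<close> by simp
          thus False using F by simp
        qed
        thus ?thesis using Suc.prems False by auto
      qed simp
      from Suc.IH[OF f1 this] obtain c q r where 1: "c \<in> S" "c \<noteq> 0" "q \<in> PS" "r \<in> PS"
        "smult c f1 = q * h + r" "r = 0 \<or> degree r < degree h" by auto
      have "smult (c * lead_coeff h) f = (q + smult c m) * h + r"
        using 1(5) by (simp add: f1_def algebra_simps smult_diff_right)
      thus ?thesis using 1 h m
        by (intro exI[of _ "c * lead_coeff h"] exI[of _ "q + smult c m"] exI[of _ r])
           (auto intro!: S_mult PS_coeff PS_add PS_smult)
    qed
  next
    case 0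
    thus ?case using S_one PS_zero by - (rule exI[of _ 1], rule exI[of _ 0], rule exI[of _ 0], auto)
  qed
  show ?thesis using *[OF f, of "Suc (degree f)"] by simp
qed

text \<open>A substitute for the resultant. Take h of least degree in the ideal of f and g. If h is
  constant, it is the eliminant. Otherwise pseudo-division shows that h divides a constant multiple
  of f and of g, and its primitive part then divides f and g themselves.\<close>

lemma eliminate_or_common_factor:
  assumes fg: "f \<in> PS" "g \<in> PS" "f \<noteq> 0"
  shows "(\<exists>u v r. u \<in> PS \<and> v \<in> PS \<and> r \<in> S \<and> r \<noteq> 0 \<and> u * f + v * g = [:r:]) \<or>
         (\<exists>h. h \<in> PS \<and> degree h \<ge> 1 \<and> h dvd f \<and> h dvd g)"
proof -
  define I where "I = {h. h \<noteq> 0 \<and> (\<exists>u\<in>PS. \<exists>v\<in>PS. h = u * f + v * g)}"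
  have gen: "\<exists>u\<in>PS. \<exists>v\<in>PS. f = u * f + v * g" "\<exists>u\<in>PS. \<exists>v\<in>PS. g = u * f + v * g"
    by (rule bexI[of _ "[:1:]"], rule bexI[of _ 0], auto intro: PS_const S_one PS_zero)
       (rule bexI[of _ 0], rule bexI[of _ "[:1:]"], auto intro: PS_const S_one PS_zero)
  have "f \<in> I" unfolding I_def using fg gen(1) by simp
  hence ne: "\<exists>h. h \<in> I" by blast
  obtain h where hI: "h \<in> I" and hmin: "\<And>k. k \<in> I \<Longrightarrow> degree h \<le> degree k"
    using ex_has_least_nat[of "\<lambda>h. h \<in> I" _ degree] ne by blast
  obtain u v where uv: "u \<in> PS" "v \<in> PS" "h = u * f + v * g" "h \<noteq> 0" using hI by (auto simp: I_def)
  have h: "h \<in> PS" using uv fg by (auto intro: PS_add PS_mult)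
  show ?thesis
  proof (cases "degree h = 0")
    case True
    then obtain r where "h = [:r:]" by (auto elim: degree_eq_zeroE)
    thus ?thesis using uv PS_coeff[OF h, of 0] by auto
  next
    case False
    have rem: "\<exists>c\<in>S. c \<noteq> 0 \<and> h dvd smult c k" if k: "k \<in> PS" "\<exists>u\<in>PS. \<exists>v\<in>PS. k = u * f + v * g" for k
    proof -
      obtain c q r where 1: "c \<in> S" "c \<noteq> 0" "q \<in> PS" "r \<in> PS" "smult c k = q * h + r"
          "r = 0 \<or> degree r < degree h"
        using pseudo_division[OF h uv(4) k(1)] by blast
      obtain u' v' where k': "u' \<in> PS" "v' \<in> PS" "k = u' * f + v' * g" using k by blast
      have "r = smult c k - q * h" using 1 by simp
      also have "\<dots> = (smult c u' - q * u) * f + (smult c v' - q * v) * g"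
        by (simp add: k' uv(3) algebra_simps smult_add_right)
      finally have "r = 0 \<or> r \<in> I" unfolding I_def using 1 k' uv
        by (auto intro!: PS_diff PS_smult PS_mult)
      hence "r = 0" using 1 hmin by (meson not_le)
      thus ?thesis using 1 by auto
    qed
    obtain c h' where h': "c \<in> S" "c \<noteq> 0" "h' \<in> PS" "h = smult c h'" "primitive h'"
      using primitive_part[OF h uv(4)] by blast
    have "h' dvd k" if kk: "k \<in> PS" "\<exists>u\<in>PS. \<exists>v\<in>PS. k = u * f + v * g" for k
    proof -
      obtain d where d: "d \<in> S" "d \<noteq> 0" "h dvd smult d k" using rem[OF kk] by blast
      have "h' dvd h" using h' by (simp add: dvd_smult)
      with d have "h' dvd smult d k" using dvd_trans by blast
      moreover have "h' \<noteq> 0" using h'(4) uv(4) by auto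
      ultimately show ?thesis using primitive_dvd_smult[OF h'(3) _ h'(5) d(1,2) kk(1)] by simp
    qed
    hence "h' dvd f" "h' dvd g" using fg gen by blast+
    moreover have "degree h' \<ge> 1" using False h' by simp
    ultimately show ?thesis using h' by blast
  qed
qed

text \<open>For constant q this is Gauss's lemma. If q has positive degree it is primitive, and one
  eliminates y from q and a: an eliminant r gives q dvd r b, hence q dvd b, while a common factor of
  positive degree is an associate of q by irreducibility.\<close>

lemma irreducible_poly_prime:
  assumes q: "q \<in> PS" "q \<noteq> 0" "\<not> q dvd 1"
    and irr: "\<And>a b. a \<in> PS \<Longrightarrow> b \<in> PS \<Longrightarrow> q = a * b \<Longrightarrow> a dvd 1 \<or> b dvd 1"
    and ab: "a \<in> PS" "b \<in> PS" "q dvd a * b"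
  shows "q dvd a \<or> q dvd b"
proof (cases "degree q = 0")
  case True
  then obtain c where c: "q = [:c:]" by (auto elim: degree_eq_zeroE)
  have cS: "c \<in> S" using PS_coeff[OF q(1), of 0] c by simp
  have "irreducible c"
  proof (rule irreducibleI)
    show "c \<noteq> 0" using q c by simp
    show "\<not> c dvd 1" using q c is_unit_const_poly_iff[of c] by simp
    fix a b assume cab: "c = a * b"
    have "a * b \<in> S" "a * b \<noteq> 0" using cS q(2) unfolding c cab by auto
    hence "a \<in> S" "b \<in> S" using S_factor S_factor2 by blast+
    moreover have "q = [:a:] * [:b:]" using c cab by simp
    ultimately have "[:a:] dvd 1 \<or> [:b:] dvd 1" using irr PS_const by blast
    thus "a dvd 1 \<or> b dvd 1" by (simp add: is_unit_const_poly_iff)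
  qed
  thus ?thesis using const_prime[OF cS _ ab(1,2)] ab(3) c by auto
next
  case False
  have prim: "primitive q" unfolding primitive_def
  proof (intro ballI impI notI)
    fix p assume p: "p \<in> S" "irreducible p" "[:p:] dvd q"
    then obtain z where z: "q = [:p:] * z" by (auto elim: dvdE)
    have "z \<in> PS" using PS_factor[OF PS_const[OF p(1)]] p z q by auto
    hence "[:p:] dvd 1 \<or> z dvd 1" using irr[OF PS_const[OF p(1)] _ z] by blast
    moreover have "degree z > 0" using z False by (auto split: if_splits)
    ultimately show False using p by (auto simp: is_unit_const_poly_iff is_unit_poly_iff dest: irreducible_not_unit)
  qed
  from eliminate_or_common_factor[OF q(1) ab(1) q(2)] show ?thesis
  proof (elim disjE exE conjE)
    fix u v r assume 1: "u \<in> PS" "v \<in> PS" "r \<in> S" "r \<noteq> 0" "u * q + v * a = [:r:]"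
    have "smult r b = (u * b) * q + v * (a * b)"
      using arg_cong[OF 1(5), of "\<lambda>x. x * b"] by (simp add: algebra_simps)
    hence "q dvd smult r b" using ab(3) by simp
    thus ?thesis using primitive_dvd_smult[OF q(1,2) prim 1(3,4) ab(2)] by simp
  next
    fix h assume 1: "h \<in> PS" "1 \<le> degree h" "h dvd q" "h dvd a"
    then obtain z where z: "q = h * z" by (auto elim: dvdE)
    have "h \<noteq> 0" using 1 by auto
    hence "z \<in> PS" using PS_factor[OF 1(1)] z q by auto
    moreover have "\<not> h dvd 1" using 1 by (auto simp: is_unit_poly_iff)
    ultimately have "z dvd 1" using irr[OF 1(1) _ z] by blast
    then obtain w where "1 = z * w" by (auto elim: dvdE)
    hence "h = q * w" using z by (simp add: mult.assoc)
    hence "q dvd h" by simp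
    thus ?thesis using 1 dvd_trans by blast
  qed
qed

end


section \<open>Multivariate polynomials: degrees, variables, and one variable singled out\<close>

abbreviation "mkeys \<equiv> Poly_Mapping.keys"
abbreviation "mlookup \<equiv> Poly_Mapping.lookup"
abbreviation "msingle \<equiv> Poly_Mapping.single"

lemma poly_mapping_sum_single:
  fixes P :: "'a \<Rightarrow>\<^sub>0 'b::comm_monoid_add"
  shows "P = (\<Sum>m\<in>mkeys P. msingle m (mlookup P m))"
proof (rule poly_mapping_eqI)
  fix k
  have "(\<Sum>m\<in>mkeys P. mlookup (msingle m (mlookup P m)) k)
      = (\<Sum>m\<in>mkeys P. if m = k then mlookup P k else 0)"
    by (intro sum.cong) (auto simp: lookup_single)
  also have "\<dots> = mlookup P k" by (auto simp: sum.delta' in_keys_iff)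
  finally show "mlookup P k = mlookup (\<Sum>m\<in>mkeys P. msingle m (mlookup P m)) k"
    by (simp add: lookup_sum)
qed

lemma lookup_mult_keys:
  fixes P Q :: "('a::monoid_add) \<Rightarrow>\<^sub>0 'b::semiring_0"
  shows "mlookup (P * Q) k = (\<Sum>m\<in>mkeys P. \<Sum>l\<in>mkeys Q. if m + l = k then mlookup P m * mlookup Q l else 0)"
proof -
  have "P * Q = (\<Sum>m\<in>mkeys P. msingle m (mlookup P m)) * (\<Sum>l\<in>mkeys Q. msingle l (mlookup Q l))"
    using poly_mapping_sum_single[of P] poly_mapping_sum_single[of Q] by simp
  also have "\<dots> = (\<Sum>m\<in>mkeys P. \<Sum>l\<in>mkeys Q. msingle (m + l) (mlookup P m * mlookup Q l))"
    by (simp add: sum_product mult_single)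
  finally show ?thesis by (simp add: lookup_sum lookup_single when_def)
qed

text \<open>Among the monomials of maximal weight, the largest ones of P and of Q in the monomial
  order add up to a monomial that arises in one way only, so its coefficient does not cancel. The
  weight is later the total degree or the degree in one variable.\<close>

lemma Max_keys_mult:
  fixes P Q :: "'K::field mpoly_pm" and \<kappa> :: "(nat \<Rightarrow>\<^sub>0 nat) \<Rightarrow> nat"
  assumes add: "\<And>a b. \<kappa> (a + b) = \<kappa> a + \<kappa> b" and PQ: "P \<noteq> 0" "Q \<noteq> 0"
  shows "Max (\<kappa> ` mkeys (P * Q)) = Max (\<kappa> ` mkeys P) + Max (\<kappa> ` mkeys Q)"
proof -
  have top: "\<exists>a\<in>mkeys R. \<kappa> a = Max (\<kappa> ` mkeys R) \<and> (\<forall>m\<in>mkeys R. \<kappa> m = \<kappa> a \<longrightarrow> m \<le> a)"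
    if "R \<noteq> 0" for R :: "'K mpoly_pm"
  proof -
    let ?A = "{m \<in> mkeys R. \<kappa> m = Max (\<kappa> ` mkeys R)}"
    have "Max (\<kappa> ` mkeys R) \<in> \<kappa> ` mkeys R" using that by (intro Max_in) auto
    hence "finite ?A" "?A \<noteq> {}" by auto
    hence "Max ?A \<in> ?A" "\<forall>m\<in>?A. m \<le> Max ?A" by (auto intro: Max_in[THEN subsetD[OF subset_refl]] simp del: Max_in)
       (use Max_in[of ?A] in auto)
    thus ?thesis by (intro bexI[of _ "Max ?A"]) auto
  qed
  obtain a where a: "a \<in> mkeys P" "\<kappa> a = Max (\<kappa> ` mkeys P)" "\<And>m. m \<in> mkeys P \<Longrightarrow> \<kappa> m = \<kappa> a \<Longrightarrow> m \<le> a"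
    using top[OF PQ(1)] by blast
  obtain b where b: "b \<in> mkeys Q" "\<kappa> b = Max (\<kappa> ` mkeys Q)" "\<And>m. m \<in> mkeys Q \<Longrightarrow> \<kappa> m = \<kappa> b \<Longrightarrow> m \<le> b"
    using top[OF PQ(2)] by blast
  have aM: "\<kappa> m \<le> \<kappa> a" if "m \<in> mkeys P" for m using that a(2) by simp
  have bM: "\<kappa> m \<le> \<kappa> b" if "m \<in> mkeys Q" for m using that b(2) by simp
  have uniq: "m = a \<and> l = b" if ml: "m \<in> mkeys P" "l \<in> mkeys Q" "m + l = a + b" for m l
  proof -
    have "\<kappa> m + \<kappa> l = \<kappa> a + \<kappa> b" using add ml(3) by metis
    hence "\<kappa> m = \<kappa> a" "\<kappa> l = \<kappa> b" using aM[OF ml(1)] bM[OF ml(2)] by linarith+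
    hence le: "m \<le> a" "l \<le> b" using a b ml by blast+
    have "m = a"
    proof (rule ccontr)
      assume "m \<noteq> a"
      hence "m + l < a + b" using le by (intro add_less_le_mono) auto
      thus False using ml(3) by simp
    qed
    thus ?thesis using ml(3) by simp
  qed
  have "mlookup (P * Q) (a + b) = (\<Sum>m\<in>mkeys P. if m = a then mlookup P a * mlookup Q b else 0)"
    unfolding lookup_mult_keys
  proof (intro sum.cong refl)
    fix m assume m: "m \<in> mkeys P"
    have "(\<Sum>l\<in>mkeys Q. if m + l = a + b then mlookup P m * mlookup Q l else 0)
        = (\<Sum>l\<in>mkeys Q. if l = b then (if m = a then mlookup P a * mlookup Q b else 0) else 0)"
      using uniq m by (intro sum.cong) auto
    thus "(\<Sum>l\<in>mkeys Q. if m + l = a + b then mlookup P m * mlookup Q l else 0)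
        = (if m = a then mlookup P a * mlookup Q b else 0)" using b(1) by (simp add: sum.delta')
  qed
  also have "\<dots> = mlookup P a * mlookup Q b" using a(1) by (simp add: sum.delta')
  finally have "a + b \<in> mkeys (P * Q)" using a(1) b(1) by (simp add: in_keys_iff)
  hence ab: "\<kappa> a + \<kappa> b \<in> \<kappa> ` mkeys (P * Q)" using add by (metis imageI)
  have "k \<le> \<kappa> a + \<kappa> b" if "k \<in> \<kappa> ` mkeys (P * Q)" for k
  proof -
    obtain m l where "m \<in> mkeys P" "l \<in> mkeys Q" "k = \<kappa> (m + l)" using \<open>k \<in> \<kappa> ` mkeys (P * Q)\<close> keys_mult[of P Q] by auto
    thus ?thesis using aM[of m] bM[of l] add by simp
  qed
  hence "Max (\<kappa> ` mkeys (P * Q)) = \<kappa> a + \<kappa> b" using ab by (intro Max_eqI) auto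
  thus ?thesis using a b by simp
qed

definition vars_in :: "nat set \<Rightarrow> 'K::zero mpoly_pm set" where
  "vars_in X = {P. \<forall>m\<in>mkeys P. mkeys m \<subseteq> X}"

lemma in_vars_iff: "in_vars n F \<longleftrightarrow> F \<in> vars_in {..<n}" by (simp add: in_vars_def vars_in_def)

definition mdeg :: "(nat \<Rightarrow>\<^sub>0 nat) \<Rightarrow> nat" where "mdeg m = (\<Sum>i\<in>mkeys m. mlookup m i)"

lemma mdeg_add: "mdeg (a + b) = mdeg a + mdeg b"
  unfolding mdeg_def by (rule setsum_keys_plus_distrib) auto

lemma mdeg_eq_0_iff: "mdeg m = 0 \<longleftrightarrow> m = 0"
  by (auto simp: mdeg_def in_keys_iff intro: poly_mapping_eqI)

definition tdeg :: "'K::zero mpoly_pm \<Rightarrow> nat" where "tdeg P = Max (mdeg ` mkeys P)"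

lemma vars_in_mono: "X \<subseteq> Y \<Longrightarrow> vars_in X \<subseteq> vars_in Y" by (auto simp: vars_in_def)

lemma vars_in_diff: "a \<in> vars_in X \<Longrightarrow> b \<in> vars_in X \<Longrightarrow> a - b \<in> vars_in X" for a b :: "'K::field mpoly_pm"
  using keys_diff[of a b] by (auto simp: vars_in_def)

lemma vars_in_add: "a \<in> vars_in X \<Longrightarrow> b \<in> vars_in X \<Longrightarrow> a + b \<in> vars_in X" for a b :: "'K::field mpoly_pm"
  using keys_add[of a b] by (auto simp: vars_in_def)

lemma sum_in_vars: "(\<And>j. j \<in> J \<Longrightarrow> f j \<in> vars_in X) \<Longrightarrow> sum f J \<in> vars_in X"
  for f :: "_ \<Rightarrow> 'K::field mpoly_pm"
proof (induction J rule: infinite_finite_induct)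
  case (insert j J)
  thus ?case by (simp add: vars_in_add)
qed (simp_all add: vars_in_def)

lemma keys_add_nat: "mkeys (a + b) = mkeys a \<union> mkeys b" for a b :: "nat \<Rightarrow>\<^sub>0 nat"
  by (auto simp: in_keys_iff lookup_add)

lemma vars_in_mult: "a \<in> vars_in X \<Longrightarrow> b \<in> vars_in X \<Longrightarrow> a * b \<in> vars_in X" for a b :: "'K::field mpoly_pm"
  using keys_mult[of a b] by (fastforce simp: vars_in_def keys_add_nat)

lemma vars_in_single: "mkeys m \<subseteq> X \<Longrightarrow> msingle m c \<in> vars_in X"
  by (auto simp: vars_in_def)

text \<open>The degree in each single variable is additive, so a variable that is absent from the
  product is absent from the factors.\<close>

lemma vars_in_factor:
  fixes a b :: "'K::field mpoly_pm"
  assumes ab: "a * b \<in> vars_in X" "a * b \<noteq> 0"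
  shows "a \<in> vars_in X"
  unfolding vars_in_def
proof (intro CollectI ballI subsetI)
  fix m i assume m: "m \<in> mkeys a" "i \<in> mkeys m"
  let ?\<kappa> = "\<lambda>m :: nat \<Rightarrow>\<^sub>0 nat. mlookup m i"
  have "mlookup m i \<le> Max (?\<kappa> ` mkeys a)" using m by simp
  also have "\<dots> \<le> Max (?\<kappa> ` mkeys (a * b))"
    using Max_keys_mult[of ?\<kappa> a b] ab by (auto simp: lookup_add)
  finally have le: "mlookup m i \<le> Max (?\<kappa> ` mkeys (a * b))" .
  have "Max (?\<kappa> ` mkeys (a * b)) \<in> ?\<kappa> ` mkeys (a * b)" using ab(2) by (intro Max_in) auto
  then obtain m' where "m' \<in> mkeys (a * b)" "mlookup m i \<le> mlookup m' i" using le by auto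
  moreover have "mlookup m i > 0" using m by (simp add: in_keys_iff)
  ultimately have "m' \<in> mkeys (a * b)" "i \<in> mkeys m'" by (auto simp: in_keys_iff)
  thus "i \<in> X" using ab(1) by (auto simp: vars_in_def)
qed

lemma single_zero_unit: "c \<noteq> 0 \<Longrightarrow> msingle 0 c dvd (1::'K::field mpoly_pm)"
proof (rule dvdI)
  assume "c \<noteq> 0"
  thus "1 = msingle 0 c * msingle 0 (1 / c)" by (simp add: mult_single)
qed

lemma keys_subset_zeroD: "mkeys P \<subseteq> {0} \<Longrightarrow> P = msingle 0 (mlookup P 0)"
  by (rule poly_mapping_eqI) (auto simp: lookup_single when_def in_keys_iff)

lemma tdeg_zero_unit:
  fixes a :: "'K::field mpoly_pm"
  assumes "a \<noteq> 0" "tdeg a = 0"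
  shows "a dvd 1"
proof -
  have "m = 0" if "m \<in> mkeys a" for m
  proof -
    have "mdeg m \<le> tdeg a" unfolding tdeg_def using that by simp
    thus ?thesis using assms mdeg_eq_0_iff by simp
  qed
  hence a: "a = msingle 0 (mlookup a 0)" by (intro keys_subset_zeroD) auto
  hence "mlookup a 0 \<noteq> 0" using assms(1) by (metis single_zero)
  thus ?thesis using single_zero_unit a by metis
qed

definition mvar :: "nat \<Rightarrow> 'K::field mpoly_pm" where "mvar i = msingle (msingle i 1) 1"

lemma mvar_power: "mvar i ^ k = msingle (msingle i k) 1"
  by (induction k) (simp_all add: mvar_def mult_single flip: single_add)

lemma lookup_mult_single:
  fixes c :: "'K::field mpoly_pm"
  shows "mlookup (c * msingle t 1) k = (\<Sum>m\<in>mkeys c. if m + t = k then mlookup c m else 0)"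
  unfolding lookup_mult_keys by (intro sum.cong) (auto simp: keys_single)

text \<open>No two powers of the substituted variable can interfere, since the coefficients do not
  contain it. This makes the substitution of \<open>mvar i\<close> injective and identifies K[X][y]
  with K[X, x_i].\<close>

lemma lookup_poly_mvar:
  fixes p :: "'K::field mpoly_pm poly"
  assumes X: "i \<notin> X" "\<And>k. coeff p k \<in> vars_in X" and m: "mlookup m i = 0"
  shows "mlookup (poly p (mvar i)) (m + msingle i k) = mlookup (coeff p k) m"
proof -
  have 1: "mlookup (coeff p j * mvar i ^ j) (m + msingle i k) = (if j = k then mlookup (coeff p k) m else 0)" for j
  proof -
    have "mlookup (coeff p j * mvar i ^ j) (m + msingle i k)
        = (\<Sum>m'\<in>mkeys (coeff p j). if m' + msingle i j = m + msingle i k then mlookup (coeff p j) m' else 0)"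
      by (simp add: mvar_power lookup_mult_single)
    also have "\<dots> = (\<Sum>m'\<in>mkeys (coeff p j). if m' = m then (if j = k then mlookup (coeff p k) m else 0) else 0)"
    proof (intro sum.cong refl)
      fix m' assume m': "m' \<in> mkeys (coeff p j)"
      hence "i \<notin> mkeys m'" using X by (auto simp: vars_in_def)
      hence z: "mlookup m' i = 0" by (simp add: in_keys_iff)
      have "j = k" if "m' + msingle i j = m + msingle i k"
        using arg_cong[OF that, of "\<lambda>x. mlookup x i"] z m by (simp add: lookup_add)
      thus "(if m' + msingle i j = m + msingle i k then mlookup (coeff p j) m' else 0)
          = (if m' = m then (if j = k then mlookup (coeff p k) m else 0) else 0)"
        by auto
    qed
    finally show ?thesis by (auto simp: sum.delta' in_keys_iff)
  qed
  have "mlookup (poly p (mvar i)) (m + msingle i k) = (\<Sum>j\<le>degree p. if j = k then mlookup (coeff p k) m else 0)"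
    by (simp add: poly_altdef lookup_sum 1)
  also have "\<dots> = mlookup (coeff p k) m" by (auto simp: sum.delta' coeff_eq_0)
  finally show ?thesis .
qed

lemma poly_mvar_eq_0:
  fixes p :: "'K::field mpoly_pm poly"
  assumes X: "i \<notin> X" "\<And>k. coeff p k \<in> vars_in X" and 0: "poly p (mvar i) = 0"
  shows "p = 0"
proof (rule poly_eqI, rule poly_mapping_eqI)
  fix k m
  show "mlookup (coeff p k) m = mlookup (coeff 0 k) m"
  proof (cases "mlookup m i = 0")
    case True
    thus ?thesis using lookup_poly_mvar[OF X(1), of p m k] X(2) 0 by simp
  next
    case False
    hence "i \<in> mkeys m" by (simp add: in_keys_iff)
    hence "m \<notin> mkeys (coeff p k)" using X by (auto simp: vars_in_def)
    thus ?thesis by (simp add: in_keys_iff)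
  qed
qed

lemma poly_mvar_exists:
  fixes P :: "'K::field mpoly_pm"
  assumes P: "P \<in> vars_in (insert i X)" and i: "i \<notin> X"
  shows "\<exists>p. (\<forall>k. coeff p k \<in> vars_in X) \<and> P = poly p (mvar i)"
proof -
  define rest where "rest m = m - msingle i (mlookup m i)" for m :: "nat \<Rightarrow>\<^sub>0 nat"
  have rest: "m = rest m + msingle i (mlookup m i)" for m
    by (rule poly_mapping_eqI) (auto simp: rest_def lookup_add lookup_minus lookup_single when_def)
  have kr: "mkeys (rest m) \<subseteq> mkeys m - {i}" for m
    by (auto simp: rest_def in_keys_iff lookup_minus lookup_single when_def split: if_splits)
  define p where "p = (\<Sum>m\<in>mkeys P. monom (msingle (rest m) (mlookup P m)) (mlookup m i))"
  have "poly p (mvar i) = (\<Sum>m\<in>mkeys P. msingle (rest m + msingle i (mlookup m i)) (mlookup P m))"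
    by (simp add: p_def poly_sum poly_monom mvar_power mult_single)
  also have "\<dots> = P" using poly_mapping_sum_single[of P] rest by simp
  finally have "P = poly p (mvar i)" by simp
  moreover have "coeff p k \<in> vars_in X" for k
  proof -
    have "0 \<in> vars_in X" by (simp add: vars_in_def)
    moreover have "msingle (rest m) (mlookup P m) \<in> vars_in X" if "m \<in> mkeys P" for m
      using that P kr[of m] by (intro vars_in_single) (auto simp: vars_in_def)
    ultimately show ?thesis unfolding p_def coeff_sum coeff_monom
      by (intro sum_in_vars) auto
  qed
  ultimately show ?thesis by blast
qed


lemma one_in_vars: "1 \<in> vars_in X" by (simp add: vars_in_def)

context
  fixes i :: nat and X :: "nat set" and x :: "'K::field mpoly_pm"
  assumes i: "i \<notin> X" and x: "x = mvar i"
begin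

lemma poly_mvar_inj:
  assumes "\<And>k. coeff A k \<in> vars_in X" "\<And>k. coeff B k \<in> vars_in X" "poly A x = poly B x"
  shows "A = B"
  using poly_mvar_eq_0[OF i, of "A - B"] assms x by (simp add: vars_in_diff)

lemma poly_mvar_closed:
  assumes "\<And>k. coeff A k \<in> vars_in X"
  shows "poly A x \<in> vars_in (insert i X)"
  unfolding poly_altdef x mvar_power
  using assms vars_in_mono[of X "insert i X"]
  by (intro sum_in_vars vars_in_mult vars_in_single) (auto simp: subset_eq)

text \<open>The quotient divides a nonzero element of the ring in the variables X and i, hence lies
  in that ring and is itself the value of a polynomial C. Injectivity of the substitution lifts the
  equation.\<close>

lemma poly_mvar_dvdD:
  assumes A: "\<And>k. coeff A k \<in> vars_in X" and B: "\<And>k. coeff B k \<in> vars_in X"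
    and dvd: "poly A x dvd poly B x" and nz: "poly B x \<noteq> 0"
    and clos: "\<And>C. (\<And>k. coeff C k \<in> vars_in X) \<Longrightarrow> (\<And>k. coeff (A * C) k \<in> vars_in X)"
  shows "A dvd B"
proof -
  obtain z where z: "poly B x = poly A x * z" using dvd by (auto elim: dvdE)
  have "z * poly A x \<in> vars_in (insert i X)" using poly_mvar_closed[OF B] z by (simp add: mult.commute)
  hence "z \<in> vars_in (insert i X)" using vars_in_factor nz z by (metis mult.commute)
  then obtain C where C: "\<And>k. coeff C k \<in> vars_in X" "z = poly C x"
    using poly_mvar_exists[OF _ i] x by blast
  have "B = A * C" using z C clos[OF C(1)] by (intro poly_mvar_inj B) auto
  thus ?thesis by simp
qed

end

text \<open>Gauss's theorem by induction on the variables: irreducibles in one more variable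
  correspond to irreducibles of \<open>PS\<close> over the smaller ring, where
  \<open>irreducible_poly_prime\<close> applies.\<close>

theorem factorial_vars_in:
  assumes "finite X"
  shows "factorial_subring (vars_in X :: 'K::field mpoly_pm set) tdeg"
  using assms
proof (induction X rule: finite_induct)
  case empty
  show ?case
  proof
    fix p a b :: "'K mpoly_pm"
    assume p: "p \<in> vars_in {}" "irreducible p"
    hence "mkeys p \<subseteq> {0}" by (auto simp: vars_in_def)
    hence "p = msingle 0 (mlookup p 0)" by (rule keys_subset_zeroD)
    moreover have "p \<noteq> 0" using p by auto
    ultimately have "p dvd 1" using single_zero_unit by (metis single_zero)
    thus "p dvd a \<or> p dvd b" using p by (auto dest: irreducible_not_unit)
  qed (auto intro: one_in_vars vars_in_diff vars_in_mult vars_in_factor tdeg_zero_unit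
        simp: tdeg_def Max_keys_mult mdeg_add)
next
  case (insert i X)
  interpret F: factorial_subring "vars_in X :: 'K mpoly_pm set" tdeg by fact
  define x :: "'K mpoly_pm" where "x = mvar i"
  note i = insert.hyps(2)
  show ?case
  proof
    fix p a b :: "'K mpoly_pm"
    assume p: "p \<in> vars_in (insert i X)" "irreducible p"
      and ab: "a \<in> vars_in (insert i X)" "b \<in> vars_in (insert i X)" "p dvd a * b"
    obtain q where q: "q \<in> F.PS" "p = poly q x"
      using poly_mvar_exists[OF p(1) i] unfolding x_def F.PS_def by blast
    obtain a' where a': "a' \<in> F.PS" "a = poly a' x"
      using poly_mvar_exists[OF ab(1) i] unfolding x_def F.PS_def by blast
    obtain b' where b': "b' \<in> F.PS" "b = poly b' x"
      using poly_mvar_exists[OF ab(2) i] unfolding x_def F.PS_def by blast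
    have dvdD: "A dvd B" if "A \<in> F.PS" "B \<in> F.PS" "poly A x dvd poly B x" "poly B x \<noteq> 0" for A B
    proof (rule poly_mvar_dvdD[OF i x_def _ _ that(3,4)])
      show "coeff (A * C) k \<in> vars_in X" if "\<And>k. coeff C k \<in> vars_in X" for C k
        using F.PS_mult[of A C] \<open>A \<in> F.PS\<close> that by (auto simp: F.PS_def)
    qed (use that F.PS_coeff in auto)
    have one: "1 \<in> F.PS" using F.PS_const[OF F.S_one] by (simp add: one_pCons)
    show "p dvd a \<or> p dvd b"
    proof (cases "a * b = 0")
      case False
      have "q dvd a' \<or> q dvd b'"
      proof (rule F.irreducible_poly_prime[OF q(1)])
        show "q \<noteq> 0" using p q by auto
        show "\<not> q dvd 1"
        proof
          assume "q dvd 1"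
          then obtain w where "1 = q * w" by (auto elim: dvdE)
          hence "1 = p * poly w x" using q(2) by (metis poly_1 poly_mult)
          hence "p dvd 1" by (metis dvd_triv_left)
          thus False using p by (auto dest: irreducible_not_unit)
        qed
        show "q dvd a' * b'" using ab(3) False a' b' q by (intro dvdD F.PS_mult) auto
      next
        fix c d assume cd: "c \<in> F.PS" "d \<in> F.PS" "q = c * d"
        hence "p = poly c x * poly d x" using q by simp
        hence "poly c x dvd 1 \<or> poly d x dvd 1" using p(2) irreducibleD by blast
        thus "c dvd 1 \<or> d dvd 1" using dvdD[OF cd(1) one] dvdD[OF cd(2) one] by auto
      qed (use a' b' in auto)
      thus ?thesis using a' b' q by (auto elim!: dvdE)
    qed auto
  qed (auto intro: one_in_vars vars_in_diff vars_in_mult vars_in_factor tdeg_zero_unit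
        simp: tdeg_def Max_keys_mult mdeg_add)
qed

text \<open>The second alternative of \<open>eliminate_or_common_factor\<close> would give a common
  divisor of F and G. Coprimality makes it constant, against its positive degree in the variable
  i.\<close>

theorem coprime_eliminate:
  fixes F G :: "'K::field mpoly_pm"
  assumes X: "finite X" "i \<in> X" and FG: "F \<in> vars_in X" "G \<in> vars_in X" "F \<noteq> 0" and cop: "mpoly_coprime F G"
  shows "\<exists>A B R. A \<in> vars_in X \<and> B \<in> vars_in X \<and> R \<in> vars_in (X - {i}) \<and> R \<noteq> 0 \<and> A * F + B * G = R"
proof -
  define Y where "Y = X - {i}"
  have Y: "i \<notin> Y" "X = insert i Y" using X by (auto simp: Y_def)
  interpret F: factorial_subring "vars_in Y :: 'K mpoly_pm set" tdeg
    by (rule factorial_vars_in) (simp add: Y_def X)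
  define x :: "'K mpoly_pm" where "x = mvar i"
  obtain f where f: "f \<in> F.PS" "F = poly f x"
    using poly_mvar_exists[OF _ Y(1)] FG(1) Y(2) unfolding x_def F.PS_def by blast
  obtain g where g: "g \<in> F.PS" "G = poly g x"
    using poly_mvar_exists[OF _ Y(1)] FG(2) Y(2) unfolding x_def F.PS_def by blast
  have "f \<noteq> 0" using f FG by auto
  from F.eliminate_or_common_factor[OF f(1) g(1) this] show ?thesis
  proof (elim disjE exE conjE)
    fix u v r assume 1: "u \<in> F.PS" "v \<in> F.PS" "r \<in> vars_in Y" "r \<noteq> 0" "u * f + v * g = [:r:]"
    have "poly u x * F + poly v x * G = r" using arg_cong[OF 1(5), of "\<lambda>p. poly p x"] f g by simp
    moreover have "poly u x \<in> vars_in X" "poly v x \<in> vars_in X"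
      using poly_mvar_closed[OF Y(1) x_def, of u] poly_mvar_closed[OF Y(1) x_def, of v] 1 F.PS_coeff Y by auto
    ultimately show ?thesis using 1 Y_def by blast
  next
    fix h assume 1: "h \<in> F.PS" "1 \<le> degree h" "h dvd f" "h dvd g"
    have "poly h x dvd F" "poly h x dvd G" using 1 f g by (auto elim!: dvdE)
    hence "mkeys (poly h x) \<subseteq> {0}" using cop by (auto simp: mpoly_coprime_def)
    then obtain c where c: "poly h x = msingle 0 c" using keys_subset_zeroD by blast
    have "h = [:msingle 0 c:]"
    proof (rule poly_mvar_inj[OF Y(1) x_def])
      show "coeff h k \<in> vars_in Y" for k using F.PS_coeff[OF 1(1)] .
      show "coeff [:msingle 0 c:] k \<in> vars_in Y" for k
        by (rule F.PS_coeff, rule F.PS_const) (simp add: vars_in_single)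
      show "poly h x = poly [:msingle 0 c:] x" using c by simp
    qed
    thus ?thesis using 1 by simp
  qed
qed

section \<open>Function fields of one variable\<close>

locale curve =
  fixes \<iota> :: "'k::field_char_0 \<Rightarrow> 'K::field"
  assumes curve: "curve_function_field \<iota>"
begin

lemma \<iota>_add: "\<iota> (a + b) = \<iota> a + \<iota> b"
  and \<iota>_mult: "\<iota> (a * b) = \<iota> a * \<iota> b"
  and \<iota>_1 [simp]: "\<iota> 1 = 1"
  using curve by (auto simp: curve_function_field_def ring_hom_fun_def)

lemma \<iota>_0 [simp]: "\<iota> 0 = 0" using \<iota>_add[of 0 0] by (metis add.right_neutral add_cancel_left_right)
lemma \<iota>_uminus: "\<iota> (- a) = - \<iota> a" using \<iota>_add[of a "-a"] by (simp add: eq_neg_iff_add_eq_0 add.commute)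
lemma \<iota>_eq_0_iff [simp]: "\<iota> a = 0 \<longleftrightarrow> a = 0"
proof
  assume "\<iota> a = 0"
  show "a = 0"
  proof (rule ccontr)
    assume "a \<noteq> 0"
    hence "\<iota> a * \<iota> (1 / a) = 1" by (simp flip: \<iota>_mult)
    thus False using \<open>\<iota> a = 0\<close> by simp
  qed
qed simp
lemma \<iota>_sum: "\<iota> (sum f A) = (\<Sum>x\<in>A. \<iota> (f x))"
  by (induction A rule: infinite_finite_induct) (auto simp: \<iota>_add)
lemma \<iota>_divide: "\<iota> (a / b) = \<iota> a / \<iota> b"
proof (cases "b = 0")
  case False
  hence "\<iota> (a / b) * \<iota> b = \<iota> a" by (simp flip: \<iota>_mult)
  thus ?thesis using False by (simp add: field_simps)
qed simp
lemma \<iota>_of_nat: "\<iota> (of_nat n) = of_nat n" by (induction n) (auto simp: \<iota>_add)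
sublocale V: vector_space "\<lambda>c x. \<iota> c * x"
  by unfold_locales (auto simp: \<iota>_add \<iota>_mult algebra_simps)

text \<open>Independence of an indexed family: a repeated value counts as a dependence, so that
  dimensions can be compared with the size of the index set. \<open>kindep_iff\<close> relates it to
  independent sets.\<close>

definition kindep :: "'i set \<Rightarrow> ('i \<Rightarrow> 'K) \<Rightarrow> bool" where
  "kindep I f \<longleftrightarrow> (\<forall>c. (\<Sum>i\<in>I. \<iota> (c i) * f i) = 0 \<longrightarrow> (\<forall>i\<in>I. c i = 0))"

lemma kindepD: "kindep I f \<Longrightarrow> (\<Sum>i\<in>I. \<iota> (c i) * f i) = 0 \<Longrightarrow> i \<in> I \<Longrightarrow> c i = 0"
  unfolding kindep_def by blast

lemma kindep_inj:
  fixes I :: "'i set"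
  assumes "kindep I f" "finite I" shows "inj_on f I"
proof (rule inj_onI, rule ccontr)
  fix i j assume ij: "i \<in> I" "j \<in> I" "f i = f j" "i \<noteq> j"
  define c :: "'i \<Rightarrow> 'k" where "c l = (if l = i then 1 else if l = j then -1 else 0)" for l
  have "(\<Sum>l\<in>I. \<iota> (c l) * f l) = (\<Sum>l\<in>I. (if l = i then f i else 0) + (if l = j then - f j else 0))"
    using ij(4) by (intro sum.cong) (auto simp: c_def \<iota>_uminus)
  also have "\<dots> = 0" using ij assms(2) by (simp add: sum.distrib sum.delta)
  finally have "c i = 0" using kindepD[OF assms(1)] ij by blast
  thus False by (simp add: c_def)
qed

lemma kindep_iff:
  assumes "finite I"
  shows "kindep I f \<longleftrightarrow> inj_on f I \<and> V.independent (f ` I)"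
proof
  assume k: "kindep I f"
  note inj = kindep_inj[OF k assms]
  have "V.independent (f ` I)"
  proof (rule V.independent_if_scalars_zero)
    fix u x assume u: "(\<Sum>x\<in>f ` I. \<iota> (u x) * x) = 0" "x \<in> f ` I"
    from u(1) have "(\<Sum>i\<in>I. \<iota> ((u \<circ> f) i) * f i) = 0" by (simp add: sum.reindex[OF inj] o_def)
    with k have "\<forall>i\<in>I. (u \<circ> f) i = 0" unfolding kindep_def by blast
    thus "u x = 0" using u(2) by auto
  qed (use assms in auto)
  thus "inj_on f I \<and> V.independent (f ` I)" using inj by simp
next
  assume *: "inj_on f I \<and> V.independent (f ` I)"
  show "kindep I f" unfolding kindep_def
  proof (intro allI impI ballI)
    fix c i assume c: "(\<Sum>i\<in>I. \<iota> (c i) * f i) = 0" and i: "i \<in> I"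
    define u where "u x = c (the_inv_into I f x)" for x
    have "(\<Sum>x\<in>f ` I. \<iota> (u x) * x) = (\<Sum>i\<in>I. \<iota> (c i) * f i)"
      using * by (simp add: sum.reindex u_def the_inv_into_f_f cong: sum.cong)
    hence "u (f i) = 0" using * c i V.dependent_finite[of "f ` I"] assms by auto
    thus "c i = 0" using * i by (simp add: u_def the_inv_into_f_f)
  qed
qed

lemma V_span_sum: "(\<And>j. j \<in> J \<Longrightarrow> e j \<in> V.span A) \<Longrightarrow> (\<Sum>j\<in>J. \<iota> (a j) * e j) \<in> V.span A"
  by (intro V.span_sum V.span_scale)

lemma kindep_card_le:
  assumes k: "kindep I f" "finite I" and J: "finite J" and span: "\<And>i. i \<in> I \<Longrightarrow> f i \<in> V.span (e ` J)"
  shows "card I \<le> card J"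
proof -
  have "inj_on f I" "V.independent (f ` I)" using kindep_iff[of I f] k by auto
  have "card I = card (f ` I)" using \<open>inj_on f I\<close> by (simp add: card_image)
  also have "\<dots> \<le> card (e ` J)"
    using V.independent_span_bound[of "e ` J" "f ` I"] J \<open>V.independent (f ` I)\<close> span by auto
  also have "\<dots> \<le> card J" using J by (rule card_image_le)
  finally show ?thesis .
qed

section \<open>Polynomial relations over the constant field and the rank of K over k[x]\<close>

definition ev :: "'K \<Rightarrow> 'k poly \<Rightarrow> 'K" where "ev x q = poly (map_poly \<iota> q) x"

lemma coeff_map_\<iota>: "coeff (map_poly \<iota> q) i = \<iota> (coeff q i)" by (simp add: coeff_map_poly)
lemma map_\<iota>_add: "map_poly \<iota> (p + q) = map_poly \<iota> p + map_poly \<iota> q"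
  by (rule poly_eqI) (simp add: coeff_map_\<iota> \<iota>_add)
lemma map_\<iota>_mult: "map_poly \<iota> (p * q) = map_poly \<iota> p * map_poly \<iota> q"
  by (rule poly_eqI) (simp add: coeff_map_\<iota> \<iota>_mult \<iota>_sum coeff_mult)

lemma ev_add: "ev x (p + q) = ev x p + ev x q" by (simp add: ev_def map_\<iota>_add)
lemma ev_mult: "ev x (p * q) = ev x p * ev x q" by (simp add: ev_def map_\<iota>_mult)
lemma ev_0 [simp]: "ev x 0 = 0" by (simp add: ev_def)
lemma ev_pCons: "ev x (pCons a p) = \<iota> a + x * ev x p"
  by (cases "a = 0 \<and> p = 0") (auto simp: ev_def map_poly_pCons)
lemma ev_const [simp]: "ev x [:a:] = \<iota> a" by (simp add: ev_pCons)
lemma ev_1 [simp]: "ev x 1 = 1" by (simp add: one_pCons)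
lemma ev_uminus: "ev x (- p) = - ev x p" using ev_add[of x p "-p"] by (simp add: eq_neg_iff_add_eq_0 add.commute)
lemma ev_diff: "ev x (p - q) = ev x p - ev x q" using ev_add[of x p "-q"] by (simp add: ev_uminus)
lemma ev_smult: "ev x (smult a p) = \<iota> a * ev x p" using ev_mult[of x "[:a:]" p] by simp
lemma ev_X [simp]: "ev x [:0, 1:] = x" by (simp add: ev_pCons)
lemma ev_power: "ev x (p ^ n) = ev x p ^ n" by (induction n) (auto simp: ev_mult)
lemma ev_monom: "ev x (monom a n) = \<iota> a * x ^ n" by (simp add: monom_altdef ev_smult ev_power)
lemma ev_sum: "ev x (sum f A) = (\<Sum>i\<in>A. ev x (f i))"
  by (induction A rule: infinite_finite_induct) (auto simp: ev_add)
lemma ev_altdef: "degree q \<le> n \<Longrightarrow> ev x q = (\<Sum>i\<le>n. \<iota> (coeff q i) * x ^ i)"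
  by (subst poly_as_sum_of_monoms'[symmetric, of q n]) (auto simp: ev_sum ev_monom)

definition transc :: "'K \<Rightarrow> bool" where "transc x \<longleftrightarrow> (\<forall>q. q \<noteq> 0 \<longrightarrow> ev x q \<noteq> 0)"

lemma alg_closed: "degree (p::'k poly) \<ge> 1 \<Longrightarrow> \<exists>x. poly p x = 0"
  using curve by (auto simp: curve_function_field_def alg_closed_field_def)

text \<open>Over the algebraically closed k a relation splits into linear factors, one of which must
  vanish at x.\<close>

lemma not_transc_const:
  assumes "\<not> transc x" shows "x \<in> range \<iota>"
proof -
  obtain q where q: "q \<noteq> 0" "ev x q = 0" using assms by (auto simp: transc_def)
  have "q \<noteq> 0 \<Longrightarrow> ev x q = 0 \<Longrightarrow> x \<in> range \<iota>" for q
  proof (induction "degree q" arbitrary: q)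
    case 0
    then obtain c where "q = [:c:]" by (metis degree_eq_zeroE)
    thus ?case using 0 by simp
  next
    case (Suc n)
    then obtain a where "poly q a = 0" using alg_closed[of q] by auto
    then obtain r where r: "q = [:-a, 1:] * r" by (auto simp: poly_eq_0_iff_dvd elim: dvdE)
    have "r \<noteq> 0" using r Suc by auto
    have "ev x q = (x - \<iota> a) * ev x r" unfolding r ev_mult by (simp add: ev_pCons \<iota>_uminus)
    hence "x = \<iota> a \<or> ev x r = 0" using Suc by auto
    moreover have "degree q = 1 + degree r" unfolding r using \<open>r \<noteq> 0\<close> by (subst degree_mult_eq) auto
    hence "degree r = n" using Suc.hyps(2) by simp
    ultimately show ?case using Suc.hyps(1)[of r] \<open>r \<noteq> 0\<close> by auto
  qed
  thus ?thesis using q by blast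
qed

lemma transc_iff: "transc x \<longleftrightarrow> x \<notin> range \<iota>"
proof
  assume t: "transc x"
  show "x \<notin> range \<iota>"
  proof
    assume "x \<in> range \<iota>"
    then obtain c where "x = \<iota> c" by auto
    hence "ev x [:-c, 1:] = 0" by (simp add: ev_pCons \<iota>_uminus)
    moreover have "[:-c, 1:] \<noteq> 0" by simp
    ultimately show False using t unfolding transc_def by blast
  qed
qed (use not_transc_const in blast)

lemma transc_inverse: "transc x \<Longrightarrow> transc (1 / x)"
proof -
  assume t: "transc x"
  have "1 / x \<notin> range \<iota>"
  proof
    assume "1 / x \<in> range \<iota>"
    then obtain c where "1 / x = \<iota> c" by auto
    have "x = 1 / (1 / x)" by simp
    also have "\<dots> = \<iota> (1 / c)" using \<open>1 / x = \<iota> c\<close> by (simp add: \<iota>_divide)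
    finally have "x = \<iota> (1 / c)" .
    thus False using t transc_iff by blast
  qed
  thus ?thesis by (simp add: transc_iff)
qed

lemma obtain_generator:
  obtains t b n where "transc t"
    "\<And>z. \<exists>p q. (\<forall>i<n. q i \<noteq> 0) \<and> z = (\<Sum>i<(n::nat). ev t (p i) / ev t (q i) * b i)"
proof -
  from curve obtain t B where t: "\<forall>q::'k poly. q \<noteq> 0 \<longrightarrow> poly (map_poly \<iota> q) t \<noteq> 0"
    and B: "\<forall>x. \<exists>cs. length cs = length B \<and> set cs \<subseteq> rat_fun_field \<iota> t \<and> x = (\<Sum>i<length B. cs ! i * B ! i)"
    unfolding curve_function_field_def function_field_one_var_def by blast
  show ?thesis
  proof (rule that[of t "length B" "\<lambda>i. B ! i"])
    show "transc t" using t by (simp add: transc_def ev_def)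
    fix z
    obtain cs where cs: "length cs = length B" "set cs \<subseteq> rat_fun_field \<iota> t" "z = (\<Sum>i<length B. cs ! i * B ! i)"
      using B by blast
    have "\<forall>i<length B. \<exists>p q. q \<noteq> 0 \<and> cs ! i = ev t p / ev t q"
    proof (intro allI impI)
      fix i assume "i < length B"
      hence "cs ! i \<in> rat_fun_field \<iota> t" using cs by auto
      thus "\<exists>p q. q \<noteq> 0 \<and> cs ! i = ev t p / ev t q" unfolding rat_fun_field_def ev_def by blast
    qed
    then obtain p q where "\<And>i. i < length B \<Longrightarrow> q i \<noteq> 0 \<and> cs ! i = ev t (p i) / ev t (q i)" by metis
    thus "\<exists>p q. (\<forall>i<length B. q i \<noteq> 0) \<and> z = (\<Sum>i<length B. ev t (p i) / ev t (q i) * B ! i)"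
      by (intro exI[of _ p] exI[of _ q]) (auto simp: cs(3) intro!: sum.cong)
  qed
qed

text \<open>A dimension count replaces the finiteness of K over k(x). \<open>M e\<close> collects
  the combinations of the generators with coefficients in k[t] of degree at most e. After
  multiplication by a fixed denominator, multiplying by x raises e by a fixed amount d, so x-powers
  times sufficiently many functions y_j crowd a space of too small dimension.\<close>

lemma bounded_rank_over_poly:
  "\<exists>N. \<forall>y::nat \<Rightarrow> 'K. \<exists>q::nat \<Rightarrow> 'k poly. (\<exists>j\<le>N. q j \<noteq> 0) \<and> (\<Sum>j\<le>N. ev x (q j) * y j) = 0"
proof -
  obtain t b n where t: "transc t"
    and gen: "\<And>z. \<exists>p q. (\<forall>i<n. q i \<noteq> 0) \<and> z = (\<Sum>i<(n::nat). ev t (p i) / ev t (q i) * b i)"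
    by (rule obtain_generator) (rule that)
  define M where "M e = {h. \<exists>a::nat \<Rightarrow> 'k poly. (\<forall>i<n. degree (a i) \<le> e) \<and> h = (\<Sum>i<n. ev t (a i) * b i)}" for e
  have M_add: "h + h' \<in> M e" if hh: "h \<in> M e" "h' \<in> M e" for h h' e
  proof -
    obtain a a' where "\<forall>i<n. degree (a i) \<le> e" "h = (\<Sum>i<n. ev t (a i) * b i)"
      "\<forall>i<n. degree (a' i) \<le> e" "h' = (\<Sum>i<n. ev t (a' i) * b i)" using hh unfolding M_def by blast
    thus ?thesis unfolding M_def
      by (intro CollectI exI[of _ "\<lambda>i. a i + a' i"]) (auto simp: ev_add sum.distrib algebra_simps degree_add_le)
  qed
  have M_0: "0 \<in> M e" for e by (auto simp: M_def intro!: exI[of _ "\<lambda>_. 0"])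
  have M_sum: "sum f A \<in> M e" if "\<And>i. i \<in> A \<Longrightarrow> f i \<in> M e" for f e and A :: "nat set"
    using that by (induction A rule: infinite_finite_induct) (auto simp: M_0 M_add)
  have M_mono: "M e \<subseteq> M e'" if "e \<le> e'" for e e' unfolding M_def using le_trans[OF _ that] by blast
  have M_ev: "ev t a * h \<in> M (d + e)" if ah: "degree a \<le> d" "h \<in> M e" for a h d e
  proof -
    obtain c where "\<forall>i<n. degree (c i) \<le> e" "h = (\<Sum>i<n. ev t (c i) * b i)" using ah(2) unfolding M_def by blast
    thus ?thesis unfolding M_def using ah(1)
      by (intro CollectI exI[of _ "\<lambda>i. a * c i"])
         (auto simp: ev_mult sum_distrib_left mult.assoc intro!: order_trans[OF degree_mult_le] add_mono)
  qed
  have 1: "\<exists>q d. q \<noteq> 0 \<and> ev t q * z \<in> M d" for z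
  proof -
    obtain p q where pq: "\<forall>i<n. q i \<noteq> 0" "z = (\<Sum>i<n. ev t (p i) / ev t (q i) * b i)" using gen by blast
    define Q where "Q = (\<Prod>i<n. q i)"
    define a where "a i = p i * (\<Prod>j\<in>{..<n}-{i}. q j)" for i
    have "ev t Q * z = (\<Sum>i<n. ev t (a i) * b i)" unfolding pq(2) sum_distrib_left
    proof (intro sum.cong refl)
      fix i assume i: "i \<in> {..<n}"
      have "ev t (q i) \<noteq> 0" using pq i t by (auto simp: transc_def)
      moreover have "Q = q i * (\<Prod>j\<in>{..<n}-{i}. q j)" unfolding Q_def using i by (subst prod.remove[of _ i]) auto
      ultimately show "ev t Q * (ev t (p i) / ev t (q i) * b i) = ev t (a i) * b i"
        by (simp add: a_def ev_mult field_simps)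
    qed
    moreover have "degree (a i) \<le> (\<Sum>i<n. degree (a i))" if "i < n" for i using that by (intro member_le_sum) auto
    ultimately have "ev t Q * z \<in> M (\<Sum>i<n. degree (a i))" unfolding M_def by blast
    moreover have "Q \<noteq> 0" using pq by (auto simp: Q_def)
    ultimately show ?thesis by blast
  qed
  have 2: "\<exists>q d. q \<noteq> 0 \<and> (\<forall>j\<le>N. ev t q * z j \<in> M d)" for z :: "nat \<Rightarrow> 'K" and N :: nat
  proof (induction N)
    case 0
    thus ?case using 1[of "z 0"] by auto
  next
    case (Suc N)
    then obtain q d where q: "q \<noteq> 0" "\<forall>j\<le>N. ev t q * z j \<in> M d" by blast
    obtain q' d' where q': "q' \<noteq> 0" "ev t q' * z (Suc N) \<in> M d'" using 1 by blast
    define e where "e = degree q + degree q' + d + d'"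
    have "ev t (q' * q) * z j \<in> M e" if "j \<le> Suc N" for j
    proof (cases "j \<le> N")
      case True
      hence "ev t q' * (ev t q * z j) \<in> M (degree q' + d)" using q by (intro M_ev) auto
      thus ?thesis using M_mono[of "degree q' + d" e] by (auto simp: e_def ev_mult mult.assoc)
    next
      case False
      hence "j = Suc N" using that by simp
      hence "ev t q * (ev t q' * z j) \<in> M (degree q + d')" using q' by (intro M_ev) auto
      thus ?thesis using M_mono[of "degree q + d'" e] by (auto simp: e_def ev_mult mult.assoc mult.left_commute)
    qed
    thus ?case using q q' by (intro exI[of _ "q' * q"] exI[of _ e]) auto
  qed
  \<comment> \<open>A common denominator for the action of x on the generators; \<open>d\<close>
    bounds the growth of the degree under both q x and q alone.\<close>
  obtain q d0 where q: "q \<noteq> 0" "\<forall>j\<le>n. ev t q * (x * b j) \<in> M d0" using 2[of n "\<lambda>j. x * b j"] by blast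
  define d where "d = d0 + degree q"
  have qx: "ev t q * x * h \<in> M (e + d)" if h: "h \<in> M e" for h e
  proof -
    obtain a where a: "\<forall>i<n. degree (a i) \<le> e" "h = (\<Sum>i<n. ev t (a i) * b i)" using h unfolding M_def by blast
    have "ev t q * x * h = (\<Sum>i<n. ev t (a i) * (ev t q * (x * b i)))"
      by (simp add: a sum_distrib_left algebra_simps)
    also have "\<dots> \<in> M (e + d0)" using a q by (intro M_sum M_ev) auto
    finally show ?thesis using M_mono[of "e + d0" "e + d"] by (auto simp: d_def)
  qed
  have q1: "ev t q * h \<in> M (e + d)" if h: "h \<in> M e" for h e
    using M_ev[OF order_refl h, of q] M_mono[of "degree q + e" "e + d"] by (auto simp: d_def)
  have qpow: "ev t q ^ L * x ^ s * h \<in> M (e + L * d)" if "h \<in> M e" "s \<le> L" for h e s L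
    using that(2)
  proof (induction L arbitrary: s)
    case (Suc L)
    show ?case
    proof (cases "s \<le> L")
      case True
      from q1[OF Suc.IH[OF this]] show ?thesis by (simp add: algebra_simps)
    next
      case False
      hence s: "s = Suc L" using Suc.prems by simp
      from qx[OF Suc.IH[of L]] show ?thesis by (simp add: s algebra_simps)
    qed
  qed (use that in simp)
  define N where "N = n * d"
  show ?thesis
  proof (intro exI[of _ N] allI)
    fix y :: "nat \<Rightarrow> 'K"
    obtain q' d' where q': "q' \<noteq> 0" "\<forall>j\<le>N. ev t q' * y j \<in> M d'" using 2[of N y] by blast
    \<comment> \<open>Chosen so that the (L + 1)(N + 1) functions outnumber the n (d' + L d + 1)
      spanning elements: with N = n d the terms n L d cancel, and L \<ge> n d' + n covers the
      rest.\<close>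
    define L where "L = n * d' + n"
    define f where "f = (\<lambda>(s,j). ev t q ^ L * x ^ s * (ev t q' * y j))"
    define e where "e = (\<lambda>(s,i). t ^ s * b i)"
    define I where "I = {..L} \<times> {..N}"
    define J where "J = {..d' + L * d} \<times> {..<n}"
    have span: "f i \<in> V.span (e ` J)" if "i \<in> I" for i
    proof -
      obtain s j where sj: "i = (s, j)" by (cases i)
      have "f i \<in> M (d' + L * d)" unfolding f_def sj prod.case
        by (rule qpow) (use that sj q' in \<open>auto simp: I_def\<close>)
      then obtain a where a: "\<forall>i<n. degree (a i) \<le> d' + L * d" "f i = (\<Sum>i<n. ev t (a i) * b i)"
        unfolding M_def by blast
      have "ev t (a l) * b l \<in> V.span (e ` J)" if l: "l < n" for l
      proof -
        have "ev t (a l) * b l = (\<Sum>r\<le>d' + L * d. \<iota> (coeff (a l) r) * e (r, l))"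
          using a(1) l ev_altdef[of "a l" "d' + L * d" t] by (simp add: e_def sum_distrib_right mult.assoc)
        also have "\<dots> \<in> V.span (e ` J)" by (intro V_span_sum V.span_base imageI) (use l in \<open>auto simp: J_def\<close>)
        finally show ?thesis .
      qed
      thus ?thesis unfolding a(2) by (intro V.span_sum) auto
    qed
    have "card J < card I" by (simp add: I_def J_def card_cartesian_product L_def N_def algebra_simps)
    hence "\<not> kindep I f" using kindep_card_le[of I f J e] span by (auto simp: I_def J_def)
    then obtain c i where c: "(\<Sum>i\<in>I. \<iota> (c i) * f i) = 0" "i \<in> I" "c i \<noteq> 0" by (auto simp: kindep_def)
    define Q where "Q j = (\<Sum>s\<le>L. monom (c (s, j)) s)" for j
    have coQ: "coeff (Q j) s = c (s, j)" if "s \<le> L" for s j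
      using that by (simp add: Q_def coeff_sum sum.delta')
    have "(\<Sum>i\<in>I. \<iota> (c i) * f i) = (\<Sum>s\<le>L. \<Sum>j\<le>N. \<iota> (c (s,j)) * f (s,j))"
      by (simp add: I_def sum.cartesian_product)
    also have "\<dots> = (\<Sum>j\<le>N. \<Sum>s\<le>L. \<iota> (c (s,j)) * f (s,j))" by (rule sum.swap)
    also have "\<dots> = ev t q ^ L * ev t q' * (\<Sum>j\<le>N. ev x (Q j) * y j)"
      by (simp add: f_def Q_def ev_sum ev_monom sum_distrib_left sum_distrib_right algebra_simps)
    finally have "ev t q ^ L * ev t q' * (\<Sum>j\<le>N. ev x (Q j) * y j) = 0" using c(1) by simp
    moreover have "ev t q \<noteq> 0" "ev t q' \<noteq> 0" using t q q' by (auto simp: transc_def)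
    ultimately have "(\<Sum>j\<le>N. ev x (Q j) * y j) = 0" by simp
    moreover have "Q (snd i) \<noteq> 0" "snd i \<le> N" using coQ[of "fst i" "snd i"] c by (auto simp: I_def)
    ultimately show "\<exists>q. (\<exists>j\<le>N. q j \<noteq> 0) \<and> (\<Sum>j\<le>N. ev x (q j) * y j) = 0" by blast
  qed
qed

end

section \<open>Places\<close>

context curve
begin

text \<open>A lower bound for the order in which 0 has order infinity. The bare function p takes the
  value 0 at 0, so all ultrametric estimates are phrased with \<open>vge\<close>.\<close>

definition vge :: "('K \<Rightarrow> int) \<Rightarrow> int \<Rightarrow> 'K \<Rightarrow> bool" where
  "vge p m x \<longleftrightarrow> x = 0 \<or> m \<le> p x"

lemma vge_0 [simp]: "vge p m 0" by (simp add: vge_def)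
lemma vge_mono: "vge p m x \<Longrightarrow> m' \<le> m \<Longrightarrow> vge p m' x" by (auto simp: vge_def)
lemma vge_self: "vge p (p x) x" by (simp add: vge_def)
context
  fixes p assumes p: "p \<in> places \<iota>"
begin

lemma place_0: "p 0 = 0"
  and place_mult: "x \<noteq> 0 \<Longrightarrow> y \<noteq> 0 \<Longrightarrow> p (x * y) = p x + p y"
  and place_add: "x \<noteq> 0 \<Longrightarrow> y \<noteq> 0 \<Longrightarrow> x + y \<noteq> 0 \<Longrightarrow> min (p x) (p y) \<le> p (x + y)"
  and place_uniformizer: "\<exists>t. t \<noteq> 0 \<and> p t = 1"
  using p by (auto simp: places_def is_place_def)

lemma place_const [simp]: "p (\<iota> c) = 0"
  using p by (cases "c = 0") (auto simp: places_def is_place_def)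

lemma place_1: "p 1 = 0" using place_const[of 1] by simp

lemma place_uminus: "p (- x) = p x"
proof (cases "x = 0")
  case False
  have "- x = \<iota> (-1) * x" by (simp add: \<iota>_uminus)
  thus ?thesis using place_mult[of "\<iota> (-1)" x] False by simp
qed simp

lemma place_inverse: "p (inverse x) = - p x"
proof (cases "x = 0")
  case False
  have "p (x * inverse x) = p x + p (inverse x)" using False by (intro place_mult) auto
  thus ?thesis using False place_1 by simp
qed (simp add: place_0)

lemma place_divide: "x \<noteq> 0 \<Longrightarrow> y \<noteq> 0 \<Longrightarrow> p (x / y) = p x - p y"
  using place_mult[of x "inverse y"] place_inverse[of y] by (simp add: divide_inverse)

lemma place_power: "p (x ^ n) = int n * p x"
  by (cases "x = 0", cases "n = 0")
     (simp_all add: place_0 place_1 power_0_left, induction n, simp_all add: place_1 place_mult algebra_simps)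

lemma place_powi: "p (x powi n) = n * p x"
  by (cases "x = 0") (auto simp: power_int_def place_power place_inverse place_0 place_1)

lemma place_prod: "(\<And>i. i \<in> I \<Longrightarrow> f i \<noteq> 0) \<Longrightarrow> p (prod f I) = (\<Sum>i\<in>I. p (f i))"
  by (induction I rule: infinite_finite_induct) (auto simp: place_1 place_mult)

lemma vge_add: "vge p m x \<Longrightarrow> vge p m y \<Longrightarrow> vge p m (x + y)"
  using place_add[of x y] by (cases "x = 0"; cases "y = 0"; cases "x + y = 0") (auto simp: vge_def)

lemma vge_uminus: "vge p m x \<Longrightarrow> vge p m (- x)" by (auto simp: vge_def place_uminus)

lemma vge_diff: "vge p m x \<Longrightarrow> vge p m y \<Longrightarrow> vge p m (x - y)"
  using vge_add[of m x "-y"] vge_uminus[of m y] by simp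

lemma vge_mult: "vge p m x \<Longrightarrow> vge p l y \<Longrightarrow> vge p (m + l) (x * y)"
  using place_mult[of x y] by (cases "x = 0"; cases "y = 0") (auto simp: vge_def)

lemma vge_const: "vge p 0 (\<iota> c)" by (simp add: vge_def)
lemma vge_1: "vge p 0 1" using vge_const[of 1] by simp

lemma vge_scale: "vge p m x \<Longrightarrow> vge p m (\<iota> c * x)" using vge_mult[of 0 "\<iota> c" m x] vge_const by simp

lemma vge_sum: "(\<And>i. i \<in> I \<Longrightarrow> vge p m (f i)) \<Longrightarrow> vge p m (sum f I)"
  by (induction I rule: infinite_finite_induct) (auto intro: vge_add)

lemma vge_prod: "(\<And>i. i \<in> I \<Longrightarrow> vge p (m i) (f i)) \<Longrightarrow> vge p (sum m I) (prod f I)"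
  by (induction I rule: infinite_finite_induct) (auto intro: vge_mult vge_1)

lemma vge_power: "vge p m x \<Longrightarrow> vge p (int n * m) (x ^ n)"
proof (induction n)
  case (Suc n)
  have "int (Suc n) * m = m + int n * m" by (simp add: algebra_simps)
  thus ?case using vge_mult[OF Suc.prems Suc.IH[OF Suc.prems]] by simp
qed (simp add: vge_1)

lemma vge_ev: "vge p 0 x \<Longrightarrow> vge p 0 (ev x q)"
  by (induction q rule: pCons_induct)
     (auto simp: ev_pCons intro!: vge_add vge_const intro: vge_mult[of 0 _ 0, simplified])

lemma place_dominant:
  assumes "x \<noteq> 0" "vge p (p x + 1) y"
  shows "x + y \<noteq> 0" "p (x + y) = p x"
proof -
  show ne: "x + y \<noteq> 0"
  proof
    assume "x + y = 0"
    hence "x = - y" by (simp add: eq_neg_iff_add_eq_0)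
    thus False using assms by (auto simp: vge_def place_uminus)
  qed
  show "p (x + y) = p x"
  proof (cases "y = 0")
    case False
    hence "p x < p y" using assms by (auto simp: vge_def)
    moreover have "min (p x) (p y) \<le> p (x + y)" using place_add ne False assms by blast
    moreover have "min (p (x + y)) (p (- y)) \<le> p (x + y + - y)"
      using ne False assms by (intro place_add) auto
    ultimately show ?thesis by (auto simp: place_uminus)
  qed simp
qed

lemma place_ev_eq_0:
  assumes "vge p 1 x" "coeff q 0 \<noteq> 0" shows "ev x q \<noteq> 0" "p (ev x q) = 0"
proof -
  obtain a r where q: "q = pCons a r" by (cases q)
  have "vge p 0 x" using assms(1) vge_mono by force
  hence "vge p 1 (x * ev x r)" using vge_mult[OF assms(1), of 0] vge_ev by simp
  thus "ev x q \<noteq> 0" "p (ev x q) = 0"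
    using place_dominant[of "\<iota> a" "x * ev x r"] assms(2) by (auto simp: q ev_pCons)
qed

text \<open>The polynomial splits over k, and if the product of the f - a is in the maximal ideal,
  then so is one of its factors.\<close>

lemma root_mod_place:
  assumes "q \<noteq> 0" "vge p 0 f" "vge p 1 (ev f q)"
  shows "\<exists>c. vge p 1 (f - \<iota> c)"
  using assms
proof (induction "degree q" arbitrary: q)
  case 0
  then obtain c where "q = [:c:]" by (metis degree_eq_zeroE)
  thus ?case using 0 by (simp add: vge_def)
next
  case (Suc n)
  then obtain a where "poly q a = 0" using alg_closed[of q] by auto
  then obtain r where r: "q = [:-a, 1:] * r" by (auto simp: poly_eq_0_iff_dvd elim: dvdE)
  have "r \<noteq> 0" using r Suc by auto
  have "degree q = 1 + degree r" unfolding r using \<open>r \<noteq> 0\<close> by (subst degree_mult_eq) auto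
  hence deg: "n = degree r" using Suc.hyps(2) by simp
  have *: "ev f q = (f - \<iota> a) * ev f r" unfolding r ev_mult by (simp add: ev_pCons \<iota>_uminus)
  show ?case
  proof (cases "vge p 1 (ev f r)")
    case True
    thus ?thesis using Suc.hyps(1)[OF deg \<open>r \<noteq> 0\<close> Suc.prems(2)] by blast
  next
    case False
    hence 1: "ev f r \<noteq> 0" "p (ev f r) \<le> 0" by (auto simp: vge_def)
    have "vge p 1 (f - \<iota> a)"
    proof (cases "f = \<iota> a")
      case False
      hence "1 \<le> p (f - \<iota> a) + p (ev f r)"
        using Suc.prems(3) 1 place_mult[of "f - \<iota> a" "ev f r"] by (auto simp: * vge_def)
      thus ?thesis using 1 by (simp add: vge_def)
    qed simp
    thus ?thesis by blast
  qed
qed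

text \<open>As long as all constant coefficients vanish, the relation can be divided by x; the total
  degree drops. The outcome is a relation that stays nontrivial when reduced modulo x.\<close>

lemma nontrivial_relation_mod:
  fixes q :: "'i \<Rightarrow> 'k poly"
  assumes "finite J" "\<exists>j\<in>J. q j \<noteq> 0" "x \<noteq> 0" "(\<Sum>j\<in>J. ev x (q j) * y j) = 0"
  shows "\<exists>q'. (\<exists>j\<in>J. coeff (q' j) 0 \<noteq> (0::'k)) \<and> (\<Sum>j\<in>J. ev x (q' j) * y j) = 0"
  using assms(2,4)
proof (induction "\<Sum>j\<in>J. degree (q j)" arbitrary: q rule: less_induct)
  case less
  show ?case
  proof (cases "\<exists>j\<in>J. coeff (q j) 0 \<noteq> 0")
    case False
    hence "\<forall>j\<in>J. \<exists>r. q j = pCons 0 r" by (metis coeff_pCons_0 pCons_cases)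
    then obtain r where r: "\<And>j. j \<in> J \<Longrightarrow> q j = pCons 0 (r j)" by metis
    have "(\<Sum>j\<in>J. ev x (q j) * y j) = x * (\<Sum>j\<in>J. ev x (r j) * y j)"
      by (simp add: sum_distrib_left r ev_pCons algebra_simps)
    hence 1: "(\<Sum>j\<in>J. ev x (r j) * y j) = 0" using less.prems assms(3) by simp
    obtain j0 where j0: "j0 \<in> J" "q j0 \<noteq> 0" using less.prems by blast
    have le: "degree (r j) \<le> degree (q j)" if "j \<in> J" for j using r[OF that] by (simp add: degree_pCons_eq_if)
    have "r j0 \<noteq> 0" using r[OF j0(1)] j0(2) by auto
    hence "degree (r j0) < degree (q j0)" using r[OF j0(1)] by simp
    hence "(\<Sum>j\<in>J. degree (r j)) < (\<Sum>j\<in>J. degree (q j))"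
      using le j0 assms(1) by (intro sum_strict_mono_ex1) auto
    thus ?thesis using less.hyps[of r] 1 \<open>r j0 \<noteq> 0\<close> j0 by blast
  qed (use less in blast)
qed

text \<open>The residue field is k. The powers of f satisfy a relation over k[t] for a uniformizer
  t; made nontrivial modulo t, its reduction is a nonzero polynomial over k of which f is a root
  modulo the place.\<close>

lemma residue_exists:
  assumes "vge p 0 f" shows "\<exists>c. vge p 1 (f - \<iota> c)"
proof -
  obtain t where t: "t \<noteq> 0" "p t = 1" using place_uniformizer by blast
  obtain N where N: "\<forall>y::nat \<Rightarrow> 'K. \<exists>q::nat \<Rightarrow> 'k poly. (\<exists>j\<le>N. q j \<noteq> 0) \<and> (\<Sum>j\<le>N. ev t (q j) * y j) = 0"
    using bounded_rank_over_poly by blast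
  obtain q0 :: "nat \<Rightarrow> 'k poly" where "\<exists>j\<le>N. q0 j \<noteq> 0" "(\<Sum>j\<le>N. ev t (q0 j) * f ^ j) = 0" using N by meson
  then obtain q :: "nat \<Rightarrow> 'k poly" where q: "\<exists>j\<in>{..N}. coeff (q j) 0 \<noteq> 0" "(\<Sum>j\<le>N. ev t (q j) * f ^ j) = 0"
    using nontrivial_relation_mod[of "{..N}" q0 t "\<lambda>j. f ^ j"] t by auto
  define Q where "Q = (\<Sum>j\<le>N. monom (coeff (q j) 0) j)"
  have "coeff Q j = coeff (q j) 0" if "j \<le> N" for j using that by (simp add: Q_def coeff_sum sum.delta')
  hence "Q \<noteq> 0" using q(1) by auto
  have "ev f Q = - (\<Sum>j\<le>N. (ev t (q j) - \<iota> (coeff (q j) 0)) * f ^ j)"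
    using q(2) by (simp add: Q_def ev_sum ev_monom algebra_simps sum_subtractf)
  moreover have "vge p 1 ((ev t (q j) - \<iota> (coeff (q j) 0)) * f ^ j)" for j
  proof -
    obtain a r where r: "q j = pCons a r" by (cases "q j")
    have "vge p 1 t" "vge p 0 t" using t by (auto simp: vge_def)
    hence "vge p 1 (t * ev t r)" using vge_mult[of 1 t 0] vge_ev by simp
    moreover have "vge p 0 (f ^ j)" using vge_power[OF assms, of j] by simp
    ultimately have "vge p 1 (t * ev t r * f ^ j)" using vge_mult[of 1 _ 0] by fastforce
    thus ?thesis by (simp add: r ev_pCons)
  qed
  ultimately have "vge p 1 (ev f Q)" by (auto intro!: vge_uminus vge_sum)
  thus ?thesis using root_mod_place[OF \<open>Q \<noteq> 0\<close> assms] by blast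
qed

end

lemma place_nonconst: "p \<in> places \<iota> \<Longrightarrow> p x \<noteq> 0 \<Longrightarrow> transc x"
  using place_const by (auto simp: transc_iff)

text \<open>Applied to f and its inverse, the hypothesis shows that functions of v-order 0 have
  w-order 0. So w is a multiple of v, and the normalization of both makes the factor 1.\<close>

lemma place_eqI:
  assumes v: "v \<in> places \<iota>" and w: "w \<in> places \<iota>" and le: "\<And>f. f \<noteq> 0 \<Longrightarrow> v f \<ge> 0 \<Longrightarrow> w f \<ge> 0"
  shows "v = w"
proof -
  obtain t where t: "t \<noteq> 0" "v t = 1" using place_uniformizer[OF v] by blast
  have z: "w f = 0" if "f \<noteq> 0" "v f = 0" for f
    using le[of f] le[of "inverse f"] that place_inverse[OF v, of f] place_inverse[OF w, of f] by auto
  have eq: "w f = v f * w t" if "f \<noteq> 0" for f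
  proof -
    have "v (f * t powi (- v f)) = 0" using that t place_mult[OF v] by (simp add: place_powi[OF v])
    hence "w (f * t powi (- v f)) = 0" using z that t by simp
    thus ?thesis using that t place_mult[OF w] by (simp add: place_powi[OF w])
  qed
  obtain s where s: "s \<noteq> 0" "w s = 1" using place_uniformizer[OF w] by blast
  have "v s * w t = 1" using eq[OF s(1)] s by simp
  moreover have "w t \<ge> 0" using le t by simp
  ultimately have "w t = 1" using zmult_eq_1_iff by fastforce
  show ?thesis
  proof
    fix f show "v f = w f"
      using eq[of f] \<open>w t = 1\<close> place_0[OF v] place_0[OF w] by (cases "f = 0") auto
  qed
qed

section \<open>Weak approximation\<close>

lemma places_separate:
  assumes "v \<in> places \<iota>" "w \<in> places \<iota>" "v \<noteq> w"
  shows "\<exists>y. y \<noteq> 0 \<and> v y > 0 \<and> w y < 0"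
proof -
  obtain f where f: "f \<noteq> 0" "v f \<ge> 0" "w f < 0" using place_eqI[of v w] assms by (meson not_le)
  obtain g where g: "g \<noteq> 0" "w g \<ge> 0" "v g < 0" using place_eqI[of w v] assms by (metis not_le)
  show ?thesis using f g assms by (intro exI[of _ "f / g"]) (auto simp: place_divide)
qed

lemma places_separate_finite:
  assumes "finite W" "W \<subseteq> places \<iota>" "v \<in> places \<iota>" "v \<notin> W"
  shows "\<exists>y. y \<noteq> 0 \<and> v y > 0 \<and> (\<forall>w\<in>W. w y < 0)"
  using assms
proof (induction W rule: finite_induct)
  case empty
  thus ?case using place_uniformizer[of v] by force
next
  case (insert w' W)
  then obtain y where y: "y \<noteq> 0" "v y > 0" "\<forall>w\<in>W. w y < 0" by auto
  obtain z where z: "z \<noteq> 0" "v z > 0" "w' z < 0" using places_separate[of v w'] insert by auto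
  show ?case
  proof (cases "w' y < 0")
    case True
    thus ?thesis using y by auto
  next
    case False
    \<comment> \<open>The exponent exceeds every pole order of y on W. So at a pole of z in W the
      power of z dominates y, at the other places of W the pole of y dominates, and no cancellation
      can occur.\<close>
    define r where "r = Suc (\<Sum>w\<in>W. nat (- w y))"
    have r: "int r > - w y" if "w \<in> W" for w
    proof -
      have "nat (- w y) \<le> (\<Sum>w\<in>W. nat (- w y))" using insert.hyps that by (intro member_le_sum) auto
      hence "nat (- w y) < r" unfolding r_def by linarith
      thus ?thesis by linarith
    qed
    have r1: "r \<ge> 1" by (simp add: r_def)
    have zr: "u (z ^ r) = int r * u z" if "u \<in> places \<iota>" for u using place_power[OF that] .
    have neg: "y + z ^ r \<noteq> 0 \<and> w (y + z ^ r) < 0" if w: "w \<in> insert w' W" for w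
    proof -
      have wp: "w \<in> places \<iota>" using w insert by auto
      show ?thesis
      proof (cases "w = w'")
        case True
        have "w' (z ^ r) < 0" using zr[of w'] z r1 wp True by (simp add: mult_pos_neg)
        hence "z ^ r + y \<noteq> 0" "w' (z ^ r + y) = w' (z ^ r)"
          using place_dominant[of w' "z ^ r" y] wp True z False by (auto simp: vge_def)
        thus ?thesis using \<open>w' (z ^ r) < 0\<close> True by (simp add: add.commute)
      next
        case F: False
        hence wW: "w \<in> W" using w by simp
        show ?thesis
        proof (cases "w z \<ge> 0")
          case True
          hence "0 \<le> w (z ^ r)" using zr[OF wp] by simp
          hence "vge w (w y + 1) (z ^ r)" using y wW by (fastforce simp: vge_def)
          thus ?thesis using place_dominant[OF wp y(1)] y wW by simp
        next
          case F2: False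
          hence "int r * w z \<le> int r * (-1)" using r1 by (intro mult_left_mono) auto
          hence lt: "w (z ^ r) < w y" using r[OF wW] zr[OF wp] by simp
          hence "vge w (w (z ^ r) + 1) y" by (simp add: vge_def)
          hence "z ^ r + y \<noteq> 0" "w (z ^ r + y) = w (z ^ r)" using place_dominant[OF wp, of "z ^ r" y] z by auto
          thus ?thesis using lt y wW by (force simp: add.commute)
        qed
      qed
    qed
    have vp: "v \<in> places \<iota>" using insert by simp
    have "v (z ^ r) > 0" using zr[OF vp] z r1 by simp
    hence "vge v 1 (y + z ^ r)" using vp y z by (intro vge_add) (auto simp: vge_def)
    moreover have "y + z ^ r \<noteq> 0" using neg by blast
    ultimately show ?thesis using neg by (intro exI[of _ "y + z ^ r"]) (auto simp: vge_def)
  qed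
qed

text \<open>If y vanishes at v and has poles on W, then 1 / (1 + y^N) is a unit at v and vanishes on
  W to an order that grows with N.\<close>

lemma approx_idempotent:
  assumes "finite W" "W \<subseteq> places \<iota>" "v \<in> places \<iota>" "v \<notin> W"
  shows "\<exists>e. e \<noteq> 0 \<and> v e = 0 \<and> (\<forall>w\<in>W. int M \<le> w e)"
proof -
  obtain y where y: "y \<noteq> 0" "v y > 0" "\<forall>w\<in>W. w y < 0" using places_separate_finite[OF assms] by blast
  define M' where "M' = Suc M"
  have pw: "u (y ^ M') = int M' * u y" if "u \<in> places \<iota>" for u using place_power[OF that] .
  have "v (y ^ M') > 0" using pw[OF assms(3)] y by (simp add: M'_def)
  hence "vge v (v 1 + 1) (y ^ M')" using place_1[OF assms(3)] by (simp add: vge_def)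
  hence 1: "1 + y ^ M' \<noteq> 0" "v (1 + y ^ M') = 0"
    using place_dominant[OF assms(3), of 1] place_1[OF assms(3)] by auto
  have 2: "int M \<le> w (inverse (1 + y ^ M'))" if w: "w \<in> W" for w
  proof -
    have wp: "w \<in> places \<iota>" using w assms by auto
    have "int M' * w y \<le> int M' * (-1)" using y w by (intro mult_left_mono) force+
    hence le: "w (y ^ M') \<le> - int M'" using pw[OF wp] by simp
    hence "vge w (w (y ^ M') + 1) 1" using place_1[OF wp] by (simp add: vge_def M'_def)
    hence "w (y ^ M' + 1) = w (y ^ M')" using place_dominant[OF wp, of "y ^ M'" 1] y by simp
    thus ?thesis using le by (simp add: place_inverse[OF wp] add.commute M'_def)
  qed
  show ?thesis using 1 2 by (intro exI[of _ "inverse (1 + y ^ M')"]) (auto simp: place_inverse[OF assms(3)])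
qed

section \<open>Independence over k[x] and finiteness of zeros\<close>

definition kx_indep :: "'K \<Rightarrow> 'i set \<Rightarrow> ('i \<Rightarrow> 'K) \<Rightarrow> bool" where
  "kx_indep x I u \<longleftrightarrow> (\<forall>q. (\<Sum>i\<in>I. ev x (q i) * u i) = 0 \<longrightarrow> (\<forall>i\<in>I. q i = 0))"

text \<open>The number of zeros of x is at most the rank over k[x]. The witnesses have the orders 0,
  ..., p x - 1 at one zero p and at least the order of x at the other zeros; in a relation that is
  nontrivial modulo x one term then has strictly smallest order at some p.\<close>

lemma zeros_kx_indep:
  assumes T: "finite T" "T \<subseteq> places \<iota>" and x: "x \<noteq> 0" "\<And>p. p \<in> T \<Longrightarrow> p x > 0"
  shows "\<exists>u. kx_indep x (SIGMA p:T. {..<nat (p x)}) (u :: ('K \<Rightarrow> int) \<times> nat \<Rightarrow> 'K)"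
proof -
  have "\<exists>u. u \<noteq> 0 \<and> p u = int j \<and> (\<forall>w\<in>T-{p}. w u \<ge> w x)" if p: "p \<in> T" for p and j :: nat
  proof -
    have pp: "p \<in> places \<iota>" using p T by auto
    obtain t where t: "t \<noteq> 0" "p t = 1" using place_uniformizer[OF pp] by blast
    \<comment> \<open>Besides reaching the order of x, the factor e has to compensate possible poles
      of the j-th power of t at the other zeros.\<close>
    define M where "M = (\<Sum>w\<in>T. nat (w x) + j * nat \<bar>w t\<bar>)"
    obtain e where e: "e \<noteq> 0" "p e = 0" "\<forall>w\<in>T-{p}. int M \<le> w e"
      using approx_idempotent[of "T - {p}" p M] T pp by auto
    show ?thesis
    proof (intro exI[of _ "t ^ j * e"] conjI ballI)
      show "t ^ j * e \<noteq> 0" using t e by simp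
      show "p (t ^ j * e) = int j" using t e place_mult[OF pp] place_power[OF pp] by simp
      fix w assume w: "w \<in> T - {p}"
      have wp: "w \<in> places \<iota>" using w T by auto
      have "nat (w x) + j * nat \<bar>w t\<bar> \<le> M" unfolding M_def using w T by (intro member_le_sum) auto
      hence "int (nat (w x)) + int j * int (nat \<bar>w t\<bar>) \<le> int M"
        by (simp only: of_nat_le_iff flip: of_nat_mult of_nat_add)
      hence "w x + int j * \<bar>w t\<bar> \<le> int M" by (auto split: if_splits)
      moreover have "int j * w t \<ge> - (int j * \<bar>w t\<bar>)"
        using mult_left_mono[of "- \<bar>w t\<bar>" "w t" "int j"] by auto
      moreover have "w (t ^ j * e) = int j * w t + w e" using t e place_mult[OF wp] place_power[OF wp] by simp
      ultimately show "w (t ^ j * e) \<ge> w x" using e w by force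
    qed
  qed
  then obtain u where u: "\<And>p j. p \<in> T \<Longrightarrow> u p j \<noteq> 0 \<and> p (u p j) = int j \<and> (\<forall>w\<in>T-{p}. w (u p j) \<ge> w x)"
    by metis
  let ?I = "SIGMA p:T. {..<nat (p x)}"
  have "kx_indep x ?I (case_prod u)" unfolding kx_indep_def
  proof (intro allI impI, rule ccontr)
    fix q :: "('K \<Rightarrow> int) \<times> nat \<Rightarrow> 'k poly"
    assume q: "(\<Sum>i\<in>?I. ev x (q i) * case_prod u i) = 0" "\<not> (\<forall>i\<in>?I. q i = 0)"
    have fin: "finite ?I" using T by auto
    obtain p0 j0 where "(p0, j0) \<in> ?I" using q(2) by auto
    have p0: "p0 \<in> places \<iota>" using \<open>(p0, j0) \<in> ?I\<close> T by auto
    obtain r where r: "\<exists>i\<in>?I. coeff (r i) 0 \<noteq> 0" "(\<Sum>i\<in>?I. ev x (r i) * case_prod u i) = 0"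
      using nontrivial_relation_mod[OF p0 fin _ x(1) q(1)] q(2) by blast
    then obtain p j' where "(p, j') \<in> ?I" "coeff (r (p, j')) 0 \<noteq> 0" by auto
    \<comment> \<open>Below j the coefficients are divisible by x and give order at least p x > j.
      Above j the functions have larger order, and those attached to other zeros have order at least
      p x. So the term at j cannot be cancelled.\<close>
    define j where "j = (LEAST j. coeff (r (p, j)) 0 \<noteq> 0)"
    have j: "coeff (r (p, j)) 0 \<noteq> 0" "\<And>l. l < j \<Longrightarrow> coeff (r (p, l)) 0 = 0" "j \<le> j'"
      unfolding j_def using LeastI[of "\<lambda>j. coeff (r (p, j)) 0 \<noteq> 0"] \<open>coeff (r (p, j')) 0 \<noteq> 0\<close>
        not_less_Least[of _ "\<lambda>j. coeff (r (p, j)) 0 \<noteq> 0"] Least_le[of "\<lambda>j. coeff (r (p, j)) 0 \<noteq> 0"] by blast+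
    have pT: "p \<in> T" and pp: "p \<in> places \<iota>" and jI: "(p, j) \<in> ?I" and jx: "int j < p x"
      using \<open>(p, j') \<in> ?I\<close> T j(3) by auto
    have px: "vge p 1 x" using x(2)[OF pT] by (simp add: vge_def)
    have px0: "vge p 0 x" using x(2)[OF pT] by (simp add: vge_def)
    have vx: "vge p (p x) x" by (simp add: vge_def)
    define A where "A = ev x (r (p, j)) * u p j"
    have A: "A \<noteq> 0" "p A = int j"
      using place_ev_eq_0[OF pp px j(1)] u[OF pT, of j] place_mult[OF pp] by (auto simp: A_def)
    have "vge p (p A + 1) (\<Sum>i\<in>?I-{(p,j)}. ev x (r i) * case_prod u i)"
    proof (intro vge_sum[OF pp])
      fix i assume i: "i \<in> ?I - {(p,j)}"
      obtain w l where wl: "i = (w, l)" by (cases i)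
      have wT: "w \<in> T" using i wl by auto
      show "vge p (p A + 1) (ev x (r i) * case_prod u i)"
      proof (cases "w = p")
        case False
        have "vge p (p x) (u w l)" using u[OF wT, of l] pT False by (auto simp: vge_def)
        hence "vge p (0 + p x) (ev x (r i) * u w l)" by (intro vge_mult[OF pp] vge_ev[OF pp] px0)
        thus ?thesis using jx A wl vge_mono by fastforce
      next
        case True
        have ul: "vge p (int l) (u p l)" using u[OF pT, of l] by (auto simp: vge_def)
        show ?thesis
        proof (cases "l < j")
          case True
          obtain s where s: "r (p, l) = pCons 0 s" using j(2)[OF True] by (metis coeff_pCons_0 pCons_cases)
          have "vge p (p x + 0 + int l) (x * ev x s * u p l)"
            by (intro vge_mult[OF pp] vge_ev[OF pp] px0 vx ul)
          thus ?thesis using jx A wl \<open>w = p\<close> s vge_mono by (fastforce simp: ev_pCons)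
        next
          case False
          hence "l > j" using i wl \<open>w = p\<close> by auto
          have "vge p (0 + int l) (ev x (r (p, l)) * u p l)"
            by (intro vge_mult[OF pp] vge_ev[OF pp] px0 ul)
          thus ?thesis using \<open>l > j\<close> A wl \<open>w = p\<close> vge_mono by fastforce
        qed
      qed
    qed
    hence "A + (\<Sum>i\<in>?I-{(p,j)}. ev x (r i) * case_prod u i) \<noteq> 0" using place_dominant[OF pp A(1)] by blast
    moreover have "(\<Sum>i\<in>?I. ev x (r i) * case_prod u i) = A + (\<Sum>i\<in>?I-{(p,j)}. ev x (r i) * case_prod u i)"
      using sum.remove[OF fin jI, of "\<lambda>i. ev x (r i) * case_prod u i"] by (simp add: A_def)
    ultimately show False using r(2) by simp
  qed
  thus ?thesis by blast
qed

lemma kx_indep_card_bounded: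
  "\<exists>N. \<forall>I (u::'i \<Rightarrow> 'K). finite I \<longrightarrow> kx_indep x I u \<longrightarrow> card I \<le> N"
proof -
  obtain N where N: "\<forall>y::nat \<Rightarrow> 'K. \<exists>q::nat \<Rightarrow> 'k poly. (\<exists>j\<le>N. q j \<noteq> 0) \<and> (\<Sum>j\<le>N. ev x (q j) * y j) = 0"
    using bounded_rank_over_poly by blast
  have "card I \<le> N" if I: "finite I" "kx_indep x I u" for I and u :: "'i \<Rightarrow> 'K"
  proof (rule ccontr)
    assume "\<not> card I \<le> N"
    obtain g where g: "bij_betw g {0..<card I} I" using ex_bij_betw_nat_finite[OF I(1)] by blast
    have inj: "inj_on g {..N}" and sub: "g ` {..N} \<subseteq> I"
      using g \<open>\<not> card I \<le> N\<close> by (auto simp: bij_betw_def inj_on_def)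
    obtain q :: "nat \<Rightarrow> 'k poly" where q: "\<exists>j\<le>N. q j \<noteq> 0" "(\<Sum>j\<le>N. ev x (q j) * u (g j)) = 0"
      using N[rule_format, of "\<lambda>j. u (g j)"] by blast
    define r where "r i = (if i \<in> g ` {..N} then q (the_inv_into {..N} g i) else 0)" for i
    have rg: "r (g j) = q j" if "j \<le> N" for j using that inj by (simp add: r_def the_inv_into_f_f)
    have "(\<Sum>i\<in>I. ev x (r i) * u i) = (\<Sum>i\<in>g ` {..N}. ev x (r i) * u i)"
      using I sub by (intro sum.mono_neutral_right) (auto simp: r_def)
    also have "\<dots> = (\<Sum>j\<le>N. ev x (q j) * u (g j))" using inj by (simp add: sum.reindex rg)
    finally have "\<forall>i\<in>I. r i = 0" using q(2) I(2) unfolding kx_indep_def by auto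
    thus False using q(1) rg sub by force
  qed
  thus ?thesis by blast
qed

text \<open>Infinitely many zeros would give independent families over k[x] larger than the rank
  allows.\<close>

lemma finite_zeros:
  assumes "x \<noteq> 0" shows "finite {p \<in> places \<iota>. p x > 0}"
proof (rule ccontr)
  assume inf: "infinite {p \<in> places \<iota>. p x > 0}"
  obtain N where N: "\<And>I (u::('K \<Rightarrow> int) \<times> nat \<Rightarrow> 'K). finite I \<Longrightarrow> kx_indep x I u \<Longrightarrow> card I \<le> N"
    using kx_indep_card_bounded[of x] by metis
  obtain T where T: "T \<subseteq> {p \<in> places \<iota>. p x > 0}" "finite T" "card T = Suc N"
    using inf by (meson infinite_arbitrarily_large)
  obtain u :: "('K \<Rightarrow> int) \<times> nat \<Rightarrow> 'K" where u: "kx_indep x (SIGMA p:T. {..<nat (p x)}) u"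
    using zeros_kx_indep[of T x] T assms by blast
  have "(SIGMA p:T. {..<nat (p x)}) \<supseteq> (\<lambda>p. (p, 0)) ` T" using T by auto
  moreover have "card ((\<lambda>p. (p, 0::nat)) ` T) = Suc N" using T by (simp add: card_image inj_on_def)
  ultimately have "Suc N \<le> card (SIGMA p:T. {..<nat (p x)})"
    using T card_mono[of "SIGMA p:T. {..<nat (p x)}" "(\<lambda>p. (p, 0)) ` T"] by auto
  thus False using N[OF _ u] T by auto
qed

lemma finite_support: assumes "x \<noteq> 0" shows "finite {p \<in> places \<iota>. p x \<noteq> 0}"
proof -
  have "{p \<in> places \<iota>. p x \<noteq> 0} = {p \<in> places \<iota>. p x > 0} \<union> {p \<in> places \<iota>. p (inverse x) > 0}"
    by (auto simp: place_inverse)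
  thus ?thesis using finite_zeros[of x] finite_zeros[of "inverse x"] assms by simp
qed

end

section \<open>Existence of places\<close>

context curve
begin

definition ksubring :: "'K set \<Rightarrow> bool" where
  "ksubring R \<longleftrightarrow> range \<iota> \<subseteq> R \<and> (\<forall>a\<in>R. \<forall>b\<in>R. a + b \<in> R \<and> a * b \<in> R)"

lemma ksubring_uminus: "ksubring R \<Longrightarrow> a \<in> R \<Longrightarrow> - a \<in> R"
proof -
  assume R: "ksubring R" "a \<in> R"
  have "\<iota> (-1) \<in> R" using R by (auto simp: ksubring_def)
  hence "\<iota> (-1) * a \<in> R" using R unfolding ksubring_def by blast
  thus ?thesis by (simp add: \<iota>_uminus)
qed

lemma ksubring_sum: "ksubring R \<Longrightarrow> (\<And>i. i \<in> I \<Longrightarrow> f i \<in> R) \<Longrightarrow> sum f I \<in> R"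
proof (induction I rule: infinite_finite_induct)
  case (insert i I)
  thus ?case by (simp add: ksubring_def)
qed (use \<iota>_0 in \<open>force simp: ksubring_def\<close>)+

lemma ksubring_adjoin:
  assumes R: "ksubring R"
  shows "ksubring {poly P y |P. \<forall>i. coeff P i \<in> R}" (is "ksubring ?A")
  unfolding ksubring_def
proof (intro conjI ballI subsetI)
  have R0: "0 \<in> R" using R \<iota>_0 unfolding ksubring_def by (metis rangeI subsetD)
  fix a assume "a \<in> range \<iota>"
  then obtain c where c: "a = \<iota> c" by auto
  have "\<iota> c \<in> R" using R by (auto simp: ksubring_def)
  hence "\<forall>i. coeff [:\<iota> c:] i \<in> R" using R0 by (auto simp: coeff_pCons split: nat.split)
  thus "a \<in> ?A" by (intro CollectI exI[of _ "[:\<iota> c:]"]) (simp add: c)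
next
  fix a b assume "a \<in> ?A" "b \<in> ?A"
  then obtain P Q where P: "a = poly P y" "\<forall>i. coeff P i \<in> R" and Q: "b = poly Q y" "\<forall>i. coeff Q i \<in> R" by blast
  have "\<forall>i. coeff (P + Q) i \<in> R" using P Q R by (auto simp: ksubring_def)
  thus "a + b \<in> ?A" using P Q by (intro CollectI exI[of _ "P + Q"]) auto
  have "\<forall>i. coeff (P * Q) i \<in> R" using P Q R by (auto simp: coeff_mult ksubring_def intro!: ksubring_sum)
  thus "a * b \<in> ?A" using P Q by (intro CollectI exI[of _ "P * Q"]) auto
qed

end

text \<open>The valuation ring of a place is obtained as a subring maximal among those not containing \<open>1 / s\<close>.\<close>

locale maximal_subring = curve \<iota> for \<iota> :: "'k::field_char_0 \<Rightarrow> 'K::field" +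
  fixes R :: "'K set" and s :: 'K
  assumes R: "ksubring R" and sR: "s \<in> R" and inv_s: "1 / s \<notin> R"
    and maximal: "\<And>Q. ksubring Q \<Longrightarrow> R \<subseteq> Q \<Longrightarrow> 1 / s \<notin> Q \<Longrightarrow> Q = R"
begin

lemma R_add: "a \<in> R \<Longrightarrow> b \<in> R \<Longrightarrow> a + b \<in> R" and R_mult: "a \<in> R \<Longrightarrow> b \<in> R \<Longrightarrow> a * b \<in> R"
  and R_const: "\<iota> c \<in> R"
  using R by (auto simp: ksubring_def)
lemma R_0: "0 \<in> R" and R_1: "1 \<in> R" using R_const[of 0] R_const[of 1] by auto
lemma R_uminus: "a \<in> R \<Longrightarrow> - a \<in> R" using ksubring_uminus[OF R] .
lemma R_diff: "a \<in> R \<Longrightarrow> b \<in> R \<Longrightarrow> a - b \<in> R" using R_add[of a "-b"] R_uminus[of b] by simp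
lemma R_sum: "(\<And>i. i \<in> I \<Longrightarrow> f i \<in> R) \<Longrightarrow> sum f I \<in> R" using ksubring_sum[OF R] .
lemma R_power: "a \<in> R \<Longrightarrow> a ^ n \<in> R" by (induction n) (auto intro: R_mult R_1)
lemma s_nz: "s \<noteq> 0" using inv_s R_0 by auto

lemma adjoin:
  assumes "y \<notin> R" shows "\<exists>P. (\<forall>i. coeff P i \<in> R) \<and> 1 / s = poly P y"
proof (rule ccontr)
  let ?A = "{poly P y |P. \<forall>i. coeff P i \<in> R}"
  assume "\<not> ?thesis"
  hence "1 / s \<notin> ?A" by blast
  moreover have "R \<subseteq> ?A"
  proof
    fix a assume a: "a \<in> R"
    hence "\<forall>i. coeff [:a:] i \<in> R" using R_0 by (auto simp: coeff_pCons split: nat.split)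
    thus "a \<in> ?A" by (intro CollectI exI[of _ "[:a:]"]) simp
  qed
  ultimately have "?A = R" using maximal ksubring_adjoin[OF R] by blast
  moreover have "\<forall>i. coeff [:0, 1:] i \<in> R" using R_0 R_1 by (auto simp: coeff_pCons split: nat.split)
  hence "y \<in> ?A" by (intro CollectI exI[of _ "[:0, 1:]"]) simp
  ultimately show False using assms by simp
qed

lemma one_minus_s_power: "b \<in> R \<Longrightarrow> \<exists>b'\<in>R. (1 - s * b) ^ m = 1 - s * b'"
proof (induction m)
  case 0
  thus ?case using R_0 by (intro bexI[of _ 0]) auto
next
  case (Suc m)
  then obtain b' where b': "b' \<in> R" "(1 - s * b) ^ m = 1 - s * b'" by auto
  have "(1 - s * b) ^ Suc m = 1 - s * (b + b' - s * (b * b'))" unfolding power_Suc b'(2) by (simp add: algebra_simps)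
  moreover have "b + b' - s * (b * b') \<in> R" using Suc.prems b' sR by (intro R_diff R_add R_mult) auto
  ultimately show ?case by blast
qed

text \<open>If the inverse of 1 - s b were missing, maximality would express 1 / s as a polynomial
  in it. Clearing denominators turns this into (1 - s b') / s = r with b' and r in R, so 1 / s would
  lie in R after all.\<close>

lemma one_minus_s_unit:
  assumes b: "b \<in> R" shows "1 - s * b \<noteq> 0" "1 / (1 - s * b) \<in> R"
proof -
  show nz: "1 - s * b \<noteq> 0"
  proof
    assume "1 - s * b = 0"
    hence "1 / s = b" using s_nz by (simp add: field_simps)
    thus False using inv_s b by simp
  qed
  show "1 / (1 - s * b) \<in> R"
  proof (rule ccontr)
    define y where "y = 1 / (1 - s * b)"
    assume "1 / (1 - s * b) \<notin> R"
    then obtain P where P: "\<forall>i. coeff P i \<in> R" "1 / s = poly P y" using adjoin y_def by blast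
    define m where "m = degree P"
    define r where "r = (\<Sum>i\<le>m. coeff P i * (1 - s * b) ^ (m - i))"
    have rR: "r \<in> R" unfolding r_def using P b sR by (intro R_sum R_mult R_power R_diff R_1) auto
    have "(1 - s * b) ^ m * poly P y = r"
      unfolding poly_altdef r_def m_def[symmetric] sum_distrib_left
    proof (intro sum.cong refl)
      fix i assume i: "i \<in> {..m}"
      have "(1 - s * b) ^ m = (1 - s * b) ^ (m - i) * (1 - s * b) ^ i" using i by (simp flip: power_add)
      thus "(1 - s * b) ^ m * (coeff P i * y ^ i) = coeff P i * (1 - s * b) ^ (m - i)"
        using nz by (simp add: y_def power_one_over)
    qed
    moreover obtain b' where b': "b' \<in> R" "(1 - s * b) ^ m = 1 - s * b'" using one_minus_s_power[OF b] by blast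
    ultimately have "(1 - s * b') * (1 / s) = r" using P by simp
    hence "1 / s = r + b'" using s_nz by (simp add: field_simps)
    thus False using inv_s R_add[OF rR b'(1)] by simp
  qed
qed

text \<open>Chevalley's argument: of two expressions of 1 / s, as a polynomial in y and as a
  polynomial in 1 / y, the one of larger degree can be shortened with the help of the other. With
  minimal degrees this is impossible.\<close>

lemma valuation_ring_aux:
  assumes y: "y \<noteq> 0"
    and P: "\<forall>i. coeff P i \<in> R" "degree P \<le> m" "1 / s = poly P y"
    and min: "\<And>P' m'. m' < m \<Longrightarrow> \<forall>i. coeff P' i \<in> R \<Longrightarrow> degree P' \<le> m' \<Longrightarrow> 1 / s \<noteq> poly P' y"
    and Q: "\<forall>i. coeff Q i \<in> R" "degree Q \<le> l" "1 / s = poly Q (1 / y)" and lm: "l \<le> m"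
  shows False
proof (cases "m = 0")
  case True
  then obtain a where "P = [:a:]" using P(2) degree_eq_zeroE by auto
  thus False using P inv_s by (metis coeff_pCons_0 poly_pCons poly_0 mult_zero_right add_0_right)
next
  case False
  define u where "u = 1 / (1 - s * coeff Q 0)"
  have u: "1 - s * coeff Q 0 \<noteq> 0" "u \<in> R" using one_minus_s_unit[of "coeff Q 0"] Q(1) by (auto simp: u_def)
  have polyP: "poly P y = (\<Sum>i<m. coeff P i * y ^ i) + coeff P m * y ^ m"
  proof -
    have "poly P y = (\<Sum>i\<le>m. coeff P i * y ^ i)"
      using P(2) by (auto simp: poly_altdef coeff_eq_0 intro!: sum.mono_neutral_left le_degree)
    thus ?thesis by (simp add: lessThan_Suc_atMost[symmetric])
  qed
  have polyQ: "poly Q (1/y) = coeff Q 0 + (\<Sum>j\<in>{1..l}. coeff Q j * (1/y) ^ j)"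
  proof -
    have "poly Q (1/y) = (\<Sum>i\<le>l. coeff Q i * (1/y) ^ i)"
      using Q(2) by (auto simp: poly_altdef coeff_eq_0 intro!: sum.mono_neutral_left le_degree)
    also have "{..l} = insert 0 {1..l}" by auto
    finally show ?thesis by simp
  qed
  have "s * coeff Q 0 + s * (\<Sum>j\<in>{1..l}. coeff Q j * (1/y) ^ j) = 1"
    using Q(3) s_nz unfolding polyQ by (simp add: field_simps)
  hence "s * (\<Sum>j\<in>{1..l}. coeff Q j * (1/y) ^ j) = 1 - s * coeff Q 0" by (simp add: algebra_simps)
  \<comment> \<open>The constant term of Q has been absorbed into the unit 1 - s Q_0. Multiplying
    the leading term of P by this expression of 1, which involves only negative powers of y, lowers
    its degree.\<close>
  hence one: "u * s * (\<Sum>j\<in>{1..l}. coeff Q j * (1/y) ^ j) = 1" using u(1) by (simp add: u_def)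
  have "coeff P m * y ^ m = coeff P m * y ^ m * (u * s * (\<Sum>j\<in>{1..l}. coeff Q j * (1/y) ^ j))"
    by (subst one) simp
  also have "\<dots> = (\<Sum>j\<in>{1..l}. (coeff P m * (u * s * coeff Q j)) * y ^ (m - j))"
    unfolding sum_distrib_left
  proof (intro sum.cong refl)
    fix j assume "j \<in> {1..l}"
    hence "y ^ m = y ^ (m - j) * y ^ j" using lm by (simp flip: power_add)
    thus "coeff P m * y ^ m * (u * s * (coeff Q j * (1 / y) ^ j)) = coeff P m * (u * s * coeff Q j) * y ^ (m - j)"
      using y by (simp add: power_one_over)
  qed
  finally have top: "coeff P m * y ^ m = (\<Sum>j\<in>{1..l}. (coeff P m * (u * s * coeff Q j)) * y ^ (m - j))" .
  define P' where "P' = (\<Sum>i<m. monom (coeff P i) i) + (\<Sum>j\<in>{1..l}. monom (coeff P m * (u * s * coeff Q j)) (m - j))"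
  have "poly P' y = poly P y" unfolding polyP top P'_def by (simp add: poly_sum poly_monom)
  moreover have "\<forall>i. coeff P' i \<in> R" unfolding P'_def using P Q u sR
    by (auto simp: coeff_sum intro!: R_add R_sum R_mult R_0)
  moreover have "degree P' \<le> m - 1" unfolding P'_def
    by (intro degree_add_le degree_sum_le order_trans[OF degree_monom_le]) auto
  ultimately show False using min[of "m - 1" P'] False P(3) by auto
qed

lemma valuation_ring:
  assumes "y \<noteq> 0" shows "y \<in> R \<or> 1 / y \<in> R"
proof (rule ccontr)
  assume neg: "\<not> ?thesis"
  define \<Phi> where "\<Phi> z m \<longleftrightarrow> (\<exists>P. (\<forall>i. coeff P i \<in> R) \<and> degree P \<le> m \<and> 1 / s = poly P z)" for z and m :: nat
  have ex: "\<exists>m. \<Phi> z m" if "z \<notin> R" for z using adjoin[OF that] unfolding \<Phi>_def by blast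
  define m where "m = (LEAST m. \<Phi> y m)"
  define l where "l = (LEAST l. \<Phi> (1 / y) l)"
  have m: "\<Phi> y m" "\<And>m'. m' < m \<Longrightarrow> \<not> \<Phi> y m'" unfolding m_def
    using LeastI_ex[OF ex[of y]] neg not_less_Least[of _ "\<Phi> y"] by blast+
  have l: "\<Phi> (1 / y) l" "\<And>m'. m' < l \<Longrightarrow> \<not> \<Phi> (1 / y) m'" unfolding l_def
    using LeastI_ex[OF ex[of "1 / y"]] neg not_less_Least[of _ "\<Phi> (1 / y)"] by blast+
  obtain P where P: "\<forall>i. coeff P i \<in> R" "degree P \<le> m" "1 / s = poly P y" using m(1) unfolding \<Phi>_def by blast
  obtain Q where Q: "\<forall>i. coeff Q i \<in> R" "degree Q \<le> l" "1 / s = poly Q (1 / y)" using l(1) unfolding \<Phi>_def by blast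
  show False
  proof (cases "l \<le> m")
    case True
    show False by (rule valuation_ring_aux[OF assms P _ Q True]) (use m(2) in \<open>auto simp: \<Phi>_def\<close>)
  next
    case False
    have P': "1 / s = poly P (1 / (1 / y))" using P by simp
    show False by (rule valuation_ring_aux[OF _ Q _ P(1,2) P']) (use l(2) assms False in \<open>auto simp: \<Phi>_def\<close>)
  qed
qed

definition U :: "'K set" where "U = {x. x \<noteq> 0 \<and> x \<in> R \<and> 1 / x \<in> R}"

lemma U_1: "1 \<in> U" by (simp add: U_def R_1)
lemma U_mult: "x \<in> U \<Longrightarrow> y \<in> U \<Longrightarrow> x * y \<in> U" using R_mult[of "1/x" "1/y"] by (simp add: U_def R_mult)
lemma U_inverse: "x \<in> U \<Longrightarrow> 1 / x \<in> U" by (simp add: U_def)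
lemma U_divide: "x \<in> U \<Longrightarrow> y \<in> U \<Longrightarrow> x / y \<in> U" using U_mult[of x "1 / y"] U_inverse by simp
lemma U_power: "x \<in> U \<Longrightarrow> x ^ n \<in> U" by (induction n) (auto intro: U_mult U_1)
lemma U_const: "c \<noteq> 0 \<Longrightarrow> \<iota> c \<in> U"
  using R_const[of c] R_const[of "1 / c"] by (simp add: U_def \<iota>_divide)

lemma s_powi_U: "s powi i \<in> U \<Longrightarrow> i = 0"
proof -
  have pos: "s ^ n \<notin> U" if n: "n > 0" for n
  proof
    assume "s ^ n \<in> U"
    hence "1 / s ^ n \<in> R" by (simp add: U_def)
    hence "s ^ (n - 1) * (1 / s ^ n) \<in> R" by (intro R_mult R_power sR)
    moreover have "s ^ n = s ^ (n - 1) * s" using n by (simp flip: power_Suc2)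
    ultimately show False using inv_s s_nz by simp
  qed
  assume i: "s powi i \<in> U"
  show "i = 0"
  proof (rule ccontr)
    assume "i \<noteq> 0"
    show False
    proof (cases "i > 0")
      case True
      thus False using i pos[of "nat i"] by (simp add: power_int_def)
    next
      case False
      hence "1 / (s powi i) = s ^ nat (- i)" using \<open>i \<noteq> 0\<close> by (simp add: power_int_def power_inverse field_simps)
      thus False using U_inverse[OF i] pos[of "nat (- i)"] \<open>i \<noteq> 0\<close> False by simp
    qed
  qed
qed

lemma nonunit_add:
  assumes "a \<in> R" "a \<notin> U" "b \<in> R" "b \<notin> U" shows "a + b \<notin> U"
proof
  assume u: "a + b \<in> U"
  have gen: False if ab: "a \<in> R" "b \<in> R" "b \<notin> U" "a + b \<in> U" "b \<noteq> 0" "a / b \<in> R" for a b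
  proof -
    have "1 / b = (1 + a / b) * (1 / (a + b))" using ab by (simp add: U_def field_simps)
    also have "\<dots> \<in> R" using ab by (intro R_mult R_add R_1) (auto simp: U_def)
    finally show False using ab by (simp add: U_def)
  qed
  show False
  proof (cases "a = 0 \<or> b = 0")
    case False
    hence "a / b \<in> R \<or> b / a \<in> R" using valuation_ring[of "a / b"] by auto
    thus False using gen[of a b] gen[of b a] assms u False by (auto simp: add.commute)
  qed (use assms u in auto)
qed

lemma nonunit_sum: "finite I \<Longrightarrow> (\<And>i. i \<in> I \<Longrightarrow> f i \<in> R \<and> f i \<notin> U) \<Longrightarrow> sum f I \<notin> U"
proof (induction I rule: finite_induct)
  case (insert i I)
  have "sum f I \<in> R" using insert.prems by (intro R_sum) auto
  thus ?case using nonunit_add[of "f i" "sum f I"] insert by simp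
qed (simp add: U_def)

text \<open>After a power of s is split off, the constant term a is nonzero, and the rest is a times
  an element of the form 1 + s b, which is a unit.\<close>

lemma ev_s_unit: "q \<noteq> 0 \<Longrightarrow> \<exists>k::nat. \<exists>u\<in>U. ev s q = s ^ k * u"
proof (induction "degree q" arbitrary: q rule: less_induct)
  case less
  obtain a r where q: "q = pCons a r" by (cases q)
  show ?case
  proof (cases "a = 0")
    case True
    hence "r \<noteq> 0" "degree r < degree q" using less.prems q by auto
    then obtain k u where "u \<in> U" "ev s r = s ^ k * u" using less.hyps by blast
    thus ?thesis using True by (intro exI[of _ "Suc k"] bexI[of _ u]) (auto simp: q ev_pCons)
  next
    case False
    have evR: "ev s r \<in> R"
      by (induction r rule: pCons_induct) (auto simp: ev_pCons R_0 intro!: R_add R_mult R_const sR)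
    have "- \<iota> (1 / a) * ev s r \<in> R" by (intro R_mult R_uminus R_const evR)
    from one_minus_s_unit[OF this] have 1: "1 + s * (\<iota> (1 / a) * ev s r) \<noteq> 0" "1 / (1 + s * (\<iota> (1 / a) * ev s r)) \<in> R"
      by auto
    have "1 + s * (\<iota> (1 / a) * ev s r) \<in> U" using 1 by (auto simp: U_def intro!: R_add R_1 R_mult sR R_const evR)
    hence "\<iota> a * (1 + s * (\<iota> (1 / a) * ev s r)) \<in> U" using U_const[OF False] U_mult by blast
    moreover have "\<iota> a * (1 + s * (\<iota> (1 / a) * ev s r)) = ev s q"
      using False by (simp add: q ev_pCons \<iota>_divide algebra_simps)
    ultimately show ?thesis by (intro exI[of _ 0]) auto
  qed
qed

text \<open>The source of discreteness. The powers of y up to a uniform N satisfy a relation over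
  k[s], and two of its terms must have the same value. Since elements of k[s] are powers of s up to
  units, some power of y is a power of s up to a unit.\<close>

lemma ex_exponent: "\<exists>M>0. \<forall>y. y \<noteq> 0 \<longrightarrow> (\<exists>i. y ^ M * s powi (- i) \<in> U)"
proof -
  obtain N where N: "\<forall>y::nat \<Rightarrow> 'K. \<exists>q::nat \<Rightarrow> 'k poly. (\<exists>j\<le>N. q j \<noteq> 0) \<and> (\<Sum>j\<le>N. ev s (q j) * y j) = 0"
    using bounded_rank_over_poly by blast
  have small: "\<exists>j\<in>{1..N}. \<exists>i. y ^ j * s powi i \<in> U" if y: "y \<noteq> 0" for y
  proof -
    obtain q :: "nat \<Rightarrow> 'k poly" where q: "\<exists>j\<le>N. q j \<noteq> 0" "(\<Sum>j\<le>N. ev s (q j) * y ^ j) = 0" using N by meson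
    define J where "J = {j. j \<le> N \<and> q j \<noteq> 0}"
    have J: "finite J" "J \<noteq> {}" using q by (auto simp: J_def)
    define T where "T j = ev s (q j) * y ^ j" for j
    have "\<forall>j. \<exists>k u. j \<in> J \<longrightarrow> u \<in> U \<and> ev s (q j) = s ^ k * u" using ev_s_unit unfolding J_def by blast
    then obtain k u where ku: "\<And>j. j \<in> J \<Longrightarrow> u j \<in> U \<and> ev s (q j) = s ^ k j * u j" by metis
    have Tnz: "T j \<noteq> 0" if "j \<in> J" for j using ku[OF that] y s_nz by (auto simp: T_def U_def)
    have minJ: "\<exists>j0\<in>J'. \<forall>j\<in>J'. T j / T j0 \<in> R" if "finite J'" "J' \<noteq> {}" "J' \<subseteq> J" for J'
      using that
    proof (induction J' rule: finite_ne_induct)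
      case (singleton j)
      thus ?case using Tnz[of j] by (simp add: R_1)
    next
      case (insert j J')
      then obtain j0 where j0: "j0 \<in> J'" "\<forall>j\<in>J'. T j / T j0 \<in> R" by auto
      have nz: "T j \<noteq> 0" "T j0 \<noteq> 0" using Tnz insert j0 by auto
      show ?case
      proof (cases "T j / T j0 \<in> R")
        case True
        thus ?thesis using j0 by auto
      next
        case False
        hence 1: "T j0 / T j \<in> R" using valuation_ring[of "T j / T j0"] nz by auto
        have "T i / T j \<in> R" if "i \<in> J'" for i
          using R_mult[OF j0(2)[rule_format, OF that] 1] nz by simp
        thus ?thesis using nz R_1 by (intro bexI[of _ j]) auto
      qed
    qed
    obtain j0 where j0: "j0 \<in> J" "\<And>j. j \<in> J \<Longrightarrow> T j / T j0 \<in> R" using minJ[OF J subset_refl] by blast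
    have "(\<Sum>j\<in>J. T j) = 0" unfolding T_def using q(2) by (subst sum.mono_neutral_left[of "{..N}"]) (auto simp: J_def)
    hence "(\<Sum>j\<in>J. T j / T j0) = 0" by (simp flip: sum_divide_distrib)
    hence "1 + (\<Sum>j\<in>J-{j0}. T j / T j0) = 0" using sum.remove[OF J(1) j0(1), of "\<lambda>j. T j / T j0"] Tnz[OF j0(1)] by simp
    hence sm: "(\<Sum>j\<in>J-{j0}. T j / T j0) = - 1" by (simp add: eq_neg_iff_add_eq_0 add.commute)
    have "- 1 \<in> U" using U_const[of "-1"] by (simp add: \<iota>_uminus)
    \<comment> \<open>All ratios to the term of least value lie in R, and those of the other terms
      add up to the unit -1; if all of them were nonunits, so would be their sum.\<close>
    hence "\<exists>j\<in>J-{j0}. T j / T j0 \<in> U"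
      using nonunit_sum[of "J - {j0}" "\<lambda>j. T j / T j0"] sm J j0 by auto
    then obtain j1 where j1: "j1 \<in> J" "j1 \<noteq> j0" "T j1 / T j0 \<in> U" by blast
    have gen: "\<exists>i. y ^ (b - a) * s powi i \<in> U" if ab: "a \<in> J" "b \<in> J" "a < b" "T b / T a \<in> U" for a b
    proof -
      have "y ^ b = y ^ (b - a) * y ^ a" using ab by (simp flip: power_add)
      hence "T b / T a * (u a / u b) = y ^ (b - a) * (s ^ k b / s ^ k a)"
        using ku ab y s_nz by (auto simp: T_def U_def)
      also have "s ^ k b / s ^ k a = s powi (int (k b) - int (k a))" using s_nz by (simp add: power_int_diff)
      finally show ?thesis using U_mult[OF ab(4) U_divide[of "u a" "u b"]] ku ab by auto
    qed
    have "T j0 / T j1 \<in> U" using U_inverse[OF j1(3)] by simp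
    hence "j0 < j1 \<Longrightarrow> \<exists>i. y ^ (j1 - j0) * s powi i \<in> U" "j1 < j0 \<Longrightarrow> \<exists>i. y ^ (j0 - j1) * s powi i \<in> U"
      using gen j0 j1 by auto
    moreover have "j0 < j1 \<Longrightarrow> j1 - j0 \<in> {1..N}" "j1 < j0 \<Longrightarrow> j0 - j1 \<in> {1..N}" using j0 j1 by (auto simp: J_def)
    ultimately show ?thesis using j1(2) by (meson linorder_neqE_nat)
  qed
  show ?thesis
  \<comment> \<open>The exponent found above depends on y but is at most N, so the factorial serves
    all y at once.\<close>
  proof (rule exI[of _ "fact N"], intro conjI allI impI)
    fix y :: 'K assume "y \<noteq> 0"
    then obtain j i where j: "j \<in> {1..N}" "y ^ j * s powi i \<in> U" using small by blast
    have "j dvd fact N" using j by (intro dvd_fact) auto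
    then obtain l where l: "fact N = j * l" by (auto elim: dvdE)
    have "(y ^ j * s powi i) ^ l \<in> U" using j by (intro U_power)
    also have "(y ^ j * s powi i) ^ l = y ^ fact N * s powi (- (- (i * int l)))"
      by (simp add: l power_mult power_mult_distrib power_int_mult)
    finally show "\<exists>i. y ^ fact N * s powi (- i) \<in> U" by blast
  qed simp
qed

text \<open>The integer i for which y^M is s^i up to a unit is a valuation of y, not yet normalized,
  with value M at s. Dividing by the least positive value gives the place.\<close>

lemma ex_place: "\<exists>p\<in>places \<iota>. p s > 0"
proof -
  obtain M where M: "M > 0" "\<And>y. y \<noteq> 0 \<Longrightarrow> \<exists>i. y ^ M * s powi (- i) \<in> U" using ex_exponent by blast
  have uniq: "i = j" if "y \<noteq> 0" "y ^ M * s powi (- i) \<in> U" "y ^ M * s powi (- j) \<in> U" for y i j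
  proof -
    have "s powi (j - i) = (y ^ M * s powi (- i)) / (y ^ M * s powi (- j))"
      using that s_nz by (simp add: power_int_diff power_int_minus field_simps)
    hence "s powi (j - i) \<in> U" using U_divide that by metis
    thus ?thesis using s_powi_U by force
  qed
  define w where "w y = (THE i. y ^ M * s powi (- i) \<in> U)" for y
  have w: "y ^ M * s powi (- w y) \<in> U" if "y \<noteq> 0" for y
    unfolding w_def using M(2)[OF that] uniq[OF that] by (metis (mono_tags, lifting) theI)
  have wI: "w y = i" if "y \<noteq> 0" "y ^ M * s powi (- i) \<in> U" for y i using uniq w that by blast
  have w_mult: "w (x * y) = w x + w y" if "x \<noteq> 0" "y \<noteq> 0" for x y
  proof (rule wI)
    have "(x * y) ^ M * s powi (- (w x + w y)) = (x ^ M * s powi (- w x)) * (y ^ M * s powi (- w y))"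
      using s_nz by (simp add: power_mult_distrib power_int_add power_int_diff power_int_minus field_simps)
    thus "(x * y) ^ M * s powi (- (w x + w y)) \<in> U" using U_mult w that by metis
  qed (use that in simp)
  have w_U: "w x = 0" if "x \<in> U" for x using that by (intro wI) (auto simp: U_power, auto simp: U_def)
  have w_R: "w x \<ge> 0" if "x \<in> R" "x \<noteq> 0" for x
  proof (rule ccontr)
    assume neg: "\<not> w x \<ge> 0"
    define u where "u = x ^ M * s powi (- w x)"
    have u: "u \<in> U" using w that u_def by simp
    have "s powi (- w x) = s ^ (nat (- w x) - 1) * s"
      using neg by (cases "nat (- w x)") (auto simp: power_int_def)
    hence "1 / s = x ^ M * s ^ (nat (- w x) - 1) * (1 / u)" using u s_nz by (auto simp: u_def U_def field_simps)
    also have "\<dots> \<in> R" using u that by (intro R_mult R_power sR) (auto simp: U_def)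
    finally show False using inv_s by simp
  qed
  have w_inv: "w (1 / x) = - w x" if "x \<noteq> 0" for x
    using w_mult[of x "1 / x"] that w_U[OF U_1] by simp
  have w_add: "min (w x) (w y) \<le> w (x + y)" if xy: "x \<noteq> 0" "y \<noteq> 0" "x + y \<noteq> 0" for x y
  proof -
    have gen: "w y \<le> w (x + y)" if xy: "x \<noteq> 0" "y \<noteq> 0" "x + y \<noteq> 0" "x / y \<in> R" for x y
    proof -
      have "x + y = (1 + x / y) * y" using xy by (simp add: field_simps)
      moreover have "1 + x / y \<noteq> 0" using xy by (auto simp: field_simps)
      moreover have "w (1 + x / y) \<ge> 0" using xy calculation by (intro w_R R_add R_1) auto
      ultimately show ?thesis using w_mult[of "1 + x / y" y] xy by simp
    qed
    have "x / y \<in> R \<or> y / x \<in> R" using valuation_ring[of "x / y"] xy by auto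
    thus ?thesis using gen[of x y] gen[of y x] xy by (auto simp: add.commute)
  qed
  have w_s: "w s = int M"
    using s_nz U_1 by (intro wI) (auto simp: power_int_minus)
  have w_powi: "w (x powi n) = n * w x" if x: "x \<noteq> 0" for x n
  proof -
    have pw: "w (z ^ k) = int k * w z" if "z \<noteq> 0" for z k
      using that by (induction k) (auto simp: w_U[OF U_1] w_mult algebra_simps)
    show ?thesis using pw[OF x] pw[of "1 / x"] w_inv[OF x] x by (auto simp: power_int_def inverse_eq_divide)
  qed
  \<comment> \<open>The least positive value generates the value group: a value with nonzero
    remainder modulo D would yield a smaller positive one.\<close>
  define D where "D = (LEAST n. n > 0 \<and> (\<exists>x. x \<noteq> 0 \<and> w x = int n))"
  have exD: "\<exists>n. n > 0 \<and> (\<exists>x. x \<noteq> 0 \<and> w x = int n)" using M(1) w_s s_nz by blast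
  have D: "D > 0" "\<exists>x. x \<noteq> 0 \<and> w x = int D" using LeastI_ex[OF exD] by (auto simp: D_def)
  have Dmin: "D \<le> n" if "n > 0" "x \<noteq> 0" "w x = int n" for n x
    unfolding D_def using that by (intro Least_le) auto
  obtain t where t: "t \<noteq> 0" "w t = int D" using D by blast
  have dvd: "int D dvd w x" if x: "x \<noteq> 0" for x
  proof (rule ccontr)
    assume nd: "\<not> int D dvd w x"
    define r where "r = w x mod int D"
    have r: "0 < r" "r < int D" 
      using nd D(1) pos_mod_sign[of "int D" "w x"] pos_mod_bound[of "int D" "w x"]
      unfolding r_def dvd_eq_mod_eq_0 by linarith+
    have "w (x * t powi (- (w x div int D))) = w x - (w x div int D) * int D"
      using w_mult[of x "t powi (- (w x div int D))"] w_powi[OF t(1)] x t by simp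
    hence "w (x * t powi (- (w x div int D))) = int (nat r)" using r by (simp add: r_def minus_div_mult_eq_mod)
    hence "D \<le> nat r" using Dmin[of "nat r" "x * t powi (- (w x div int D))"] r x t by simp
    thus False using r by simp
  qed
  define v where "v x = (if x = 0 then 0 else w x div int D)" for x
  have v: "w x = v x * int D" if "x \<noteq> 0" for x using dvd[OF that] that by (auto simp: v_def)
  have Dpos: "int D > 0" using D by simp
  have "is_place \<iota> v" unfolding is_place_def
  proof (intro conjI allI impI)
    show "v 0 = 0" by (simp add: v_def)
    fix x y :: 'K assume xy: "x \<noteq> 0" "y \<noteq> 0"
    have "v (x * y) * int D = (v x + v y) * int D"
      using xy w_mult[OF xy] v[of x] v[of y] v[of "x * y"] by (simp add: algebra_simps)
    thus "v (x * y) = v x + v y" using Dpos by simp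
    assume "x + y \<noteq> 0"
    have "min (v x * int D) (v y * int D) \<le> v (x + y) * int D"
      using w_add[OF xy \<open>x + y \<noteq> 0\<close>] v xy \<open>x + y \<noteq> 0\<close> by simp
    thus "min (v x) (v y) \<le> v (x + y)" using Dpos by (auto simp: min_def mult_le_cancel_right split: if_splits)
  next
    fix c :: 'k assume "c \<noteq> 0"
    thus "v (\<iota> c) = 0" using w_U[OF U_const] by (simp add: v_def)
  next
    show "\<exists>t. t \<noteq> 0 \<and> v t = 1" using t D by (intro exI[of _ t]) (auto simp: v_def)
  qed
  moreover have "v s > 0" using w_s M(1) v[OF s_nz] Dpos by (simp add: zero_less_mult_iff)
      (metis Dpos zero_less_mult_pos2 of_nat_0_less_iff)
  ultimately show ?thesis by (auto simp: places_def)
qed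

end

context curve
begin

text \<open>Zorn's lemma is started at k[s], which does not contain 1 / s because s is
  transcendental. In the resulting maximal subring s is a nonunit, hence has positive order at its
  place.\<close>

lemma ex_zero:
  assumes s: "transc s" shows "\<exists>p\<in>places \<iota>. p s > 0"
proof -
  have snz: "s \<noteq> 0" using s \<iota>_0 by (metis transc_iff rangeI)
  define \<R> where "\<R> = {R. ksubring R \<and> s \<in> R \<and> 1 / s \<notin> R}"
  have "range (ev s) \<in> \<R>"
  proof -
    have "ksubring (range (ev s))" unfolding ksubring_def
    proof (intro conjI subsetI ballI)
      show "a \<in> range (ev s)" if "a \<in> range \<iota>" for a using that ev_const by (metis rangeE rangeI)
    qed (auto simp flip: ev_add ev_mult)
    moreover have "s \<in> range (ev s)" using ev_X by (metis rangeI)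
    moreover have "1 / s \<notin> range (ev s)"
    proof
      assume "1 / s \<in> range (ev s)"
      then obtain q where "1 / s = ev s q" by blast
      hence "ev s (pCons (-1) q) = 0" using snz by (simp add: ev_pCons \<iota>_uminus field_simps)
      thus False using s by (auto simp: transc_def)
    qed
    ultimately show ?thesis by (simp add: \<R>_def)
  qed
  hence "\<exists>R\<in>\<R>. \<forall>Q\<in>\<R>. R \<subseteq> Q \<longrightarrow> Q = R"
  proof (intro subset_Zorn_nonempty)
    fix \<C> assume C: "\<C> \<noteq> {}" "subset.chain \<R> \<C>"
    have CR: "\<C> \<subseteq> \<R>" using C by (simp add: subset.chain_def)
    have tot: "\<exists>Z\<in>\<C>. a \<in> Z \<and> b \<in> Z" if "a \<in> \<Union>\<C>" "b \<in> \<Union>\<C>" for a b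
    proof -
      obtain Z1 Z2 where Z: "Z1 \<in> \<C>" "a \<in> Z1" "Z2 \<in> \<C>" "b \<in> Z2" using \<open>a \<in> \<Union>\<C>\<close> \<open>b \<in> \<Union>\<C>\<close> by blast
      moreover have "Z1 \<subseteq> Z2 \<or> Z2 \<subseteq> Z1" using C(2) Z unfolding subset_chain_def by blast
      ultimately show ?thesis by blast
    qed
    have "ksubring (\<Union>\<C>)" unfolding ksubring_def
    proof (intro conjI ballI)
      show "range \<iota> \<subseteq> \<Union>\<C>" using C CR by (fastforce simp: \<R>_def ksubring_def)
      fix a b assume "a \<in> \<Union>\<C>" "b \<in> \<Union>\<C>"
      then obtain Z where Z: "Z \<in> \<C>" "a \<in> Z" "b \<in> Z" using tot by blast
      hence "ksubring Z" using CR by (auto simp: \<R>_def)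
      thus "a + b \<in> \<Union>\<C>" "a * b \<in> \<Union>\<C>" using Z by (auto simp: ksubring_def)
    qed
    thus "\<Union>\<C> \<in> \<R>" using C CR by (auto simp: \<R>_def)
  qed blast
  then obtain R where R: "R \<in> \<R>" "\<And>Q. Q \<in> \<R> \<Longrightarrow> R \<subseteq> Q \<Longrightarrow> Q = R" by blast
  interpret maximal_subring \<iota> R s
    by unfold_locales (use R in \<open>auto simp: \<R>_def\<close>)
  show ?thesis by (rule ex_place)
qed

lemma ex_pole: "transc s \<Longrightarrow> \<exists>p\<in>places \<iota>. p s < 0"
proof -
  assume s: "transc s"
  obtain p where "p \<in> places \<iota>" "p (1 / s) > 0" using ex_zero[OF transc_inverse[OF s]] by blast
  thus ?thesis using place_inverse[of p s] by (auto simp: inverse_eq_divide)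
qed

lemma no_poles_const: "(\<And>p. p \<in> places \<iota> \<Longrightarrow> vge p 0 f) \<Longrightarrow> f \<in> range \<iota>"
  using ex_pole[of f] transc_iff[of f] by (force simp: vge_def dest: place_0)

end

section \<open>Riemann--Roch spaces and the product formula\<close>

context curve
begin

abbreviation LL :: "(('K \<Rightarrow> int) \<Rightarrow> int) \<Rightarrow> 'K set" where "LL \<equiv> riemann_roch_space \<iota>"

lemma LL_iff: "f \<in> LL D \<longleftrightarrow> (\<forall>p\<in>places \<iota>. vge p (- D p) f)"
  by (force simp: riemann_roch_space_def vge_def)

lemma LL_mono: "(\<And>p. p \<in> places \<iota> \<Longrightarrow> D p \<le> D' p) \<Longrightarrow> LL D \<subseteq> LL D'"
proof
  fix f assume le: "\<And>p. p \<in> places \<iota> \<Longrightarrow> D p \<le> D' p" and f: "f \<in> LL D"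
  have "vge p (- D' p) f" if "p \<in> places \<iota>" for p
    using f that le[OF that] vge_mono[of p "- D p" f "- D' p"] by (simp add: LL_iff)
  thus "f \<in> LL D'" by (simp add: LL_iff)
qed

lemma LL_subspace: "V.subspace (LL D)"
  by (auto simp: V.subspace_def LL_iff vge_add vge_scale)

text \<open>Dimension at least m, not exactly m. The notion is monotone and can be used before the
  finiteness of the spaces is known.\<close>

definition hasdim :: "'K set \<Rightarrow> nat \<Rightarrow> bool" where
  "hasdim V m \<longleftrightarrow> (\<exists>B. B \<subseteq> V \<and> finite B \<and> V.independent B \<and> card B = m)"

lemma hasdim_mono: "hasdim V m \<Longrightarrow> l \<le> m \<Longrightarrow> V \<subseteq> W \<Longrightarrow> hasdim W l"
proof -
  assume "hasdim V m" "l \<le> m" "V \<subseteq> W"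
  then obtain B where B: "B \<subseteq> V" "finite B" "V.independent B" "card B = m" by (auto simp: hasdim_def)
  then obtain B' where "B' \<subseteq> B" "card B' = l" using \<open>l \<le> m\<close> by (meson obtain_subset_with_card_n)
  thus ?thesis using B \<open>V \<subseteq> W\<close> V.independent_mono[of B B'] finite_subset[of B' B]
    unfolding hasdim_def by (intro exI[of _ B']) auto
qed

lemma hasdim_family:
  assumes "finite I" "kindep I f" "\<And>i. i \<in> I \<Longrightarrow> f i \<in> V"
  shows "hasdim V (card I)"
  using assms kindep_iff[of I f] by (auto simp: hasdim_def card_image intro!: exI[of _ "f ` I"])

lemma kindep_set_iff: "finite B \<Longrightarrow> kindep B (\<lambda>b. b) \<longleftrightarrow> V.independent B"
  using kindep_iff[of B "\<lambda>b. b"] by simp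

text \<open>Allowing one more pole at p adds at most one dimension: if b0 attains the extra pole,
  the residue of b / b0 at p is a constant c, and b - c b0 lies in the smaller space.\<close>

lemma hasdim_LL_step:
  assumes p: "p \<in> places \<iota>" and dim: "hasdim (LL (D(p := D p + 1))) (Suc m)"
  shows "hasdim (LL D) m"
proof -
  let ?D' = "D(p := D p + 1)"
  obtain B where B: "B \<subseteq> LL ?D'" "finite B" "V.independent B" "card B = Suc m"
    using dim by (auto simp: hasdim_def)
  have inD: "vge q (- ?D' q) b" if "b \<in> B" "q \<in> places \<iota>" for b q using B(1) that LL_iff by blast
  show ?thesis
  proof (cases "B \<subseteq> LL D")
    case True
    thus ?thesis using B hasdim_mono[of B "Suc m" m "LL D"] by (auto simp: hasdim_def)
  next
    case False
    then obtain b0 where b0: "b0 \<in> B" "b0 \<notin> LL D" by blast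
    have b0nz: "b0 \<noteq> 0" using b0 B V.dependent_zero by auto
    have "\<not> vge p (- D p) b0"
    proof
      assume *: "vge p (- D p) b0"
      have "vge q (- D q) b0" if "q \<in> places \<iota>" for q
        using inD[OF b0(1) that] * by (cases "q = p") auto
      thus False using b0(2) by (auto simp: LL_iff)
    qed
    moreover have "vge p (- D p - 1) b0" using inD[OF b0(1) p] by simp
    ultimately have pb0: "p b0 = - D p - 1" using b0nz by (auto simp: vge_def)
    have "\<exists>c. vge p (- D p) (b - \<iota> c * b0)" if "b \<in> B" for b
    proof -
      have "vge p (- D p - 1) b" using inD[OF that p] by simp
      hence "vge p 0 (b / b0)" using pb0 b0nz p by (cases "b = 0") (auto simp: vge_def place_divide)
      then obtain c where c: "vge p 1 (b / b0 - \<iota> c)" using residue_exists[OF p] by blast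
      have "vge p (1 + (- D p - 1)) ((b / b0 - \<iota> c) * b0)"
        using pb0 by (intro vge_mult[OF p c]) (auto simp: vge_def)
      moreover have "(b / b0 - \<iota> c) * b0 = b - \<iota> c * b0" using b0nz by (simp add: field_simps)
      ultimately show ?thesis by auto
    qed
    then obtain c where c: "\<And>b. b \<in> B \<Longrightarrow> vge p (- D p) (b - \<iota> (c b) * b0)" by metis
    have "kindep (B - {b0}) (\<lambda>b. b - \<iota> (c b) * b0)" unfolding kindep_def
    proof (intro allI impI)
      fix a assume a: "(\<Sum>b\<in>B - {b0}. \<iota> (a b) * (b - \<iota> (c b) * b0)) = 0"
      define a' where "a' b = (if b = b0 then - (\<Sum>b\<in>B - {b0}. a b * c b) else a b)" for b
      have "(\<Sum>b\<in>B. \<iota> (a' b) * b) = \<iota> (a' b0) * b0 + (\<Sum>b\<in>B - {b0}. \<iota> (a b) * b)"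
        using B(2) b0(1) by (subst sum.remove[of _ b0]) (auto simp: a'_def intro!: sum.cong)
      also have "\<dots> = (\<Sum>b\<in>B - {b0}. \<iota> (a b) * (b - \<iota> (c b) * b0))"
        by (simp add: a'_def \<iota>_uminus \<iota>_sum \<iota>_mult sum_distrib_left sum_distrib_right algebra_simps sum_subtractf)
      finally have "(\<Sum>b\<in>B. \<iota> (a' b) * b) = 0" using a by simp
      hence a'0: "a' b = 0" if "b \<in> B" for b using B(2,3) kindep_set_iff kindepD[of B "\<lambda>b. b"] that by blast
      show "\<forall>b\<in>B - {b0}. a b = 0"
      proof
        fix b assume "b \<in> B - {b0}"
        thus "a b = 0" using a'0[of b] by (simp add: a'_def)
      qed
    qed
    moreover have "b - \<iota> (c b) * b0 \<in> LL D" if b: "b \<in> B - {b0}" for b unfolding LL_iff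
    proof
      fix q assume q: "q \<in> places \<iota>"
      show "vge q (- D q) (b - \<iota> (c b) * b0)"
      proof (cases "q = p")
        case False
        have "vge q (- D q) b" "vge q (- D q) b0" using False inD[OF _ q, of b] inD[OF _ q, of b0] b b0(1) by auto
        thus ?thesis using vge_diff[OF q] vge_scale[OF q] by blast
      qed (use c b in auto)
    qed
    ultimately have "hasdim (LL D) (card (B - {b0}))" using B(2) by (intro hasdim_family) auto
    thus ?thesis using B b0 by simp
  qed
qed

lemma hasdim_LL_finite:
  assumes "finite T" "T \<subseteq> places \<iota>"
    and "hasdim (LL (\<lambda>p. D p + (if p \<in> T then int (e p) else 0))) (m + (\<Sum>p\<in>T. e p))"
  shows "hasdim (LL D) m"
  using assms
proof (induction T arbitrary: D m rule: finite_induct)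
  case (insert q T)
  have step: "hasdim (LL (D(q := D q + int k))) (l + k) \<Longrightarrow> hasdim (LL D) l" for k D l
  proof (induction k arbitrary: l)
    case (Suc k)
    have q: "q \<in> places \<iota>" using insert.prems(1) by simp
    have "D(q := D q + int (Suc k)) = (D(q := D q + int k))(q := (D(q := D q + int k)) q + 1)" by auto
    hence "hasdim (LL ((D(q := D q + int k))(q := (D(q := D q + int k)) q + 1))) (Suc (l + k))"
      using Suc.prems by (simp only: add_Suc_right)
    from Suc.IH[OF hasdim_LL_step[OF q this]] show ?case .
  qed (use fun_upd_triv in \<open>simp add: fun_upd_idem\<close>)
  have eq: "(\<lambda>p. D p + (if p \<in> insert q T then int (e p) else 0))
      = (\<lambda>p. (D(q := D q + int (e q))) p + (if p \<in> T then int (e p) else 0))"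
    by (rule ext) (use insert.hyps in auto)
  have sm: "m + (\<Sum>p\<in>insert q T. e p) = m + e q + (\<Sum>p\<in>T. e p)" using insert.hyps by simp
  have "T \<subseteq> places \<iota>" using insert.prems(1) by simp
  from insert.IH[OF this insert.prems(2)[unfolded eq sm]]
  have "hasdim (LL (D(q := D q + int (e q)))) (m + e q)" .
  thus ?case by (rule step)
qed simp

lemma is_divisor_finite: "is_divisor \<iota> D \<Longrightarrow> finite {p. D p \<noteq> 0}"
  and is_divisor_outside: "is_divisor \<iota> D \<Longrightarrow> p \<notin> places \<iota> \<Longrightarrow> D p = 0"
  by (auto simp: is_divisor_def)

lemma is_divisorI: "finite T \<Longrightarrow> T \<subseteq> places \<iota> \<Longrightarrow> (\<And>p. p \<notin> T \<Longrightarrow> D p = 0) \<Longrightarrow> is_divisor \<iota> D"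
  unfolding is_divisor_def by (metis (mono_tags, lifting) finite_subset mem_Collect_eq subset_iff)

lemma div_deg_eq: "finite T \<Longrightarrow> (\<And>p. p \<notin> T \<Longrightarrow> D p = 0) \<Longrightarrow> div_deg D = (\<Sum>p\<in>T. D p)"
  unfolding div_deg_def by (intro sum.mono_neutral_left) auto

lemma is_divisor_add: "is_divisor \<iota> D \<Longrightarrow> is_divisor \<iota> E \<Longrightarrow> is_divisor \<iota> (\<lambda>p. D p + E p)"
  by (rule is_divisorI[of "{p. D p \<noteq> 0} \<union> {p. E p \<noteq> 0}"]) (auto simp: is_divisor_def)

lemma is_divisor_mult: "is_divisor \<iota> D \<Longrightarrow> is_divisor \<iota> (\<lambda>p. c * D p)"
  by (rule is_divisorI[of "{p. D p \<noteq> 0}"]) (auto simp: is_divisor_def)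

lemma div_deg_add: "is_divisor \<iota> D \<Longrightarrow> is_divisor \<iota> E \<Longrightarrow> div_deg (\<lambda>p. D p + E p) = div_deg D + div_deg E"
proof -
  assume DE: "is_divisor \<iota> D" "is_divisor \<iota> E"
  let ?T = "{p. D p \<noteq> 0} \<union> {p. E p \<noteq> 0}"
  have T: "finite ?T" using DE by (auto simp: is_divisor_def)
  show ?thesis using div_deg_eq[OF T, of D] div_deg_eq[OF T, of E] div_deg_eq[OF T, of "\<lambda>p. D p + E p"]
    by (simp add: sum.distrib)
qed

lemma div_deg_mult: "div_deg (\<lambda>p. c * D p) = c * div_deg D"
  by (cases "c = 0") (auto simp: div_deg_def sum_distrib_left)

lemma div_deg_nonneg: "(\<And>p. D p \<ge> 0) \<Longrightarrow> div_deg D \<ge> 0"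
  unfolding div_deg_def by (intro sum_nonneg) auto

lemma hasdim_LL_le:
  assumes D: "is_divisor \<iota> D" "is_divisor \<iota> D'" and le: "\<And>p. D p \<le> D' p"
    and dim: "hasdim (LL D') m" and l: "int m \<ge> int l + (div_deg D' - div_deg D)"
  shows "hasdim (LL D) l"
proof -
  let ?T = "{p. D p \<noteq> 0} \<union> {p. D' p \<noteq> 0}"
  define e where "e p = nat (D' p - D p)" for p
  have T: "finite ?T" "?T \<subseteq> places \<iota>" using D by (auto simp: is_divisor_def)
  have "int (\<Sum>p\<in>?T. e p) = (\<Sum>p\<in>?T. D' p) - (\<Sum>p\<in>?T. D p)"
    using le by (simp add: e_def of_nat_sum sum_subtractf)
  also have "\<dots> = div_deg D' - div_deg D" using div_deg_eq[OF T(1), of D] div_deg_eq[OF T(1), of D'] by simp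
  finally have "m \<ge> l + (\<Sum>p\<in>?T. e p)" using l by linarith
  moreover have "(\<lambda>p. D p + (if p \<in> ?T then int (e p) else 0)) = D'"
    by (rule ext) (use le in \<open>auto simp: e_def\<close>)
  ultimately have "hasdim (LL (\<lambda>p. D p + (if p \<in> ?T then int (e p) else 0))) (l + (\<Sum>p\<in>?T. e p))"
    using hasdim_mono[OF dim _ subset_refl] by metis
  thus ?thesis by (rule hasdim_LL_finite[OF T])
qed

lemma hasdim_LL_0: "hasdim (LL (\<lambda>_. 0)) m \<Longrightarrow> m \<le> 1"
proof -
  assume "hasdim (LL (\<lambda>_. 0)) m"
  then obtain B where B: "B \<subseteq> LL (\<lambda>_. 0)" "finite B" "V.independent B" "card B = m" by (auto simp: hasdim_def)
  have "LL (\<lambda>_. 0) \<subseteq> V.span {1}"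
  proof
    fix f assume "f \<in> LL (\<lambda>_. 0)"
    hence "f \<in> range \<iota>" by (intro no_poles_const) (auto simp: LL_iff)
    then obtain c where "f = \<iota> c * 1" by auto
    thus "f \<in> V.span {1}" using V.span_scale[OF V.span_base[of 1 "{1}"], of c] by simp
  qed
  hence "card B \<le> card {1::'K}" using V.independent_span_bound[of "{1}" B] B by auto
  thus ?thesis using B by simp
qed

lemma hasdim_LL_bound:
  assumes A: "is_divisor \<iota> A" "\<And>p. A p \<ge> 0" and dim: "hasdim (LL A) m"
  shows "int m \<le> div_deg A + 1"
proof (rule ccontr)
  assume *: "\<not> ?thesis"
  have "is_divisor \<iota> (\<lambda>_. 0)" by (simp add: is_divisor_def)
  moreover have "div_deg (\<lambda>_::'K \<Rightarrow> int. 0) = 0" by (simp add: div_deg_def)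
  ultimately have "hasdim (LL (\<lambda>_. 0)) 2"
    using * A by (intro hasdim_LL_le[OF _ A(1) _ dim]) auto
  thus False using hasdim_LL_0 by fastforce
qed

section \<open>Pole divisors and the product formula\<close>

definition poles :: "'K \<Rightarrow> ('K \<Rightarrow> int) \<Rightarrow> int" where
  "poles x p = (if p \<in> places \<iota> then max 0 (- p x) else 0)"

lemma poles_nonneg: "poles x p \<ge> 0" by (simp add: poles_def)

lemma is_divisor_poles: "is_divisor \<iota> (poles x)"
proof (cases "x = 0")
  case True
  thus ?thesis by (simp add: is_divisor_def poles_def place_0)
next
  case False
  show ?thesis by (rule is_divisorI[OF finite_support[OF False]]) (auto simp: poles_def)
qed

lemma vge_poles: "p \<in> places \<iota> \<Longrightarrow> vge p (- poles x p) x" by (simp add: vge_def poles_def max_def)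

lemma is_divisor_sum: "(\<And>i. i \<in> I \<Longrightarrow> is_divisor \<iota> (D i)) \<Longrightarrow> is_divisor \<iota> (\<lambda>p. \<Sum>i\<in>I. D i p)"
  by (induction I rule: infinite_finite_induct) (auto intro: is_divisor_add simp: is_divisor_def[of _ "\<lambda>_. 0"])

lemma kx_family_LL:
  assumes I: "finite I" "kx_indep x I u"
  shows "hasdim (LL (\<lambda>p. int l * poles x p + (\<Sum>i\<in>I. poles (u i) p))) (Suc l * card I)"
proof -
  let ?f = "\<lambda>(s,i). x ^ s * u i"
  have "kindep ({..l} \<times> I) ?f" unfolding kindep_def
  proof (intro allI impI ballI)
    fix c i assume c: "(\<Sum>i\<in>{..l} \<times> I. \<iota> (c i) * ?f i) = 0" and i: "i \<in> {..l} \<times> I"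
    define Q where "Q j = (\<Sum>s\<le>l. monom (c (s, j)) s)" for j
    have coQ: "coeff (Q j) s = c (s, j)" if "s \<le> l" for s j
      using that by (simp add: Q_def coeff_sum sum.delta')
    have "(\<Sum>i\<in>{..l} \<times> I. \<iota> (c i) * ?f i) = (\<Sum>s\<le>l. \<Sum>j\<in>I. \<iota> (c (s,j)) * (x ^ s * u j))"
      by (simp add: sum.cartesian_product case_prod_unfold)
    also have "\<dots> = (\<Sum>j\<in>I. \<Sum>s\<le>l. \<iota> (c (s,j)) * (x ^ s * u j))" by (rule sum.swap)
    also have "\<dots> = (\<Sum>j\<in>I. ev x (Q j) * u j)"
      by (simp add: Q_def ev_sum ev_monom sum_distrib_right mult.assoc)
    finally have "\<forall>j\<in>I. Q j = 0" using c I(2) unfolding kx_indep_def by auto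
    thus "c i = 0" using coQ[of "fst i" "snd i"] i by auto
  qed
  moreover have "?f i \<in> LL (\<lambda>p. int l * poles x p + (\<Sum>i\<in>I. poles (u i) p))" if i: "i \<in> {..l} \<times> I" for i
    unfolding LL_iff
  proof
    fix p assume p: "p \<in> places \<iota>"
    obtain s j where sj: "i = (s, j)" "s \<le> l" "j \<in> I" using i by auto
    have "vge p (int s * (- poles x p) + (- poles (u j) p)) (x ^ s * u j)"
      by (intro vge_mult vge_power vge_poles p)
    moreover have "int s * poles x p \<le> int l * poles x p" using sj poles_nonneg by (intro mult_right_mono) auto
    moreover have "poles (u j) p \<le> (\<Sum>i\<in>I. poles (u i) p)" using sj I poles_nonneg by (intro member_le_sum) auto
    ultimately show "vge p (- (int l * poles x p + (\<Sum>i\<in>I. poles (u i) p))) (?f i)"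
      unfolding sj(1) prod.case by (elim vge_mono) linarith
  qed
  ultimately have "hasdim (LL (\<lambda>p. int l * poles x p + (\<Sum>i\<in>I. poles (u i) p))) (card ({..l} \<times> I))"
    using I by (intro hasdim_family) auto
  thus ?thesis by (simp add: card_cartesian_product)
qed

text \<open>The rank over k[x] is at most the number of poles. The products of x^s for s \<le> l
  with an independent family have poles bounded by l times those of x plus a fixed divisor C. So l +
  1 times the size of the family is at most l deg (poles x) + deg C + 1, and l is taken
  large.\<close>

lemma kx_indep_card_le_poles:
  assumes I: "finite I" "kx_indep x I u"
  shows "int (card I) \<le> div_deg (poles x)"
proof (rule ccontr)
  define C where "C p = (\<Sum>i\<in>I. poles (u i) p)" for p
  have C: "is_divisor \<iota> C" "\<And>p. C p \<ge> 0" unfolding C_def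
    by (auto intro!: is_divisor_sum is_divisor_poles sum_nonneg poles_nonneg)
  assume *: "\<not> ?thesis"
  define d where "d = div_deg (poles x)"
  have d: "d \<ge> 0" unfolding d_def using poles_nonneg by (rule div_deg_nonneg)
  \<comment> \<open>With this l the upper bound l d + deg C + 1 equals l (d + 1), which is smaller
    than (l + 1)(d + 1).\<close>
  define l where "l = nat (div_deg C + 1)"
  have l: "int l = div_deg C + 1" using div_deg_nonneg[of C] C by (simp add: l_def)
  have "int (Suc l * card I) \<le> div_deg (\<lambda>p. int l * poles x p + C p) + 1"
    using kx_family_LL[OF I, of l] C poles_nonneg unfolding C_def[symmetric]
    by (intro hasdim_LL_bound is_divisor_add is_divisor_mult is_divisor_poles) auto
  also have "\<dots> = int l * d + div_deg C + 1"
    by (subst div_deg_add) (auto simp: div_deg_mult d_def intro!: is_divisor_mult is_divisor_poles C)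
  also have "\<dots> = int l * (d + 1)" using l by (simp add: algebra_simps)
  also have "\<dots> < int (Suc l) * (d + 1)" using d by (simp add: algebra_simps)
  also have "\<dots> \<le> int (Suc l) * int (card I)" using * by (intro mult_left_mono) (auto simp: d_def)
  finally show False by (simp only: of_nat_mult)
qed

definition zeros :: "'K \<Rightarrow> ('K \<Rightarrow> int) \<Rightarrow> int" where "zeros x = poles (inverse x)"

lemma zeros_eq: "zeros x p = (if p \<in> places \<iota> then max 0 (p x) else 0)"
  by (simp add: zeros_def poles_def place_inverse)

lemma ex_zeros_family:
  assumes x: "x \<noteq> 0"
  shows "\<exists>I (u :: ('K \<Rightarrow> int) \<times> nat \<Rightarrow> 'K). finite I \<and> kx_indep x I u \<and> int (card I) = div_deg (zeros x)"
proof -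
  define T where "T = {p \<in> places \<iota>. p x > 0}"
  have T: "finite T" "T \<subseteq> places \<iota>" using finite_zeros[OF x] by (auto simp: T_def)
  obtain u :: "('K \<Rightarrow> int) \<times> nat \<Rightarrow> 'K" where u: "kx_indep x (SIGMA p:T. {..<nat (p x)}) u"
    using zeros_kx_indep[OF T x] T_def by auto
  have "div_deg (zeros x) = (\<Sum>p\<in>T. zeros x p)"
    using T by (intro div_deg_eq) (auto simp: zeros_eq T_def)
  also have "\<dots> = int (\<Sum>p\<in>T. nat (p x))"
    by (auto simp: zeros_eq T_def of_nat_sum intro!: sum.cong)
  also have "(\<Sum>p\<in>T. nat (p x)) = card (SIGMA p:T. {..<nat (p x)})" using T by simp
  finally show ?thesis using u T by (intro exI[of _ "SIGMA p:T. {..<nat (p x)}"] exI[of _ u]) auto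
qed

text \<open>The zeros of x are counted by a family independent over k[x], and such a family is no
  larger than the degree of the poles of x. The same inequality for the inverse of x is the
  converse.\<close>

lemma deg_zeros_eq_poles:
  assumes "x \<noteq> 0" shows "div_deg (zeros x) = div_deg (poles x)"
proof -
  have le: "div_deg (zeros x) \<le> div_deg (poles x)" if xnz: "x \<noteq> 0" for x
  proof -
    obtain I and u :: "('K \<Rightarrow> int) \<times> nat \<Rightarrow> 'K" where "finite I" "kx_indep x I u" "int (card I) = div_deg (zeros x)"
      using ex_zeros_family[OF xnz] by blast
    thus ?thesis using kx_indep_card_le_poles[of I x u] by simp
  qed
  from le[OF assms] le[of "inverse x"] assms show ?thesis by (simp add: zeros_def)
qed

theorem product_formula:
  assumes x: "x \<noteq> 0" and T: "finite T" "T \<subseteq> places \<iota>" "\<And>p. p \<in> places \<iota> - T \<Longrightarrow> p x = 0"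
  shows "(\<Sum>p\<in>T. p x) = 0"
proof -
  have out: "zeros x p = 0 \<and> poles x p = 0" if "p \<notin> T" for p
    using T(3)[of p] that by (cases "p \<in> places \<iota>") (auto simp: zeros_eq poles_def)
  have "(\<Sum>p\<in>T. p x) = (\<Sum>p\<in>T. zeros x p) - (\<Sum>p\<in>T. poles x p)"
    using T(2) by (auto simp: sum_subtractf[symmetric] zeros_eq poles_def intro!: sum.cong)
  also have "(\<Sum>p\<in>T. zeros x p) = div_deg (zeros x)"
    using T out by (intro div_deg_eq[symmetric]) auto
  also have "(\<Sum>p\<in>T. poles x p) = div_deg (poles x)"
    using T out by (intro div_deg_eq[symmetric]) auto
  finally show ?thesis using deg_zeros_eq_poles[OF x] by simp
qed

lemma height_eq_poles: "height \<iota> x = real_of_int (div_deg (poles x))"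
proof -
  have "div_deg (poles x) = (\<Sum>p\<in>{p\<in>places \<iota>. p x < 0}. poles x p)"
    unfolding div_deg_def by (rule sum.cong) (auto simp: poles_def split: if_splits)
  also have "\<dots> = (\<Sum>p\<in>{p\<in>places \<iota>. p x < 0}. - p x)" by (rule sum.cong) (auto simp: poles_def)
  finally show ?thesis by (simp add: height_def)
qed

section \<open>Dimensions of Riemann-Roch spaces, Riemann's inequality and the genus\<close>

lemma k_lin_indep_iff: "k_lin_indep \<iota> B \<longleftrightarrow> finite B \<and> V.independent B"
  using kindep_set_iff[of B] by (auto simp: k_lin_indep_def kindep_def)

lemma hasdim_LL_bounded:
  assumes D: "is_divisor \<iota> D" and "hasdim (LL D) m"
  shows "m \<le> nat (div_deg (\<lambda>p. max 0 (D p)) + 1)"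
proof -
  have "is_divisor \<iota> (\<lambda>p. max 0 (D p))"
    using D by (intro is_divisorI[of "{p. D p \<noteq> 0}"]) (auto simp: is_divisor_def)
  moreover have "hasdim (LL (\<lambda>p. max 0 (D p))) m" by (rule hasdim_mono[OF assms(2) order_refl LL_mono]) auto
  ultimately have "int m \<le> div_deg (\<lambda>p. max 0 (D p)) + 1" by (intro hasdim_LL_bound) auto
  thus ?thesis by linarith
qed

lemma ell_alt: "ell \<iota> D = (GREATEST r. hasdim (LL D) r)"
  unfolding ell_def hasdim_def k_lin_indep_iff by (rule arg_cong[where f = Greatest]) auto

lemma hasdim_0: "hasdim V 0" unfolding hasdim_def by (rule exI[of _ "{}"]) (simp add: V.independent_empty)

lemma hasdim_ell: "is_divisor \<iota> D \<Longrightarrow> hasdim (LL D) (ell \<iota> D)"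
  unfolding ell_alt using hasdim_0 hasdim_LL_bounded[of D]
    GreatestI_nat[of "hasdim (LL D)" 0 "nat (div_deg (\<lambda>p. max 0 (D p)) + 1)"] by blast

lemma le_ell: "is_divisor \<iota> D \<Longrightarrow> hasdim (LL D) m \<Longrightarrow> m \<le> ell \<iota> D"
  unfolding ell_alt using hasdim_LL_bounded[of D]
    Greatest_le_nat[of "hasdim (LL D)" m "nat (div_deg (\<lambda>p. max 0 (D p)) + 1)"] by blast

lemma ell_diff_le:
  assumes "is_divisor \<iota> D" "is_divisor \<iota> D'" "\<And>p. D p \<le> D' p"
  shows "int (ell \<iota> D') \<le> int (ell \<iota> D) + (div_deg D' - div_deg D)"
proof (rule ccontr)
  assume *: "\<not> ?thesis"
  have "hasdim (LL D) (Suc (ell \<iota> D))"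
    using * by (intro hasdim_LL_le[OF assms hasdim_ell[OF assms(2)]]) auto
  thus False using le_ell[OF assms(1)] by fastforce
qed

text \<open>Ensures that the maximum defining the genus exists. For the divisors H_l = l B + C the
  dimension is known from below. An effective A lies below a divisor linearly equivalent to some
  H_l, and the dimension drops from there to A by at most the difference of the degrees.\<close>

theorem riemann_inequality: "\<exists>\<gamma>. \<forall>D. is_divisor \<iota> D \<longrightarrow> div_deg D - int (ell \<iota> D) + 1 \<le> \<gamma>"
proof -
  obtain s where s: "transc s" by (rule obtain_generator)
  have snz: "s \<noteq> 0" using s \<iota>_0 by (metis transc_iff rangeI)
  obtain I and u :: "('K \<Rightarrow> int) \<times> nat \<Rightarrow> 'K" where I: "finite I" "kx_indep s I u" "int (card I) = div_deg (zeros s)"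
    using ex_zeros_family[OF snz] by blast
  define B where "B = poles s"
  define C where "C p = (\<Sum>i\<in>I. poles (u i) p)" for p
  define N where "N = card I"
  have BC: "is_divisor \<iota> B" "is_divisor \<iota> C" unfolding C_def B_def
    by (auto intro!: is_divisor_sum is_divisor_poles)
  have degB: "div_deg B = int N" using I deg_zeros_eq_poles[OF snz] by (simp add: B_def N_def)
  have "N > 0"
  proof -
    obtain p where p: "p \<in> places \<iota>" "p s < 0" using ex_pole[OF s] by blast
    have "B p \<le> (\<Sum>q\<in>{q. B q \<noteq> 0}. B q)" 
      using is_divisor_finite[OF BC(1)] p by (intro member_le_sum) (auto simp: B_def poles_def)
    thus ?thesis using degB p by (auto simp: div_deg_def B_def poles_def)
  qed
  define H where "H l = (\<lambda>p. int l * B p + C p)" for l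
  have H: "is_divisor \<iota> (H l)" for l unfolding H_def using BC by (intro is_divisor_add is_divisor_mult)
  have degH: "div_deg (H l) = int l * int N + div_deg C" for l unfolding H_def
    using BC by (subst div_deg_add) (auto simp: div_deg_mult degB intro: is_divisor_mult)
  have dimH: "hasdim (LL (H l)) (Suc l * N)" for l
    using kx_family_LL[OF I(1,2), of l] by (simp add: H_def B_def C_def N_def)
  have pos: "div_deg A - int (ell \<iota> A) \<le> div_deg C" if A: "is_divisor \<iota> A" "\<And>p. A p \<ge> 0" for A
  proof -
    \<comment> \<open>Since N > 0, the dimension (l + 1) N at H_l exceeds deg A, so that H_l - A
      still has a nonzero section z.\<close>
    define l where "l = nat (div_deg A)"
    have "int (Suc l * N) \<ge> int (Suc l)" using \<open>N > 0\<close> by (cases N) auto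
    moreover have "1 + div_deg A \<le> int (Suc l)" by (simp add: l_def)
    ultimately have l: "int (Suc l * N) \<ge> 1 + div_deg A" by linarith
    define G where "G p = H l p + (- 1) * A p" for p
    have G: "is_divisor \<iota> G" unfolding G_def by (intro is_divisor_add is_divisor_mult A H)
    have degG: "div_deg G = div_deg (H l) - div_deg A" unfolding G_def
      by (subst div_deg_add[OF H is_divisor_mult[OF A(1)]], subst div_deg_mult) simp
    have "hasdim (LL G) 1"
      using l by (intro hasdim_LL_le[OF G H[of l] _ dimH[of l]]) (use A degG in \<open>auto simp: G_def\<close>)
    then obtain b where "b \<subseteq> LL G" "V.independent b" "card b = 1" by (auto simp: hasdim_def)
    then obtain z where z: "z \<in> LL G" "z \<noteq> 0" using V.dependent_zero by (auto simp: card_1_singleton_iff)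
    define Z where "Z p = (if p \<in> places \<iota> then p z else 0)" for p
    have Z: "is_divisor \<iota> Z" by (rule is_divisorI[OF finite_support[OF z(2)]]) (auto simp: Z_def)
    have degZ: "div_deg Z = 0"
    proof -
      have "div_deg Z = (\<Sum>p\<in>{p \<in> places \<iota>. p z \<noteq> 0}. Z p)"
        by (rule div_deg_eq[OF finite_support[OF z(2)]]) (auto simp: Z_def)
      also have "\<dots> = (\<Sum>p\<in>{p \<in> places \<iota>. p z \<noteq> 0}. p z)" by (rule sum.cong) (auto simp: Z_def)
      also have "\<dots> = 0" by (rule product_formula[OF z(2) finite_support[OF z(2)]]) auto
      finally show ?thesis .
    qed
    \<comment> \<open>Linearly equivalent to H_l by means of z: division by z carries the known
      sections of H_l to sections of A', and the choice of z gives A \<le> A'.\<close>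
    define A' where "A' p = H l p + Z p" for p
    have A': "is_divisor \<iota> A'" "div_deg A' = div_deg (H l)"
      unfolding A'_def using H Z div_deg_add[OF H Z] degZ by (auto intro: is_divisor_add)
    have le: "A p \<le> A' p" for p
    proof (cases "p \<in> places \<iota>")
      case True
      hence "vge p (- G p) z" using z by (auto simp: LL_iff)
      thus ?thesis using z True by (auto simp: vge_def G_def A'_def Z_def)
    next
      case False
      thus ?thesis using is_divisor_outside[OF A(1)] is_divisor_outside[OF A'(1)] by simp
    qed
    obtain Bs where Bs: "Bs \<subseteq> LL (H l)" "finite Bs" "V.independent Bs" "card Bs = Suc l * N"
      using dimH[of l] by (auto simp: hasdim_def)
    have "kindep Bs (\<lambda>b. b / z)" unfolding kindep_def
    proof (intro allI impI)
      fix c assume "(\<Sum>b\<in>Bs. \<iota> (c b) * (b / z)) = 0"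
      hence "(\<Sum>b\<in>Bs. \<iota> (c b) * b) = 0" using z(2) by (simp flip: sum_divide_distrib)
      thus "\<forall>b\<in>Bs. c b = 0" using Bs kindep_set_iff[of Bs] by (auto simp: kindep_def)
    qed
    moreover have "b / z \<in> LL A'" if "b \<in> Bs" for b unfolding LL_iff
    proof
      fix p assume p: "p \<in> places \<iota>"
      have "vge p (- H l p) b" using that Bs p by (auto simp: LL_iff)
      thus "vge p (- A' p) (b / z)" using z p by (cases "b = 0") (auto simp: vge_def A'_def Z_def place_divide)
    qed
    ultimately have "hasdim (LL A') (card Bs)" using Bs by (intro hasdim_family) auto
    hence "Suc l * N \<le> ell \<iota> A'" using le_ell[OF A'(1)] Bs(4) by simp
    hence "int (Suc l * N) \<le> int (ell \<iota> A) + (div_deg (H l) - div_deg A)"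
      using ell_diff_le[OF A(1) A'(1) le] A'(2) by linarith
    thus ?thesis unfolding degH by (simp add: algebra_simps)
  qed
  have "div_deg D - int (ell \<iota> D) + 1 \<le> div_deg C + 1" if D: "is_divisor \<iota> D" for D
  proof -
    have A: "is_divisor \<iota> (\<lambda>p. max 0 (D p))"
      using D by (intro is_divisorI[of "{p. D p \<noteq> 0}"]) (auto simp: is_divisor_def)
    show ?thesis using ell_diff_le[OF D A] pos[OF A] by force
  qed
  thus ?thesis by blast
qed

text \<open>The zero divisor already gives a value 1 - ell(0) \<ge> 0, because functions without
  poles are constants. Nonnegativity is what makes 2 genus - 2 + |S| at least |S| - 2 in the final
  estimate.\<close>

theorem genus_nonneg: "genus \<iota> \<ge> 0"
proof -
  define P where "P g \<longleftrightarrow> (\<exists>D. is_divisor \<iota> D \<and> g = div_deg D - int (ell \<iota> D) + 1)" for g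
  obtain \<gamma> where \<gamma>: "\<And>g. P g \<Longrightarrow> g \<le> \<gamma>" using riemann_inequality by (auto simp: P_def)
  have D0: "is_divisor \<iota> (\<lambda>_. 0)" by (simp add: is_divisor_def)
  have P0: "P (- int (ell \<iota> (\<lambda>_. 0)) + 1)" unfolding P_def
    by (rule exI[of _ "\<lambda>_. 0"]) (simp add: D0 div_deg_def)
  define g0 where "g0 = - int (ell \<iota> (\<lambda>_. 0)) + 1"
  have g0: "g0 \<ge> 0" using hasdim_LL_0[OF hasdim_ell[OF D0]] by (simp add: g0_def)
  \<comment> \<open>The maximum of a set of integers bounded above by \<gamma> is obtained as the
    least distance from \<gamma>.\<close>
  define k where "k = (LEAST k. P (\<gamma> - int k))"
  have "P (\<gamma> - int (nat (\<gamma> - g0)))" using P0 \<gamma>[OF P0] by (simp add: g0_def)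
  hence k: "P (\<gamma> - int k)" unfolding k_def by (rule LeastI)
  have max: "g \<le> \<gamma> - int k" if "P g" for g
  proof -
    have "P (\<gamma> - int (nat (\<gamma> - g)))" using that \<gamma>[OF that] by simp
    hence "k \<le> nat (\<gamma> - g)" unfolding k_def by (rule Least_le)
    thus ?thesis using \<gamma>[OF that] by linarith
  qed
  have "genus \<iota> = Greatest P" by (simp add: genus_def P_def[abs_def])
  also have "\<dots> = \<gamma> - int k" using k max by (rule Greatest_equality)
  also have "\<dots> \<ge> g0" using max[of g0] P0 by (simp add: g0_def)
  finally show ?thesis using g0 by simp
qed

lemma LL_basis:
  assumes D: "is_divisor \<iota> D"
  shows "\<exists>B. finite B \<and> V.independent B \<and> B \<subseteq> LL D \<and> V.span B = LL D \<and> card B = ell \<iota> D"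
proof -
  obtain B where B: "B \<subseteq> LL D" "finite B" "V.independent B" "card B = ell \<iota> D"
    using hasdim_ell[OF D] by (auto simp: hasdim_def)
  have "LL D \<subseteq> V.span B"
  proof (rule ccontr)
    assume "\<not> LL D \<subseteq> V.span B"
    then obtain f where f: "f \<in> LL D" "f \<notin> V.span B" by blast
    hence "f \<notin> B" using V.span_base by blast
    have "V.independent (insert f B)" using f B V.independent_insertI by blast
    hence "hasdim (LL D) (Suc (ell \<iota> D))" unfolding hasdim_def
      using B f \<open>f \<notin> B\<close> by (intro exI[of _ "insert f B"]) auto
    thus False using le_ell[OF D] by fastforce
  qed
  moreover have "V.span B \<subseteq> LL D" using B LL_subspace by (simp add: V.span_minimal)
  ultimately show ?thesis using B by blast
qed

end

section \<open>Laurent expansions and derivations\<close>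

lemma fls_deriv_subdegree_ge:
  fixes F :: "'a::field_char_0 fls"
  assumes "fls_deriv F \<noteq> 0" "m \<le> fls_subdegree F"
  shows "m - 1 \<le> fls_subdegree (fls_deriv F)"
  using assms by (intro fls_subdegree_geI) auto

lemma fls_deriv_subdegree_nonneg:
  fixes F :: "'a::field_char_0 fls"
  assumes "fls_deriv F \<noteq> 0" "0 \<le> fls_subdegree F"
  shows "0 \<le> fls_subdegree (fls_deriv F)"
proof (rule fls_subdegree_geI[OF assms(1)])
  fix k :: int assume "k < 0"
  hence "k = - 1 \<or> k + 1 < fls_subdegree F" using assms(2) by linarith
  thus "fls_nth (fls_deriv F) k = 0" by (auto simp: fls_deriv_nth)
qed

text \<open>The chain rule for a derivation along a homomorphism e. It is needed with values in a
  field of Laurent series, where e is the expansion at a place.\<close>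

lemma twisted_derivation_poly:
  fixes e \<delta> :: "'a::field \<Rightarrow> 'b::field"
  assumes add: "\<And>a b. \<delta> (a + b) = \<delta> a + \<delta> b" and mult: "\<And>a b. \<delta> (a * b) = e a * \<delta> b + e b * \<delta> a"
    and e_add: "\<And>a b. e (a + b) = e a + e b" and e_mult: "\<And>a b. e (a * b) = e a * e b"
  shows "\<delta> (poly P y) = poly (map_poly \<delta> P) (e y) + e (poly (pderiv P) y) * \<delta> y"
proof -
  have d0: "\<delta> 0 = 0" using add[of 0 0] by (metis add.right_neutral add_cancel_left_right)
  have e0: "e 0 = 0" using e_add[of 0 0] by (metis add.right_neutral add_cancel_left_right)
  show ?thesis
  proof (induction P rule: pCons_induct)
    case (pCons a P)
    have "map_poly \<delta> (pCons a P) = pCons (\<delta> a) (map_poly \<delta> P)"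
      by (rule poly_eqI) (auto simp: coeff_map_poly d0 coeff_pCons split: nat.split)
    thus ?case by (simp add: add mult e_add e_mult pCons.IH pderiv_pCons algebra_simps)
  qed (simp add: d0 e0)
qed

lemma field_hom_poly:
  fixes e :: "'a::field \<Rightarrow> 'b::field"
  assumes e_add: "\<And>a b. e (a + b) = e a + e b" and e_mult: "\<And>a b. e (a * b) = e a * e b"
  shows "e (poly P y) = poly (map_poly e P) (e y)"
proof -
  have e0: "e 0 = 0" using e_add[of 0 0] by (metis add.right_neutral add_cancel_left_right)
  show ?thesis
  proof (induction P rule: pCons_induct)
    case (pCons a P)
    have "map_poly e (pCons a P) = pCons (e a) (map_poly e P)"
      by (rule poly_eqI) (auto simp: coeff_map_poly e0 coeff_pCons split: nat.split)
    thus ?case by (simp add: e_add e_mult pCons.IH)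
  qed (simp add: e0)
qed

context curve
begin

definition represents :: "('K \<Rightarrow> int) \<Rightarrow> 'K \<Rightarrow> 'K \<Rightarrow> 'k fps \<Rightarrow> bool" where
  "represents p t f \<phi> \<longleftrightarrow> (\<forall>N q. (\<forall>i<N. coeff q i = fps_nth \<phi> i) \<longrightarrow> vge p (int N) (f - ev t q))"

definition trunc :: "nat \<Rightarrow> 'k fps \<Rightarrow> 'k poly" where
  "trunc N \<phi> = (\<Sum>i<N. monom (fps_nth \<phi> i) i)"

lemma coeff_trunc: "coeff (trunc N \<phi>) i = (if i < N then fps_nth \<phi> i else 0)"
  by (simp add: trunc_def coeff_sum sum.delta')

context
  fixes p t assumes p: "p \<in> places \<iota>" and t: "t \<noteq> 0" "p t = 1"
begin

lemma vge_t: "vge p 0 t" "vge p 1 t" using t by (auto simp: vge_def)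

lemma vge_t_power: "vge p (int N) (t ^ N)" using vge_power[OF p vge_t(2), of N] by simp

lemma vge_low_zero: assumes "\<forall>i<N. coeff q i = 0" shows "vge p (int N) (ev t q)"
proof -
  have "monom 1 N dvd q" using assms by (simp add: monom_1_dvd_iff')
  then obtain r where r: "q = monom 1 N * r" by (rule dvdE)
  show ?thesis unfolding r ev_mult ev_monom
    using vge_mult[OF p vge_t_power vge_ev[OF p vge_t(1)], of N r] by simp
qed

lemma representsD: "represents p t f \<phi> \<Longrightarrow> vge p (int N) (f - ev t (trunc N \<phi>))"
  unfolding represents_def by (auto simp: coeff_trunc)

lemma representsI: assumes "\<And>N. vge p (int N) (f - ev t (trunc N \<phi>))" shows "represents p t f \<phi>"
  unfolding represents_def
proof (intro allI impI)
  fix N q assume q: "\<forall>i<N. coeff q i = fps_nth \<phi> i"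
  have "vge p (int N) (ev t (trunc N \<phi> - q))" by (rule vge_low_zero) (use q in \<open>auto simp: coeff_trunc\<close>)
  hence "vge p (int N) ((f - ev t (trunc N \<phi>)) + ev t (trunc N \<phi> - q))" by (intro vge_add p assms)
  thus "vge p (int N) (f - ev t q)" by (simp add: ev_diff)
qed

text \<open>The coefficients are successive residues: subtract the residue, divide by t and
  repeat.\<close>

lemma represents_exists: assumes "vge p 0 f" shows "\<exists>\<phi>. represents p t f \<phi>"
proof -
  define res where "res g = (SOME c. vge p 1 (g - \<iota> c))" for g
  have res: "vge p 1 (g - \<iota> (res g))" if "vge p 0 g" for g
    unfolding res_def using residue_exists[OF p that] by (rule someI_ex)
  define g where "g = rec_nat f (\<lambda>_ h. (h - \<iota> (res h)) / t)"
  have g: "g 0 = f" "g (Suc n) = (g n - \<iota> (res (g n))) / t" for n by (auto simp: g_def)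
  have gO: "vge p 0 (g n)" for n
  proof (induction n)
    case (Suc n)
    show ?case
    proof (cases "g n = \<iota> (res (g n))")
      case True
      thus ?thesis by (simp add: g)
    next
      case False
      thus ?thesis using res[OF Suc] t p unfolding g by (auto simp: vge_def place_divide)
    qed
  qed (simp add: g assms)
  define \<phi> where "\<phi> = Abs_fps (\<lambda>n. res (g n))"
  have "f = ev t (trunc N \<phi>) + t ^ N * g N" for N
  proof (induction N)
    case (Suc N)
    have "t ^ N * g N = \<iota> (res (g N)) * t ^ N + t ^ Suc N * g (Suc N)" using t by (simp add: g field_simps)
    thus ?case using Suc by (simp add: trunc_def ev_add ev_monom \<phi>_def)
  qed (simp add: g trunc_def)
  hence "f - ev t (trunc N \<phi>) = t ^ N * g N" for N by (metis add_diff_cancel_left')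
  moreover have "vge p (int N + 0) (t ^ N * g N)" for N by (intro vge_mult p vge_t_power gO)
  ultimately have "represents p t f \<phi>" by (intro representsI) simp
  thus ?thesis by blast
qed

lemma represents_nonneg: "represents p t f \<phi> \<Longrightarrow> vge p 0 f"
  using representsD[of f \<phi> 0] by (simp add: trunc_def)

lemma represents_0D: assumes "represents p t 0 \<phi>" shows "\<phi> = 0"
proof (rule ccontr)
  assume nz: "\<phi> \<noteq> 0"
  define n where "n = subdegree \<phi>"
  have "\<forall>i<Suc n. coeff (monom (fps_nth \<phi> n) n) i = fps_nth \<phi> i"
  proof (intro allI impI)
    fix i assume "i < Suc n"
    show "coeff (monom (fps_nth \<phi> n) n) i = fps_nth \<phi> i"
    proof (cases "i = n")
      case False
      hence "i < subdegree \<phi>" using \<open>i < Suc n\<close> by (simp add: n_def)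
      hence "fps_nth \<phi> i = 0" by (rule nth_less_subdegree_zero)
      thus ?thesis using False by simp
    qed simp
  qed
  hence "vge p (int (Suc n)) (0 - ev t (monom (fps_nth \<phi> n) n))"
    using assms unfolding represents_def by blast
  moreover have "fps_nth \<phi> n \<noteq> 0" using nz by (simp add: n_def)
  ultimately show False using t p by (auto simp: ev_monom vge_def place_uminus place_mult place_power)
qed

lemma represents_diff:
  assumes "represents p t f \<phi>" "represents p t g \<psi>" shows "represents p t (f - g) (\<phi> - \<psi>)"
proof (rule representsI)
  fix N
  have "trunc N (\<phi> - \<psi>) = trunc N \<phi> - trunc N \<psi>" by (rule poly_eqI) (auto simp: coeff_trunc)
  hence eq: "f - g - ev t (trunc N (\<phi> - \<psi>)) = (f - ev t (trunc N \<phi>)) - (g - ev t (trunc N \<psi>))" by (simp add: ev_diff)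
  show "vge p (int N) (f - g - ev t (trunc N (\<phi> - \<psi>)))" unfolding eq
    by (intro vge_diff p representsD assms)
qed

lemma represents_unique: "represents p t f \<phi> \<Longrightarrow> represents p t f \<psi> \<Longrightarrow> \<phi> = \<psi>"
  using represents_0D[of "\<phi> - \<psi>"] represents_diff[of f \<phi> f \<psi>] by simp

lemma represents_ev: "(\<And>i. coeff q i = fps_nth \<phi> i) \<Longrightarrow> represents p t (ev t q) \<phi>"
  unfolding represents_def
proof (intro allI impI)
  fix N r assume "\<And>i. coeff q i = fps_nth \<phi> i" "\<forall>i<N. coeff r i = fps_nth \<phi> i"
  hence "vge p (int N) (ev t (q - r))" by (intro vge_low_zero) auto
  thus "vge p (int N) (ev t q - ev t r)" by (simp add: ev_diff)
qed

lemma represents_const: "represents p t (\<iota> c) (fps_const c)"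
  using represents_ev[of "[:c:]" "fps_const c"] by (auto simp: coeff_pCons split: nat.split)

lemma represents_t: "represents p t t fps_X"
  using represents_ev[of "[:0,1:]" fps_X] by (auto simp: coeff_pCons fps_X_def split: nat.splits)

lemma represents_add:
  assumes "represents p t f \<phi>" "represents p t g \<psi>" shows "represents p t (f + g) (\<phi> + \<psi>)"
proof -
  have "represents p t 0 0" using represents_const[of 0] by simp
  hence "represents p t (0 - g) (0 - \<psi>)" using represents_diff assms by blast
  from represents_diff[OF assms(1) this] show ?thesis by simp
qed

lemma represents_mult:
  assumes f: "represents p t f \<phi>" and g: "represents p t g \<psi>" shows "represents p t (f * g) (\<phi> * \<psi>)"
proof (rule representsI)
  fix N
  let ?q = "trunc N \<phi>" let ?r = "trunc N \<psi>"
  have "vge p (int N + 0) ((f - ev t ?q) * g)" by (intro vge_mult p representsD f represents_nonneg[OF g])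
  moreover have "vge p (0 + int N) (ev t ?q * (g - ev t ?r))" by (intro vge_mult p representsD g vge_ev vge_t)
  moreover have "vge p (int N) (ev t (?q * ?r - trunc N (\<phi> * \<psi>)))"
    by (rule vge_low_zero) (auto simp: coeff_trunc coeff_mult fps_mult_nth atLeast0AtMost intro!: sum.cong)
  ultimately have "vge p (int N) ((f - ev t ?q) * g + ev t ?q * (g - ev t ?r) + ev t (?q * ?r - trunc N (\<phi> * \<psi>)))"
    by (intro vge_add p) auto
  thus "vge p (int N) (f * g - ev t (trunc N (\<phi> * \<psi>)))" by (simp add: ev_mult ev_diff algebra_simps)
qed

definition series :: "'K \<Rightarrow> 'k fps" where "series f = (THE \<phi>. represents p t f \<phi>)"

lemma series_eqI: "represents p t f \<phi> \<Longrightarrow> series f = \<phi>"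
  unfolding series_def using represents_unique by blast

lemma represents_series: "vge p 0 f \<Longrightarrow> represents p t f (series f)"
  using represents_exists series_eqI by blast

lemma series_add: "vge p 0 f \<Longrightarrow> vge p 0 g \<Longrightarrow> series (f + g) = series f + series g"
  by (intro series_eqI represents_add represents_series)
lemma series_mult: "vge p 0 f \<Longrightarrow> vge p 0 g \<Longrightarrow> series (f * g) = series f * series g"
  by (intro series_eqI represents_mult represents_series)
lemma series_const: "series (\<iota> c) = fps_const c" by (intro series_eqI represents_const)
lemma series_t: "series t = fps_X" by (intro series_eqI represents_t)
lemma series_t_power: "series (t ^ n) = fps_X ^ n"
proof (induction n)
  case (Suc n)
  have "vge p 0 (t ^ n)" using vge_t_power[of n] vge_mono by force
  thus ?case using Suc series_mult[OF vge_t(1)] series_t by simp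
qed (use series_const[of 1] in simp)

lemma series_unit: assumes "f \<noteq> 0" "p f = 0" shows "fps_nth (series f) 0 \<noteq> 0"
proof
  assume 0: "fps_nth (series f) 0 = 0"
  have "represents p t f (series f)" using assms by (intro represents_series) (simp add: vge_def)
  hence "vge p (int 1) (f - ev t 0)" unfolding represents_def using 0 by (metis coeff_0 less_one)
  thus False using assms by (simp add: vge_def)
qed

definition pole_order :: "'K \<Rightarrow> nat" where "pole_order f = nat (- p f)"

text \<open>The pole is removed by a power of t before expanding and restored afterwards.
  \<open>laurent_eq\<close> shows that any sufficiently large power gives the same result, which is
  what makes the map additive and multiplicative.\<close>

definition laurent :: "'K \<Rightarrow> 'k fls" where
  "laurent f = fps_to_fls (series (f * t ^ pole_order f)) / fls_X ^ pole_order f"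

lemma vge_times_power: "vge p (- int m) f \<Longrightarrow> vge p 0 (f * t ^ m)"
  using vge_mult[OF p _ vge_t_power, of "- int m" f m] by simp

lemma vge_pole_order: "pole_order f \<le> m \<Longrightarrow> vge p (- int m) f"
  by (auto simp: pole_order_def vge_def)

lemma laurent_eq:
  assumes "vge p (- int m) f" shows "laurent f = fps_to_fls (series (f * t ^ m)) / fls_X ^ m"
proof (cases "f = 0")
  case True
  have "series 0 = 0" using series_const[of 0] by simp
  thus ?thesis using True by (simp add: laurent_def)
next
  case False
  define n where "n = pole_order f"
  have "n \<le> m" using assms False by (auto simp: vge_def n_def pole_order_def)
  then obtain k where k: "m = n + k" by (metis le_add_diff_inverse)
  have "vge p 0 (t ^ k)" using vge_t_power[of k] vge_mono by force
  hence "series (f * t ^ m) = series (f * t ^ n) * fps_X ^ k"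
    using series_mult[OF vge_times_power[OF vge_pole_order[of f n]], of "t ^ k"]
    by (simp add: k power_add mult.assoc series_t_power n_def)
  thus ?thesis by (simp add: laurent_def n_def[symmetric] k power_add fls_times_fps_to_fls fps_to_fls_power)
qed

lemma laurent_add: "laurent (f + g) = laurent f + laurent g"
proof -
  define m where "m = max (pole_order f) (pole_order g)"
  have fg: "vge p (- int m) f" "vge p (- int m) g" by (auto intro!: vge_pole_order simp: m_def)
  have "laurent (f + g) = fps_to_fls (series (f * t ^ m + g * t ^ m)) / fls_X ^ m"
    using laurent_eq[OF vge_add[OF p fg]] by (simp add: algebra_simps)
  also have "\<dots> = laurent f + laurent g"
    by (simp add: laurent_eq[OF fg(1)] laurent_eq[OF fg(2)] series_add vge_times_power fg add_divide_distrib)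
  finally show ?thesis .
qed

lemma laurent_mult: "laurent (f * g) = laurent f * laurent g"
proof -
  define m where "m = pole_order f" define n where "n = pole_order g"
  have fg: "vge p (- int m) f" "vge p (- int n) g" by (auto intro!: vge_pole_order simp: m_def n_def)
  have "vge p (- int m + (- int n)) (f * g)" by (intro vge_mult p fg)
  hence "laurent (f * g) = fps_to_fls (series (f * g * t ^ (m + n))) / fls_X ^ (m + n)"
    by (intro laurent_eq) simp
  also have "f * g * t ^ (m + n) = (f * t ^ m) * (g * t ^ n)" by (simp add: power_add algebra_simps)
  also have "fps_to_fls (series \<dots>) / fls_X ^ (m + n) = laurent f * laurent g"
    unfolding laurent_eq[OF fg(1)] laurent_eq[OF fg(2)] series_mult[OF vge_times_power[OF fg(1)] vge_times_power[OF fg(2)]]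
    by (simp only: fls_times_fps_to_fls power_add times_divide_times_eq)
  finally show ?thesis .
qed

lemma laurent_const: "laurent (\<iota> c) = fls_const c"
  using laurent_eq[of 0 "\<iota> c"] vge_const[OF p] by (simp add: series_const)

lemma laurent_t: "laurent t = fls_X"
  using laurent_eq[of 0 t] vge_t by (simp add: series_t)

lemma laurent_0 [simp]: "laurent 0 = 0" using laurent_const[of 0] by simp
lemma laurent_1 [simp]: "laurent 1 = 1" using laurent_const[of 1] by simp

lemma laurent_uminus: "laurent (- f) = - laurent f"
  using laurent_add[of f "- f"] by (simp add: eq_neg_iff_add_eq_0 add.commute)

lemma laurent_diff: "laurent (f - g) = laurent f - laurent g"
  using laurent_add[of f "- g"] laurent_uminus[of g] by simp

lemma laurent_eq_0_iff [simp]: "laurent f = 0 \<longleftrightarrow> f = 0"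
proof
  assume "laurent f = 0"
  show "f = 0"
  proof (rule ccontr)
    assume "f \<noteq> 0"
    hence "laurent f * laurent (1 / f) = 1" by (simp flip: laurent_mult)
    thus False using \<open>laurent f = 0\<close> by simp
  qed
qed simp

lemma laurent_inj: "laurent f = laurent g \<Longrightarrow> f = g"
  using laurent_eq_0_iff[of "f - g"] by (simp add: laurent_diff)

lemma laurent_divide: "laurent (f / g) = laurent f / laurent g"
proof (cases "g = 0")
  case False
  hence "laurent (f / g) * laurent g = laurent f" by (simp flip: laurent_mult)
  thus ?thesis using False by (simp add: field_simps)
qed simp

lemma laurent_power: "laurent (f ^ n) = laurent f ^ n" by (induction n) (auto simp: laurent_mult)

lemma subdegree_laurent: assumes "f \<noteq> 0" shows "fls_subdegree (laurent f) = p f"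
proof -
  define u where "u = f / t powi (p f)"
  have u: "u \<noteq> 0" "p u = 0" using assms t by (auto simp: u_def place_divide[OF p] place_powi[OF p])
  have "laurent u = fps_to_fls (series u)" using laurent_eq[of 0 u] u by (simp add: vge_def)
  moreover have "subdegree (series u) = 0" using series_unit[OF u] by (simp add: subdegree_eq_0_iff)
  ultimately have 0: "fls_subdegree (laurent u) = 0" by (simp add: fls_subdegree_fls_to_fps)
  have "laurent (t powi n) = laurent t powi n" for n
    by (auto simp: power_int_def laurent_power inverse_eq_divide laurent_divide)
  hence "laurent (t powi n) = fls_X powi n" for n by (simp only: laurent_t)
  moreover have "f = u * t powi (p f)" using t by (simp add: u_def)
  ultimately have "laurent f = laurent u * fls_X powi (p f)" by (metis laurent_mult)
  thus ?thesis using 0 u by (simp add: fls_subdegree_mult_fls_X_intpow)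
qed

lemma vge_iff_laurent: "vge p m f \<longleftrightarrow> laurent f = 0 \<or> m \<le> fls_subdegree (laurent f)"
  by (cases "f = 0") (auto simp: vge_def subdegree_laurent)

end

lemma ksubringD: "ksubring R \<Longrightarrow> \<iota> c \<in> R" "ksubring R \<Longrightarrow> a \<in> R \<Longrightarrow> b \<in> R \<Longrightarrow> a + b \<in> R"
    "ksubring R \<Longrightarrow> a \<in> R \<Longrightarrow> b \<in> R \<Longrightarrow> a * b \<in> R"
  by (auto simp: ksubring_def)

lemma ev_ksubring: "ksubring A \<Longrightarrow> t \<in> A \<Longrightarrow> ev t q \<in> A"
  using ksubringD(1)[of A 0] by (induction q rule: pCons_induct) (auto simp: ev_pCons intro!: ksubringD)

text \<open>In characteristic 0 the derivative of an annihilating polynomial of least degree is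
  nonzero of smaller degree, so it does not vanish at y. With this, statements about derivations
  pass from a subring containing t to all of K.\<close>

lemma separable_annihilator:
  assumes A: "ksubring A" "t \<in> A" and t: "transc t"
  shows "\<exists>P. (\<forall>i. coeff P i \<in> A) \<and> poly P y = 0 \<and> poly (pderiv P) y \<noteq> 0"
proof -
  have A0: "0 \<in> A" using A \<iota>_0 unfolding ksubring_def by (metis rangeI subsetD)
  have evA: "ev t q \<in> A" for q
    by (rule ev_ksubring[OF A])
  define good where "good P \<longleftrightarrow> P \<noteq> 0 \<and> (\<forall>i. coeff P i \<in> A) \<and> poly P y = 0" for P
  obtain N where N: "\<forall>y::nat \<Rightarrow> 'K. \<exists>q::nat \<Rightarrow> 'k poly. (\<exists>j\<le>N. q j \<noteq> 0) \<and> (\<Sum>j\<le>N. ev t (q j) * y j) = 0"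
    using bounded_rank_over_poly by blast
  obtain q :: "nat \<Rightarrow> 'k poly" where q: "\<exists>j\<le>N. q j \<noteq> 0" "(\<Sum>j\<le>N. ev t (q j) * y ^ j) = 0" using N by meson
  define P0 where "P0 = (\<Sum>j\<le>N. monom (ev t (q j)) j)"
  have co: "coeff P0 j = (if j \<le> N then ev t (q j) else 0)" for j
    by (simp add: P0_def coeff_sum sum.delta')
  have "P0 \<noteq> 0" using q(1) t co unfolding transc_def by (metis coeff_0)
  hence "good P0" unfolding good_def using q(2) co evA A0 by (auto simp: P0_def poly_sum poly_monom)
  then obtain P where P: "good P" "\<And>Q. good Q \<Longrightarrow> degree P \<le> degree Q"
    using ex_has_least_nat[of good P0 degree] by blast
  have "degree P > 0"
  proof (rule ccontr)
    assume "\<not> degree P > 0"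
    then obtain c where c: "P = [:c:]" by (metis degree_eq_zeroE not_gr_zero)
    have "P \<noteq> 0" "poly P y = 0" using P(1) unfolding good_def by blast+
    thus False using c by simp
  qed
  have co': "coeff (pderiv P) i = \<iota> (of_nat (Suc i)) * coeff P (Suc i)" for i by (simp only: coeff_pderiv \<iota>_of_nat)
  have "pderiv P \<noteq> 0"
  proof
    assume "pderiv P = 0"
    hence "\<iota> (of_nat (Suc (degree P - 1))) * coeff P (Suc (degree P - 1)) = 0" using co'[of "degree P - 1"] by simp
    hence "of_nat (Suc (degree P - 1)) = (0::'k) \<or> coeff P (Suc (degree P - 1)) = 0" by (simp only: mult_eq_0_iff \<iota>_eq_0_iff)
    hence "lead_coeff P = 0" using \<open>degree P > 0\<close> by (simp only: of_nat_eq_0_iff) simp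
    thus False using P(1) by (simp add: good_def)
  qed
  have "\<forall>i. coeff (pderiv P) i \<in> A" unfolding co' using P(1) A by (auto simp: good_def ksubring_def)
  moreover have "degree (pderiv P) < degree P"
    using \<open>degree P > 0\<close> \<open>pderiv P \<noteq> 0\<close> by (intro degree_lessI) (auto simp: co' coeff_eq_0)
  ultimately have "poly (pderiv P) y \<noteq> 0"
    using P(2)[of "pderiv P"] \<open>pderiv P \<noteq> 0\<close> by (auto simp: good_def)
  thus ?thesis using P(1) by (auto simp: good_def)
qed

text \<open>The last clause demands that the kernel is exactly k; it is what turns a vanishing
  Wronskian into a linear relation with coefficients in k.\<close>

definition derivation :: "('K \<Rightarrow> 'K) \<Rightarrow> bool" where
  "derivation D \<longleftrightarrow> (\<forall>a b. D (a + b) = D a + D b) \<and> (\<forall>a b. D (a * b) = a * D b + b * D a) \<and>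
     (\<forall>c. D (\<iota> c) = 0) \<and> (\<forall>x. D x = 0 \<longrightarrow> x \<in> range \<iota>)"

text \<open>Formal differentiation of the Laurent series at one place is transported to K. The
  functions whose differentiated series is again an expansion form a subring containing t;
  differentiating a separable equation over this subring shows that it is all of K.\<close>

lemma ex_derivation: "\<exists>D. derivation D"
proof -
  obtain s where s: "transc s" by (rule obtain_generator)
  obtain p where p: "p \<in> places \<iota>" using ex_zero[OF s] by blast
  obtain t where t: "t \<noteq> 0" "p t = 1" using place_uniformizer[OF p] by blast
  define L where "L = laurent p t"
  note L_add = laurent_add[OF p t, folded L_def] and L_mult = laurent_mult[OF p t, folded L_def]
    and L_const = laurent_const[OF p t, folded L_def] and L_0 = laurent_0[OF p t, folded L_def]
    and L_inj = laurent_inj[OF p t, folded L_def] and L_t = laurent_t[OF p t, folded L_def]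
    and L_div = laurent_divide[OF p t, folded L_def] and L_uminus = laurent_uminus[OF p t, folded L_def]
    and L_eq0 = laurent_eq_0_iff[OF p t, folded L_def]
  define \<delta> where "\<delta> f = fls_deriv (L f)" for f
  have d_add: "\<delta> (a + b) = \<delta> a + \<delta> b" and d_mult: "\<delta> (a * b) = L a * \<delta> b + L b * \<delta> a" for a b
    by (simp_all add: \<delta>_def L_add L_mult)
  have d_const: "\<delta> (\<iota> c) = 0" for c by (simp add: \<delta>_def L_const)
  define A where "A = {f. \<exists>h. L h = \<delta> f}"
  have "ksubring A" unfolding ksubring_def
  proof (intro conjI ballI)
    show "range \<iota> \<subseteq> A" using L_0 by (auto simp: A_def d_const)
    fix a b assume "a \<in> A" "b \<in> A"
    then obtain h k where hk: "L h = \<delta> a" "L k = \<delta> b" by (auto simp: A_def)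
    have "L (h + k) = \<delta> (a + b)" "L (a * k + b * h) = \<delta> (a * b)" using hk by (simp_all add: L_add L_mult d_add d_mult)
    thus "a + b \<in> A" "a * b \<in> A" by (auto simp: A_def)
  qed
  have "L 1 = \<delta> t" using L_t laurent_1[OF p t] by (simp add: \<delta>_def L_def)
  hence "t \<in> A" by (auto simp: A_def)
  have tr: "transc t" using place_nonconst[OF p] t by simp
  have "y \<in> A" for y
  proof -
    obtain P where P: "\<forall>i. coeff P i \<in> A" "poly P y = 0" "poly (pderiv P) y \<noteq> 0"
      using separable_annihilator[OF \<open>ksubring A\<close> \<open>t \<in> A\<close> tr] by blast
    define h where "h f = (SOME h. L h = \<delta> f)" for f
    have h: "L (h f) = \<delta> f" if "f \<in> A" for f unfolding h_def using that by (auto simp: A_def intro: someI)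
    have d0: "\<delta> 0 = 0" using d_const[of 0] by simp
    have "L (h 0) = 0" using h[of 0] \<open>ksubring A\<close> d0 \<iota>_0 unfolding ksubring_def by (metis rangeI subsetD)
    hence h0: "h 0 = 0" using L_eq0 by blast
    have "map_poly \<delta> P = map_poly L (map_poly h P)"
      by (rule poly_eqI) (use P h in \<open>auto simp: coeff_map_poly d0 h0 L_0\<close>)
    moreover have "\<delta> (poly P y) = poly (map_poly \<delta> P) (L y) + L (poly (pderiv P) y) * \<delta> y"
      by (rule twisted_derivation_poly[OF d_add d_mult L_add L_mult])
    ultimately have "L (poly (map_poly h P) y) + L (poly (pderiv P) y) * \<delta> y = 0"
      using P(2) d0 field_hom_poly[of L, OF L_add L_mult] by simp
    hence "\<delta> y * L (poly (pderiv P) y) = - L (poly (map_poly h P) y)"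
      by (simp add: eq_neg_iff_add_eq_0 add.commute mult.commute)
    hence "\<delta> y = L (- poly (map_poly h P) y / poly (pderiv P) y)"
      using P(3) L_eq0 by (simp add: L_div L_uminus field_simps)
    thus ?thesis by (auto simp: A_def)
  qed
  hence "\<exists>h. L h = \<delta> f" for f by (auto simp: A_def)
  then obtain D where D: "\<And>f. L (D f) = \<delta> f" by metis
  have "derivation D" unfolding derivation_def
  proof (intro conjI allI impI)
    show "D (a + b) = D a + D b" for a b by (rule L_inj) (simp add: D L_add d_add)
    show "D (a * b) = a * D b + b * D a" for a b by (rule L_inj) (simp add: D L_add L_mult d_mult)
    show "D (\<iota> c) = 0" for c by (rule L_inj) (simp add: D d_const L_0)
    fix x assume "D x = 0"
    hence "fls_deriv (L x) = 0" using D[of x] L_0 by (simp add: \<delta>_def)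
    then obtain c where "L x = fls_const c" using fls_deriv_eq_iff_ex[of "L x" 0] by auto
    hence "x = \<iota> c" by (intro L_inj) (simp add: L_const)
    thus "x \<in> range \<iota>" by simp
  qed
  thus ?thesis by blast
qed

text \<open>The difference of the two sides is a derivation along the expansion map that vanishes at
  t. Its kernel is a subring containing t, and a separable equation over the kernel forces it to
  vanish everywhere.\<close>

lemma derivation_laurent:
  assumes D: "derivation D" and p: "p \<in> places \<iota>" and t: "t \<noteq> 0" "p t = 1"
  shows "laurent p t (D f) = laurent p t (D t) * fls_deriv (laurent p t f)"
proof -
  define L where "L = laurent p t"
  note L_add = laurent_add[OF p t, folded L_def] and L_mult = laurent_mult[OF p t, folded L_def]
    and L_const = laurent_const[OF p t, folded L_def] and L_0 = laurent_0[OF p t, folded L_def]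
    and L_t = laurent_t[OF p t, folded L_def] and L_eq0 = laurent_eq_0_iff[OF p t, folded L_def]
  define \<delta> where "\<delta> f = L (D f) - L (D t) * fls_deriv (L f)" for f
  have d_add: "\<delta> (a + b) = \<delta> a + \<delta> b" and d_mult: "\<delta> (a * b) = L a * \<delta> b + L b * \<delta> a" for a b
    using D by (simp_all add: \<delta>_def derivation_def L_add L_mult algebra_simps)
  have d_const: "\<delta> (\<iota> c) = 0" for c using D by (simp add: \<delta>_def derivation_def L_const L_0)
  have tr: "transc t" using place_nonconst[OF p] t by simp
  have "ksubring {f. \<delta> f = 0}" by (auto simp: ksubring_def d_add d_mult d_const)
  moreover have "t \<in> {f. \<delta> f = 0}" by (simp add: \<delta>_def L_t)
  ultimately obtain P where P: "\<forall>i. coeff P i \<in> {f. \<delta> f = 0}" "poly P f = 0" "poly (pderiv P) f \<noteq> 0"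
    using separable_annihilator[OF _ _ tr] by blast
  have d0: "\<delta> 0 = 0" using d_const[of 0] by simp
  have "map_poly \<delta> P = 0" by (rule poly_eqI) (use P d0 in \<open>auto simp: coeff_map_poly\<close>)
  hence "L (poly (pderiv P) f) * \<delta> f = 0"
    using twisted_derivation_poly[of \<delta> L P f, OF d_add d_mult L_add L_mult] P(2) d0 by simp
  hence "\<delta> f = 0" using P(3) L_eq0 by simp
  thus ?thesis by (simp add: \<delta>_def L_def)
qed

text \<open>Differentiating in t lowers the order by at most one and keeps regular series regular;
  the factor D t contributes its order.\<close>

lemma derivation_local:
  assumes D: "derivation D" and p: "p \<in> places \<iota>" and t: "t \<noteq> 0" "p t = 1" and a: "vge p a (D t)"
  shows "vge p m f \<Longrightarrow> vge p (m - 1 + a) (D f)" "vge p 0 f \<Longrightarrow> vge p a (D f)"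
proof -
  define L where "L = laurent p t"
  note vL = vge_iff_laurent[OF p t, folded L_def]
  have LD: "L (D f) = L (D t) * fls_deriv (L f)" unfolding L_def by (rule derivation_laurent[OF D p t])
  show "vge p (m - 1 + a) (D f)" if "vge p m f"
  proof (cases "L (D f) = 0")
    case False
    hence nz: "L (D t) \<noteq> 0" "fls_deriv (L f) \<noteq> 0" using LD by auto
    hence "L f \<noteq> 0" by auto
    hence "m - 1 \<le> fls_subdegree (fls_deriv (L f))" using that nz by (intro fls_deriv_subdegree_ge) (auto simp: vL)
    moreover have "a \<le> fls_subdegree (L (D t))" using a nz by (simp add: vL)
    ultimately show ?thesis using nz LD by (simp add: vL fls_subdegree_mult)
  qed (simp add: vL)
  show "vge p a (D f)" if "vge p 0 f"
  proof (cases "L (D f) = 0")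
    case False
    hence nz: "L (D t) \<noteq> 0" "fls_deriv (L f) \<noteq> 0" using LD by auto
    hence "L f \<noteq> 0" by auto
    hence "0 \<le> fls_subdegree (fls_deriv (L f))" using that nz by (intro fls_deriv_subdegree_nonneg) (auto simp: vL)
    moreover have "a \<le> fls_subdegree (L (D t))" using a nz by (simp add: vL)
    ultimately show ?thesis using nz LD by (simp add: vL fls_subdegree_mult)
  qed (simp add: vL)
qed

end

section \<open>Local bounds for derivations\<close>

context curve
begin

lemma ksubring_range_ev: "ksubring (range (ev w))"
  unfolding ksubring_def
proof (intro conjI subsetI ballI)
  show "a \<in> range (ev w)" if "a \<in> range \<iota>" for a using that ev_const by (metis rangeE rangeI)
qed (auto simp flip: ev_add ev_mult)

lemma gen_in_range_ev: "w \<in> range (ev w)" using ev_X by (metis rangeI)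

context
  fixes p w assumes p: "p \<in> places \<iota>" and w: "w \<noteq> 0" "vge p 1 w"
begin

lemma vge_w: "vge p 0 w" using w(2) vge_mono by force

lemma range_ev_vge: "h \<in> range (ev w) \<Longrightarrow> vge p 0 h" using vge_ev[OF p vge_w] by auto

lemma range_ev_value:
  assumes "h \<in> range (ev w)" "h \<noteq> 0" shows "\<exists>k::nat. p h = int k * p w"
proof -
  have "ev w q \<noteq> 0 \<Longrightarrow> \<exists>k::nat. p (ev w q) = int k * p w" for q
  proof (induction q rule: pCons_induct)
    case (pCons a q)
    show ?case
    proof (cases "a = 0")
      case True
      hence nz: "ev w q \<noteq> 0" using pCons.prems by (auto simp: ev_pCons)
      then obtain k where "p (ev w q) = int k * p w" using pCons.IH by blast
      hence "p (ev w (pCons a q)) = int (Suc k) * p w"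
        using True nz w p by (simp add: ev_pCons place_mult algebra_simps)
      thus ?thesis by blast
    next
      case False
      hence "p (ev w (pCons a q)) = 0" using place_ev_eq_0[OF p w(2), of "pCons a q"] by simp
      thus ?thesis by (intro exI[of _ 0]) simp
    qed
  qed simp
  thus ?thesis using assms by auto
qed

text \<open>The closure of k[w] at the place p. Here w vanishes at p but need not be a uniformizer;
  all orders of nonzero elements of the closure are multiples of p w (\<open>approx_value\<close>),
  which is how w will be recognized as a uniformizer.\<close>

definition approx :: "'K \<Rightarrow> bool" where
  "approx f \<longleftrightarrow> (\<forall>M::nat. \<exists>h\<in>range (ev w). vge p (int M) (f - h))"

lemma approx_range: "h \<in> range (ev w) \<Longrightarrow> approx h"
  unfolding approx_def by (intro allI bexI[of _ h]) auto

lemma approx_vge: "approx f \<Longrightarrow> vge p 0 f"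
proof -
  assume "approx f"
  then obtain h where h: "h \<in> range (ev w)" "vge p (int 0) (f - h)" unfolding approx_def by blast
  have "vge p 0 ((f - h) + h)" by (rule vge_add[OF p _ range_ev_vge[OF h(1)]]) (use h(2) in simp)
  thus ?thesis by simp
qed

lemma approx_add: "approx f \<Longrightarrow> approx g \<Longrightarrow> approx (f + g)"
  unfolding approx_def
proof
  fix M assume fg: "\<forall>M::nat. \<exists>h\<in>range (ev w). vge p (int M) (f - h)" "\<forall>M::nat. \<exists>h\<in>range (ev w). vge p (int M) (g - h)"
  obtain h k where hk: "h \<in> range (ev w)" "vge p (int M) (f - h)" "k \<in> range (ev w)" "vge p (int M) (g - k)"
    using fg by meson
  have "vge p (int M) ((f - h) + (g - k))" by (intro vge_add p hk)
  hence "vge p (int M) (f + g - (h + k))" by (simp add: algebra_simps)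
  thus "\<exists>h\<in>range (ev w). vge p (int M) (f + g - h)" using ksubringD(2)[OF ksubring_range_ev hk(1,3)] by blast
qed

lemma approx_mult: assumes f: "approx f" and g: "approx g" shows "approx (f * g)"
  unfolding approx_def
proof
  fix M
  obtain h k where hk: "h \<in> range (ev w)" "vge p (int M) (f - h)" "k \<in> range (ev w)" "vge p (int M) (g - k)"
    using f g unfolding approx_def by meson
  have "vge p (int M + 0) ((f - h) * g)" by (intro vge_mult p hk approx_vge g)
  moreover have "vge p (0 + int M) (h * (g - k))" by (intro vge_mult p hk range_ev_vge)
  ultimately have "vge p (int M) ((f - h) * g + h * (g - k))" by (intro vge_add p) auto
  hence "vge p (int M) (f * g - h * k)" by (simp add: algebra_simps)
  thus "\<exists>h\<in>range (ev w). vge p (int M) (f * g - h)" using ksubringD(3)[OF ksubring_range_ev hk(1,3)] by blast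
qed

lemma approx_sum: "(\<And>i. i \<in> I \<Longrightarrow> approx (f i)) \<Longrightarrow> approx (sum f I)"
proof (induction I rule: infinite_finite_induct)
  case (insert i I)
  thus ?case by (simp add: approx_add)
qed (auto intro!: approx_range simp: rangeI[of "ev w" 0, simplified])

lemma approx_value:
  assumes "approx f" "f \<noteq> 0" shows "\<exists>k::nat. p f = int k * p w"
proof -
  have "p f \<ge> 0" using approx_vge assms by (auto simp: vge_def)
  obtain h where h: "h \<in> range (ev w)" "vge p (int (nat (p f + 1))) (f - h)" using assms(1) unfolding approx_def by blast
  have "vge p (p f + 1) (- (f - h))" using h(2) \<open>p f \<ge> 0\<close> by (intro vge_uminus p) auto
  hence "f + (- (f - h)) \<noteq> 0" "p (f + (- (f - h))) = p f" using place_dominant[OF p assms(2)] by blast+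
  thus ?thesis using range_ev_value[OF h(1)] by simp
qed

lemma taylor:
  assumes P: "\<And>i. vge p 0 (coeff P i)" and y: "vge p 0 y" and h: "vge p 0 h"
  shows "\<exists>s. vge p 0 s \<and> poly P h = poly P y + (h - y) * (poly (pderiv P) y + (h - y) * s)"
    and "vge p 0 (poly P y)" and "vge p 0 (poly (pderiv P) y)"
proof -
  have "(\<exists>s. vge p 0 s \<and> poly P h = poly P y + (h - y) * (poly (pderiv P) y + (h - y) * s))
      \<and> vge p 0 (poly P y) \<and> vge p 0 (poly (pderiv P) y)"
    using P
  proof (induction P rule: pCons_induct)
    case (pCons a P)
    have a: "vge p 0 a" using pCons.prems[of 0] by simp
    have "vge p 0 (coeff P i)" for i using pCons.prems[of "Suc i"] by simp
    from pCons.IH[OF this] obtain s where s: "vge p 0 s" "poly P h = poly P y + (h - y) * (poly (pderiv P) y + (h - y) * s)"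
      and o: "vge p 0 (poly P y)" "vge p 0 (poly (pderiv P) y)" by blast
    have m: "vge p 0 (u * v)" if "vge p 0 u" "vge p 0 v" for u v using vge_mult[OF p that] by simp
    have "poly (pCons a P) h = poly (pCons a P) y + (h - y) * (poly (pderiv (pCons a P)) y
        + (h - y) * (poly (pderiv P) y + h * s))"
      by (simp add: pderiv_pCons s(2) algebra_simps)
    moreover have "vge p 0 (poly (pderiv P) y + h * s)" by (intro vge_add p o m s h)
    moreover have "vge p 0 (poly (pCons a P) y)" using a o y by (auto intro!: vge_add p m)
    moreover have "vge p 0 (poly (pderiv (pCons a P)) y)" using o y by (auto simp: pderiv_pCons intro!: vge_add p m)
    ultimately show ?case by blast
  qed (auto intro: exI[of _ 0])
  thus "\<exists>s. vge p 0 s \<and> poly P h = poly P y + (h - y) * (poly (pderiv P) y + (h - y) * s)"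
    and "vge p 0 (poly P y)" and "vge p 0 (poly (pderiv P) y)" by blast+
qed

text \<open>Newton iteration: a simple root modulo \<open>p\<close> of a polynomial over \<open>k[w]\<close> is a limit of
  elements of \<open>k[w]\<close>; the valuation of each correction term is a multiple of that of \<open>w\<close>.\<close>

lemma approx_simple_root:
  assumes P: "\<And>i. coeff P i \<in> range (ev w)" "poly P y = 0" and y: "vge p 0 y"
    and simple: "poly (pderiv P) y \<noteq> 0" "p (poly (pderiv P) y) = 0"
  shows "approx y"
proof -
  have PO: "vge p 0 (coeff P i)" for i using range_ev_vge P(1) by blast
  have "\<exists>h\<in>range (ev w). vge p (int (Suc M)) (y - h)" for M
  proof (induction M)
    case 0
    obtain c where "vge p 1 (y - \<iota> c)" using residue_exists[OF p y] by blast
    moreover have "\<iota> c \<in> range (ev w)" using ksubringD(1)[OF ksubring_range_ev] .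
    ultimately show ?case by auto
  next
    case (Suc M)
    then obtain h where h: "h \<in> range (ev w)" "vge p (int (Suc M)) (y - h)" by blast
    show ?case
    proof (cases "vge p (int (Suc (Suc M))) (y - h)")
      case False
      hence val: "y - h \<noteq> 0" "p (y - h) = int (Suc M)" using h(2) by (auto simp: vge_def)
      obtain s where s: "vge p 0 s" "poly P h = poly P y + (h - y) * (poly (pderiv P) y + (h - y) * s)"
        using taylor(1)[OF PO y range_ev_vge[OF h(1)]] by blast
      have hy: "h - y = - (y - h)" by simp
      have "vge p (1 + 0) ((h - y) * s)"
        using val place_uminus[OF p, of "y - h"] unfolding hy by (intro vge_mult p s(1)) (auto simp: vge_def)
      hence "poly (pderiv P) y + (h - y) * s \<noteq> 0" "p (poly (pderiv P) y + (h - y) * s) = 0"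
        using place_dominant[OF p simple(1), of "(h - y) * s"] simple(2) by auto
      note u = this
      have hy': "h - y \<noteq> 0" "p (h - y) = int (Suc M)"
        using val place_uminus[OF p, of "y - h"] unfolding hy by auto
      have "poly P h = (h - y) * (poly (pderiv P) y + (h - y) * s)" using s(2) P(2) by simp
      hence Ph: "poly P h \<noteq> 0" "p (poly P h) = int (Suc M)"
        using place_mult[OF p hy'(1) u(1)] hy' u by auto
      have "poly P h \<in> range (ev w)" unfolding poly_altdef
        by (intro ksubring_sum[OF ksubring_range_ev] ksubringD(3)[OF ksubring_range_ev] P)
           (use h(1) in \<open>auto simp flip: ev_power\<close>)
      then obtain k :: nat where k: "int (Suc M) = int k * p w" using range_ev_value Ph by metis
      have wk: "p (w ^ k) = int (Suc M)" using place_power[OF p] k by simp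
      have "vge p 0 ((y - h) / w ^ k)" using val wk w by (simp add: vge_def place_divide[OF p])
      then obtain c where c: "vge p 1 ((y - h) / w ^ k - \<iota> c)" using residue_exists[OF p] by blast
      have "vge p (1 + int (Suc M)) (((y - h) / w ^ k - \<iota> c) * w ^ k)"
        by (intro vge_mult p c) (use wk in \<open>simp add: vge_def\<close>)
      moreover have "((y - h) / w ^ k - \<iota> c) * w ^ k = y - (h + \<iota> c * w ^ k)" using w by (simp add: field_simps)
      ultimately have "vge p (int (Suc (Suc M))) (y - (h + \<iota> c * w ^ k))" by (simp add: add.commute)
      moreover have "h + \<iota> c * w ^ k \<in> range (ev w)"
      proof -
        obtain q where "h = ev w q" using h(1) by blast
        hence "h + \<iota> c * w ^ k = ev w (q + monom c k)" by (simp add: ev_add ev_monom)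
        thus ?thesis by blast
      qed
      ultimately show ?thesis by blast
    qed (use h in blast)
  qed
  hence 1: "\<exists>h\<in>range (ev w). vge p (int (Suc M)) (y - h)" for M .
  show ?thesis unfolding approx_def
  proof
    fix M
    obtain h where "h \<in> range (ev w)" "vge p (int (Suc M)) (y - h)" using 1 by blast
    thus "\<exists>h\<in>range (ev w). vge p (int M) (y - h)" using vge_mono[of p "int (Suc M)" "y - h" "int M"] by auto
  qed
qed

end

text \<open>Outside a finite set w = t - c, with c the residue of t, is a uniformizer: the
  generators of K over k(t) are simple roots of polynomials over k[w] modulo p, hence limits of
  k[w], so every order is a multiple of p w. Moreover D w = D t is regular there.\<close>

lemma finite_ramification:
  assumes D: "derivation D"
  shows "\<exists>X. finite X \<and> (\<forall>p\<in>places \<iota> - X. \<exists>t. t \<noteq> 0 \<and> p t = 1 \<and> vge p 0 (D t))"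
proof -
  obtain t b n where t: "transc t"
    and gen: "\<And>z. \<exists>p q. (\<forall>i<n. q i \<noteq> 0) \<and> z = (\<Sum>i<(n::nat). ev t (p i) / ev t (q i) * b i)"
    by (rule obtain_generator) (rule that)
  have "\<exists>P. (\<forall>i. coeff P i \<in> range (ev t)) \<and> poly P (b j) = 0 \<and> poly (pderiv P) (b j) \<noteq> 0" for j
    by (rule separable_annihilator[OF ksubring_range_ev gen_in_range_ev t])
  then obtain P where P: "\<And>j i. coeff (P j) i \<in> range (ev t)" "\<And>j. poly (P j) (b j) = 0"
    "\<And>j. poly (pderiv (P j)) (b j) \<noteq> 0" by metis
  define supp where "supp x = (if x = 0 then {} else {p \<in> places \<iota>. p x \<noteq> 0})" for x
  have fin: "finite (supp x)" for x using finite_support by (simp add: supp_def)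
  \<comment> \<open>Off X all of t, D t and the generators are regular, and the derivatives of the
    defining polynomials are units at the generators, as the Newton iteration requires.\<close>
  define X where "X = supp t \<union> supp (D t) \<union> (\<Union>i<n. supp (b i) \<union> supp (poly (pderiv (P i)) (b i)))"
  have "finite X" using fin by (simp add: X_def)
  moreover have "\<exists>w. w \<noteq> 0 \<and> p w = 1 \<and> vge p 0 (D w)" if pX: "p \<in> places \<iota> - X" for p
  proof -
    have p: "p \<in> places \<iota>" using pX by simp
    have s: "x = 0 \<or> p x = 0" if "supp x \<subseteq> X" for x
      using that pX by (auto simp: supp_def split: if_splits)
    have vs: "vge p 0 x" if "supp x \<subseteq> X" for x using s[OF that] by (auto simp: vge_def)
    have sb: "supp (b i) \<subseteq> X" "supp (poly (pderiv (P i)) (b i)) \<subseteq> X" if "i < n" for i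
      using that by (auto simp: X_def)
    have v0: "vge p 0 t" "vge p 0 (D t)" by (intro vs; auto simp: X_def)+
    have vb: "vge p 0 (b i)" if "i < n" for i using vs sb that by blast
    have vP: "p (poly (pderiv (P i)) (b i)) = 0" if "i < n" for i using s[OF sb(2)[OF that]] P(3) by blast
    obtain c where c: "vge p 1 (t - \<iota> c)" using residue_exists[OF p v0(1)] by blast
    define w where "w = t - \<iota> c"
    have w: "w \<noteq> 0" "vge p 1 w" using c t by (auto simp: w_def transc_iff)
    have tw: "t \<in> range (ev w)"
      using ksubringD(2)[OF ksubring_range_ev gen_in_range_ev ksubringD(1)[OF ksubring_range_ev], of w c] by (simp add: w_def)
    have sub: "range (ev t) \<subseteq> range (ev w)" using ev_ksubring[OF ksubring_range_ev tw] by blast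
    have ap: "approx p w (b i)" if i: "i < n" for i
      by (rule approx_simple_root[OF p w, of "P i"]) (use P(1) sub in blast, use P(2,3) vb[OF i] vP[OF i] in auto)
    have dvd: "p w dvd p f" if f: "f \<noteq> 0" for f
    proof -
      obtain r q where rq: "\<forall>i<n. q i \<noteq> 0" "f = (\<Sum>i<n. ev t (r i) / ev t (q i) * b i)" using gen by blast
      define Q where "Q = (\<Prod>i<n. q i)"
      define a where "a i = r i * (\<Prod>j\<in>{..<n}-{i}. q j)" for i
      have Qf: "ev t Q * f = (\<Sum>i<n. ev t (a i) * b i)" unfolding rq(2) sum_distrib_left
      proof (intro sum.cong refl)
        fix i assume i: "i \<in> {..<n}"
        have "ev t (q i) \<noteq> 0" using rq i t by (auto simp: transc_def)
        moreover have "Q = q i * (\<Prod>j\<in>{..<n}-{i}. q j)" unfolding Q_def using i by (subst prod.remove[of _ i]) auto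
        ultimately show "ev t Q * (ev t (r i) / ev t (q i) * b i) = ev t (a i) * b i"
          by (simp add: a_def ev_mult field_simps)
      qed
      have Qnz: "ev t Q \<noteq> 0" using rq(1) t by (auto simp: Q_def transc_def)
      have evap: "approx p w (ev t x)" for x using sub by (intro approx_range[OF p w]) auto
      have "approx p w (ev t Q * f)" unfolding Qf
        by (intro approx_sum[OF p w] approx_mult[OF p w] evap ap) auto
      hence "p w dvd p (ev t Q * f)" using approx_value[OF p w] Qnz f by (metis dvd_triv_right mult_eq_0_iff)
      moreover have "p w dvd p (ev t Q)" using approx_value[OF p w evap Qnz] by (metis dvd_triv_right)
      ultimately show ?thesis using place_mult[OF p Qnz f] by (simp add: dvd_add_right_iff)
    qed
    obtain u where "u \<noteq> 0" "p u = 1" using place_uniformizer[OF p] by blast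
    hence "p w dvd 1" using dvd by metis
    moreover have "p w \<ge> 1" using w by (simp add: vge_def)
    ultimately have "p w = 1" by auto
    have "D t = D (w + \<iota> c)" by (simp add: w_def)
    also have "\<dots> = D w" using D by (simp add: derivation_def)
    finally show ?thesis using v0(2) w \<open>p w = 1\<close> by metis
  qed
  ultimately show ?thesis by blast
qed

text \<open>The bound a p is the pole order of D t for a uniformizer t at p, chosen with D t regular
  off the finite ramification set.\<close>

lemma derivation_bounds:
  assumes D: "derivation D"
  shows "\<exists>a::('K \<Rightarrow> int) \<Rightarrow> nat. finite {p \<in> places \<iota>. a p \<noteq> 0} \<and>
     (\<forall>p\<in>places \<iota>. \<forall>f. (\<forall>m. vge p m f \<longrightarrow> vge p (m - 1 - int (a p)) (D f)) \<and> (vge p 0 f \<longrightarrow> vge p (- int (a p)) (D f)))"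
proof -
  obtain X where X: "finite X" "\<And>p. p \<in> places \<iota> - X \<Longrightarrow> \<exists>t. t \<noteq> 0 \<and> p t = 1 \<and> vge p 0 (D t)"
    using finite_ramification[OF D] by blast
  have ex: "\<exists>t. t \<noteq> 0 \<and> p t = 1 \<and> vge p (if p \<in> X then p (D t) else 0) (D t)" if p: "p \<in> places \<iota>" for p
    using X(2)[of p] place_uniformizer[OF p] vge_self p by auto
  define t where "t p = (SOME t. t \<noteq> 0 \<and> p t = 1 \<and> vge p (if p \<in> X then p (D t) else 0) (D t))" for p
  have t: "t p \<noteq> 0 \<and> p (t p) = 1 \<and> vge p (if p \<in> X then p (D (t p)) else 0) (D (t p))" if "p \<in> places \<iota>" for p
    unfolding t_def using ex[OF that] by (rule someI_ex)
  define a where "a p = (if p \<in> X then nat (- p (D (t p))) else 0)" for p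
  show ?thesis
  proof (rule exI[of _ a], intro conjI ballI allI)
    show "finite {p \<in> places \<iota>. a p \<noteq> 0}" by (rule finite_subset[OF _ X(1)]) (auto simp: a_def split: if_splits)
    fix p f assume p: "p \<in> places \<iota>"
    have tp: "t p \<noteq> 0" "p (t p) = 1" and v: "vge p (- int (a p)) (D (t p))"
      using t[OF p] by (auto simp: a_def elim!: vge_mono)
    show "vge p m f \<longrightarrow> vge p (m - 1 - int (a p)) (D f)" for m
      using derivation_local(1)[OF D p tp v, of m f] by simp
    show "vge p 0 f \<longrightarrow> vge p (- int (a p)) (D f)"
      using derivation_local(2)[OF D p tp v, of f] by simp
  qed
qed

end

section \<open>The Wronskian inequality\<close>

text \<open>The set \<open>E\<close> is a subfield containing the functions to which the Wronskian is applied, and \<open>\<alpha> p\<close>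
  bounds how much \<open>D\<close> lowers the valuation at \<open>p\<close>. At a place outside \<open>S\<close> with \<open>\<alpha> p = 0\<close> only
  regularity has to be preserved.\<close>

locale wronskian_setting = curve \<iota> for \<iota> :: "'k::field_char_0 \<Rightarrow> 'K::field" +
  fixes D :: "'K \<Rightarrow> 'K" and E :: "'K set" and S :: "('K \<Rightarrow> int) set" and \<alpha> :: "('K \<Rightarrow> int) \<Rightarrow> nat"
  assumes deriv: "derivation D"
    and E_ring: "ksubring E" and E_divide: "\<And>a b. a \<in> E \<Longrightarrow> b \<in> E \<Longrightarrow> a / b \<in> E"
    and E_D: "\<And>a. a \<in> E \<Longrightarrow> D a \<in> E"
    and S_places: "finite S" "S \<subseteq> places \<iota>" and \<alpha>_finite: "finite {p \<in> places \<iota>. \<alpha> p \<noteq> 0}"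
    and loss: "\<And>p m f. p \<in> places \<iota> \<Longrightarrow> p \<in> S \<or> \<alpha> p \<noteq> 0 \<Longrightarrow> f \<in> E \<Longrightarrow> vge p m f \<Longrightarrow>
          vge p (m - int (\<alpha> p)) (D f)"
    and no_loss: "\<And>p f. p \<in> places \<iota> - S \<Longrightarrow> \<alpha> p = 0 \<Longrightarrow> f \<in> E \<Longrightarrow> vge p 0 f \<Longrightarrow> vge p 0 (D f)"
begin

lemma D_add: "D (a + b) = D a + D b" and D_mult: "D (a * b) = a * D b + b * D a" and D_const: "D (\<iota> c) = 0"
  and D_kernel: "D x = 0 \<Longrightarrow> x \<in> range \<iota>"
  using deriv by (auto simp: derivation_def)

lemma D_0 [simp]: "D 0 = 0" using D_const[of 0] by simp
lemma D_sum: "D (sum f I) = (\<Sum>i\<in>I. D (f i))"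
  by (induction I rule: infinite_finite_induct) (auto simp: D_add)
lemma D_scale: "D (\<iota> c * x) = \<iota> c * D x" by (simp add: D_mult D_const)

lemma Dpow_sum: "(D ^^ n) (\<Sum>i\<in>I. \<iota> (c i) * f i) = (\<Sum>i\<in>I. \<iota> (c i) * (D ^^ n) (f i))"
  by (induction n) (auto simp: D_sum D_scale)

lemma Dpow_E: "f \<in> E \<Longrightarrow> (D ^^ n) f \<in> E" by (induction n) (auto intro: E_D)

definition Wmat :: "(nat \<Rightarrow> 'K) \<Rightarrow> nat \<Rightarrow> 'K mat" where
  "Wmat f N = mat N N (\<lambda>(i, j). (D ^^ i) (f j))"

lemma Wmat_carrier [simp]: "Wmat f N \<in> carrier_mat N N" by (simp add: Wmat_def)

lemma mat_mult_vec_eq_0_iff: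
  assumes "A \<in> carrier_mat N N" "v \<in> carrier_vec N"
  shows "A *\<^sub>v v = 0\<^sub>v N \<longleftrightarrow> (\<forall>i<N. (\<Sum>j<N. A $$ (i, j) * v $ j) = 0)"
proof -
  have "(A *\<^sub>v v) $ i = (\<Sum>j<N. A $$ (i, j) * v $ j)" if "i < N" for i
    using that assms by (auto simp: scalar_prod_def atLeast0LessThan intro!: sum.cong)
  moreover have "A *\<^sub>v v = 0\<^sub>v N \<longleftrightarrow> (\<forall>i<N. (A *\<^sub>v v) $ i = 0)"
  proof
    assume "\<forall>i<N. (A *\<^sub>v v) $ i = 0"
    thus "A *\<^sub>v v = 0\<^sub>v N" using assms by (intro eq_vecI) (simp_all del: index_mult_mat_vec)
  qed (metis index_zero_vec(1))
  ultimately show ?thesis by simp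
qed

text \<open>Induction on N. A kernel vector of the vanishing Wronskian can be normalized to have
  last entry 1, because the smaller Wronskian is nonzero; its other entries then turn out to be
  constants and give a relation over k.\<close>

lemma det_Wmat_nonzero:
  assumes "kindep {..<N} f" shows "det (Wmat f N) \<noteq> 0"
  using assms
proof (induction N)
  case 0
  have "det (Wmat f 0) = 1" by (rule det_dim_zero) simp
  thus ?case by simp
next
  case (Suc N)
  have kN: "kindep {..<N} f" unfolding kindep_def
  proof (intro allI impI ballI)
    fix c i assume c: "(\<Sum>i<N. \<iota> (c i) * f i) = 0" "i \<in> {..<N}"
    define c' where "c' i = (if i < N then c i else 0)" for i
    have "(\<Sum>i<Suc N. \<iota> (c' i) * f i) = 0" using c(1) by (simp add: c'_def)
    hence "c' i = 0" using kindepD[OF Suc.prems, of c' i] c by simp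
    thus "c i = 0" using c by (simp add: c'_def)
  qed
  note nz = Suc.IH[OF kN]
  have kernel: "\<forall>j<N. u j = 0" if "\<forall>i<N. (\<Sum>j<N. (D ^^ i) (f j) * u j) = 0" for u
  proof (rule ccontr)
    assume "\<not> ?thesis"
    hence "vec N u \<noteq> 0\<^sub>v N" by (metis index_vec index_zero_vec(1))
    moreover have "Wmat f N *\<^sub>v vec N u = 0\<^sub>v N"
      using that by (subst mat_mult_vec_eq_0_iff) (auto simp: Wmat_def)
    ultimately show False using nz det_0_iff_vec_prod_zero_field[of "Wmat f N" N] by (metis Wmat_carrier vec_carrier)
  qed
  show ?case
  proof
    assume "det (Wmat f (Suc N)) = 0"
    then obtain v where v: "v \<in> carrier_vec (Suc N)" "v \<noteq> 0\<^sub>v (Suc N)" "Wmat f (Suc N) *\<^sub>v v = 0\<^sub>v (Suc N)"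
      using det_0_iff_vec_prod_zero_field[of "Wmat f (Suc N)" "Suc N"] by auto
    have rel: "(\<Sum>j<N. (D ^^ i) (f j) * v $ j) + (D ^^ i) (f N) * v $ N = 0" if "i \<le> N" for i
      using v(3) that mat_mult_vec_eq_0_iff[OF Wmat_carrier v(1)] by (simp add: Wmat_def less_Suc_eq_le)
    have vN: "v $ N \<noteq> 0"
    proof
      assume vN: "v $ N = 0"
      have "\<forall>j<N. v $ j = 0"
      proof (rule kernel, intro allI impI)
        fix i assume "i < N"
        thus "(\<Sum>j<N. (D ^^ i) (f j) * v $ j) = 0" using rel[of i] vN by simp
      qed
      hence "v = 0\<^sub>v (Suc N)" using v(1) vN by (intro eq_vecI) (auto simp: less_Suc_eq)
      thus False using v(2) by simp
    qed
    define c where "c j = v $ j / v $ N" for j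
    have rel': "(\<Sum>j<N. (D ^^ i) (f j) * c j) + (D ^^ i) (f N) = 0" if "i \<le> N" for i
    proof -
      have "((\<Sum>j<N. (D ^^ i) (f j) * v $ j) + (D ^^ i) (f N) * v $ N) / v $ N = 0" using rel[OF that] by simp
      thus ?thesis using vN by (simp add: c_def add_divide_distrib sum_divide_distrib)
    qed
    \<comment> \<open>Differentiating the i-th relation and subtracting the next one leaves a
      relation among the D (c j), and these are then in the trivial kernel of the smaller Wronskian
      matrix.\<close>
    have "\<forall>j<N. D (c j) = 0"
    proof (rule kernel, intro allI impI)
      fix i assume i: "i < N"
      have "D ((\<Sum>j<N. (D ^^ i) (f j) * c j) + (D ^^ i) (f N)) = 0" using rel'[of i] i by simp
      hence "(\<Sum>j<N. (D ^^ i) (f j) * D (c j)) + ((\<Sum>j<N. (D ^^ Suc i) (f j) * c j) + (D ^^ Suc i) (f N)) = 0"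
        by (simp add: D_add D_sum D_mult sum.distrib algebra_simps)
      thus "(\<Sum>j<N. (D ^^ i) (f j) * D (c j)) = 0" using rel'[of "Suc i"] i by simp
    qed
    hence "\<forall>j<N. \<exists>a. c j = \<iota> a" using D_kernel by blast
    then obtain a where a: "\<And>j. j < N \<Longrightarrow> c j = \<iota> (a j)" by metis
    define a' where "a' j = (if j < N then a j else 1)" for j
    have "(\<Sum>j<Suc N. \<iota> (a' j) * f j) = (\<Sum>j<N. f j * c j) + f N" by (simp add: a'_def a mult.commute)
    also have "\<dots> = 0" using rel'[of 0] by simp
    finally have "a' N = 0" using kindepD[OF Suc.prems, of a' N] by simp
    thus False by (simp add: a'_def)
  qed
qed

lemma vge_det:
  assumes p: "p \<in> places \<iota>" and A: "A \<in> carrier_mat N N"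
    and c: "\<And>i j. i < N \<Longrightarrow> j < N \<Longrightarrow> vge p (c j) (A $$ (i, j))"
  shows "vge p (\<Sum>j<N. c j) (det A)"
  unfolding det_def'[OF A]
proof (rule vge_sum[OF p])
  fix \<pi> assume "\<pi> \<in> {\<pi>. \<pi> permutes {0..<N}}"
  hence \<pi>: "\<pi> permutes {..<N}" by (simp add: atLeast0LessThan)
  have "vge p 0 (signof \<pi> :: 'K)" using vge_const[OF p, of 1] vge_const[OF p, of "-1"] by (auto simp: sign_def \<iota>_uminus)
  moreover have "vge p (\<Sum>i\<in>{0..<N}. c (\<pi> i)) (\<Prod>i=0..<N. A $$ (i, \<pi> i))"
    using \<pi> by (intro vge_prod p c) (use permutes_in_image[OF \<pi>] in auto)
  moreover have "(\<Sum>i\<in>{0..<N}. c (\<pi> i)) = (\<Sum>j<N. c j)"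
    using sum.permute[OF \<pi>, of c] by (simp add: atLeast0LessThan o_def)
  ultimately show "vge p (\<Sum>j<N. c j) (signof \<pi> * (\<Prod>i=0..<N. A $$ (i, \<pi> i)))"
    using vge_mult[OF p, of 0 "signof \<pi>"] by fastforce
qed

lemma det_Wmat_base_change:
  assumes g: "\<And>j. j < N \<Longrightarrow> g j = (\<Sum>l<N. \<iota> (a l j) * f l)"
  shows "\<exists>c. det (Wmat g N) = det (Wmat f N) * \<iota> c"
proof -
  define A where "A = mat N N (\<lambda>(l, j). \<iota> (a l j))"
  have A: "A \<in> carrier_mat N N" by (simp add: A_def)
  have "Wmat g N = Wmat f N * A"
  proof (rule eq_matI)
    fix i j assume "i < dim_row (Wmat f N * A)" "j < dim_col (Wmat f N * A)"
    hence ij: "i < N" "j < N" by (auto simp: A_def Wmat_def)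
    have "(Wmat f N * A) $$ (i, j) = (\<Sum>l<N. (D ^^ i) (f l) * \<iota> (a l j))"
      using ij by (auto simp: A_def Wmat_def scalar_prod_def atLeast0LessThan intro!: sum.cong)
    also have "\<dots> = (D ^^ i) (g j)" unfolding g[OF ij(2)] Dpow_sum by (simp add: mult.commute)
    finally show "Wmat g N $$ (i, j) = (Wmat f N * A) $$ (i, j)" using ij by (simp add: Wmat_def)
  qed (auto simp: A_def Wmat_def)
  hence "det (Wmat g N) = det (Wmat f N) * det A" using det_mult[OF Wmat_carrier A] by simp
  \<comment> \<open>The entries are constants, so the determinant is regular at every place and
    therefore constant.\<close>
  moreover have "det A \<in> range \<iota>"
  proof (rule no_poles_const)
    fix p assume p: "p \<in> places \<iota>"
    have "vge p (\<Sum>j<N. 0) (det A)" by (rule vge_det[OF p A]) (auto simp: A_def vge_const[OF p])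
    thus "vge p 0 (det A)" by simp
  qed
  ultimately show ?thesis by auto
qed

text \<open>Off S, where \<alpha> p may be 0, the derivation is only known to preserve regularity;
  this is why m = 0 is required there.\<close>

lemma vge_Dpow:
  assumes p: "p \<in> places \<iota>" and f: "f \<in> E" "vge p m f" and cond: "p \<in> S \<or> m = 0"
  shows "vge p (m - int i * int (\<alpha> p)) ((D ^^ i) f)"
proof (induction i)
  case (Suc i)
  show ?case
  proof (cases "p \<in> S \<or> \<alpha> p \<noteq> 0")
    case True
    show ?thesis using loss[OF p True Dpow_E[OF f(1)] Suc] by (simp add: algebra_simps)
  next
    case False
    thus ?thesis using no_loss[OF _ _ Dpow_E[OF f(1), of i]] Suc cond p by simp
  qed
qed (use f in simp)

text \<open>Each of the N factors in a term of the determinant carries fewer than N derivatives,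
  which is the crude source of the loss N^2 \<alpha> p.\<close>

lemma vge_det_Wmat:
  assumes p: "p \<in> places \<iota>" and f: "\<And>j. j < N \<Longrightarrow> f j \<in> E" and c: "\<And>j. j < N \<Longrightarrow> vge p (c j) (f j)"
    and cond: "p \<in> S \<or> (\<forall>j<N. c j = 0)"
  shows "vge p ((\<Sum>j<N. c j) - int (N * N * \<alpha> p)) (det (Wmat f N))"
proof -
  have "vge p (\<Sum>j<N. c j - int (N * \<alpha> p)) (det (Wmat f N))"
  proof (rule vge_det[OF p Wmat_carrier])
    fix i j assume ij: "i < N" "j < N"
    have "int i * int (\<alpha> p) \<le> int (N * \<alpha> p)" using ij by (simp add: mult_right_mono)
    moreover have "vge p (c j - int i * int (\<alpha> p)) ((D ^^ i) (f j))"
      using ij cond by (intro vge_Dpow p f c) auto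
    ultimately have "vge p (c j - int (N * \<alpha> p)) ((D ^^ i) (f j))" by (elim vge_mono) linarith
    thus "vge p (c j - int (N * \<alpha> p)) (Wmat f N $$ (i, j))" using ij by (simp add: Wmat_def)
  qed
  thus ?thesis by (simp add: sum_subtractf mult.assoc)
qed

text \<open>The Wronskian is homogeneous: multiplying all functions by \<open>h\<close> acts on the Wronskian matrix by
  a triangular matrix with diagonal \<open>h\<close>.\<close>

lemma det_Wmat_scale: "det (Wmat (\<lambda>j. h * y j) N) = h ^ N * det (Wmat y N)"
proof -
  define L :: "nat \<Rightarrow> nat \<Rightarrow> 'K" where "L = rec_nat (\<lambda>l. if l = 0 then h else 0) (\<lambda>i R l. D (R l) + (if l = 0 then 0 else R (l - 1)))"
  have L0: "L 0 l = (if l = 0 then h else 0)"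
    and LS: "L (Suc i) l = D (L i l) + (if l = 0 then 0 else L i (l - 1))" for i l
    by (simp_all add: L_def)
  have Lz: "i < l \<Longrightarrow> L i l = 0" for i l
    by (induction i arbitrary: l) (auto simp: L0 LS)
  have Ld: "L i i = h" for i
    by (induction i) (auto simp: L0 LS Lz)
  have Leib: "(D ^^ i) (h * x) = (\<Sum>l\<le>i. L i l * (D ^^ l) x)" for i x
  proof (induction i)
    case (Suc i)
    have "(D ^^ Suc i) (h * x) = (\<Sum>l\<le>i. D (L i l) * (D ^^ l) x) + (\<Sum>l\<le>i. L i l * (D ^^ Suc l) x)"
      by (simp add: Suc D_sum D_mult sum.distrib algebra_simps)
    also have "(\<Sum>l\<le>i. D (L i l) * (D ^^ l) x) = (\<Sum>l\<le>Suc i. D (L i l) * (D ^^ l) x)" by (simp add: Lz)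
    also have "(\<Sum>l\<le>i. L i l * (D ^^ Suc l) x) = (\<Sum>l\<le>Suc i. (if l = 0 then 0 else L i (l - 1)) * (D ^^ l) x)"
      by (subst sum.atMost_Suc_shift) simp
    also have "(\<Sum>l\<le>Suc i. D (L i l) * (D ^^ l) x) + \<dots> = (\<Sum>l\<le>Suc i. L (Suc i) l * (D ^^ l) x)"
      by (simp only: LS sum.distrib[symmetric] distrib_right)
    finally show ?case .
  qed (simp add: L0)
  define M where "M = mat N N (\<lambda>(i, l). L i l)"
  have M: "M \<in> carrier_mat N N" by (simp add: M_def)
  have "Wmat (\<lambda>j. h * y j) N = M * Wmat y N"
  proof (rule eq_matI)
    fix i j assume "i < dim_row (M * Wmat y N)" "j < dim_col (M * Wmat y N)"
    hence ij: "i < N" "j < N" by (auto simp: M_def Wmat_def)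
    have "(M * Wmat y N) $$ (i, j) = (\<Sum>l<N. L i l * (D ^^ l) (y j))"
      using ij by (auto simp: M_def Wmat_def scalar_prod_def atLeast0LessThan intro!: sum.cong)
    also have "\<dots> = (\<Sum>l\<le>i. L i l * (D ^^ l) (y j))"
      using ij Lz by (intro sum.mono_neutral_right) auto
    finally show "Wmat (\<lambda>j. h * y j) N $$ (i, j) = (M * Wmat y N) $$ (i, j)"
      using ij Leib by (simp add: Wmat_def)
  qed (auto simp: M_def Wmat_def)
  hence "det (Wmat (\<lambda>j. h * y j) N) = det M * det (Wmat y N)" using det_mult[OF M Wmat_carrier] by simp
  also have "det M = prod_list (diag_mat M)"
    by (rule det_lower_triangular[OF _ M]) (auto simp: M_def Lz)
  also have "diag_mat M = map (\<lambda>_. h) [0..<N]" unfolding diag_mat_def by (auto simp: M_def Ld)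
  also have "prod_list \<dots> = h ^ N" by (simp add: map_replicate_const)
  finally show ?thesis .
qed

lemma E_span: "A \<subseteq> E \<Longrightarrow> x \<in> V.span A \<Longrightarrow> x \<in> E"
  using V.span_minimal[of A E] E_ring ksubringD(1)[OF E_ring, of 0]
  by (auto simp: V.subspace_def intro: ksubringD)

text \<open>Up to the loss, w p bounds the order of the Wronskian from below, and these orders sum
  to 0. In S any basis C of the same span may be used, because a change of basis multiplies the
  Wronskian by a constant. At the other places of \<Omega> a common order m of the functions is
  factored out, and off \<Omega> the Wronskian is regular.\<close>

theorem wronskian_inequality:
  assumes B: "finite B" "V.independent B" "B \<subseteq> E"
    and \<Omega>: "finite \<Omega>" "\<Omega> \<subseteq> places \<iota>" "S \<subseteq> \<Omega>"
    and out: "\<And>p. p \<in> places \<iota> - \<Omega> \<Longrightarrow> \<alpha> p = 0 \<and> (\<forall>x\<in>B. vge p 0 x)"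
    and inS: "\<And>p. p \<in> S \<Longrightarrow> \<exists>C c. finite C \<and> V.independent C \<and> C \<subseteq> V.span B \<and> card C = card B \<and>
          (\<forall>x\<in>C. vge p (c x) x) \<and> w p \<le> (\<Sum>x\<in>C. c x)"
    and notS: "\<And>p. p \<in> \<Omega> - S \<Longrightarrow> \<exists>m. (\<forall>x\<in>B. vge p m x) \<and> w p \<le> int (card B) * m"
  shows "(\<Sum>p\<in>\<Omega>. w p) \<le> int ((card B)\<^sup>2 * (\<Sum>p\<in>\<Omega>. \<alpha> p))"
proof -
  define N where "N = card B"
  obtain f where f: "bij_betw f {..<N} B"
    using ex_bij_betw_nat_finite[OF B(1)] by (auto simp: N_def atLeast0LessThan)
  have fE: "f j \<in> E" "f j \<in> B" if "j < N" for j using f that B(3) by (auto simp: bij_betw_def)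
  have kf: "kindep {..<N} f" using f B(2) by (subst kindep_iff) (auto simp: bij_betw_def)
  define W where "W = det (Wmat f N)"
  have W: "W \<noteq> 0" using det_Wmat_nonzero[OF kf] by (simp add: W_def)
  have bound: "w p - int (N * N * \<alpha> p) \<le> p W" if p: "p \<in> \<Omega>" for p
  proof (cases "p \<in> S")
    case True
    have pp: "p \<in> places \<iota>" using p \<Omega> by auto
    obtain C c where C: "finite C" "V.independent C" "C \<subseteq> V.span B" "card C = N"
        "\<forall>x\<in>C. vge p (c x) x" "w p \<le> (\<Sum>x\<in>C. c x)" using inS[OF True] by (auto simp: N_def)
    obtain g where g: "bij_betw g {..<N} C"
      using ex_bij_betw_nat_finite[OF C(1)] C(4) by (auto simp: atLeast0LessThan)
    have kg: "kindep {..<N} g" using g C(2) by (subst kindep_iff) (auto simp: bij_betw_def)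
    have gC: "g j \<in> C" if "j < N" for j using g that by (auto simp: bij_betw_def)
    have "\<exists>a. g j = (\<Sum>l<N. \<iota> (a l) * f l)" if j: "j < N" for j
    proof -
      obtain u where "g j = (\<Sum>v\<in>B. \<iota> (u v) * v)" using gC[OF j] C(3) V.span_finite[OF B(1)] by auto
      also have "\<dots> = (\<Sum>l<N. \<iota> (u (f l)) * f l)" using sum.reindex_bij_betw[OF f, of "\<lambda>v. \<iota> (u v) * v"] by simp
      finally show ?thesis by (intro exI[of _ "\<lambda>l. u (f l)"])
    qed
    then obtain a where "\<And>j. j < N \<Longrightarrow> g j = (\<Sum>l<N. \<iota> (a j l) * f l)" by metis
    then obtain d where d: "det (Wmat g N) = W * \<iota> d"
      using det_Wmat_base_change[of N g "\<lambda>l j. a j l" f] by (auto simp: W_def)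
    have nz: "W * \<iota> d \<noteq> 0" using det_Wmat_nonzero[OF kg] d by simp
    have "vge p ((\<Sum>j<N. c (g j)) - int (N * N * \<alpha> p)) (W * \<iota> d)"
      unfolding d[symmetric] using True C gC E_span[OF B(3)] by (intro vge_det_Wmat[OF pp]) auto
    moreover have "(\<Sum>j<N. c (g j)) = (\<Sum>x\<in>C. c x)" by (rule sum.reindex_bij_betw[OF g])
    moreover have "p (W * \<iota> d) = p W" using nz place_mult[OF pp, of W "\<iota> d"] place_const[OF pp] by simp
    ultimately show ?thesis using nz C(6) by (auto simp: vge_def)
  next
    case False
    have pp: "p \<in> places \<iota>" using p \<Omega> by auto
    obtain m where m: "\<forall>x\<in>B. vge p m x" "w p \<le> int N * m" using notS[of p] False p by (auto simp: N_def)
    show ?thesis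
    proof (cases "N = 0")
      case True
      hence "W = 1" by (simp add: W_def det_dim_zero[OF Wmat_carrier])
      thus ?thesis using True m place_1[OF pp] by simp
    next
      case False
      have fnz: "f j \<noteq> 0" if "j < N" for j
        using fE(2)[OF that] B(2) V.dependent_zero by metis
      obtain j0 where j0: "j0 < N" "\<And>j. j < N \<Longrightarrow> p (f j0) \<le> p (f j)"
      proof -
        have "Min ((\<lambda>j. p (f j)) ` {..<N}) \<in> (\<lambda>j. p (f j)) ` {..<N}" using False by (intro Min_in) auto
        then obtain j0 where "j0 < N" "p (f j0) = Min ((\<lambda>j. p (f j)) ` {..<N})" by auto
        thus ?thesis using that[of j0] by auto
      qed
      \<comment> \<open>Dividing by the function of least order leaves regular functions, to which
        the weaker hypothesis off S applies. The quotients stay in E because E is a field, and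
        homogeneity of the Wronskian restores the factor.\<close>
      define y where "y j = f j / f j0" for j
      have "Wmat f N = Wmat (\<lambda>j. f j0 * y j) N"
        using fnz[OF j0(1)] by (auto simp: Wmat_def y_def)
      hence Wy: "W = f j0 ^ N * det (Wmat y N)" by (simp add: W_def det_Wmat_scale)
      hence nz: "det (Wmat y N) \<noteq> 0" using W by auto
      have "vge p ((\<Sum>j<N. 0) - int (N * N * \<alpha> p)) (det (Wmat y N))"
      proof (rule vge_det_Wmat[OF pp])
        fix j assume j: "j < N"
        show "y j \<in> E" unfolding y_def using fE j j0 by (intro E_divide) auto
        show "vge p 0 (y j)" using j0 fnz j by (auto simp: y_def vge_def place_divide[OF pp])
      qed simp
      hence "- int (N * N * \<alpha> p) \<le> p (det (Wmat y N))" using nz by (simp add: vge_def)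
      moreover have "p W = int N * p (f j0) + p (det (Wmat y N))"
        unfolding Wy using nz fnz[OF j0(1)] by (simp add: place_mult[OF pp] place_power[OF pp])
      moreover have "m \<le> p (f j0)" using m(1) fE(2)[OF j0(1)] fnz[OF j0(1)] by (auto simp: vge_def)
      hence "int N * m \<le> int N * p (f j0)" by (intro mult_left_mono) auto
      ultimately show ?thesis using m(2) by linarith
    qed
  qed
  have pos: "0 \<le> p W" if p: "p \<in> places \<iota> - \<Omega>" for p
  proof -
    have "vge p ((\<Sum>j<N. 0) - int (N * N * \<alpha> p)) (det (Wmat f N))"
      using p out[OF p] fE by (intro vge_det_Wmat) auto
    thus ?thesis using W out[OF p] by (simp add: vge_def W_def)
  qed
  define T where "T = \<Omega> \<union> {p \<in> places \<iota>. p W \<noteq> 0}"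
  have T: "finite T" "T \<subseteq> places \<iota>" using \<Omega> finite_support[OF W] by (auto simp: T_def)
  have "(\<Sum>p\<in>\<Omega>. w p - int (N * N * \<alpha> p)) \<le> (\<Sum>p\<in>\<Omega>. p W)" by (intro sum_mono bound)
  also have "\<dots> \<le> (\<Sum>p\<in>T. p W)" using T pos by (intro sum_mono2) (auto simp: T_def)
  also have "\<dots> = 0" by (rule product_formula[OF W T]) (auto simp: T_def)
  finally show ?thesis by (simp add: sum_subtractf N_def power2_eq_square sum_distrib_left)
qed

end

section \<open>Sums of units\<close>

context curve
begin

lemma height_eq_sum:
  assumes "finite S" "S \<subseteq> places \<iota>" "\<And>p. p \<in> places \<iota> - S \<Longrightarrow> p x = 0"
  shows "height \<iota> x = real_of_int (\<Sum>p\<in>S. max 0 (- p x))"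
proof -
  have "poles x p = 0" if "p \<notin> S" for p using assms(3)[of p] that by (cases "p \<in> places \<iota>") (auto simp: poles_def)
  hence "div_deg (poles x) = (\<Sum>p\<in>S. poles x p)" using assms(1) by (intro div_deg_eq) auto
  also have "\<dots> = (\<Sum>p\<in>S. max 0 (- p x))" using assms(2) by (intro sum.cong) (auto simp: poles_def)
  finally show ?thesis by (simp add: height_eq_poles)
qed

lemma S_unit_nonzero: "S_unit \<iota> S f \<Longrightarrow> f \<noteq> 0"
  and S_unit_outside: "S_unit \<iota> S f \<Longrightarrow> p \<in> places \<iota> - S \<Longrightarrow> p f = 0"
  by (auto simp: S_unit_def)

lemma S_unit_mult: "S_unit \<iota> S f \<Longrightarrow> S_unit \<iota> S g \<Longrightarrow> S_unit \<iota> S (f * g)"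
proof -
  assume fg: "S_unit \<iota> S f" "S_unit \<iota> S g"
  have "p (f * g) = 0" if "p \<in> places \<iota> - S" for p
    using S_unit_outside[OF fg(1) that] S_unit_outside[OF fg(2) that] fg place_mult[of p f g] that
    by (simp add: S_unit_nonzero)
  thus ?thesis using fg unfolding S_unit_def by simp
qed

lemma S_unit_const: "c \<noteq> 0 \<Longrightarrow> S_unit \<iota> S (\<iota> c)"
  by (auto simp: S_unit_def place_const)

lemma S_unit_power: "S_unit \<iota> S f \<Longrightarrow> S_unit \<iota> S (f ^ k)"
  by (auto simp: S_unit_def place_power)

lemma S_unit_prod: "(\<And>i. i \<in> I \<Longrightarrow> S_unit \<iota> S (f i)) \<Longrightarrow> S_unit \<iota> S (prod f I)"
  using S_unit_const[of 1] by (induction I rule: infinite_finite_induct) (auto intro: S_unit_mult)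

lemma S_unit_mono: "S_unit \<iota> S f \<Longrightarrow> S \<subseteq> S' \<Longrightarrow> S_unit \<iota> S' f"
  by (auto simp: S_unit_def)

lemma product_formula_S_unit:
  "finite S \<Longrightarrow> S \<subseteq> places \<iota> \<Longrightarrow> S_unit \<iota> S f \<Longrightarrow> (\<Sum>p\<in>S. p f) = 0"
  using product_formula[of f S] by (auto simp: S_unit_def)

lemma height_nonneg: "height \<iota> x \<ge> 0"
  using div_deg_nonneg[of "poles x"] poles_nonneg by (simp add: height_eq_poles)

lemma height_mult_le:
  assumes "x \<noteq> 0" "y \<noteq> 0" shows "height \<iota> (x * y) \<le> height \<iota> x + height \<iota> y"
proof -
  define T where "T = {p \<in> places \<iota>. p x \<noteq> 0} \<union> {p \<in> places \<iota>. p y \<noteq> 0}"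
  have T: "finite T" "T \<subseteq> places \<iota>" using finite_support assms by (auto simp: T_def)
  have "height \<iota> (x * y) = real_of_int (\<Sum>p\<in>T. max 0 (- p (x * y)))"
    using T assms by (intro height_eq_sum) (auto simp: T_def place_mult)
  also have "\<dots> \<le> real_of_int (\<Sum>p\<in>T. max 0 (- p x) + max 0 (- p y))"
    unfolding of_int_le_iff
  proof (rule sum_mono)
    fix p assume "p \<in> T"
    hence "p (x * y) = p x + p y" using T assms by (intro place_mult) auto
    thus "max 0 (- p (x * y)) \<le> max 0 (- p x) + max 0 (- p y)" by simp
  qed
  also have "\<dots> = height \<iota> x + height \<iota> y"
    using height_eq_sum[OF T, of x] height_eq_sum[OF T, of y] by (simp add: sum.distrib T_def)
  finally show ?thesis .
qed

lemma sum_abs_S_unit: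
  assumes "finite S" "S \<subseteq> places \<iota>" "S_unit \<iota> S x"
  shows "real_of_int (\<Sum>p\<in>S. \<bar>p x\<bar>) = 2 * height \<iota> x"
proof -
  have "(\<Sum>p\<in>S. \<bar>p x\<bar>) = (\<Sum>p\<in>S. p x + 2 * max 0 (- p x))" by (intro sum.cong) auto
  also have "\<dots> = 2 * (\<Sum>p\<in>S. max 0 (- p x))"
    using product_formula_S_unit[OF assms] by (simp add: sum.distrib sum_distrib_left)
  moreover have "height \<iota> x = real_of_int (\<Sum>p\<in>S. max 0 (- p x))"
    by (rule height_eq_sum[OF assms(1,2)]) (rule S_unit_outside[OF assms(3)])
  ultimately show ?thesis by simp
qed

end

context wronskian_setting
begin

definition loss_total :: nat where "loss_total = (\<Sum>p\<in>{p \<in> places \<iota>. \<alpha> p \<noteq> 0}. \<alpha> p)"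

lemma sum_loss: "finite \<Omega> \<Longrightarrow> \<Omega> \<subseteq> places \<iota> \<Longrightarrow> (\<Sum>p\<in>\<Omega>. \<alpha> p) \<le> loss_total"
proof -
  assume \<Omega>: "finite \<Omega>" "\<Omega> \<subseteq> places \<iota>"
  have "(\<Sum>p\<in>\<Omega>. \<alpha> p) = (\<Sum>p\<in>{p \<in> \<Omega>. \<alpha> p \<noteq> 0}. \<alpha> p)" using \<Omega> by (intro sum.mono_neutral_right) auto
  also have "\<dots> \<le> loss_total" unfolding loss_total_def using \<Omega> \<alpha>_finite by (intro sum_mono2) auto
  finally show ?thesis .
qed

text \<open>For \<open>p \<in> S\<close> the element of minimal valuation is exchanged against the sum.\<close>

lemma unit_sum_inequality:
  assumes B: "finite B" "V.independent B" "B \<subseteq> E" "B \<noteq> {}" and unit: "\<And>x. x \<in> B \<Longrightarrow> S_unit \<iota> S x"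
  shows "(\<Sum>p\<in>S. p (\<Sum>B) - Min (p ` B)) \<le> int ((card B)\<^sup>2 * loss_total)"
proof -
  define \<Omega> where "\<Omega> = S \<union> {p \<in> places \<iota>. \<alpha> p \<noteq> 0}"
  have \<Omega>: "finite \<Omega>" "\<Omega> \<subseteq> places \<iota>" "S \<subseteq> \<Omega>" using S_places \<alpha>_finite by (auto simp: \<Omega>_def)
  define w where "w p = (if p \<in> S then (\<Sum>x\<in>B. p x) - Min (p ` B) + p (\<Sum>B) else 0)" for p :: "'K \<Rightarrow> int"
  have "(\<Sum>p\<in>\<Omega>. w p) \<le> int ((card B)\<^sup>2 * (\<Sum>p\<in>\<Omega>. \<alpha> p))"
  proof (rule wronskian_inequality[OF B(1-3) \<Omega>])
    fix p assume p: "p \<in> places \<iota> - \<Omega>"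
    show "\<alpha> p = 0 \<and> (\<forall>x\<in>B. vge p 0 x)"
      using p S_unit_outside[OF unit, of _ p] by (auto simp: \<Omega>_def vge_def)
  next
    fix p assume p: "p \<in> \<Omega> - S"
    hence "\<forall>x\<in>B. vge p 0 x" using \<Omega> S_unit_outside[OF unit, of _ p] by (auto simp: vge_def)
    thus "\<exists>m. (\<forall>x\<in>B. vge p m x) \<and> w p \<le> int (card B) * m" using p by (intro exI[of _ 0]) (auto simp: w_def)
  next
    fix p assume p: "p \<in> S"
    have "Min (p ` B) \<in> p ` B" using B by (intro Min_in) auto
    then obtain x0 where x0: "x0 \<in> B" "p x0 = Min (p ` B)" by auto
    have y: "\<Sum>B = x0 + \<Sum>(B - {x0})" using sum.remove[OF B(1) x0(1), of "\<lambda>x. x"] by simp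
    have "\<Sum>B \<notin> V.span (B - {x0})"
    proof
      assume "\<Sum>B \<in> V.span (B - {x0})"
      moreover have "\<Sum>(B - {x0}) \<in> V.span (B - {x0})" by (intro V.span_sum V.span_base) auto
      ultimately have "\<Sum>B - \<Sum>(B - {x0}) \<in> V.span (B - {x0})" by (rule V.span_diff)
      hence "x0 \<in> V.span (B - {x0})" by (simp add: y)
      thus False using B(2) x0(1) unfolding V.dependent_def by blast
    qed
    note notin = this
    have ind0: "V.independent (B - {x0})" by (rule V.independent_mono[OF B(2)]) blast
    have "\<Sum>B \<notin> B - {x0}" using notin V.span_base[of "\<Sum>B" "B - {x0}"] by metis
    moreover have "V.independent (insert (\<Sum>B) (B - {x0}))" by (rule V.independent_insertI[OF notin ind0])
    ultimately have 1: "\<Sum>B \<notin> B - {x0}" "V.independent (insert (\<Sum>B) (B - {x0}))" .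
    show "\<exists>C c. finite C \<and> V.independent C \<and> C \<subseteq> V.span B \<and> card C = card B \<and>
        (\<forall>x\<in>C. vge p (c x) x) \<and> w p \<le> (\<Sum>x\<in>C. c x)"
    proof (intro exI[of _ "insert (\<Sum>B) (B - {x0})"] exI[of _ p] conjI ballI)
      show "insert (\<Sum>B) (B - {x0}) \<subseteq> V.span B" by (auto intro: V.span_base V.span_sum)
      have "card B > 0" using B x0(1) by (auto simp: card_gt_0_iff)
      thus "card (insert (\<Sum>B) (B - {x0})) = card B" using 1 B x0 by (simp add: card_insert_disjoint)
      show "w p \<le> (\<Sum>x\<in>insert (\<Sum>B) (B - {x0}). p x)"
        using 1 B p x0 sum.remove[OF B(1) x0(1), of p] by (simp add: w_def)
    qed (use 1 B vge_self in auto)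
  qed
  also have "int ((card B)\<^sup>2 * (\<Sum>p\<in>\<Omega>. \<alpha> p)) \<le> int ((card B)\<^sup>2 * loss_total)"
    using sum_loss[OF \<Omega>(1,2)] by (simp only: of_nat_le_iff mult_le_mono2)
  also have "(\<Sum>p\<in>\<Omega>. w p) = (\<Sum>p\<in>S. w p)" using \<Omega> by (intro sum.mono_neutral_right) (auto simp: w_def)
  also have "(\<Sum>p\<in>S. w p) = (\<Sum>p\<in>S. \<Sum>x\<in>B. p x) + (\<Sum>p\<in>S. p (\<Sum>B) - Min (p ` B))"
    by (simp add: w_def sum.distrib sum_subtractf)
  also have "(\<Sum>p\<in>S. \<Sum>x\<in>B. p x) = (\<Sum>x\<in>B. \<Sum>p\<in>S. p x)" by (rule sum.swap)
  also have "\<dots> = 0" using product_formula_S_unit[OF S_places unit] by simp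
  finally show ?thesis by simp
qed

text \<open>A relation of minimal support meets two classes, since each class is independent. Moving
  one term to the other side leaves terms that are independent by minimality, so
  \<open>unit_sum_inequality\<close> applies with a unit as the sum. The class map guarantees that
  the two monomials produced later are different.\<close>

lemma dependent_units_small_ratio:
  fixes f :: "'i \<Rightarrow> 'K" and cls :: "'i \<Rightarrow> 'm"
  assumes I: "finite I" and f: "\<And>i. i \<in> I \<Longrightarrow> f i \<in> E \<and> S_unit \<iota> S (f i)" and dep: "\<not> kindep I f"
    and cls: "\<And>m. kindep {i \<in> I. cls i = m} f"
  shows "\<exists>i\<in>I. \<exists>j\<in>I. cls i \<noteq> cls j \<and> height \<iota> (f i / f j) \<le> real ((card I)\<^sup>2 * loss_total)"
proof -
  define rel where "rel c \<longleftrightarrow> (\<Sum>i\<in>I. \<iota> (c i) * f i) = 0 \<and> (\<exists>i\<in>I. c i \<noteq> 0)" for c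
  obtain c0 where "rel c0" using dep by (auto simp: rel_def kindep_def)
  then obtain c where c: "rel c" "\<And>c'. rel c' \<Longrightarrow> card {i \<in> I. c i \<noteq> 0} \<le> card {i \<in> I. c' i \<noteq> 0}"
    using ex_has_least_nat[of rel c0 "\<lambda>c. card {i \<in> I. c i \<noteq> 0}"] by blast
  define X where "X = {i \<in> I. c i \<noteq> 0}"
  have X: "finite X" "X \<subseteq> I" using I by (auto simp: X_def)
  obtain i0 where i0: "i0 \<in> X" using c(1) by (auto simp: rel_def X_def)
  have relX: "(\<Sum>i\<in>X. \<iota> (c i) * f i) = 0"
    using c(1) X I by (subst sum.mono_neutral_left[of I]) (auto simp: rel_def X_def)
  have "\<exists>i1\<in>X. cls i1 \<noteq> cls i0"
  proof (rule ccontr)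
    assume "\<not> ?thesis"
    hence same: "cls i = cls i0" if "i \<in> X" for i using that by blast
    have "(\<Sum>i\<in>{i \<in> I. cls i = cls i0}. \<iota> (c i) * f i) = (\<Sum>i\<in>X. \<iota> (c i) * f i)"
      using X I same by (intro sum.mono_neutral_right) (auto simp: X_def)
    hence "c i0 = 0" using kindepD[OF cls, of c "cls i0" i0] relX i0 X by auto
    thus False using i0 by (simp add: X_def)
  qed
  then obtain i1 where i1: "i1 \<in> X" "cls i1 \<noteq> cls i0" by blast
  define h where "h i = - (\<iota> (c i) * f i)" for i
  have "kindep (X - {i0}) h" unfolding kindep_def
  proof (intro allI impI, rule ccontr)
    fix a assume a: "(\<Sum>i\<in>X - {i0}. \<iota> (a i) * h i) = 0" "\<not> (\<forall>i\<in>X - {i0}. a i = 0)"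
    define c' where "c' i = (if i \<in> X - {i0} then a i * c i else 0)" for i
    have "(\<Sum>i\<in>I. \<iota> (c' i) * f i) = (\<Sum>i\<in>X - {i0}. \<iota> (c' i) * f i)"
      using X I by (intro sum.mono_neutral_right) (auto simp: c'_def)
    also have "\<dots> = (\<Sum>i\<in>X - {i0}. - (\<iota> (a i) * h i))"
    proof (rule sum.cong[OF refl])
      fix i assume "i \<in> X - {i0}"
      hence "c' i = a i * c i" by (simp add: c'_def)
      thus "\<iota> (c' i) * f i = - (\<iota> (a i) * h i)"
        by (simp only: h_def \<iota>_mult mult_minus_right minus_minus mult.assoc)
    qed
    also have "\<dots> = - (\<Sum>i\<in>X - {i0}. \<iota> (a i) * h i)" by (rule sum_negf)
    finally have "(\<Sum>i\<in>I. \<iota> (c' i) * f i) = 0" using a(1) by simp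
    moreover have "\<exists>i\<in>I. c' i \<noteq> 0" using a(2) X by (auto simp: c'_def X_def)
    ultimately have "card X \<le> card {i \<in> I. c' i \<noteq> 0}" using c(2)[of c'] by (simp add: rel_def X_def)
    also have "\<dots> \<le> card (X - {i0})" using X by (intro card_mono) (auto simp: c'_def)
    finally show False using i0 X card_Diff1_less[OF X(1) i0] by simp
  qed
  hence inj: "inj_on h (X - {i0})" and ind: "V.independent (h ` (X - {i0}))" using kindep_iff[of "X - {i0}" h] X by auto
  define B where "B = h ` (X - {i0})"
  have sumB: "\<Sum>B = \<iota> (c i0) * f i0"
  proof -
    have "\<Sum>B = (\<Sum>i\<in>X - {i0}. h i)" unfolding B_def using sum.reindex[OF inj, of "\<lambda>x. x"] by simp
    also have "\<dots> = - (\<Sum>i\<in>X - {i0}. \<iota> (c i) * f i)" by (simp add: h_def sum_negf)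
    also have "\<dots> = \<iota> (c i0) * f i0" using relX sum.remove[OF X(1) i0, of "\<lambda>i. \<iota> (c i) * f i"]
      by (simp add: eq_neg_iff_add_eq_0 neg_eq_iff_add_eq_0 add.commute)
    finally show ?thesis .
  qed
  have hi: "h i = \<iota> (- c i) * f i" for i by (simp add: h_def \<iota>_uminus)
  have hunit: "S_unit \<iota> S (h i)" "h i \<in> E" if "i \<in> X" for i
  proof -
    have i: "f i \<in> E" "S_unit \<iota> S (f i)" "- c i \<noteq> 0" using that f[of i] X by (auto simp: X_def)
    show "S_unit \<iota> S (h i)" unfolding hi using S_unit_mult[OF S_unit_const[OF i(3)] i(2)] .
    show "h i \<in> E" unfolding hi using ksubringD(3)[OF E_ring ksubringD(1)[OF E_ring] i(1)] .
  qed
  have fin: "finite B" using X by (simp add: B_def)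
  have i1B: "h i1 \<in> B" using i1 by (auto simp: B_def)
  have nz: "f i0 \<noteq> 0" "f i1 \<noteq> 0" "c i0 \<noteq> 0" "c i1 \<noteq> 0"
    using f[of i0] f[of i1] i0 i1 X by (auto simp: X_def S_unit_def)
  have "(\<Sum>p\<in>S. p (\<Sum>B) - Min (p ` B)) \<le> int ((card B)\<^sup>2 * loss_total)"
    using hunit ind fin i1B by (intro unit_sum_inequality) (auto simp: B_def)
  also have "\<dots> \<le> int ((card I)\<^sup>2 * loss_total)"
  proof -
    have "card B \<le> card (X - {i0})" unfolding B_def using X by (intro card_image_le) auto
    also have "\<dots> \<le> card I" using X I by (intro card_mono) auto
    finally have "(card B)\<^sup>2 * loss_total \<le> (card I)\<^sup>2 * loss_total" by (intro mult_le_mono1 power_mono) auto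
    thus ?thesis by (simp only: of_nat_le_iff)
  qed
  finally have main: "(\<Sum>p\<in>S. p (\<Sum>B) - Min (p ` B)) \<le> int ((card I)\<^sup>2 * loss_total)" .
  have "height \<iota> (f i1 / f i0) = real_of_int (\<Sum>p\<in>S. max 0 (- p (f i1 / f i0)))"
  proof (rule height_eq_sum[OF S_places])
    fix p assume p: "p \<in> places \<iota> - S"
    have "p (f i1) = 0" "p (f i0) = 0" using S_unit_outside[OF _ p] f i0 i1 X by blast+
    thus "p (f i1 / f i0) = 0" using nz p by (simp add: place_divide)
  qed
  \<comment> \<open>Up to constants f i0 is the sum over B and f i1 an element of B. Hence each
    summand on the right is nonnegative and at least the order of f i0 minus that of f i1.\<close>
  also have "\<dots> \<le> real_of_int (\<Sum>p\<in>S. p (\<Sum>B) - Min (p ` B))"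
    unfolding of_int_le_iff
  proof (rule sum_mono)
    fix p assume "p \<in> S"
    hence p: "p \<in> places \<iota>" using S_places by auto
    have le: "Min (p ` B) \<le> p x" if "x \<in> B" for x using that fin by simp
    have pB: "p (\<Sum>B) = p (f i0)" unfolding sumB using nz p by (simp add: place_mult place_const)
    have "p (h i1) = p (f i1)" unfolding hi using nz p place_mult[OF p, of "\<iota> (- c i1)" "f i1"] place_const[OF p] by simp
    hence "Min (p ` B) \<le> p (f i1)" using le[OF i1B] by simp
    moreover have "vge p (Min (p ` B)) (\<Sum>B)" using le by (intro vge_sum p) (auto simp: vge_def)
    hence "Min (p ` B) \<le> p (\<Sum>B)" using nz by (auto simp: vge_def sumB)
    ultimately show "max 0 (- p (f i1 / f i0)) \<le> p (\<Sum>B) - Min (p ` B)"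
      using nz p pB by (simp add: place_divide)
  qed
  also have "\<dots> \<le> real_of_int (int ((card I)\<^sup>2 * loss_total))" using main by (simp only: of_int_le_iff)
  finally have "height \<iota> (f i1 / f i0) \<le> real ((card I)\<^sup>2 * loss_total)" by simp
  thus ?thesis using i0 i1 X by blast
qed

text \<open>At each place of \<open>S\<close> the family \<open>h\<close> has the valuations of all but \<open>\<kappa>\<close> of the units \<open>G \<mu>\<close>, each occurring \<open>l\<close> times.
  It is completed to a basis of the span of \<open>Gen\<close> by elements for which only the trivial bound \<open>low\<close> is known.\<close>

theorem gcd_core:
  fixes G :: "'m \<Rightarrow> 'K" and Bx :: "'m set"
  assumes Bx: "finite Bx" and G: "\<And>\<mu>. \<mu> \<in> Bx \<Longrightarrow> S_unit \<iota> S (G \<mu>)"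
    and Gen: "finite Gen" "Gen \<subseteq> E" and Hs: "finite Hs" "Gen \<subseteq> V.span Hs" "card Hs \<le> M"
    and e: "is_divisor \<iota> e" "\<And>p. e p \<ge> 0"
    and \<gamma>: "finite {p \<in> places \<iota> - S. \<gamma> p \<noteq> 0}"
    and sel: "\<And>p. p \<in> S \<Longrightarrow> \<exists>T h. T \<subseteq> Bx \<and> card (Bx - T) \<le> \<kappa> \<and> kindep (T \<times> {..<l}) h \<and>
        (\<forall>\<mu>\<in>T. \<forall>k<l. h (\<mu>, k) \<in> Gen \<and> vge p (p (G \<mu>) - e p) (h (\<mu>, k)))"
    and low: "\<And>p x. p \<in> S \<Longrightarrow> x \<in> Gen \<Longrightarrow> vge p (- s p - e p) x"
    and s: "\<And>p \<mu>. p \<in> S \<Longrightarrow> \<mu> \<in> Bx \<Longrightarrow> \<bar>p (G \<mu>)\<bar> \<le> s p" "\<And>p. p \<in> S \<Longrightarrow> 0 \<le> s p"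
    and out: "\<And>p x. p \<in> places \<iota> - S \<Longrightarrow> x \<in> Gen \<Longrightarrow> vge p (\<gamma> p - e p) x"
    and ne: "S \<noteq> {}"
  shows "\<exists>N::nat. int l * (int (card Bx) - int \<kappa>) \<le> int N \<and> N \<le> M \<and>
     int N * (\<Sum>p\<in>{p \<in> places \<iota> - S. \<gamma> p \<noteq> 0}. \<gamma> p)
       \<le> (int M - int l * int (card Bx) + 2 * int l * int \<kappa>) * (\<Sum>p\<in>S. s p) + int N * div_deg e + int (N\<^sup>2 * loss_total)"
proof -
  obtain B where B: "B \<subseteq> Gen" "V.independent B" "Gen \<subseteq> V.span B"
    using V.maximal_independent_subset[of Gen] by blast
  have finB: "finite B" using B Gen finite_subset by blast
  define N where "N = card B"
  have NM: "N \<le> M" using V.independent_span_bound[OF Hs(1) B(2)] subset_trans[OF B(1) Hs(2)] Hs(3) by (auto simp: N_def)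
  \<comment> \<open>Q bounds the number of times s p has to be paid. The completing elements are at
    most M - l (|Bx| - \<kappa>), and each of the at most \<kappa> units missing from T costs s p
    again in each of its l copies.\<close>
  define Q where "Q = int M - int l * int (card Bx) + 2 * int l * int \<kappa>"
  have inS: "\<exists>C c. finite C \<and> V.independent C \<and> C \<subseteq> V.span B \<and> card C = card B \<and>
          (\<forall>x\<in>C. vge p (c x) x) \<and> int l * (\<Sum>\<mu>\<in>Bx. p (G \<mu>)) - Q * s p - int N * e p \<le> (\<Sum>x\<in>C. c x)"
    and Nge: "int l * (int (card Bx) - int \<kappa>) \<le> int N" if p: "p \<in> S" for p
  proof -
    obtain T h where T: "T \<subseteq> Bx" "card (Bx - T) \<le> \<kappa>" and k: "kindep (T \<times> {..<l}) h"
      and h: "\<And>\<mu> k. \<mu> \<in> T \<Longrightarrow> k < l \<Longrightarrow> h (\<mu>, k) \<in> Gen \<and> vge p (p (G \<mu>) - e p) (h (\<mu>, k))" using sel[OF p] by blast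
    have finT: "finite T" using T Bx finite_subset by blast
    define J where "J = T \<times> {..<l}"
    have J: "finite J" using finT by (simp add: J_def)
    have inj: "inj_on h J" and ind: "V.independent (h ` J)" using k kindep_iff[OF J, of h] by (auto simp: J_def)
    have "h ` J \<subseteq> Gen" using h by (auto simp: J_def)
    then obtain C where C: "h ` J \<subseteq> C" "C \<subseteq> Gen" "V.independent C" "Gen \<subseteq> V.span C"
      using V.maximal_independent_subset_extend[OF _ ind] by blast
    have finC: "finite C" using C Gen finite_subset by blast
    have "card C \<le> card B" using V.independent_span_bound[OF finB C(3)] C B by blast
    moreover have "card B \<le> card C" using V.independent_span_bound[OF finC B(2)] C B by blast
    ultimately have CB: "card C = card B" by simp
    have cJ: "card (h ` J) = card T * l" using inj by (simp add: card_image J_def card_cartesian_product)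
    have cC: "card (C - h ` J) = N - card T * l" "card T * l \<le> N"
      using C(1) finC J cJ CB card_mono[OF finC C(1)] by (auto simp: card_Diff_subset N_def)
    have cT: "int (card Bx) - int \<kappa> \<le> int (card T)" using T Bx finT card_Diff_subset[OF finT T(1)] card_mono[OF Bx T(1)] by simp
    have "int l * (int (card Bx) - int \<kappa>) \<le> int l * int (card T)" by (intro mult_left_mono cT) auto
    also have "\<dots> \<le> int N" using cC(2) by (simp add: mult.commute flip: of_nat_mult)
    finally show "int l * (int (card Bx) - int \<kappa>) \<le> int N" .
    define c where "c x = (if x \<in> h ` J then p (G (fst (the_inv_into J h x))) - e p else - s p - e p)" for x
    have ch: "c (h j) = p (G (fst j)) - e p" if "j \<in> J" for j using that inj by (auto simp: c_def the_inv_into_f_f)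
    have vc: "vge p (c x) x" if x: "x \<in> C" for x
    proof (cases "x \<in> h ` J")
      case True
      then obtain j where "j \<in> J" "x = h j" by auto
      thus ?thesis using ch[of j] h[of "fst j" "snd j"] by (auto simp: J_def)
    next
      case False
      thus ?thesis using low[OF p] x C by (auto simp: c_def)
    qed
    have "(\<Sum>x\<in>C. c x) = (\<Sum>x\<in>C - h ` J. c x) + (\<Sum>x\<in>h ` J. c x)" by (rule sum.subset_diff[OF C(1) finC])
    also have "(\<Sum>x\<in>C - h ` J. c x) = (int N - int (card T) * int l) * (- s p - e p)"
      using cC by (simp add: c_def of_nat_diff)
    also have "(\<Sum>x\<in>h ` J. c x) = (\<Sum>j\<in>J. p (G (fst j)) - e p)"
      using sum.reindex[OF inj, of c] ch by simp
    also have "\<dots> = (\<Sum>\<mu>\<in>T. \<Sum>k<l. p (G \<mu>) - e p)" unfolding J_def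
      by (subst sum.cartesian_product) (simp add: case_prod_unfold)
    also have "\<dots> = int l * (\<Sum>\<mu>\<in>T. p (G \<mu>)) - int (card T) * int l * e p"
      by (simp add: sum_subtractf sum_distrib_left algebra_simps)
    finally have sumc: "(\<Sum>x\<in>C. c x) = int l * (\<Sum>\<mu>\<in>T. p (G \<mu>)) - (int N - int (card T) * int l) * s p - int N * e p"
      by (simp add: algebra_simps)
    have "(\<Sum>\<mu>\<in>Bx. p (G \<mu>)) = (\<Sum>\<mu>\<in>Bx - T. p (G \<mu>)) + (\<Sum>\<mu>\<in>T. p (G \<mu>))" by (rule sum.subset_diff[OF T(1) Bx])
    also have "(\<Sum>\<mu>\<in>Bx - T. p (G \<mu>)) \<le> (\<Sum>\<mu>\<in>Bx - T. s p)"
    proof (rule sum_mono)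
      fix \<mu> assume "\<mu> \<in> Bx - T" thus "p (G \<mu>) \<le> s p" using s(1)[OF p, of \<mu>] by auto
    qed
    also have "\<dots> \<le> int \<kappa> * s p" using T(2) s(2)[OF p] by (simp add: mult_right_mono)
    finally have "int l * (\<Sum>\<mu>\<in>Bx. p (G \<mu>)) \<le> int l * (int \<kappa> * s p + (\<Sum>\<mu>\<in>T. p (G \<mu>)))"
      by (intro mult_left_mono) auto
    moreover have "(int N - int (card T) * int l) * s p \<le> (int M - int l * int (card Bx) + int l * int \<kappa>) * s p"
    proof (rule mult_right_mono[OF _ s(2)[OF p]])
      have "int l * (int (card Bx) - int \<kappa>) \<le> int l * int (card T)" by (intro mult_left_mono cT) auto
      thus "int N - int (card T) * int l \<le> int M - int l * int (card Bx) + int l * int \<kappa>"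
        using NM by (simp add: algebra_simps)
    qed
    ultimately have "int l * (\<Sum>\<mu>\<in>Bx. p (G \<mu>)) - Q * s p - int N * e p \<le> (\<Sum>x\<in>C. c x)"
      unfolding sumc Q_def by (simp add: algebra_simps)
    thus "\<exists>C c. finite C \<and> V.independent C \<and> C \<subseteq> V.span B \<and> card C = card B \<and>
          (\<forall>x\<in>C. vge p (c x) x) \<and> int l * (\<Sum>\<mu>\<in>Bx. p (G \<mu>)) - Q * s p - int N * e p \<le> (\<Sum>x\<in>C. c x)"
      using finC C(3) CB vc subset_trans[OF C(2) B(3)] by - (rule exI[of _ C], rule exI[of _ c], simp)
  qed
  define Z where "Z = {p \<in> places \<iota> - S. \<gamma> p \<noteq> 0}"
  define \<Omega> where "\<Omega> = S \<union> Z \<union> {p. e p \<noteq> 0} \<union> {p \<in> places \<iota>. \<alpha> p \<noteq> 0}"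
  have \<Omega>: "finite \<Omega>" "\<Omega> \<subseteq> places \<iota>" "S \<subseteq> \<Omega>"
    using S_places \<alpha>_finite \<gamma> e(1) by (auto simp: \<Omega>_def Z_def is_divisor_def)
  define w where "w p = (if p \<in> S then int l * (\<Sum>\<mu>\<in>Bx. p (G \<mu>)) - Q * s p - int N * e p else int N * (\<gamma> p - e p))"
    for p :: "'K \<Rightarrow> int"
  have "(\<Sum>p\<in>\<Omega>. w p) \<le> int ((card B)\<^sup>2 * (\<Sum>p\<in>\<Omega>. \<alpha> p))"
  proof (rule wronskian_inequality[OF finB B(2) _ \<Omega>])
    show "B \<subseteq> E" using B Gen by blast
    fix p assume p: "p \<in> places \<iota> - \<Omega>"
    have "p \<in> places \<iota> - S" "\<gamma> p = 0" "e p = 0" "\<alpha> p = 0" using p by (auto simp: \<Omega>_def Z_def)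
    thus "\<alpha> p = 0 \<and> (\<forall>x\<in>B. vge p 0 x)" using out[of p] B by force
  next
    fix p assume p: "p \<in> \<Omega> - S"
    show "\<exists>m. (\<forall>x\<in>B. vge p m x) \<and> w p \<le> int (card B) * m"
      using p \<Omega> out[of p] B by (intro exI[of _ "\<gamma> p - e p"]) (auto simp: w_def N_def)
  next
    fix p assume p: "p \<in> S"
    thus "\<exists>C c. finite C \<and> V.independent C \<and> C \<subseteq> V.span B \<and> card C = card B \<and>
          (\<forall>x\<in>C. vge p (c x) x) \<and> w p \<le> (\<Sum>x\<in>C. c x)"
      using inS[OF p] by (simp add: w_def)
  qed
  also have "\<dots> \<le> int (N\<^sup>2 * loss_total)"
    using sum_loss[OF \<Omega>(1,2)] unfolding N_def by (simp only: of_nat_le_iff mult_le_mono2)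
  finally have main: "(\<Sum>p\<in>\<Omega>. w p) \<le> int (N\<^sup>2 * loss_total)" .
  have "(\<Sum>p\<in>\<Omega>. w p) = (\<Sum>p\<in>\<Omega> - S. w p) + (\<Sum>p\<in>S. w p)" by (rule sum.subset_diff[OF \<Omega>(3,1)])
  also have "(\<Sum>p\<in>\<Omega> - S. w p) = (\<Sum>p\<in>\<Omega> - S. int N * \<gamma> p - int N * e p)"
    by (intro sum.cong) (auto simp: w_def algebra_simps)
  also have "\<dots> = int N * (\<Sum>p\<in>\<Omega> - S. \<gamma> p) - int N * (\<Sum>p\<in>\<Omega> - S. e p)"
    by (simp add: sum_subtractf sum_distrib_left)
  also have "(\<Sum>p\<in>\<Omega> - S. \<gamma> p) = (\<Sum>p\<in>Z. \<gamma> p)"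
    using \<Omega> by (intro sum.mono_neutral_right) (auto simp: \<Omega>_def Z_def)
  also have "(\<Sum>p\<in>S. w p) = int l * (\<Sum>p\<in>S. \<Sum>\<mu>\<in>Bx. p (G \<mu>)) - Q * (\<Sum>p\<in>S. s p) - int N * (\<Sum>p\<in>S. e p)"
    by (simp add: w_def sum_subtractf sum_distrib_left)
  also have "(\<Sum>p\<in>S. \<Sum>\<mu>\<in>Bx. p (G \<mu>)) = (\<Sum>\<mu>\<in>Bx. \<Sum>p\<in>S. p (G \<mu>))" by (rule sum.swap)
  also have "\<dots> = 0" using product_formula_S_unit[OF S_places G] by simp
  finally have "(\<Sum>p\<in>\<Omega>. w p) = int N * (\<Sum>p\<in>Z. \<gamma> p) - int N * ((\<Sum>p\<in>\<Omega> - S. e p) + (\<Sum>p\<in>S. e p)) - Q * (\<Sum>p\<in>S. s p)"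
    by (simp add: algebra_simps)
  also have "(\<Sum>p\<in>\<Omega> - S. e p) + (\<Sum>p\<in>S. e p) = (\<Sum>p\<in>\<Omega>. e p)" by (rule sum.subset_diff[OF \<Omega>(3,1), symmetric])
  also have "(\<Sum>p\<in>\<Omega>. e p) = div_deg e" using \<Omega> by (intro div_deg_eq[symmetric]) (auto simp: \<Omega>_def)
  finally have "int N * (\<Sum>p\<in>Z. \<gamma> p) \<le> Q * (\<Sum>p\<in>S. s p) + int N * div_deg e + int (N\<^sup>2 * loss_total)"
    using main by linarith
  moreover obtain p where "p \<in> S" using ne by blast
  ultimately show ?thesis using Nge[of p] NM unfolding Q_def Z_def by blast
qed

end

section \<open>Monomials and elimination over the constant field\<close>

definition mono_eval :: "(nat \<Rightarrow> 'K::field) \<Rightarrow> (nat \<Rightarrow>\<^sub>0 nat) \<Rightarrow> 'K" where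
  "mono_eval g m = (\<Prod>i\<in>mkeys m. g i ^ mlookup m i)"

lemma mono_eval_superset: "finite A \<Longrightarrow> mkeys m \<subseteq> A \<Longrightarrow> mono_eval g m = (\<Prod>i\<in>A. g i ^ mlookup m i)"
  unfolding mono_eval_def by (intro prod.mono_neutral_left) (auto simp: in_keys_iff)

lemma mono_eval_add: "mono_eval g (m + l) = mono_eval g m * mono_eval g l"
proof -
  let ?A = "mkeys m \<union> mkeys l"
  have "mono_eval g (m + l) = (\<Prod>i\<in>?A. g i ^ mlookup (m + l) i)"
    by (rule mono_eval_superset) (auto simp: keys_add_nat)
  also have "\<dots> = mono_eval g m * mono_eval g l"
    using mono_eval_superset[of ?A m g] mono_eval_superset[of ?A l g]
    by (simp add: lookup_add power_add prod.distrib)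
  finally show ?thesis .
qed

lemma mpoly_eval_alt: "mpoly_eval F g = (\<Sum>m\<in>mkeys F. mlookup F m * mono_eval g m)"
  by (simp add: mpoly_eval_def mono_eval_def)

lemma mpoly_eval_superset: "finite A \<Longrightarrow> mkeys F \<subseteq> A \<Longrightarrow> mpoly_eval F g = (\<Sum>m\<in>A. mlookup F m * mono_eval g m)"
  unfolding mpoly_eval_alt by (intro sum.mono_neutral_left) (auto simp: in_keys_iff)

lemma mpoly_eval_add: "mpoly_eval (F + G) g = mpoly_eval F g + mpoly_eval G g"
proof -
  let ?A = "mkeys F \<union> mkeys G"
  have "mpoly_eval (F + G) g = (\<Sum>m\<in>?A. mlookup (F + G) m * mono_eval g m)"
    using keys_add[of F G] by (intro mpoly_eval_superset) auto
  also have "\<dots> = mpoly_eval F g + mpoly_eval G g"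
    using mpoly_eval_superset[of ?A F g] mpoly_eval_superset[of ?A G g]
    by (simp add: lookup_add distrib_right sum.distrib)
  finally show ?thesis .
qed

lemma mpoly_eval_mult: "mpoly_eval (F * G) g = mpoly_eval F g * mpoly_eval G g"
proof -
  let ?A = "(\<lambda>(m, l). m + l) ` (mkeys F \<times> mkeys G)"
  have "mpoly_eval (F * G) g = (\<Sum>k\<in>?A. mlookup (F * G) k * mono_eval g k)"
    using keys_mult[of F G] by (intro mpoly_eval_superset) force+
  also have "\<dots> = (\<Sum>k\<in>?A. \<Sum>m\<in>mkeys F. \<Sum>l\<in>mkeys G. if m + l = k then mlookup F m * mlookup G l * mono_eval g k else 0)"
    by (simp add: lookup_mult_keys sum_distrib_right if_distrib[of "\<lambda>x. x * _"] cong: if_cong)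
  also have "\<dots> = (\<Sum>m\<in>mkeys F. \<Sum>l\<in>mkeys G. \<Sum>k\<in>?A. if m + l = k then mlookup F m * mlookup G l * mono_eval g k else 0)"
    by (subst sum.swap) (intro sum.cong refl sum.swap)
  also have "\<dots> = (\<Sum>m\<in>mkeys F. \<Sum>l\<in>mkeys G. mlookup F m * mlookup G l * mono_eval g (m + l))"
    by (intro sum.cong refl) (auto simp: sum.delta)
  also have "\<dots> = mpoly_eval F g * mpoly_eval G g"
    by (simp add: mpoly_eval_alt sum_product mono_eval_add algebra_simps)
  finally show ?thesis .
qed

definition mbox :: "nat \<Rightarrow> nat \<Rightarrow> (nat \<Rightarrow>\<^sub>0 nat) set" where
  "mbox n d = {m. mkeys m \<subseteq> {..<n} \<and> (\<forall>i<n. mlookup m i \<le> d)}"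

lemma bij_betw_monomials_PiE:
  fixes C :: "nat \<Rightarrow> nat set"
  assumes "\<And>i. i < n \<Longrightarrow> finite (C i)"
  shows "bij_betw (\<lambda>m. restrict (mlookup m) {..<n}) {m. mkeys m \<subseteq> {..<n} \<and> (\<forall>i<n. mlookup m i \<in> C i)} (PiE {..<n} C)"
proof (rule bij_betw_imageI)
  show "inj_on (\<lambda>m. restrict (mlookup m) {..<n}) {m. mkeys m \<subseteq> {..<n} \<and> (\<forall>i<n. mlookup m i \<in> C i)}"
  proof (rule inj_onI, rule poly_mapping_eqI)
    fix a b :: "nat \<Rightarrow>\<^sub>0 nat" and i
    assume a: "a \<in> {m. mkeys m \<subseteq> {..<n} \<and> (\<forall>i<n. mlookup m i \<in> C i)}"
      and b: "b \<in> {m. mkeys m \<subseteq> {..<n} \<and> (\<forall>i<n. mlookup m i \<in> C i)}"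
      and eq: "restrict (mlookup a) {..<n} = restrict (mlookup b) {..<n}"
    show "mlookup a i = mlookup b i"
    proof (cases "i < n")
      case True
      thus ?thesis using fun_cong[OF eq, of i] by simp
    next
      case False
      hence "i \<notin> mkeys a" "i \<notin> mkeys b" using a b by auto
      thus ?thesis by (simp add: in_keys_iff)
    qed
  qed
  show "(\<lambda>m. restrict (mlookup m) {..<n}) ` {m. mkeys m \<subseteq> {..<n} \<and> (\<forall>i<n. mlookup m i \<in> C i)} = PiE {..<n} C"
  proof (intro equalityI subsetI)
    fix f assume f: "f \<in> PiE {..<n} C"
    define m where "m = (\<Sum>i<n. msingle i (f i))"
    have l: "mlookup m i = (if i < n then f i else 0)" for i
      by (simp add: m_def lookup_sum lookup_single when_def sum.delta)
    have "restrict (mlookup m) {..<n} = f" using f by (auto simp: l restrict_def PiE_def extensional_def)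
    moreover have "mkeys m \<subseteq> {..<n}" by (auto simp: in_keys_iff l split: if_splits)
    moreover have "\<forall>i<n. mlookup m i \<in> C i" using f by (auto simp: l PiE_def)
    ultimately show "f \<in> (\<lambda>m. restrict (mlookup m) {..<n}) ` {m. mkeys m \<subseteq> {..<n} \<and> (\<forall>i<n. mlookup m i \<in> C i)}"
      by (intro image_eqI[of _ _ m]) auto
  qed (auto simp: PiE_def extensional_def)
qed

lemma card_monomials_PiE:
  fixes C :: "nat \<Rightarrow> nat set"
  assumes "\<And>i. i < n \<Longrightarrow> finite (C i)"
  shows "finite {m. mkeys m \<subseteq> {..<n} \<and> (\<forall>i<n. mlookup m i \<in> C i)}"
    and "card {m. mkeys m \<subseteq> {..<n} \<and> (\<forall>i<n. mlookup m i \<in> C i)} = (\<Prod>i<n. card (C i))"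
proof -
  note bij = bij_betw_monomials_PiE[of n C, OF assms]
  show "finite {m. mkeys m \<subseteq> {..<n} \<and> (\<forall>i<n. mlookup m i \<in> C i)}"
    using bij_betw_finite[OF bij] assms finite_PiE[of "{..<n}" C] by auto
  show "card {m. mkeys m \<subseteq> {..<n} \<and> (\<forall>i<n. mlookup m i \<in> C i)} = (\<Prod>i<n. card (C i))"
    using bij_betw_same_card[OF bij] by (simp add: card_PiE)
qed

lemma finite_mbox: "finite (mbox n d)" and card_mbox: "card (mbox n d) = (d + 1) ^ n"
  using card_monomials_PiE[of n "\<lambda>_. {..d}"] by (auto simp: mbox_def)

text \<open>One exponent i is left free because the i-th eliminant does not contain that variable.
  The others keep distance b from both ends, where b will bound the exponents in the
  eliminants.\<close>

definition inner_box :: "nat \<Rightarrow> nat \<Rightarrow> nat \<Rightarrow> (nat \<Rightarrow>\<^sub>0 nat) set" where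
  "inner_box n d b = {m \<in> mbox n d. \<exists>i<n. \<forall>j<n. j \<noteq> i \<longrightarrow> b \<le> mlookup m j \<and> mlookup m j + b \<le> d}"

text \<open>A monomial outside the inner box has two exponents near the ends of \<open>{0..d}\<close>.\<close>

lemma card_outside_inner_box:
  assumes n: "n \<ge> 1"
  shows "(d + 1)\<^sup>2 * card (mbox n d - inner_box n d b) \<le> n\<^sup>2 * (2 * b)\<^sup>2 * (d + 1) ^ n"
proof -
  define Ed where "Ed = {x. x \<le> d \<and> (x < b \<or> d < x + b)}"
  have Ed: "finite Ed" "card Ed \<le> 2 * b"
  proof -
    have "Ed \<subseteq> {..<b} \<union> {d + 1 - b..<d + 1}" by (auto simp: Ed_def)
    moreover have "card ({..<b} \<union> {d + 1 - b..<d + 1}) \<le> 2 * b" by (rule order_trans[OF card_Un_le]) auto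
    ultimately show "finite Ed" "card Ed \<le> 2 * b"
      by (auto intro: finite_subset order_trans[OF card_mono])
  qed
  define Q where "Q j l = {m. mkeys m \<subseteq> {..<n} \<and> (\<forall>i<n. mlookup m i \<in> (if i = j \<or> i = l then Ed else {..d}))}" for j l
  have Qfin: "finite (Q j l)" for j l
    unfolding Q_def by (rule card_monomials_PiE(1)) (use Ed in auto)
  have Qcard: "(d + 1)\<^sup>2 * card (Q j l) \<le> (2 * b)\<^sup>2 * (d + 1) ^ n" if jl: "j < n" "l < n" "j \<noteq> l" for j l
  proof -
    have "card (Q j l) = (\<Prod>i<n. card (if i = j \<or> i = l then Ed else {..d}))"
      unfolding Q_def by (rule card_monomials_PiE(2)) (use Ed in auto)
    also have "\<dots> = card Ed * (\<Prod>i\<in>{..<n} - {j}. card (if i = j \<or> i = l then Ed else {..d}))"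
      using jl by (subst prod.remove[of _ j]) auto
    also have "(\<Prod>i\<in>{..<n} - {j}. card (if i = j \<or> i = l then Ed else {..d})) =
        card Ed * (\<Prod>i\<in>{..<n} - {j} - {l}. card (if i = j \<or> i = l then Ed else {..d}))"
      using jl by (subst prod.remove[of _ l]) auto
    also have "(\<Prod>i\<in>{..<n} - {j} - {l}. card (if i = j \<or> i = l then Ed else {..d})) = (\<Prod>i\<in>{..<n} - {j} - {l}. d + 1)"
      by (intro prod.cong) auto
    also have "\<dots> = (d + 1) ^ (n - 2)" using jl by (simp add: card_Diff_subset numeral_2_eq_2)
    finally have "(d + 1)\<^sup>2 * card (Q j l) = (card Ed)\<^sup>2 * ((d + 1)\<^sup>2 * (d + 1) ^ (n - 2))"
      by (simp add: power2_eq_square mult_ac)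
    also have "(d + 1)\<^sup>2 * (d + 1) ^ (n - 2) = (d + 1) ^ n" 
    proof -
      have "(d + 1)\<^sup>2 * (d + 1) ^ (n - 2) = (d + 1) ^ (2 + (n - 2))" by (rule power_add[symmetric])
      also have "2 + (n - 2) = n" using jl by simp
      finally show ?thesis .
    qed
    also have "(card Ed)\<^sup>2 * (d + 1) ^ n \<le> (2 * b)\<^sup>2 * (d + 1) ^ n" using Ed by (intro mult_right_mono power_mono) auto
    finally show ?thesis .
  qed
  define P where "P = {(j, l). j < n \<and> l < n \<and> j \<noteq> l}"
  have P: "finite P" "card P \<le> n\<^sup>2"
  proof -
    have "P \<subseteq> {..<n} \<times> {..<n}" by (auto simp: P_def)
    moreover have "card ({..<n} \<times> {..<n}) = n\<^sup>2" by (simp add: power2_eq_square)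
    ultimately show "finite P" "card P \<le> n\<^sup>2" using card_mono[of "{..<n} \<times> {..<n}" P] finite_subset by auto
  qed
  have "mbox n d - inner_box n d b \<subseteq> (\<Union>x\<in>P. Q (fst x) (snd x))"
  proof
    fix m assume m: "m \<in> mbox n d - inner_box n d b"
    have edge: "\<exists>j<n. j \<noteq> i \<and> mlookup m j \<in> Ed" if "i < n" for i
      using m that by (fastforce simp: inner_box_def mbox_def Ed_def)
    obtain j where j: "j < n" "mlookup m j \<in> Ed" using edge[of 0] n by auto
    obtain l where l: "l < n" "l \<noteq> j" "mlookup m l \<in> Ed" using edge[OF j(1)] by auto
    have "m \<in> Q j l" using m j l by (auto simp: Q_def mbox_def)
    thus "m \<in> (\<Union>x\<in>P. Q (fst x) (snd x))" using j l by (auto simp: P_def intro!: bexI[of _ "(j, l)"])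
  qed
  hence "card (mbox n d - inner_box n d b) \<le> card (\<Union>x\<in>P. Q (fst x) (snd x))"
    using P Qfin by (intro card_mono) auto
  also have "\<dots> \<le> (\<Sum>x\<in>P. card (Q (fst x) (snd x)))" by (rule card_UN_le[OF P(1)])
  finally have "(d + 1)\<^sup>2 * card (mbox n d - inner_box n d b) \<le> (d + 1)\<^sup>2 * (\<Sum>x\<in>P. card (Q (fst x) (snd x)))"
    by (rule mult_le_mono2)
  also have "\<dots> = (\<Sum>x\<in>P. (d + 1)\<^sup>2 * card (Q (fst x) (snd x)))" by (rule sum_distrib_left)
  also have "\<dots> \<le> (\<Sum>x\<in>P. (2 * b)\<^sup>2 * (d + 1) ^ n)" by (intro sum_mono Qcard) (auto simp: P_def)
  also have "\<dots> = card P * ((2 * b)\<^sup>2 * (d + 1) ^ n)" by simp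
  also have "\<dots> \<le> n\<^sup>2 * ((2 * b)\<^sup>2 * (d + 1) ^ n)" by (rule mult_le_mono1[OF P(2)])
  finally show ?thesis by (simp add: mult.assoc)
qed

lemma lookup_mult_superset:
  fixes P Q :: "('a::monoid_add) \<Rightarrow>\<^sub>0 'b::semiring_0"
  assumes "finite A" "mkeys P \<subseteq> A" "finite B" "mkeys Q \<subseteq> B"
  shows "mlookup (P * Q) k = (\<Sum>m\<in>A. \<Sum>l\<in>B. if m + l = k then mlookup P m * mlookup Q l else 0)"
proof -
  have "(\<Sum>m\<in>A. \<Sum>l\<in>B. if m + l = k then mlookup P m * mlookup Q l else 0)
      = (\<Sum>m\<in>mkeys P. \<Sum>l\<in>B. if m + l = k then mlookup P m * mlookup Q l else 0)"
    using assms by (intro sum.mono_neutral_right) (auto simp: in_keys_iff intro!: sum.neutral)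
  also have "\<dots> = (\<Sum>m\<in>mkeys P. \<Sum>l\<in>mkeys Q. if m + l = k then mlookup P m * mlookup Q l else 0)"
    using assms by (intro sum.cong refl sum.mono_neutral_right) (auto simp: in_keys_iff)
  finally show ?thesis by (simp add: lookup_mult_keys)
qed

context curve
begin

definition const_coeffs :: "'K mpoly_pm \<Rightarrow> bool" where
  "const_coeffs P \<longleftrightarrow> (\<forall>m. mlookup P m \<in> range \<iota>)"

lemma ex_linear_functional:
  assumes "z \<noteq> 0"
  shows "\<exists>\<psi>. (\<forall>x y. \<psi> (x + y) = \<psi> x + \<psi> y) \<and> (\<forall>c x. \<psi> (\<iota> c * x) = \<iota> c * \<psi> x) \<and>
    (\<forall>x. \<psi> x \<in> range \<iota>) \<and> \<psi> z \<noteq> 0"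
proof -
  have ind: "V.independent {z}" using assms by simp
  define B where "B = V.extend_basis {z}"
  have B: "V.independent B" "z \<in> B" "\<And>x. x \<in> V.span B"
    using V.independent_extend_basis[OF ind] V.extend_basis_superset[OF ind] V.span_extend_basis[OF ind] by (auto simp: B_def)
  show ?thesis
  proof (intro exI[of _ "\<lambda>x. \<iota> (V.representation B x z)"] conjI allI)
    fix x y c
    show "\<iota> (V.representation B (x + y) z) = \<iota> (V.representation B x z) + \<iota> (V.representation B y z)"
      using V.representation_add[OF B(1) B(3) B(3), of x y] by (simp add: \<iota>_add)
    show "\<iota> (V.representation B (\<iota> c * x) z) = \<iota> c * \<iota> (V.representation B x z)"
      using V.representation_scale[OF B(1) B(3), of c x] by (simp add: \<iota>_mult)
    show "\<iota> (V.representation B z z) \<noteq> 0" using V.representation_basis[OF B(1,2)] by simp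
  qed auto
qed

text \<open>A k-linear functional K \<rightarrow> k applied to all coefficients commutes with
  multiplication by F and G, whose coefficients are constants. It is chosen nonzero at one
  coefficient of R, so the eliminant survives.\<close>

lemma descend_combination:
  assumes FG: "const_coeffs F" "const_coeffs G" and eq: "A * F + B * G = R" and nz: "R \<noteq> 0"
  shows "\<exists>A' B' R'. const_coeffs A' \<and> const_coeffs B' \<and> const_coeffs R' \<and> A' * F + B' * G = R' \<and> R' \<noteq> 0 \<and>
    mkeys A' \<subseteq> mkeys A \<and> mkeys B' \<subseteq> mkeys B \<and> mkeys R' \<subseteq> mkeys R"
proof -
  obtain m0 where m0: "mlookup R m0 \<noteq> 0" using nz by (metis lookup_zero poly_mapping_eqI)
  obtain \<psi> where \<psi>: "\<And>x y. \<psi> (x + y) = \<psi> x + \<psi> y" "\<And>c x. \<psi> (\<iota> c * x) = \<iota> c * \<psi> x"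
    "\<And>x. \<psi> x \<in> range \<iota>" "\<psi> (mlookup R m0) \<noteq> 0" using ex_linear_functional[OF m0] by blast
  have \<psi>0: "\<psi> 0 = 0" using \<psi>(2)[of 0 0] by simp
  have \<psi>_sum: "\<psi> (sum f I) = (\<Sum>i\<in>I. \<psi> (f i))" for f and I :: "(nat \<Rightarrow>\<^sub>0 nat) set"
    by (induction I rule: infinite_finite_induct) (auto simp: \<psi>0 \<psi>(1))
  define T where "T P = Poly_Mapping.map \<psi> P" for P :: "'K mpoly_pm"
  have lT: "mlookup (T P) m = \<psi> (mlookup P m)" for P m
    by (auto simp: T_def Poly_Mapping.map.rep_eq when_def \<psi>0)
  have kT: "mkeys (T P) \<subseteq> mkeys P" for P using \<psi>0 by (auto simp: in_keys_iff lT)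
  have T_mult: "T (P * Q) = T P * Q" if Q: "const_coeffs Q" for P Q
  proof (rule poly_mapping_eqI)
    fix k
    have *: "\<psi> (x * mlookup Q l) = \<psi> x * mlookup Q l" for x l
    proof -
      obtain c where "mlookup Q l = \<iota> c" using Q by (auto simp: const_coeffs_def)
      thus ?thesis using \<psi>(2)[of c x] by (simp add: mult.commute)
    qed
    have "mlookup (T (P * Q)) k = (\<Sum>m\<in>mkeys P. \<Sum>l\<in>mkeys Q. \<psi> (if m + l = k then mlookup P m * mlookup Q l else 0))"
      by (simp add: lT lookup_mult_keys \<psi>_sum)
    also have "\<dots> = (\<Sum>m\<in>mkeys P. \<Sum>l\<in>mkeys Q. if m + l = k then mlookup (T P) m * mlookup Q l else 0)"
      by (intro sum.cong refl) (auto simp: * lT \<psi>0)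
    also have "\<dots> = mlookup (T P * Q) k" by (rule lookup_mult_superset[symmetric]) (auto simp: kT)
    finally show "mlookup (T (P * Q)) k = mlookup (T P * Q) k" .
  qed
  have T_add: "T (P + Q) = T P + T Q" for P Q by (rule poly_mapping_eqI) (simp add: lT lookup_add \<psi>(1))
  have "T A * F + T B * G = T R" using eq T_add T_mult FG by metis
  moreover have "mlookup (T R) m0 \<noteq> 0" using \<psi>(4) by (simp add: lT)
  hence "T R \<noteq> 0" by auto
  moreover have "const_coeffs (T P)" for P using \<psi>(3) by (simp add: const_coeffs_def lT)
  ultimately show ?thesis using kT by blast
qed

text \<open>The clause on constant coefficients is needed for the exact two-point case: there the
  divisor dominating all coefficients must be zero.\<close>

lemma elimination_family:
  assumes FG: "F \<in> vars_in {..<n}" "G \<in> vars_in {..<n}" "F \<noteq> 0" and cop: "mpoly_coprime F G"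
  shows "\<exists>A B R. \<forall>i<n. A i \<in> vars_in {..<n} \<and> B i \<in> vars_in {..<n} \<and> R i \<in> vars_in ({..<n} - {i}) \<and> R i \<noteq> 0 \<and>
    A i * F + B i * G = R i \<and> (const_coeffs F \<and> const_coeffs G \<longrightarrow> const_coeffs (A i) \<and> const_coeffs (B i) \<and> const_coeffs (R i))"
proof -
  define Pr where "Pr i A B R \<longleftrightarrow> A \<in> vars_in {..<n} \<and> B \<in> vars_in {..<n} \<and> R \<in> vars_in ({..<n} - {i}) \<and> R \<noteq> 0 \<and>
    A * F + B * G = R \<and> (const_coeffs F \<and> const_coeffs G \<longrightarrow> const_coeffs A \<and> const_coeffs B \<and> const_coeffs R)"
    for i and A B R :: "'K mpoly_pm"
  have "\<exists>A B R. Pr i A B R" if i: "i < n" for i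
  proof -
    obtain A B R where 1: "A \<in> vars_in {..<n}" "B \<in> vars_in {..<n}" "R \<in> vars_in ({..<n} - {i})" "R \<noteq> 0" "A * F + B * G = R"
      using coprime_eliminate[OF _ _ FG cop, of i] i by auto
    show ?thesis
    proof (cases "const_coeffs F \<and> const_coeffs G")
      case True
      then obtain A' B' R' where "const_coeffs A'" "const_coeffs B'" "const_coeffs R'" "A' * F + B' * G = R'" "R' \<noteq> 0"
        "mkeys A' \<subseteq> mkeys A" "mkeys B' \<subseteq> mkeys B" "mkeys R' \<subseteq> mkeys R"
        using descend_combination[OF _ _ 1(5,4)] by blast
      moreover from this have "A' \<in> vars_in {..<n}" "B' \<in> vars_in {..<n}" "R' \<in> vars_in ({..<n} - {i})"
        using 1(1-3) unfolding vars_in_def by blast+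
      ultimately show ?thesis unfolding Pr_def by blast
    qed (use 1 in \<open>unfold Pr_def, blast\<close>)
  qed
  then obtain A B R where "\<And>i. i < n \<Longrightarrow> Pr i (A i) (B i) (R i)" by metis
  thus ?thesis unfolding Pr_def by blast
qed

end

section \<open>The auxiliary space of functions\<close>

text \<open>Leading monomials at a place are taken with respect to the order at that place, ties
  being broken by the monomial order. Both parts are compatible with multiplication by
  monomials.\<close>

lemma ex_lexmin:
  fixes val :: "'a::linorder \<Rightarrow> int"
  assumes "finite A" "A \<noteq> {}"
  shows "\<exists>a\<in>A. \<forall>m\<in>A. val a < val m \<or> (val a = val m \<and> a \<le> m)"
proof -
  define v where "v = Min (val ` A)"
  have "v \<in> val ` A" unfolding v_def using assms by (intro Min_in) auto
  hence ne: "{m \<in> A. val m = v} \<noteq> {}" "finite {m \<in> A. val m = v}" using assms by auto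
  define a where "a = Min {m \<in> A. val m = v}"
  have a: "a \<in> {m \<in> A. val m = v}" unfolding a_def using ne by (intro Min_in) auto
  have "val a < val m \<or> (val a = val m \<and> a \<le> m)" if m: "m \<in> A" for m
  proof -
    have "v \<le> val m" unfolding v_def using assms m by simp
    moreover have "a \<le> m" if "val m = v" unfolding a_def using that m ne by (intro Min_le) auto
    ultimately show ?thesis using a by force
  qed
  thus ?thesis using a by blast
qed

text \<open>A single divisor e dominates the poles of all coefficients, so that multiplying by one
  of them is controlled by adding e once.\<close>

locale gcd_data = curve \<iota> for \<iota> :: "'k::field_char_0 \<Rightarrow> 'K::field" +
  fixes n b :: nat and F G :: "'K mpoly_pm" and A B R :: "nat \<Rightarrow> 'K mpoly_pm" and e :: "('K \<Rightarrow> int) \<Rightarrow> int"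
  assumes n: "n \<ge> 1"
    and F_vars: "F \<in> vars_in {..<n}" and G_vars: "G \<in> vars_in {..<n}" and F_nz: "F \<noteq> 0" and G_nz: "G \<noteq> 0"
    and R_vars: "\<And>i. i < n \<Longrightarrow> R i \<in> vars_in ({..<n} - {i})" and R_nz: "\<And>i. i < n \<Longrightarrow> R i \<noteq> 0"
    and A_vars: "\<And>i. i < n \<Longrightarrow> A i \<in> vars_in {..<n}" and B_vars: "\<And>i. i < n \<Longrightarrow> B i \<in> vars_in {..<n}"
    and comb: "\<And>i. i < n \<Longrightarrow> A i * F + B i * G = R i"
    and R_deg: "\<And>i m j. i < n \<Longrightarrow> m \<in> mkeys (R i) \<Longrightarrow> mlookup m j \<le> b"
    and e_div: "is_divisor \<iota> e" and e_nonneg: "\<And>p. e p \<ge> 0"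
    and F_coeff: "\<And>m. mlookup F m \<in> LL e" and G_coeff: "\<And>m. mlookup G m \<in> LL e"
    and A_coeff: "\<And>i m. i < n \<Longrightarrow> mlookup (A i) m \<in> LL e" and B_coeff: "\<And>i m. i < n \<Longrightarrow> mlookup (B i) m \<in> LL e"
    and R_coeff: "\<And>i m. i < n \<Longrightarrow> mlookup (R i) m \<in> LL e"

context curve
begin

text \<open>Auxiliary coefficients are taken from L(r e); multiplying by a coefficient of an
  eliminant leads to L((r + 1) e). This explains the pair of r and \<open>Suc r\<close>
  throughout.\<close>

definition mult_div :: "nat \<Rightarrow> (('K \<Rightarrow> int) \<Rightarrow> int) \<Rightarrow> ('K \<Rightarrow> int) \<Rightarrow> int" where
  "mult_div r e p = int r * e p"

lemma is_divisor_mult_div: "is_divisor \<iota> e \<Longrightarrow> is_divisor \<iota> (mult_div r e)"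
  using is_divisor_mult[of e "int r"] by (simp add: mult_div_def[abs_def])

lemma div_deg_mult_div: "div_deg (mult_div r e) = int r * div_deg e"
  using div_deg_mult[of "int r" e] by (simp add: mult_div_def[abs_def])

lemma LL_mult_div: "x \<in> LL (mult_div r e) \<Longrightarrow> y \<in> LL e \<Longrightarrow> x * y \<in> LL (mult_div (Suc r) e)"
  unfolding LL_iff
proof
  fix p assume xy: "\<forall>p\<in>places \<iota>. vge p (- mult_div r e p) x" "\<forall>p\<in>places \<iota>. vge p (- e p) y" and p: "p \<in> places \<iota>"
  have "vge p (- mult_div r e p + (- e p)) (x * y)" using xy p by (intro vge_mult) auto
  thus "vge p (- mult_div (Suc r) e p) (x * y)" by (simp add: mult_div_def algebra_simps)
qed

lemma LL_mult_div_mono: "(\<And>p. e p \<ge> 0) \<Longrightarrow> r \<le> s \<Longrightarrow> LL (mult_div r e) \<subseteq> LL (mult_div s e)"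
  by (intro LL_mono) (simp add: mult_div_def mult_right_mono)

lemma LL_mult_div_1: "mult_div (Suc 0) e = e" by (simp add: mult_div_def[abs_def])

lemma LL_sum: "(\<And>i. i \<in> I \<Longrightarrow> f i \<in> LL D) \<Longrightarrow> sum f I \<in> LL D"
  using V.subspace_sum[OF LL_subspace] by blast

lemma LL_scale: "f \<in> LL D \<Longrightarrow> \<iota> c * f \<in> LL D" using V.subspace_scale[OF LL_subspace] .

lemma LL_zero: "0 \<in> LL D" using V.subspace_0[OF LL_subspace] .

definition total_val :: "nat \<Rightarrow> (nat \<Rightarrow> 'K) \<Rightarrow> ('K \<Rightarrow> int) \<Rightarrow> int" where
  "total_val n g p = (\<Sum>i<n. \<bar>p (g i)\<bar>)"

lemma place_mono_eval:
  assumes "p \<in> places \<iota>" "mkeys m \<subseteq> {..<n}" "\<And>i. i < n \<Longrightarrow> g i \<noteq> 0"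
  shows "p (mono_eval g m) = (\<Sum>i<n. int (mlookup m i) * p (g i))"
proof -
  have "p (\<Prod>i<n. g i ^ mlookup m i) = (\<Sum>i<n. p (g i ^ mlookup m i))"
    using assms(3) by (intro place_prod assms(1)) auto
  thus ?thesis using assms by (simp add: mono_eval_superset[of "{..<n}"] place_power)
qed

lemma place_mono_eval_bound:
  assumes p: "p \<in> places \<iota>" and m: "m \<in> mbox n d" and g: "\<And>i. i < n \<Longrightarrow> g i \<noteq> 0"
  shows "\<bar>p (mono_eval g m)\<bar> \<le> int d * total_val n g p"
proof -
  have "\<bar>p (mono_eval g m)\<bar> \<le> (\<Sum>i<n. \<bar>int (mlookup m i) * p (g i)\<bar>)"
    using m by (subst place_mono_eval[OF p _ g]) (auto simp: mbox_def)
  also have "\<dots> \<le> (\<Sum>i<n. int d * \<bar>p (g i)\<bar>)"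
    using m by (intro sum_mono) (auto simp: mbox_def abs_mult intro!: mult_right_mono)
  finally show ?thesis by (simp add: total_val_def sum_distrib_left)
qed

lemma total_val_nonneg: "total_val n g p \<ge> 0" by (simp add: total_val_def sum_nonneg)

lemma mono_eval_S_unit:
  assumes "mkeys m \<subseteq> {..<n}" "\<And>i. i < n \<Longrightarrow> S_unit \<iota> S (g i)" shows "S_unit \<iota> S (mono_eval g m)"
  unfolding mono_eval_def using assms by (intro S_unit_prod S_unit_power) auto

lemma ksubring_prod: "ksubring E \<Longrightarrow> (\<And>i. i \<in> I \<Longrightarrow> f i \<in> E) \<Longrightarrow> prod f I \<in> E"
  using ksubringD(1)[of E 1] by (induction I rule: infinite_finite_induct) (auto intro: ksubringD)

lemma ksubring_power: "ksubring E \<Longrightarrow> x \<in> E \<Longrightarrow> x ^ k \<in> E"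
  using ksubringD(1)[of E 1] by (induction k) (auto intro: ksubringD)

lemma mono_eval_ksubring:
  assumes "ksubring E" "mkeys m \<subseteq> {..<n}" "\<And>i. i < n \<Longrightarrow> g i \<in> E" shows "mono_eval g m \<in> E"
  unfolding mono_eval_def using assms by (intro ksubring_prod ksubring_power) auto

end

lemma mono_eval_mult_mpoly_eval:
  "mono_eval g \<nu> * mpoly_eval P g = (\<Sum>m\<in>mkeys P. mlookup P m * mono_eval g (\<nu> + m))"
  by (simp add: mpoly_eval_alt sum_distrib_left mono_eval_add algebra_simps)

text \<open>The assumption \<open>indep\<close> is the favourable case of the dichotomy: the
  monomials of the box evaluated at g are independent over the space of coefficients. Polynomials
  supported in the box with coefficients in this space can then be recovered from their
  values.\<close>

locale gcd_setup = wronskian_setting \<iota> D EE S \<alpha> + gcd_data \<iota> n b F G A B R e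
  for \<iota> :: "'k::field_char_0 \<Rightarrow> 'K::field" and D EE S \<alpha> and n b :: nat
  and F G :: "'K mpoly_pm" and A B R :: "nat \<Rightarrow> 'K mpoly_pm" and e :: "('K \<Rightarrow> int) \<Rightarrow> int" +
  fixes g :: "nat \<Rightarrow> 'K" and d r :: nat
  assumes g: "\<And>i. i < n \<Longrightarrow> S_unit \<iota> S (g i)" and gE: "\<And>i. i < n \<Longrightarrow> g i \<in> EE"
    and LE: "LL (mult_div (Suc r) e) \<subseteq> EE"
    and indep: "\<And>c. (\<And>\<mu>. \<mu> \<in> mbox n d \<Longrightarrow> c \<mu> \<in> LL (mult_div (Suc r) e)) \<Longrightarrow>
        (\<Sum>\<mu>\<in>mbox n d. c \<mu> * mono_eval g \<mu>) = 0 \<Longrightarrow> (\<forall>\<mu>\<in>mbox n d. c \<mu> = 0)"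
    and S_ne: "S \<noteq> {}"
    and FG_box: "mkeys F \<subseteq> mbox n d" "mkeys G \<subseteq> mbox n d"
begin

lemma g_nz: "i < n \<Longrightarrow> g i \<noteq> 0" using g by (auto simp: S_unit_def)

lemma mbox_keys: "m \<in> mbox n d \<Longrightarrow> mkeys m \<subseteq> {..<n}" by (simp add: mbox_def)

lemma e_le: "LL e \<subseteq> LL (mult_div (Suc r) e)"
  using LL_mult_div_mono[of e "Suc 0" "Suc r"] e_nonneg by (simp add: LL_mult_div_1)

lemma eval_nz: assumes P: "P \<noteq> 0" "mkeys P \<subseteq> mbox n d" "\<And>m. mlookup P m \<in> LL e" shows "mpoly_eval P g \<noteq> 0"
proof
  assume 0: "mpoly_eval P g = 0"
  have "\<forall>\<mu>\<in>mbox n d. mlookup P \<mu> = 0"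
    using 0 P e_le mpoly_eval_superset[OF finite_mbox P(2), of g] by (intro indep) auto
  have "mlookup P m = 0" for m
  proof (cases "m \<in> mbox n d")
    case False
    hence "m \<notin> mkeys P" using P(2) by blast
    thus ?thesis by (simp add: in_keys_iff)
  qed (use \<open>\<forall>\<mu>\<in>mbox n d. mlookup P \<mu> = 0\<close> in blast)
  thus False using P(1) by (metis lookup_zero poly_mapping_eqI)
qed

lemma Fg_nz: "mpoly_eval F g \<noteq> 0" and Gg_nz: "mpoly_eval G g \<noteq> 0"
  using eval_nz F_nz G_nz FG_box F_coeff G_coeff by auto

definition gam :: "('K \<Rightarrow> int) \<Rightarrow> int" where
  "gam p = min (max 0 (p (mpoly_eval F g))) (max 0 (p (mpoly_eval G g)))"

text \<open>The variable whose eliminant is used to produce a function with leading monomial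
  \<mu>.\<close>

definition base_poly :: "(nat \<Rightarrow>\<^sub>0 nat) \<Rightarrow> nat" where
  "base_poly \<mu> = (SOME i. i < n \<and> (\<forall>j<n. j \<noteq> i \<longrightarrow> b \<le> mlookup \<mu> j \<and> mlookup \<mu> j + b \<le> d))"

lemma base_poly: "\<mu> \<in> inner_box n d b \<Longrightarrow> base_poly \<mu> < n \<and>
    (\<forall>j<n. j \<noteq> base_poly \<mu> \<longrightarrow> b \<le> mlookup \<mu> j \<and> mlookup \<mu> j + b \<le> d)"
  unfolding base_poly_def by (rule someI_ex) (auto simp: inner_box_def)

text \<open>Replacing the monomial a of the eliminant by another one changes every exponent by at
  most b and leaves the exponent of the eliminated variable unchanged, so the shifted eliminant
  stays in the box.\<close>

lemma inner_box_shift: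
  assumes \<mu>: "\<mu> \<in> inner_box n d b" and a: "a \<in> mkeys (R (base_poly \<mu>))"
  shows "\<mu> - a + a = \<mu>" and "mkeys (\<mu> - a) \<subseteq> {..<n}"
    and "m \<in> mkeys (R (base_poly \<mu>)) \<Longrightarrow> \<mu> - a + m \<in> mbox n d"
proof -
  let ?i = "base_poly \<mu>"
  note bp = base_poly[OF \<mu>]
  have \<mu>b: "mkeys \<mu> \<subseteq> {..<n}" "\<And>j. j < n \<Longrightarrow> mlookup \<mu> j \<le> d" using \<mu> by (auto simp: inner_box_def mbox_def)
  have z: "mlookup m j = 0" if "m \<in> mkeys (R ?i)" "j = ?i \<or> \<not> j < n" for m j
  proof -
    have "mkeys m \<subseteq> {..<n} - {?i}" using R_vars[of ?i] bp that(1) by (auto simp: vars_in_def)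
    hence "j \<notin> mkeys m" using that(2) by auto
    thus ?thesis by (simp add: in_keys_iff)
  qed
  have le: "mlookup a j \<le> mlookup \<mu> j" for j
  proof (cases "j = ?i \<or> \<not> j < n")
    case False
    thus ?thesis using bp R_deg[of ?i a j] a by force
  qed (use z[OF a] in simp)
  show "\<mu> - a + a = \<mu>" by (rule poly_mapping_eqI) (use le in \<open>simp add: lookup_add lookup_minus\<close>)
  show k: "mkeys (\<mu> - a) \<subseteq> {..<n}"
  proof
    fix j assume "j \<in> mkeys (\<mu> - a)"
    hence "j \<in> mkeys \<mu>" by (simp add: in_keys_iff lookup_minus)
    thus "j \<in> {..<n}" using \<mu>b(1) by blast
  qed
  show "\<mu> - a + m \<in> mbox n d" if m: "m \<in> mkeys (R ?i)"
  proof -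
    have "mlookup (\<mu> - a + m) j \<le> d" if j: "j < n" for j
    proof (cases "j = ?i")
      case True
      thus ?thesis using z[OF m, of j] \<mu>b(2)[OF j] by (simp add: lookup_add lookup_minus)
    next
      case False
      thus ?thesis using bp R_deg[of ?i m j] m j by (force simp: lookup_add lookup_minus)
    qed
    moreover have "mkeys m \<subseteq> {..<n}" using R_vars[of ?i] bp m by (auto simp: vars_in_def)
    ultimately show ?thesis using k by (auto simp: mbox_def keys_add_nat)
  qed
qed

text \<open>Values of those monomial multiples of the eliminants that fit into the box, with
  coefficients from a basis of L(r e); these functions span the space to which the Wronskian is
  applied.\<close>

definition Gen :: "'K set \<Rightarrow> 'K set" where
  "Gen Br = (\<lambda>(\<beta>, i, \<nu>). \<beta> * (mono_eval g \<nu> * mpoly_eval (R i) g)) `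
     (Br \<times> (SIGMA i:{..<n}. {\<nu> \<in> mbox n d. \<forall>m\<in>mkeys (R i). \<nu> + m \<in> mbox n d}))"

lemma GenE:
  assumes "x \<in> Gen Br"
  obtains \<beta> i \<nu> where "\<beta> \<in> Br" "i < n" "\<nu> \<in> mbox n d" "\<And>m. m \<in> mkeys (R i) \<Longrightarrow> \<nu> + m \<in> mbox n d"
    "x = \<beta> * (mono_eval g \<nu> * mpoly_eval (R i) g)"
  using assms unfolding Gen_def by auto

text \<open>The members have pairwise distinct leading monomials \<mu>. In a relation take the
  smallest \<mu> that occurs: its monomial receives a contribution from this member alone, and
  independence of the box makes that contribution vanish.\<close>

lemma leading_family_indep:
  fixes a :: "nat \<Rightarrow> (nat \<Rightarrow>\<^sub>0 nat)" and bk :: "nat \<Rightarrow> 'K"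
  assumes p: "p \<in> places \<iota>"
    and a: "\<And>i. i < n \<Longrightarrow> a i \<in> mkeys (R i)"
    and amin: "\<And>i m. i < n \<Longrightarrow> m \<in> mkeys (R i) \<Longrightarrow> p (mono_eval g (a i)) < p (mono_eval g m) \<or>
        (p (mono_eval g (a i)) = p (mono_eval g m) \<and> a i \<le> m)"
    and bk: "kindep {..<l} bk" "\<And>k. k < l \<Longrightarrow> bk k \<in> LL (mult_div r e)"
  shows "kindep (inner_box n d b \<times> {..<l})
     (\<lambda>(\<mu>, k). bk k * (mono_eval g (\<mu> - a (base_poly \<mu>)) * mpoly_eval (R (base_poly \<mu>)) g))"
  unfolding kindep_def
proof (intro allI impI)
  let ?T = "inner_box n d b"
  define \<nu> where "\<nu> \<mu> = \<mu> - a (base_poly \<mu>)" for \<mu>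
  define Rm where "Rm \<mu> = R (base_poly \<mu>)" for \<mu>
  fix c assume c: "(\<Sum>j\<in>?T \<times> {..<l}. \<iota> (c j) * (case j of (\<mu>, k) \<Rightarrow>
      bk k * (mono_eval g (\<mu> - a (base_poly \<mu>)) * mpoly_eval (R (base_poly \<mu>)) g))) = 0"
  have Tfin: "finite ?T" using finite_mbox[of n d] by (auto simp: inner_box_def)
  have bp: "base_poly \<mu> < n" "a (base_poly \<mu>) \<in> mkeys (R (base_poly \<mu>))" if "\<mu> \<in> ?T" for \<mu>
    using base_poly[OF that] a by auto
  have shift: "\<nu> \<mu> + a (base_poly \<mu>) = \<mu>" "mkeys (\<nu> \<mu>) \<subseteq> {..<n}" "\<And>m. m \<in> mkeys (Rm \<mu>) \<Longrightarrow> \<nu> \<mu> + m \<in> mbox n d"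
    if "\<mu> \<in> ?T" for \<mu>
    using inner_box_shift[OF that bp(2)[OF that]] by (auto simp: \<nu>_def Rm_def)
  define em where "em \<mu> = (\<Sum>k<l. \<iota> (c (\<mu>, k)) * bk k)" for \<mu>
  have emL: "em \<mu> \<in> LL (mult_div r e)" for \<mu> unfolding em_def using bk(2) by (intro LL_sum LL_scale) auto
  have "0 = (\<Sum>\<mu>\<in>?T. \<Sum>k<l. \<iota> (c (\<mu>, k)) * (bk k * (mono_eval g (\<nu> \<mu>) * mpoly_eval (Rm \<mu>) g)))"
    using c by (subst sum.cartesian_product) (simp add: \<nu>_def Rm_def case_prod_unfold)
  also have "\<dots> = (\<Sum>\<mu>\<in>?T. em \<mu> * (mono_eval g (\<nu> \<mu>) * mpoly_eval (Rm \<mu>) g))"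
    by (simp add: em_def sum_distrib_right mult.assoc)
  also have "\<dots> = (\<Sum>\<mu>\<in>?T. \<Sum>m\<in>mkeys (Rm \<mu>). em \<mu> * mlookup (Rm \<mu>) m * mono_eval g (\<nu> \<mu> + m))"
    by (simp add: mono_eval_mult_mpoly_eval sum_distrib_left mult.assoc)
  also have "\<dots> = (\<Sum>\<mu>\<in>?T. \<Sum>m\<in>mkeys (Rm \<mu>). \<Sum>x\<in>mbox n d.
      (if \<nu> \<mu> + m = x then em \<mu> * mlookup (Rm \<mu>) m * mono_eval g x else 0))"
    using shift(3) finite_mbox[of n d] by (intro sum.cong refl) (auto simp: sum.delta)
  also have "\<dots> = (\<Sum>\<mu>\<in>?T. \<Sum>x\<in>mbox n d. \<Sum>m\<in>mkeys (Rm \<mu>).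
      (if \<nu> \<mu> + m = x then em \<mu> * mlookup (Rm \<mu>) m * mono_eval g x else 0))"
    by (intro sum.cong refl sum.swap)
  also have "\<dots> = (\<Sum>x\<in>mbox n d. \<Sum>\<mu>\<in>?T. \<Sum>m\<in>mkeys (Rm \<mu>).
      (if \<nu> \<mu> + m = x then em \<mu> * mlookup (Rm \<mu>) m * mono_eval g x else 0))"
    by (rule sum.swap)
  finally have rel: "(\<Sum>x\<in>mbox n d. \<Sum>\<mu>\<in>?T. \<Sum>m\<in>mkeys (Rm \<mu>).
      (if \<nu> \<mu> + m = x then em \<mu> * mlookup (Rm \<mu>) m * mono_eval g x else 0)) = 0" by simp
  \<comment> \<open>The coefficient of the monomial x after collecting terms. It lies in L((r + 1)
    e), the space over which the monomials of the box are assumed independent.\<close>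
  define cx where "cx x = (\<Sum>\<mu>\<in>?T. \<Sum>m\<in>mkeys (Rm \<mu>). if \<nu> \<mu> + m = x then em \<mu> * mlookup (Rm \<mu>) m else 0)" for x
  have "(\<Sum>x\<in>mbox n d. cx x * mono_eval g x) = 0"
    using rel by (simp add: cx_def sum_distrib_right if_distrib[of "\<lambda>y. y * _"] cong: if_cong)
  moreover have "cx x \<in> LL (mult_div (Suc r) e)" for x
    unfolding cx_def using LL_mult_div[OF emL R_coeff] bp(1) by (intro LL_sum) (auto simp: Rm_def LL_zero)
  ultimately have cx0: "cx x = 0" if "x \<in> mbox n d" for x using indep[of cx] that by blast
  have "em \<mu> = 0" if "\<mu> \<in> ?T" for \<mu>
  proof (rule ccontr)
    assume "em \<mu> \<noteq> 0"
    hence ne: "{\<mu> \<in> ?T. em \<mu> \<noteq> 0} \<noteq> {}" using that by blast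
    obtain \<mu>0 where \<mu>0: "\<mu>0 \<in> ?T" "em \<mu>0 \<noteq> 0" and min: "\<And>\<mu>. \<mu> \<in> ?T \<Longrightarrow> em \<mu> \<noteq> 0 \<Longrightarrow>
        p (mono_eval g \<mu>0) < p (mono_eval g \<mu>) \<or> (p (mono_eval g \<mu>0) = p (mono_eval g \<mu>) \<and> \<mu>0 \<le> \<mu>)"
      using ex_lexmin[OF _ ne, of "\<lambda>\<mu>. p (mono_eval g \<mu>)"] Tfin by auto
    have uniq: "\<mu> = \<mu>0 \<and> m = a (base_poly \<mu>0)"
      if \<mu>: "\<mu> \<in> ?T" "em \<mu> \<noteq> 0" and m: "m \<in> mkeys (Rm \<mu>)" and eq: "\<nu> \<mu> + m = \<mu>0" for \<mu> m
    proof -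
      let ?a = "a (base_poly \<mu>)"
      have mn: "mkeys m \<subseteq> {..<n}" "mkeys ?a \<subseteq> {..<n}"
        using R_vars[of "base_poly \<mu>"] bp[OF \<mu>(1)] m by (auto simp: vars_in_def Rm_def)
      have nz: "mono_eval g x \<noteq> 0" if "mkeys x \<subseteq> {..<n}" for x
        using mono_eval_S_unit[OF that g] by (simp add: S_unit_def)
      have "p (mono_eval g \<mu>) = p (mono_eval g (\<nu> \<mu>)) + p (mono_eval g ?a)"
        using shift(1,2)[OF \<mu>(1)] nz mn place_mult[OF p] mono_eval_add by metis
      moreover have "p (mono_eval g \<mu>0) = p (mono_eval g (\<nu> \<mu>)) + p (mono_eval g m)"
        using eq shift(2)[OF \<mu>(1)] nz mn place_mult[OF p] mono_eval_add by metis
      moreover have "p (mono_eval g ?a) < p (mono_eval g m) \<or> (p (mono_eval g ?a) = p (mono_eval g m) \<and> ?a \<le> m)"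
        using amin[OF bp(1)[OF \<mu>(1)]] m by (simp add: Rm_def)
      moreover note min[OF \<mu>]
      ultimately have "?a \<le> m" "\<mu>0 \<le> \<mu>" by auto
      moreover have "\<mu> = \<nu> \<mu> + ?a" using shift(1)[OF \<mu>(1)] by simp
      ultimately have "\<mu> \<le> \<mu>0" using add_left_mono[of ?a m "\<nu> \<mu>"] eq by simp
      hence "\<mu> = \<mu>0" using \<open>\<mu>0 \<le> \<mu>\<close> by simp
      moreover have "m = ?a" using eq shift(1)[OF \<mu>(1)] \<open>\<mu> = \<mu>0\<close> by (metis add_left_cancel)
      ultimately show ?thesis by simp
    qed
    have "cx \<mu>0 = (\<Sum>\<mu>\<in>?T. if \<mu> = \<mu>0 then em \<mu>0 * mlookup (Rm \<mu>0) (a (base_poly \<mu>0)) else 0)"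
      unfolding cx_def
    proof (intro sum.cong refl)
      fix \<mu> assume \<mu>: "\<mu> \<in> ?T"
      have "(\<Sum>m\<in>mkeys (Rm \<mu>). if \<nu> \<mu> + m = \<mu>0 then em \<mu> * mlookup (Rm \<mu>) m else 0)
          = (\<Sum>m\<in>mkeys (Rm \<mu>). if m = a (base_poly \<mu>0) then
              (if \<mu> = \<mu>0 then em \<mu>0 * mlookup (Rm \<mu>0) (a (base_poly \<mu>0)) else 0) else 0)"
      proof (intro sum.cong refl)
        fix m assume m: "m \<in> mkeys (Rm \<mu>)"
        show "(if \<nu> \<mu> + m = \<mu>0 then em \<mu> * mlookup (Rm \<mu>) m else 0)
          = (if m = a (base_poly \<mu>0) then (if \<mu> = \<mu>0 then em \<mu>0 * mlookup (Rm \<mu>0) (a (base_poly \<mu>0)) else 0) else 0)"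
        proof (cases "em \<mu> = 0")
          case True
          hence "\<mu> \<noteq> \<mu>0" using \<mu>0(2) by blast
          thus ?thesis using True by simp
        next
          case False
          show ?thesis
          proof (cases "\<nu> \<mu> + m = \<mu>0")
            case True
            show ?thesis using uniq[OF \<mu> False m True] True by simp
          next
            case F2: False
            have "\<not> (m = a (base_poly \<mu>0) \<and> \<mu> = \<mu>0)" using F2 shift(1)[OF \<mu>0(1)] by blast
            thus ?thesis using F2 by simp
          qed
        qed
      qed
      also have "\<dots> = (if \<mu> = \<mu>0 then em \<mu>0 * mlookup (Rm \<mu>0) (a (base_poly \<mu>0)) else 0)"
        using bp(2)[OF \<mu>] by (auto simp: sum.delta' Rm_def)
      finally show "(\<Sum>m\<in>mkeys (Rm \<mu>). if \<nu> \<mu> + m = \<mu>0 then em \<mu> * mlookup (Rm \<mu>) m else 0)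
          = (if \<mu> = \<mu>0 then em \<mu>0 * mlookup (Rm \<mu>0) (a (base_poly \<mu>0)) else 0)" .
    qed
    also have "\<dots> = em \<mu>0 * mlookup (Rm \<mu>0) (a (base_poly \<mu>0))" using Tfin \<mu>0(1) by (simp add: sum.delta')
    also have "\<dots> \<noteq> 0" using \<mu>0 bp(2)[OF \<mu>0(1)] by (simp add: Rm_def in_keys_iff)
    finally show False using cx0 \<mu>0(1) by (simp add: inner_box_def)
  qed
  hence "c (\<mu>, k) = 0" if "\<mu> \<in> ?T" "k < l" for \<mu> k
    using that kindepD[OF bk(1), of "\<lambda>k. c (\<mu>, k)" k] by (simp add: em_def)
  thus "\<forall>j\<in>?T \<times> {..<l}. c j = 0" by auto
qed

text \<open>Feeds \<open>gcd_core\<close>. Off S the eliminants inherit the common zeros of F(g) and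
  G(g) because R = A F + B G; in S the shifted eliminants realize the valuations of all monomials of
  the inner box. The dimension is at most that of all coefficients in L((r + 1) e) on the whole
  box.\<close>

theorem gcd_estimate:
  defines "l \<equiv> ell \<iota> (mult_div r e)" and "l' \<equiv> ell \<iota> (mult_div (Suc r) e)"
    and "\<kappa> \<equiv> card (mbox n d - inner_box n d b)"
  shows "\<exists>N::nat. int l * (int ((d + 1) ^ n) - int \<kappa>) \<le> int N \<and> N \<le> l' * (d + 1) ^ n \<and>
     int N * (\<Sum>p\<in>{p \<in> places \<iota> - S. gam p \<noteq> 0}. gam p)
       \<le> (int (l' * (d + 1) ^ n) - int l * int ((d + 1) ^ n) + 2 * int l * int \<kappa>) * (\<Sum>p\<in>S. int d * total_val n g p)
         + int N * (int (Suc r) * div_deg e) + int (N\<^sup>2 * loss_total)"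
proof -
  obtain Br where Br: "finite Br" "V.independent Br" "Br \<subseteq> LL (mult_div r e)" "card Br = l"
    using LL_basis[OF is_divisor_mult_div[OF e_div], of r] by (auto simp: l_def)
  obtain Br' where Br': "finite Br'" "V.span Br' = LL (mult_div (Suc r) e)" "card Br' = l'"
    using LL_basis[OF is_divisor_mult_div[OF e_div], of "Suc r"] by (auto simp: l'_def)
  obtain bk where bk: "bij_betw bk {..<l} Br"
    using ex_bij_betw_nat_finite[OF Br(1)] Br(4) by (auto simp: atLeast0LessThan)
  have kbk: "kindep {..<l} bk" using bk Br(2) by (subst kindep_iff) (auto simp: bij_betw_def)
  have bkB: "bk k \<in> Br" if "k < l" for k using bk that by (auto simp: bij_betw_def)
  define Hs where "Hs = (\<lambda>(\<beta>, \<mu>). \<beta> * mono_eval g \<mu>) ` (Br' \<times> mbox n d)"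
  have vR: "vge p (- mult_div (Suc r) e p + x) (\<beta> * (mono_eval g \<nu> * mpoly_eval (R i) g))"
    if p: "p \<in> places \<iota>" and \<beta>: "\<beta> \<in> LL (mult_div r e)" and i: "i < n"
      and x: "\<And>m. m \<in> mkeys (R i) \<Longrightarrow> x \<le> p (mono_eval g (\<nu> + m))" for p x \<beta> \<nu> i
  proof -
    have "vge p (- e p + x) (mono_eval g \<nu> * mpoly_eval (R i) g)"
      unfolding mono_eval_mult_mpoly_eval
    proof (intro vge_sum p vge_mult)
      fix m assume m: "m \<in> mkeys (R i)"
      show "vge p (- e p) (mlookup (R i) m)" using R_coeff[OF i] p by (auto simp: LL_iff)
      show "vge p x (mono_eval g (\<nu> + m))" using x[OF m] by (simp add: vge_def)
    qed
    moreover have "vge p (- mult_div r e p) \<beta>" using \<beta> p by (auto simp: LL_iff)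
    ultimately have "vge p (- mult_div r e p + (- e p + x)) (\<beta> * (mono_eval g \<nu> * mpoly_eval (R i) g))"
      by (rule vge_mult[OF p, rotated])
    moreover have "- mult_div r e p + (- e p + x) = - mult_div (Suc r) e p + x"
      by (simp add: mult_div_def algebra_simps)
    ultimately show ?thesis by metis
  qed
  have "\<exists>N::nat. int l * (int (card (mbox n d)) - int \<kappa>) \<le> int N \<and> N \<le> l' * (d + 1) ^ n \<and>
     int N * (\<Sum>p\<in>{p \<in> places \<iota> - S. gam p \<noteq> 0}. gam p)
       \<le> (int (l' * (d + 1) ^ n) - int l * int (card (mbox n d)) + 2 * int l * int \<kappa>) * (\<Sum>p\<in>S. int d * total_val n g p)
         + int N * div_deg (mult_div (Suc r) e) + int (N\<^sup>2 * loss_total)"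
  proof (rule gcd_core[where G = "mono_eval g" and Gen = "Gen Br" and Hs = Hs])
    show "finite (mbox n d)" by (rule finite_mbox)
    show "S_unit \<iota> S (mono_eval g \<mu>)" if "\<mu> \<in> mbox n d" for \<mu>
      by (rule mono_eval_S_unit[OF mbox_keys[OF that] g])
    have fin: "finite (Br \<times> (SIGMA i:{..<n}. {\<nu> \<in> mbox n d. \<forall>m\<in>mkeys (R i). \<nu> + m \<in> mbox n d}))"
      using Br finite_mbox[of n d] by auto
    thus "finite (Gen Br)" unfolding Gen_def by (rule finite_imageI)
    show "Gen Br \<subseteq> V.span Hs"
    proof
      fix x assume "x \<in> Gen Br"
      then obtain \<beta> i \<nu> where 1: "\<beta> \<in> Br" "i < n" "\<nu> \<in> mbox n d" "\<And>m. m \<in> mkeys (R i) \<Longrightarrow> \<nu> + m \<in> mbox n d"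
        "x = \<beta> * (mono_eval g \<nu> * mpoly_eval (R i) g)" by (rule GenE) (rule that)
      have "x = (\<Sum>m\<in>mkeys (R i). \<beta> * mlookup (R i) m * mono_eval g (\<nu> + m))"
        by (simp add: 1(5) mono_eval_mult_mpoly_eval sum_distrib_left mult.assoc)
      also have "\<dots> \<in> V.span Hs"
      proof (rule V.span_sum)
        fix m assume m: "m \<in> mkeys (R i)"
        have "\<beta> * mlookup (R i) m \<in> V.span Br'"
          using LL_mult_div[OF _ R_coeff[OF 1(2)]] Br(3) 1(1) by (auto simp: Br'(2))
        then obtain u where "\<beta> * mlookup (R i) m = (\<Sum>v\<in>Br'. \<iota> (u v) * v)" using V.span_finite[OF Br'(1)] by auto
        hence "\<beta> * mlookup (R i) m * mono_eval g (\<nu> + m) = (\<Sum>v\<in>Br'. \<iota> (u v) * (v * mono_eval g (\<nu> + m)))"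
          by (simp add: sum_distrib_right mult.assoc)
        also have "\<dots> \<in> V.span Hs"
          using 1(4)[OF m] by (intro V_span_sum V.span_base) (auto simp: Hs_def)
        finally show "\<beta> * mlookup (R i) m * mono_eval g (\<nu> + m) \<in> V.span Hs" .
      qed
      finally show "x \<in> V.span Hs" .
    qed
    show "finite Hs" using Br' finite_mbox[of n d] by (simp add: Hs_def)
    have "card Hs \<le> card (Br' \<times> mbox n d)" unfolding Hs_def using Br' finite_mbox[of n d] by (intro card_image_le) auto
    thus "card Hs \<le> l' * (d + 1) ^ n" using Br'(3) card_mbox[of n d] by (simp add: card_cartesian_product)
    have hs_E: "Hs \<subseteq> EE" unfolding Hs_def
      using LE Br'(2) V.span_base[of _ Br'] mono_eval_ksubring[OF E_ring mbox_keys gE] by (auto intro!: ksubringD(3)[OF E_ring])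
    thus "Gen Br \<subseteq> EE" using \<open>Gen Br \<subseteq> V.span Hs\<close> E_span by blast
    show "is_divisor \<iota> (mult_div (Suc r) e)" by (rule is_divisor_mult_div[OF e_div])
    show "mult_div (Suc r) e p \<ge> 0" for p using e_nonneg by (simp add: mult_div_def)
    show "finite {p \<in> places \<iota> - S. gam p \<noteq> 0}"
      by (rule finite_subset[OF _ finite_support[OF Fg_nz]]) (auto simp: gam_def)
    show "S \<noteq> {}" by (rule S_ne)
    fix p
    show "int d * total_val n g p \<ge> 0" using total_val_nonneg by simp
    show "vge p (- (int d * total_val n g p) - mult_div (Suc r) e p) x" if p: "p \<in> S" and x: "x \<in> Gen Br" for x
    proof -
      have pp: "p \<in> places \<iota>" using p S_places by auto
      from x obtain \<beta> i \<nu> where 1: "\<beta> \<in> Br" "i < n" "\<nu> \<in> mbox n d" "\<And>m. m \<in> mkeys (R i) \<Longrightarrow> \<nu> + m \<in> mbox n d"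
        "x = \<beta> * (mono_eval g \<nu> * mpoly_eval (R i) g)" by (rule GenE) (rule that)
      have bd: "- (int d * total_val n g p) \<le> p (mono_eval g (\<nu> + m))" if "m \<in> mkeys (R i)" for m
      proof -
        have "\<bar>p (mono_eval g (\<nu> + m))\<bar> \<le> int d * total_val n g p"
          by (rule place_mono_eval_bound[OF pp 1(4)[OF that]]) (rule g_nz)
        thus ?thesis by linarith
      qed
      have "vge p (- mult_div (Suc r) e p + (- (int d * total_val n g p))) x" unfolding 1(5)
        using bd 1(1,2) Br(3) by (intro vR pp) auto
      thus ?thesis by (elim vge_mono) simp
    qed
    show "\<bar>p (mono_eval g \<mu>)\<bar> \<le> int d * total_val n g p" if "p \<in> S" "\<mu> \<in> mbox n d" for \<mu>
      using that S_places by (intro place_mono_eval_bound g_nz) auto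
    show "vge p (gam p - mult_div (Suc r) e p) x" if p: "p \<in> places \<iota> - S" and x: "x \<in> Gen Br" for x
    proof -
      have pp: "p \<in> places \<iota>" using p by auto
      from x obtain \<beta> i \<nu> where 1: "\<beta> \<in> Br" "i < n" "\<nu> \<in> mbox n d" "\<And>m. m \<in> mkeys (R i) \<Longrightarrow> \<nu> + m \<in> mbox n d"
        "x = \<beta> * (mono_eval g \<nu> * mpoly_eval (R i) g)" by (rule GenE) (rule that)
      have z: "p (mono_eval g m) = 0" if "m \<in> mbox n d" for m
        by (rule S_unit_outside[OF mono_eval_S_unit[OF mbox_keys[OF that] g] p])
      show ?thesis
      \<comment> \<open>If the common order is 0, F(g) or G(g) may have a pole, so R = A F + B G
        gives nothing useful; the coefficients of R itself provide the bound.\<close>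
      proof (cases "gam p = 0")
        case True
        have "vge p (- mult_div (Suc r) e p + 0) x" unfolding 1(5)
          using z 1 Br(3) by (intro vR pp) auto
        thus ?thesis using True by simp
      next
        case False
        hence FG: "vge p (gam p) (mpoly_eval F g)" "vge p (gam p) (mpoly_eval G g)" by (auto simp: gam_def vge_def)
        have ev: "vge p (- e p) (mpoly_eval P g)" if P: "P \<in> vars_in {..<n}" "\<And>m. mlookup P m \<in> LL e" for P
          unfolding mpoly_eval_alt
        proof (rule vge_sum[OF pp])
          fix m assume "m \<in> mkeys P"
          hence "mkeys m \<subseteq> {..<n}" using P by (auto simp: vars_in_def)
          from mono_eval_S_unit[OF this g] have "p (mono_eval g m) = 0" using p by (rule S_unit_outside)
          moreover have "vge p (- e p) (mlookup P m)" using P(2) pp by (auto simp: LL_iff)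
          ultimately have "vge p (- e p + 0) (mlookup P m * mono_eval g m)" by (intro vge_mult pp) (auto simp: vge_def)
          thus "vge p (- e p) (mlookup P m * mono_eval g m)" by simp
        qed
        have "mpoly_eval (R i) g = mpoly_eval (A i) g * mpoly_eval F g + mpoly_eval (B i) g * mpoly_eval G g"
          by (simp flip: comb[OF 1(2)] add: mpoly_eval_add mpoly_eval_mult)
        also have "vge p (- e p + gam p) \<dots>"
          using ev A_vars B_vars A_coeff B_coeff 1(2) FG by (intro vge_add vge_mult pp) auto
        finally have vRi: "vge p (- e p + gam p) (mpoly_eval (R i) g)" .
        have "vge p (- mult_div r e p) \<beta>" using 1(1) Br(3) pp by (auto simp: LL_iff)
        moreover have "vge p 0 (mono_eval g \<nu>)" using z[OF 1(3)] by (simp add: vge_def)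
        ultimately have "vge p (- mult_div r e p + (0 + (- e p + gam p))) x" unfolding 1(5)
          by (intro vge_mult[OF pp _ vge_mult[OF pp _ vRi]])
        moreover have "- mult_div r e p + (0 + (- e p + gam p)) = gam p - mult_div (Suc r) e p"
          by (simp add: mult_div_def algebra_simps)
        ultimately show ?thesis by metis
      qed
    qed
    show "\<exists>T h. T \<subseteq> mbox n d \<and> card (mbox n d - T) \<le> \<kappa> \<and> kindep (T \<times> {..<l}) h \<and>
        (\<forall>\<mu>\<in>T. \<forall>k<l. h (\<mu>, k) \<in> Gen Br \<and> vge p (p (mono_eval g \<mu>) - mult_div (Suc r) e p) (h (\<mu>, k)))"
      if p: "p \<in> S"
    proof -
      have pp: "p \<in> places \<iota>" using p S_places by auto
      \<comment> \<open>The leading exponent of each eliminant depends on the place, which is why a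
        different basis is needed at every p in S.\<close>
      have "\<exists>a\<in>mkeys (R i). \<forall>m\<in>mkeys (R i). p (mono_eval g a) < p (mono_eval g m) \<or> (p (mono_eval g a) = p (mono_eval g m) \<and> a \<le> m)"
        if "i < n" for i using R_nz[OF that] by (intro ex_lexmin) auto
      then obtain a where a: "\<And>i. i < n \<Longrightarrow> a i \<in> mkeys (R i)" "\<And>i m. i < n \<Longrightarrow> m \<in> mkeys (R i) \<Longrightarrow>
          p (mono_eval g (a i)) < p (mono_eval g m) \<or> (p (mono_eval g (a i)) = p (mono_eval g m) \<and> a i \<le> m)" by metis
      define h where "h = (\<lambda>(\<mu>, k). bk k * (mono_eval g (\<mu> - a (base_poly \<mu>)) * mpoly_eval (R (base_poly \<mu>)) g))"
      have "kindep (inner_box n d b \<times> {..<l}) h" unfolding h_def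
        by (rule leading_family_indep[OF pp a kbk]) (use bkB Br(3) in auto)
      moreover have "h (\<mu>, k) \<in> Gen Br \<and> vge p (p (mono_eval g \<mu>) - mult_div (Suc r) e p) (h (\<mu>, k))"
        if \<mu>: "\<mu> \<in> inner_box n d b" and k: "k < l" for \<mu> k
      proof -
        let ?i = "base_poly \<mu>" let ?\<nu> = "\<mu> - a ?i"
        have i: "?i < n" "a ?i \<in> mkeys (R ?i)" using base_poly[OF \<mu>] a by auto
        note sh = inner_box_shift[OF \<mu> i(2)]
        have "mlookup ?\<nu> j \<le> mlookup \<mu> j" for j by (simp add: lookup_minus)
        moreover have "mlookup \<mu> j \<le> d" if "j < n" for j using \<mu> that by (auto simp: inner_box_def mbox_def)
        ultimately have "mlookup ?\<nu> j \<le> d" if "j < n" for j using that order_trans by blast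
        hence "?\<nu> \<in> mbox n d" using sh(2) by (simp add: mbox_def)
        hence 1: "h (\<mu>, k) \<in> Gen Br" unfolding Gen_def h_def using bkB[OF k] i sh(3)
          by (intro image_eqI[of _ _ "(bk k, ?i, ?\<nu>)"]) auto
        have nz: "mono_eval g x \<noteq> 0" if "mkeys x \<subseteq> {..<n}" for x
          using mono_eval_S_unit[OF that g] by (simp add: S_unit_def)
        have kR: "mkeys m \<subseteq> {..<n}" if "m \<in> mkeys (R ?i)" for m using R_vars[OF i(1)] that by (auto simp: vars_in_def)
        have pm: "p (mono_eval g (?\<nu> + m)) = p (mono_eval g ?\<nu>) + p (mono_eval g m)" if "m \<in> mkeys (R ?i)" for m
          unfolding mono_eval_add by (intro place_mult pp nz sh kR that)
        have "p (mono_eval g \<mu>) \<le> p (mono_eval g (?\<nu> + m))" if m: "m \<in> mkeys (R ?i)" for m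
          using pm[OF m] pm[OF i(2)] a(2)[OF i(1) m] unfolding sh(1) by auto
        hence "vge p (- mult_div (Suc r) e p + p (mono_eval g \<mu>)) (h (\<mu>, k))" unfolding h_def prod.case
          using bkB[OF k] Br(3) i by (intro vR pp) auto
        hence "vge p (p (mono_eval g \<mu>) - mult_div (Suc r) e p) (h (\<mu>, k))" by (elim vge_mono) simp
        thus ?thesis using 1 by blast
      qed
      ultimately show ?thesis
        by (intro exI[of _ "inner_box n d b"] exI[of _ h]) (auto simp: inner_box_def \<kappa>_def)
    qed
  qed
  thus ?thesis unfolding card_mbox div_deg_mult_div .
qed

end

section \<open>Bounds for the greatest common divisor\<close>

context gcd_setup
begin

text \<open>With x = d + 1 the relative defect in dimension is at most 2 K / x^2, while the
  monomials of the box have valuations of total size at most 2 n H x. The product 4 n K H / x is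
  small for large d.\<close>

lemma gcd_bound:
  assumes H: "\<And>i. i < n \<Longrightarrow> height \<iota> (g i) \<le> H" and H0: "H \<ge> 0"
    and growth: "div_deg e * int ((d + 1)\<^sup>2) \<le> int (ell \<iota> (mult_div r e))" "ell \<iota> (mult_div r e) \<ge> 1"
    and d_large: "8 * n\<^sup>2 * b\<^sup>2 \<le> (d + 1)\<^sup>2"
  shows "real_of_int (\<Sum>p\<in>{p \<in> places \<iota> - S. gam p \<noteq> 0}. gam p)
    \<le> 4 * real n * (1 + 8 * (real n)\<^sup>2 * (real b)\<^sup>2) / (real d + 1) * H + real (Suc r) * real_of_int (div_deg e)
      + real (ell \<iota> (mult_div (Suc r) e) * (d + 1) ^ n) * real loss_total"
proof -
  define l where "l = ell \<iota> (mult_div r e)"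
  define l' where "l' = ell \<iota> (mult_div (Suc r) e)"
  define \<kappa> where "\<kappa> = card (mbox n d - inner_box n d b)"
  define q where "q = (d + 1) ^ n"
  define \<Gamma> where "\<Gamma> = real_of_int (\<Sum>p\<in>{p \<in> places \<iota> - S. gam p \<noteq> 0}. gam p)"
  define K where "K = 1 + 8 * (real n)\<^sup>2 * (real b)\<^sup>2"
  define x where "x = real d + 1"
  have x: "x \<ge> 1" by (simp add: x_def)
  obtain N :: nat where N: "int l * (int q - int \<kappa>) \<le> int N" "N \<le> l' * q"
    and est: "int N * (\<Sum>p\<in>{p \<in> places \<iota> - S. gam p \<noteq> 0}. gam p)
       \<le> (int (l' * q) - int l * int q + 2 * int l * int \<kappa>) * (\<Sum>p\<in>S. int d * total_val n g p)
         + int N * (int (Suc r) * div_deg e) + int (N\<^sup>2 * loss_total)"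
    using gcd_estimate unfolding l_def[symmetric] l'_def[symmetric] \<kappa>_def[symmetric] q_def[symmetric] by blast
  have \<kappa>: "x\<^sup>2 * real \<kappa> \<le> 4 * (real n)\<^sup>2 * (real b)\<^sup>2 * real q"
  proof -
    have "real ((d + 1)\<^sup>2 * \<kappa>) \<le> real (n\<^sup>2 * (2 * b)\<^sup>2 * q)"
      using card_outside_inner_box[OF n, of d b] unfolding \<kappa>_def q_def by (simp only: of_nat_le_iff)
    thus ?thesis by (simp add: x_def power_mult_distrib algebra_simps)
  qed
  have l1: "real l \<ge> 1" using growth(2) by (simp add: l_def)
  have q0: "real q > 0" by (simp add: q_def)
  have "real (8 * n\<^sup>2 * b\<^sup>2) \<le> real ((d + 1)\<^sup>2)" using d_large by (simp only: of_nat_le_iff)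
  hence dl: "8 * (real n)\<^sup>2 * (real b)\<^sup>2 \<le> x\<^sup>2" by (simp add: x_def algebra_simps)
  have "x\<^sup>2 * real \<kappa> \<le> x\<^sup>2 * (real q / 2)"
  proof -
    have "4 * (real n)\<^sup>2 * (real b)\<^sup>2 * real q = 8 * (real n)\<^sup>2 * (real b)\<^sup>2 * (real q / 2)" by simp
    also have "\<dots> \<le> x\<^sup>2 * (real q / 2)" using dl by (intro mult_right_mono) auto
    finally show ?thesis using \<kappa> by linarith
  qed
  hence \<kappa>2: "real \<kappa> \<le> real q / 2" using x by (simp add: mult_le_cancel_left)
  have "real l * (real q - real \<kappa>) \<le> real N"
  proof -
    have "real_of_int (int l * (int q - int \<kappa>)) \<le> real_of_int (int N)" using N(1) by (simp only: of_int_le_iff)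
    thus ?thesis by simp
  qed
  moreover have "real l * (real q / 2) \<le> real l * (real q - real \<kappa>)" using \<kappa>2 by (intro mult_left_mono) auto
  \<comment> \<open>The assumption on d makes at least half of the box inner, so dividing the
    estimate by N costs only a factor 2.\<close>
  ultimately have Nge: "real l * real q \<le> 2 * real N" by simp
  have N0: "real N > 0"
  proof -
    have "0 < real l * real q" using l1 q0 by (intro mult_pos_pos) auto
    thus ?thesis using Nge by simp
  qed
  define \<Delta> where "\<Delta> = real_of_int (div_deg e)"
  have \<Delta>0: "\<Delta> \<ge> 0" unfolding \<Delta>_def using div_deg_nonneg[of e] e_nonneg by simp
  have "int l' \<le> int l + (div_deg (mult_div (Suc r) e) - div_deg (mult_div r e))" unfolding l_def l'_def
    by (intro ell_diff_le is_divisor_mult_div e_div) (simp add: mult_div_def e_nonneg mult_right_mono)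
  hence "int l' \<le> int l + div_deg e" by (simp add: div_deg_mult_div algebra_simps)
  hence "real_of_int (int l') \<le> real_of_int (int l + div_deg e)" by (simp only: of_int_le_iff)
  hence l'l: "real l' \<le> real l + \<Delta>" by (simp add: \<Delta>_def)
  have "real_of_int (div_deg e * int ((d + 1)\<^sup>2)) \<le> real_of_int (int l)"
    using growth(1) unfolding l_def by (simp only: of_int_le_iff)
  hence \<Delta>l: "\<Delta> * x\<^sup>2 \<le> real l" by (simp add: \<Delta>_def x_def algebra_simps)
  define Q where "Q = real l' * real q - real l * real q + 2 * real l * real \<kappa>"
  \<comment> \<open>Two sources of defect: passing from r e to (r + 1) e adds at most deg e per
    monomial, which is at most l / x^2 by the choice of r, and the monomials outside the inner box
    are a proportion O(1 / x^2).\<close>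
  have "x\<^sup>2 * Q \<le> real l * real q * K"
  proof -
    have "Q \<le> \<Delta> * real q + 2 * real l * real \<kappa>"
      using mult_right_mono[OF l'l, of "real q"] by (simp add: Q_def algebra_simps)
    hence "x\<^sup>2 * Q \<le> x\<^sup>2 * (\<Delta> * real q + 2 * real l * real \<kappa>)" by (intro mult_left_mono) auto
    also have "\<dots> = (\<Delta> * x\<^sup>2) * real q + 2 * real l * (x\<^sup>2 * real \<kappa>)" by (simp add: algebra_simps)
    also have "\<dots> \<le> real l * real q + 2 * real l * (4 * (real n)\<^sup>2 * (real b)\<^sup>2 * real q)"
      using \<Delta>l \<kappa> by (intro add_mono mult_right_mono mult_left_mono) auto
    also have "\<dots> = real l * real q * K" by (simp add: K_def algebra_simps)
    finally show ?thesis .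
  qed
  also have "real l * real q * K \<le> 2 * real N * K" using Nge by (intro mult_right_mono) (auto simp: K_def)
  finally have Q: "Q \<le> 2 * real N * K / x\<^sup>2" using x by (simp add: field_simps)
  define s where "s = real_of_int (\<Sum>p\<in>S. int d * total_val n g p)"
  have "s = real d * (\<Sum>i<n. real_of_int (\<Sum>p\<in>S. \<bar>p (g i)\<bar>))"
  proof -
    have "(\<Sum>p\<in>S. int d * total_val n g p) = int d * (\<Sum>i<n. \<Sum>p\<in>S. \<bar>p (g i)\<bar>)"
      unfolding total_val_def by (subst sum.swap) (simp add: sum_distrib_left)
    thus ?thesis by (simp add: s_def)
  qed
  also have "\<dots> = real d * (\<Sum>i<n. 2 * height \<iota> (g i))"
    using sum_abs_S_unit[OF S_places g] by simp
  also have "\<dots> \<le> real d * (\<Sum>i<n. 2 * H)" using H by (intro mult_left_mono sum_mono) auto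
  also have "\<dots> = real d * (2 * real n * H)" by simp
  also have "\<dots> \<le> x * (2 * real n * H)" using H0 by (intro mult_right_mono) (auto simp: x_def)
  finally have s: "s \<le> 2 * real n * H * x" by (simp add: mult.commute)
  have s0: "s \<ge> 0" unfolding s_def using total_val_nonneg by (simp add: sum_nonneg)
  have "real_of_int (int N * (\<Sum>p\<in>{p \<in> places \<iota> - S. gam p \<noteq> 0}. gam p)) \<le>
     real_of_int ((int (l' * q) - int l * int q + 2 * int l * int \<kappa>) * (\<Sum>p\<in>S. int d * total_val n g p)
         + int N * (int (Suc r) * div_deg e) + int (N\<^sup>2 * loss_total))"
    using est by (simp only: of_int_le_iff)
  hence "real N * \<Gamma> \<le> Q * s + real N * (real (Suc r) * \<Delta>) + (real N)\<^sup>2 * real loss_total"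
    by (simp add: \<Gamma>_def s_def Q_def \<Delta>_def)
  also have "Q * s \<le> (2 * real N * K / x\<^sup>2) * s" using Q s0 by (rule mult_right_mono)
  also have "\<dots> \<le> (2 * real N * K / x\<^sup>2) * (2 * real n * H * x)"
    using s by (rule mult_left_mono) (simp add: K_def)
  also have "\<dots> = real N * (4 * real n * K / x * H)" using x by (simp add: power2_eq_square field_simps)
  also have "(real N)\<^sup>2 * real loss_total \<le> real N * (real (l' * q) * real loss_total)"
  proof -
    have "real N * real loss_total \<le> real (l' * q) * real loss_total"
      using N(2) by (intro mult_right_mono) (simp_all only: of_nat_le_iff of_nat_0_le_iff)
    thus ?thesis by (simp add: power2_eq_square mult.assoc mult_left_mono)
  qed
  finally have "real N * \<Gamma> \<le> real N * (4 * real n * K / x * H + real (Suc r) * \<Delta> + real (l' * q) * real loss_total)"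
    by (simp add: algebra_simps)
  hence "\<Gamma> \<le> 4 * real n * K / x * H + real (Suc r) * \<Delta> + real (l' * q) * real loss_total"
    using N0 by (simp add: mult_le_cancel_left)
  thus ?thesis by (simp add: \<Gamma>_def K_def x_def \<Delta>_def l'_def q_def)
qed

end

context wronskian_setting
begin

lemma prod_powi_diff:
  assumes "\<And>i. i < n \<Longrightarrow> g i \<noteq> 0" "mkeys \<mu> \<subseteq> {..<n}" "mkeys \<mu>' \<subseteq> {..<n}"
  shows "(\<Prod>i<n. g i powi (int (mlookup \<mu> i) - int (mlookup \<mu>' i))) = mono_eval g \<mu> / mono_eval g \<mu>'"
  using assms by (simp add: mono_eval_superset[of "{..<n}"] power_int_diff prod_dividef)

text \<open>Written in the basis Br the relation becomes a dependence among the units \<beta>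
  g^\<mu>. Those with a fixed \<mu> are independent, so two different monomials have a ratio of
  small height, up to \<beta>' / \<beta> from a fixed finite set.\<close>

lemma dependent_monomials:
  assumes g: "\<And>i. i < n \<Longrightarrow> S_unit \<iota> S (g i) \<and> g i \<in> E"
    and Br: "finite Br" "V.independent Br" "\<And>\<beta>. \<beta> \<in> Br \<Longrightarrow> S_unit \<iota> S \<beta> \<and> \<beta> \<in> E"
    and c: "\<And>\<mu>. \<mu> \<in> mbox n d \<Longrightarrow> c \<mu> \<in> V.span Br" "(\<Sum>\<mu>\<in>mbox n d. c \<mu> * mono_eval g \<mu>) = 0"
      "\<not> (\<forall>\<mu>\<in>mbox n d. c \<mu> = 0)"
  shows "\<exists>ms::nat \<Rightarrow> int. (\<exists>i<n. ms i \<noteq> 0) \<and> (\<Sum>i<n. \<bar>ms i\<bar>) \<le> int (n * d) \<and>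
    height \<iota> (\<Prod>i<n. g i powi ms i) \<le> real (((d + 1) ^ n * card Br)\<^sup>2 * loss_total)
      + (\<Sum>\<beta>\<in>Br. \<Sum>\<beta>'\<in>Br. height \<iota> (\<beta>' / \<beta>))"
proof -
  define I where "I = mbox n d \<times> Br"
  have I: "finite I" "card I = (d + 1) ^ n * card Br"
    using finite_mbox[of n d] Br(1) by (auto simp: I_def card_cartesian_product card_mbox)
  define f where "f = (\<lambda>(\<mu>, \<beta>). \<beta> * mono_eval g \<mu>)"
  have mb: "mkeys \<mu> \<subseteq> {..<n}" if "\<mu> \<in> mbox n d" for \<mu> using that by (simp add: mbox_def)
  have mu: "S_unit \<iota> S (mono_eval g \<mu>)" "mono_eval g \<mu> \<in> E" if "\<mu> \<in> mbox n d" for \<mu>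
    using mono_eval_S_unit[OF mb[OF that]] mono_eval_ksubring[OF E_ring mb[OF that]] g by blast+
  have munz: "mono_eval g \<mu> \<noteq> 0" if "\<mu> \<in> mbox n d" for \<mu> using S_unit_nonzero[OF mu(1)[OF that]] .
  have fu: "f i \<in> E \<and> S_unit \<iota> S (f i)" if "i \<in> I" for i
    using that mu Br(3) by (auto simp: I_def f_def intro!: S_unit_mult ksubringD(3)[OF E_ring])
  have "\<exists>u. c \<mu> = (\<Sum>\<beta>\<in>Br. \<iota> (u \<beta>) * \<beta>)" if "\<mu> \<in> mbox n d" for \<mu>
    using c(1)[OF that] V.span_finite[OF Br(1)] by auto
  then obtain u where u: "\<And>\<mu>. \<mu> \<in> mbox n d \<Longrightarrow> c \<mu> = (\<Sum>\<beta>\<in>Br. \<iota> (u \<mu> \<beta>) * \<beta>)" by metis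
  have "\<not> kindep I f"
  proof
    assume k: "kindep I f"
    have "(\<Sum>i\<in>I. \<iota> (u (fst i) (snd i)) * f i) = (\<Sum>\<mu>\<in>mbox n d. \<Sum>\<beta>\<in>Br. \<iota> (u \<mu> \<beta>) * (\<beta> * mono_eval g \<mu>))"
      unfolding I_def by (subst sum.cartesian_product) (simp add: f_def case_prod_unfold)
    also have "\<dots> = (\<Sum>\<mu>\<in>mbox n d. c \<mu> * mono_eval g \<mu>)"
      by (intro sum.cong refl) (simp add: u sum_distrib_right mult.assoc)
    finally have "(\<Sum>i\<in>I. \<iota> (u (fst i) (snd i)) * f i) = 0" using c(2) by simp
    hence "u \<mu> \<beta> = 0" if "\<mu> \<in> mbox n d" "\<beta> \<in> Br" for \<mu> \<beta>
      using kindepD[OF k, of "\<lambda>i. u (fst i) (snd i)" "(\<mu>, \<beta>)"] that by (simp add: I_def)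
    hence "c \<mu> = 0" if "\<mu> \<in> mbox n d" for \<mu> using that by (simp add: u)
    thus False using c(3) by blast
  qed
  moreover have "kindep {i \<in> I. fst i = m} f" for m unfolding kindep_def
  proof (intro allI impI ballI)
    fix a i assume a: "(\<Sum>i\<in>{i \<in> I. fst i = m}. \<iota> (a i) * f i) = 0" and i: "i \<in> {i \<in> I. fst i = m}"
    hence m: "m \<in> mbox n d" by (auto simp: I_def)
    have "{i \<in> I. fst i = m} = (\<lambda>\<beta>. (m, \<beta>)) ` Br" using m by (auto simp: I_def)
    hence "(\<Sum>i\<in>{i \<in> I. fst i = m}. \<iota> (a i) * f i) = (\<Sum>\<beta>\<in>Br. \<iota> (a (m, \<beta>)) * (\<beta> * mono_eval g m))"
      by (simp add: sum.reindex inj_on_def f_def)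
    also have "\<dots> = (\<Sum>\<beta>\<in>Br. \<iota> (a (m, \<beta>)) * \<beta>) * mono_eval g m" by (simp add: sum_distrib_right mult.assoc)
    finally have "(\<Sum>\<beta>\<in>Br. \<iota> (a (m, \<beta>)) * \<beta>) = 0" using a munz[OF m] by simp
    moreover have "kindep Br (\<lambda>b. b)" using kindep_set_iff Br by blast
    ultimately have "\<forall>\<beta>\<in>Br. a (m, \<beta>) = 0" using kindepD[of Br "\<lambda>b. b" "\<lambda>\<beta>. a (m, \<beta>)"] by simp
    thus "a i = 0" using i by (auto simp: I_def)
  qed
  ultimately have "\<exists>i\<in>I. \<exists>j\<in>I. fst i \<noteq> fst j \<and> height \<iota> (f i / f j) \<le> real ((card I)\<^sup>2 * loss_total)"
    by (intro dependent_units_small_ratio[where f = f and cls = fst, OF I(1)] fu)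
  then obtain i j where ij: "i \<in> I" "j \<in> I" "fst i \<noteq> fst j"
    and h: "height \<iota> (f i / f j) \<le> real ((card I)\<^sup>2 * loss_total)" by blast
  obtain \<mu> \<beta> \<mu>' \<beta>' where i: "i = (\<mu>, \<beta>)" and j: "j = (\<mu>', \<beta>')" by (cases i, cases j)
  have M: "\<mu> \<in> mbox n d" "\<mu>' \<in> mbox n d" "\<beta> \<in> Br" "\<beta>' \<in> Br" "\<mu> \<noteq> \<mu>'" using ij i j by (auto simp: I_def)
  have nz: "\<beta> \<noteq> 0" "\<beta>' \<noteq> 0" using Br(3) M by (auto simp: S_unit_def)
  define ms where "ms i = int (mlookup \<mu> i) - int (mlookup \<mu>' i)" for i
  have "\<exists>i<n. ms i \<noteq> 0"
  proof (rule ccontr)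
    assume "\<not> ?thesis"
    hence "mlookup \<mu> i = mlookup \<mu>' i" if "i < n" for i using that unfolding ms_def by auto
    moreover have "mlookup \<mu> i = mlookup \<mu>' i" if "\<not> i < n" for i
    proof -
      have "i \<notin> mkeys \<mu>" "i \<notin> mkeys \<mu>'" using mb[OF M(1)] mb[OF M(2)] that by auto
      thus ?thesis by (simp add: in_keys_iff)
    qed
    ultimately have "mlookup \<mu> i = mlookup \<mu>' i" for i by blast
    thus False using M(5) poly_mapping_eqI by blast
  qed
  moreover have "(\<Sum>i<n. \<bar>ms i\<bar>) \<le> int (n * d)"
  proof -
    have "(\<Sum>i<n. \<bar>ms i\<bar>) \<le> (\<Sum>i<n. int d)" using M(1,2) by (intro sum_mono) (force simp: ms_def mbox_def)
    thus ?thesis by simp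
  qed
  moreover have "height \<iota> (\<Prod>i<n. g i powi ms i) \<le> real (((d + 1) ^ n * card Br)\<^sup>2 * loss_total)
      + (\<Sum>\<beta>\<in>Br. \<Sum>\<beta>'\<in>Br. height \<iota> (\<beta>' / \<beta>))"
  proof -
    have "(\<Prod>i<n. g i powi ms i) = mono_eval g \<mu> / mono_eval g \<mu>'"
      unfolding ms_def using g mb M by (intro prod_powi_diff) (auto simp: S_unit_def)
    also have "\<dots> = (f i / f j) * (\<beta>' / \<beta>)" using nz by (simp add: f_def i j)
    finally have "height \<iota> (\<Prod>i<n. g i powi ms i) \<le> height \<iota> (f i / f j) + height \<iota> (\<beta>' / \<beta>)"
      using height_mult_le[of "f i / f j" "\<beta>' / \<beta>"] nz munz M by (simp add: f_def i j)
    moreover have "height \<iota> (\<beta>' / \<beta>) \<le> (\<Sum>\<beta>'\<in>Br. height \<iota> (\<beta>' / \<beta>))"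
      using Br(1) M height_nonneg by (intro member_le_sum) auto
    moreover have "(\<Sum>\<beta>'\<in>Br. height \<iota> (\<beta>' / \<beta>)) \<le> (\<Sum>\<beta>\<in>Br. \<Sum>\<beta>'\<in>Br. height \<iota> (\<beta>' / \<beta>))"
      using Br(1) M height_nonneg by (intro member_le_sum sum_nonneg) auto
    ultimately show ?thesis using h I(2) by simp
  qed
  ultimately show ?thesis by blast
qed

text \<open>The sum of the terms of F(g) cannot vanish much deeper than its least term, and the
  constant term, a fixed coefficient, bounds the least order from above.\<close>

lemma proximity_bound:
  assumes F: "F \<in> vars_in {..<n}" "mlookup F 0 \<noteq> 0"
    and coeff: "\<And>m. m \<in> mkeys F \<Longrightarrow> S_unit \<iota> S (mlookup F m) \<and> mlookup F m \<in> E"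
    and g: "\<And>i. i < n \<Longrightarrow> S_unit \<iota> S (g i) \<and> g i \<in> E"
    and indep: "kindep (mkeys F) (\<lambda>m. mlookup F m * mono_eval g m)"
  shows "(\<Sum>p\<in>S. max 0 (p (mpoly_eval F g))) \<le> int ((card (mkeys F))\<^sup>2 * loss_total) + (\<Sum>p\<in>S. \<bar>p (mlookup F 0)\<bar>)"
proof -
  define f where "f m = mlookup F m * mono_eval g m" for m
  define Bs where "Bs = f ` mkeys F"
  have inj: "inj_on f (mkeys F)" and ind: "V.independent Bs"
    using kindep_iff[of "mkeys F" f] indep by (auto simp: f_def[abs_def] Bs_def)
  have k0: "0 \<in> mkeys F" using F(2) by (simp add: in_keys_iff)
  have kn: "mkeys m \<subseteq> {..<n}" if "m \<in> mkeys F" for m using F(1) that by (auto simp: vars_in_def)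
  have fu: "S_unit \<iota> S (f m)" "f m \<in> E" if "m \<in> mkeys F" for m
    using coeff[OF that] mono_eval_S_unit[OF kn[OF that]] mono_eval_ksubring[OF E_ring kn[OF that]] g
    unfolding f_def by (auto intro!: S_unit_mult ksubringD(3)[OF E_ring])
  have sum: "\<Sum>Bs = mpoly_eval F g" unfolding Bs_def using sum.reindex[OF inj, of "\<lambda>x. x"]
    by (simp add: mpoly_eval_alt f_def)
  have cB: "card Bs = card (mkeys F)" unfolding Bs_def by (rule card_image[OF inj])
  have fin: "finite Bs" by (simp add: Bs_def)
  have f0: "f 0 = mlookup F 0" by (simp add: f_def mono_eval_def)
  have Fnz: "mpoly_eval F g \<noteq> 0"
  proof
    assume "mpoly_eval F g = 0"
    hence "(\<Sum>m\<in>mkeys F. \<iota> 1 * (mlookup F m * mono_eval g m)) = 0" by (simp add: mpoly_eval_alt)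
    thus False using kindepD[OF indep, of "\<lambda>_. 1"] k0 by auto
  qed
  have "(\<Sum>p\<in>S. max 0 (p (mpoly_eval F g))) \<le> (\<Sum>p\<in>S. (p (\<Sum>Bs) - Min (p ` Bs)) + \<bar>p (mlookup F 0)\<bar>)"
  proof (rule sum_mono)
    fix p assume "p \<in> S"
    hence p: "p \<in> places \<iota>" using S_places by auto
    have le: "Min (p ` Bs) \<le> p x" if "x \<in> Bs" for x using that fin by simp
    have "f 0 \<in> Bs" using k0 by (simp add: Bs_def)
    hence "Min (p ` Bs) \<le> p (mlookup F 0)" using le f0 by metis
    moreover have "vge p (Min (p ` Bs)) (\<Sum>Bs)" using le by (intro vge_sum p) (auto simp: vge_def)
    hence "Min (p ` Bs) \<le> p (mpoly_eval F g)" using Fnz by (auto simp: vge_def sum)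
    ultimately show "max 0 (p (mpoly_eval F g)) \<le> (p (\<Sum>Bs) - Min (p ` Bs)) + \<bar>p (mlookup F 0)\<bar>"
      unfolding sum by linarith
  qed
  also have "\<dots> \<le> int ((card Bs)\<^sup>2 * loss_total) + (\<Sum>p\<in>S. \<bar>p (mlookup F 0)\<bar>)"
    unfolding sum.distrib
    by (rule add_right_mono, rule unit_sum_inequality[OF fin ind]) (use fu k0 in \<open>auto simp: Bs_def\<close>)
  finally show ?thesis by (simp add: cB)
qed

end

section \<open>Derivations with small loss\<close>

context curve
begin

text \<open>The successor accounts for the order lost in differentiating a function with a zero or a
  pole. At the remaining places only regularity has to be preserved, and nothing is lost.\<close>

definition loss_fun :: "(('K \<Rightarrow> int) \<Rightarrow> nat) \<Rightarrow> ('K \<Rightarrow> int) set \<Rightarrow> ('K \<Rightarrow> int) \<Rightarrow> nat" where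
  "loss_fun a S p = (if p \<in> S \<or> a p \<noteq> 0 then Suc (a p) else 0)"

lemma loss_fun_eq_0 [simp]: "loss_fun a S p = 0 \<longleftrightarrow> p \<notin> S \<and> a p = 0"
  by (simp add: loss_fun_def)

text \<open>The derivation is fixed before S. The finitely many places where it is singular
  contribute the constant C, and every other place of S contributes 1.\<close>

lemma general_setting:
  "\<exists>D a C. \<forall>S. finite S \<longrightarrow> S \<subseteq> places \<iota> \<longrightarrow>
     wronskian_setting \<iota> D UNIV S (loss_fun a S) \<and> wronskian_setting.loss_total \<iota> (loss_fun a S) \<le> C + card S"
proof -
  obtain D where D: "derivation D" using ex_derivation by blast
  obtain a :: "('K \<Rightarrow> int) \<Rightarrow> nat" where a: "finite {p \<in> places \<iota>. a p \<noteq> 0}"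
    "\<And>p f m. p \<in> places \<iota> \<Longrightarrow> vge p m f \<Longrightarrow> vge p (m - 1 - int (a p)) (D f)"
    "\<And>p f. p \<in> places \<iota> \<Longrightarrow> vge p 0 f \<Longrightarrow> vge p (- int (a p)) (D f)" using derivation_bounds[OF D] by blast
  define Z where "Z = {p \<in> places \<iota>. a p \<noteq> 0}"
  define C where "C = (\<Sum>p\<in>Z. Suc (a p))"
  have "wronskian_setting \<iota> D UNIV S (loss_fun a S) \<and> wronskian_setting.loss_total \<iota> (loss_fun a S) \<le> C + card S"
    if S: "finite S" "S \<subseteq> places \<iota>" for S
  proof
    show ws: "wronskian_setting \<iota> D UNIV S (loss_fun a S)"
    proof
      show "finite {p \<in> places \<iota>. loss_fun a S p \<noteq> 0}"
        by (rule finite_subset[of _ "Z \<union> S"]) (use a(1) S in \<open>auto simp: Z_def simp del: neq0_conv\<close>)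
      show "vge p (m - int (loss_fun a S p)) (D f)"
        if "p \<in> places \<iota>" "p \<in> S \<or> loss_fun a S p \<noteq> 0" "vge p m f" for p m f
      proof -
        have "p \<in> S \<or> a p \<noteq> 0" using that(2) by auto
        hence "loss_fun a S p = Suc (a p)" by (auto simp: loss_fun_def)
        thus ?thesis using a(2)[OF that(1,3)] by (simp add: algebra_simps)
      qed
      show "vge p 0 (D f)" if "p \<in> places \<iota> - S" "loss_fun a S p = 0" "vge p 0 f" for p f
        using a(3)[of p f] that by auto
    qed (use D S in \<open>auto simp: ksubring_def\<close>)
    have "wronskian_setting.loss_total \<iota> (loss_fun a S) = (\<Sum>p\<in>{p \<in> places \<iota>. loss_fun a S p \<noteq> 0}. loss_fun a S p)"
      by (rule wronskian_setting.loss_total_def[OF ws])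
    also have "\<dots> \<le> (\<Sum>p\<in>Z \<union> (S - Z). loss_fun a S p)"
      using a(1) S by (intro sum_mono2) (auto simp: Z_def simp del: neq0_conv)
    also have "\<dots> = (\<Sum>p\<in>Z. loss_fun a S p) + (\<Sum>p\<in>S - Z. loss_fun a S p)"
      using a(1) S by (intro sum.union_disjoint) (auto simp: Z_def)
    also have "(\<Sum>p\<in>Z. loss_fun a S p) = C" unfolding C_def by (intro sum.cong) (auto simp: Z_def loss_fun_def simp del: neq0_conv)
    also have "(\<Sum>p\<in>S - Z. loss_fun a S p) = card (S - Z)"
      using S by (subst sum.cong[of _ _ _ "\<lambda>_. 1"]) (auto simp: Z_def loss_fun_def simp del: neq0_conv)
    also have "C + card (S - Z) \<le> C + card S" using S by (simp add: card_mono)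
    finally show "wronskian_setting.loss_total \<iota> (loss_fun a S) \<le> C + card S" .
  qed
  thus ?thesis by blast
qed

lemma derivation_divide:
  assumes D: "derivation D" and y: "y \<noteq> 0" shows "D (x / y) = (D x * y - x * D y) / (y * y)"
proof -
  have "D x = D (x / y * y)" using y by simp
  also have "\<dots> = x / y * D y + y * D (x / y)" using D unfolding derivation_def by blast
  finally show ?thesis using y by (simp add: field_simps)
qed

text \<open>For two places, all \<open>S\<close>-units are constant multiples of powers of one of them, \<open>u\<close>, and on
  \<open>k(u)\<close> the derivation \<open>u d/du\<close> loses nothing at any place.\<close>

lemma two_point_setting:
  assumes S: "S \<subseteq> places \<iota>" "card S = 2" and f0: "S_unit \<iota> S f0" "f0 \<notin> range \<iota>"
  shows "\<exists>D E. wronskian_setting \<iota> D E S (\<lambda>_. 0) \<and> (\<forall>f. S_unit \<iota> S f \<longrightarrow> f \<in> E)"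
proof -
  have finS: "finite S" using S(2) by (intro card_ge_0_finite) simp
  obtain v v' where S2: "S = {v, v'}" "v \<noteq> v'" using S(2) by (auto simp: card_2_iff)
  have vp: "v \<in> places \<iota>" "v' \<in> places \<iota>" using S S2 by auto
  have opp: "v' f = - v f" if "S_unit \<iota> S f" for f
    using product_formula_S_unit[OF finS S(1) that] S2 by simp
  have const: "f \<in> range \<iota>" if f: "S_unit \<iota> S f" "v f = 0" for f
  proof (rule no_poles_const)
    fix p assume "p \<in> places \<iota>"
    thus "vge p 0 f" using f opp[OF f(1)] S2 S_unit_outside[OF f(1), of p] by (cases "p \<in> S") (auto simp: vge_def)
  qed
  have inv: "S_unit \<iota> S (1 / f)" if "S_unit \<iota> S f" for f
    using that by (auto simp: S_unit_def place_divide place_1)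
  have "v f0 \<noteq> 0" using const f0 by blast
  \<comment> \<open>The unit u has the least positive order at v. Division with remainder and the
    product formula, which determines the order at v', then make every S-unit a constant times a
    power of u.\<close>
  define P where "P k \<longleftrightarrow> k > 0 \<and> (\<exists>f. S_unit \<iota> S f \<and> v f = int k)" for k
  have "\<exists>k. P k"
  proof (cases "v f0 > 0")
    case True
    thus ?thesis unfolding P_def using f0(1) by (intro exI[of _ "nat (v f0)"]) auto
  next
    case False
    hence "v (1 / f0) = - v f0" using place_inverse[OF vp(1), of f0] by (simp add: inverse_eq_divide)
    thus ?thesis unfolding P_def using False \<open>v f0 \<noteq> 0\<close> inv[OF f0(1)] by (intro exI[of _ "nat (- v f0)"]) auto
  qed
  define k where "k = (LEAST k. P k)"
  have k: "P k" "\<And>j. P j \<Longrightarrow> k \<le> j" unfolding k_def using LeastI_ex[OF \<open>\<exists>k. P k\<close>] Least_le[of P] by blast+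
  obtain u where u: "S_unit \<iota> S u" "v u = int k" using k(1) by (auto simp: P_def)
  have k0: "k > 0" using k(1) by (simp add: P_def)
  have unz: "u \<noteq> 0" using u(1) S_unit_nonzero by blast
  have uS: "S_unit \<iota> S (u powi j)" for j
    using u(1) S_unit_power[OF u(1)] S_unit_power[OF inv[OF u(1)]] by (simp add: power_int_def inverse_eq_divide)
  have utr: "transc u" using place_nonconst[OF vp(1)] u(2) k0 by simp
  have gen: "\<exists>c j. f = \<iota> c * u powi j" if f: "S_unit \<iota> S f" for f
  proof -
    define j where "j = v f div int k"
    define h where "h = f * u powi (- j)"
    have hS: "S_unit \<iota> S h" unfolding h_def by (intro S_unit_mult f uS)
    have vh: "v h = v f mod int k"
      using place_mult[OF vp(1), of f "u powi (- j)"] S_unit_nonzero[OF f] unz place_powi[OF vp(1), of u "- j"] u(2)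
      by (simp add: h_def j_def minus_div_mult_eq_mod)
    have "v h = 0"
    proof (rule ccontr)
      assume "v h \<noteq> 0"
      moreover have "v h \<ge> 0" "v h < int k" using vh k0 by auto
      ultimately have "P (nat (v h))" unfolding P_def using hS by (intro conjI exI[of _ h]) auto
      hence "k \<le> nat (v h)" by (rule k(2))
      thus False using \<open>v h < int k\<close> \<open>v h \<ge> 0\<close> by linarith
    qed
    then obtain c where "h = \<iota> c" using const[OF hS] by blast
    moreover have "f = h * u powi j" using unz by (simp add: h_def power_int_minus field_simps)
    ultimately show ?thesis by blast
  qed
  obtain D where D: "derivation D" using ex_derivation by blast
  have Du: "D u \<noteq> 0" using D utr by (auto simp: derivation_def transc_iff)
  define \<theta> where "\<theta> f = u / D u * D f" for f
  have \<theta>: "derivation \<theta>" using D Du unz by (auto simp: derivation_def \<theta>_def algebra_simps)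
  have \<theta>u: "\<theta> u = u" using Du by (simp add: \<theta>_def)
  \<comment> \<open>This is the field k(u). The restriction to it is essential, since at places
    ramified over k(u) the derivation can produce poles from other functions of K.\<close>
  define E where "E = {x / y | x y. x \<in> range (ev u) \<and> y \<in> range (ev u) \<and> y \<noteq> 0}"
  note kr = ksubring_range_ev[of u]
  have EI: "x / y \<in> E" if "x \<in> range (ev u)" "y \<in> range (ev u)" "y \<noteq> 0" for x y using that unfolding E_def by blast
  have EE: "\<exists>x y. f = x / y \<and> x \<in> range (ev u) \<and> y \<in> range (ev u) \<and> y \<noteq> 0" if "f \<in> E" for f
    using that unfolding E_def by blast
  have one: "1 \<in> range (ev u)" using ksubringD(1)[OF kr, of 1] by simp
  have E_ring: "ksubring E" unfolding ksubring_def
  proof (intro conjI ballI subsetI)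
    show "x \<in> E" if "x \<in> range \<iota>" for x using EI[of x 1] one that ksubringD(1)[OF kr] by auto
    fix a b assume "a \<in> E" "b \<in> E"
    then obtain x y x' y' where 1: "a = x / y" "b = x' / y'" "x \<in> range (ev u)" "y \<in> range (ev u)" "y \<noteq> 0"
      "x' \<in> range (ev u)" "y' \<in> range (ev u)" "y' \<noteq> 0" using EE by meson
    have "a + b = (x * y' + x' * y) / (y * y')" using 1 by (simp add: field_simps)
    also have "\<dots> \<in> E" using 1 by (intro EI ksubringD[OF kr]) auto
    finally show "a + b \<in> E" .
    have "a * b = (x * x') / (y * y')" using 1 by simp
    also have "\<dots> \<in> E" using 1 by (intro EI ksubringD[OF kr]) auto
    finally show "a * b \<in> E" .
  qed
  have E_div: "a / b \<in> E" if ab: "a \<in> E" "b \<in> E" for a b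
  proof (cases "b = 0")
    case True
    thus ?thesis using ksubringD(1)[OF E_ring, of 0] by simp
  next
    case False
    obtain x y where 1: "b = x / y" "x \<in> range (ev u)" "y \<in> range (ev u)" "y \<noteq> 0" using EE[OF ab(2)] by blast
    have "x \<noteq> 0" using 1 False by auto
    hence "y / x \<in> E" using 1 by (intro EI) auto
    moreover have "a / b = a * (y / x)" using 1 by simp
    ultimately show ?thesis using ksubringD(3)[OF E_ring ab(1)] by metis
  qed
  have \<theta>range: "\<theta> (ev u q) \<in> range (ev u)" for q
  proof (induction q rule: pCons_induct)
    case 0
    have "\<theta> 0 = 0" by (simp add: \<theta>_def) (use D \<iota>_0 in \<open>metis derivation_def\<close>)
    thus ?case using ksubringD(1)[OF kr, of 0] by simp
  next
    case (pCons a q)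
    have "\<theta> (ev u (pCons a q)) = u * \<theta> (ev u q) + ev u q * u"
      using \<theta> \<theta>u by (simp add: ev_pCons derivation_def)
    also have "\<dots> \<in> range (ev u)"
      using pCons.IH gen_in_range_ev[of u] by (intro ksubringD(2,3)[OF kr]) auto
    finally show ?case .
  qed
  have E_\<theta>: "\<theta> a \<in> E" if aE: "a \<in> E" for a
  proof -
    obtain x y where 1: "a = x / y" "x \<in> range (ev u)" "y \<in> range (ev u)" "y \<noteq> 0" using EE[OF aE] by blast
    have r: "\<theta> x \<in> range (ev u)" "\<theta> y \<in> range (ev u)" using 1 \<theta>range by auto
    have "\<theta> x * y - x * \<theta> y = \<theta> x * y + \<iota> (-1) * (x * \<theta> y)" by (simp add: \<iota>_uminus)
    also have "\<dots> \<in> range (ev u)" using 1 r by (intro ksubringD[OF kr])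
    finally show ?thesis unfolding 1(1) derivation_divide[OF \<theta> 1(4)] using 1
      by (intro EI ksubringD(3)[OF kr]) auto
  qed
  \<comment> \<open>The order of \<theta> t for a uniformizer t can be read off from any w of
    nonzero order: up to the factor \<theta> t, \<theta> differentiates the series of w, and in
    characteristic 0 this lowers its order by exactly 1.\<close>
  have local_value: "p (\<theta> t) = p (\<theta> w) - p w + 1"
    if p: "p \<in> places \<iota>" and t: "t \<noteq> 0" "p t = 1" and w: "w \<noteq> 0" "p w \<noteq> 0" for p t w
  proof -
    define L where "L = laurent p t"
    have eq: "L (\<theta> w) = L (\<theta> t) * fls_deriv (L w)" unfolding L_def by (rule derivation_laurent[OF \<theta> p t])
    have sub: "x \<noteq> 0 \<Longrightarrow> fls_subdegree (L x) = p x" for x unfolding L_def by (rule subdegree_laurent[OF p t])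
    have "fls_subdegree (L w) \<noteq> 0" using sub w by simp
    hence dw: "fls_subdegree (fls_deriv (L w)) = p w - 1" using sub[OF w(1)] by (simp add: fls_subdegree_deriv)
    have "transc w" using place_nonconst[OF p w(2)] .
    hence nzw: "\<theta> w \<noteq> 0" using \<theta> by (auto simp: derivation_def transc_iff)
    have "transc t" using place_nonconst[OF p] t by simp
    hence nzt: "\<theta> t \<noteq> 0" using \<theta> by (auto simp: derivation_def transc_iff)
    have "L (\<theta> w) \<noteq> 0" "L (\<theta> t) \<noteq> 0" unfolding L_def using laurent_eq_0_iff[OF p t] nzw nzt by auto
    hence "fls_subdegree (L (\<theta> w)) = fls_subdegree (L (\<theta> t)) + fls_subdegree (fls_deriv (L w))"
      unfolding eq by (intro fls_subdegree_mult) auto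
    thus ?thesis using sub[OF nzw] sub[OF nzt] dw by simp
  qed
  have "wronskian_setting \<iota> \<theta> E S (\<lambda>_. 0)"
  proof
    show "derivation \<theta>" "ksubring E" "finite S" "S \<subseteq> places \<iota>" by fact+
    show "vge p (m - int 0) (\<theta> f)" if p: "p \<in> places \<iota>" "p \<in> S \<or> (0::nat) \<noteq> 0" and f: "vge p m f" for p m f
    proof -
      obtain t where t: "t \<noteq> 0" "p t = 1" using place_uniformizer[OF p(1)] by blast
      have "p u \<noteq> 0" using p(2) S2 opp[OF u(1)] u(2) k0 by auto
      hence "p (\<theta> t) = 1" using local_value[OF p(1) t unz] \<theta>u by simp
      hence "vge p 1 (\<theta> t)" by (simp add: vge_def)
      from derivation_local(1)[OF \<theta> p(1) t this f] show ?thesis by simp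
    qed
    show "vge p 0 (\<theta> f)" if p: "p \<in> places \<iota> - S" and f: "f \<in> E" "vge p 0 f" for p f
    proof -
      have pp: "p \<in> places \<iota>" using p by simp
      obtain t where t: "t \<noteq> 0" "p t = 1" using place_uniformizer[OF pp] by blast
      have pu: "p u = 0" using S_unit_outside[OF u(1) p] .
      obtain c where c: "vge p 1 (u - \<iota> c)" using residue_exists[OF pp, of u] pu by (auto simp: vge_def)
      define w where "w = u - \<iota> c"
      have w: "w \<noteq> 0" "vge p 1 w" using c utr by (auto simp: w_def transc_iff)
      have pw: "p w \<ge> 1" using w by (simp add: vge_def)
      have "\<theta> u = \<theta> (w + \<iota> c)" by (simp add: w_def)
      also have "\<dots> = \<theta> w" using \<theta> by (simp add: derivation_def)
      finally have "p (\<theta> t) = 1 - p w" using local_value[OF pp t w(1)] pw \<theta>u pu by simp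
      hence vt: "vge p (1 - p w) (\<theta> t)" by (simp add: vge_def)
      have uw: "u \<in> range (ev w)"
        using ksubringD(2)[OF ksubring_range_ev gen_in_range_ev ksubringD(1)[OF ksubring_range_ev], of w c] by (simp add: w_def)
      have dvd: "p w dvd p h" if h: "h \<in> E" "h \<noteq> 0" for h
      proof -
        obtain x y where 1: "h = x / y" "x \<in> range (ev u)" "y \<in> range (ev u)" "y \<noteq> 0" using EE[OF h(1)] by blast
        have "x \<in> range (ev w)" "y \<in> range (ev w)" "x \<noteq> 0" using 1 h ev_ksubring[OF ksubring_range_ev uw] by auto
        hence "p w dvd p x" "p w dvd p y" using range_ev_value[OF pp w] 1(4) by (metis dvd_triv_right)+
        thus ?thesis using 1 \<open>x \<noteq> 0\<close> by (simp add: place_divide[OF pp])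
      qed
      obtain c' where c': "vge p 1 (f - \<iota> c')" using residue_exists[OF pp f(2)] by blast
      have "f - \<iota> c' = f + \<iota> (- c')" by (simp add: \<iota>_uminus)
      hence fE: "f - \<iota> c' \<in> E" using ksubringD(2)[OF E_ring f(1) ksubringD(1)[OF E_ring]] by metis
      \<comment> \<open>Orders on k(u) at p are multiples of the ramification index p w, so
        subtracting the residue gains p w at once. Differentiation in t costs 1 and the factor
        \<theta> t has order 1 - p w, which leaves a regular function.\<close>
      have "vge p (p w) (f - \<iota> c')"
      proof (cases "f - \<iota> c' = 0")
        case False
        hence "p (f - \<iota> c') \<ge> 1" using c' by (simp add: vge_def)
        hence "p w \<le> p (f - \<iota> c')" using dvd[OF fE False] by (intro zdvd_imp_le) auto
        thus ?thesis by (simp add: vge_def)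
      qed simp
      from derivation_local(1)[OF \<theta> pp t vt this] have "vge p 0 (\<theta> (f - \<iota> c'))" by simp
      moreover have "\<theta> (f - \<iota> c' + \<iota> c') = \<theta> (f - \<iota> c') + \<theta> (\<iota> c')" "\<theta> (\<iota> c') = 0"
        using \<theta> unfolding derivation_def by blast+
      ultimately show ?thesis by simp
    qed
  qed (use E_div E_\<theta> in auto)
  moreover have "f \<in> E" if f: "S_unit \<iota> S f" for f
  proof -
    obtain c j where cj: "f = \<iota> c * u powi j" using gen[OF f] by blast
    have "u \<in> E" using EI[OF gen_in_range_ev one] by simp
    hence "u ^ i \<in> E" "1 / u ^ i \<in> E" for i
      using ksubring_power[OF E_ring] E_div[of 1] ksubringD(1)[OF E_ring, of 1] by auto
    hence "u powi j \<in> E" by (auto simp: power_int_def inverse_eq_divide power_one_over)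
    thus ?thesis unfolding cj by (intro ksubringD(3)[OF E_ring] ksubringD(1)[OF E_ring])
  qed
  ultimately show ?thesis by blast
qed

lemma gcd_ext_sum:
  assumes f: "f \<noteq> 0" and h: "h \<noteq> 0" and A: "A \<subseteq> places \<iota>"
  shows "ereal_of_enat (ext_sum (\<lambda>p. min (vzero p f) (vzero p h)) A)
    = ereal (real_of_int (\<Sum>p\<in>{p \<in> A. min (max 0 (p f)) (max 0 (p h)) \<noteq> 0}. min (max 0 (p f)) (max 0 (p h))))"
proof -
  define \<gamma> where "\<gamma> p = min (max 0 (p f)) (max 0 (p h))" for p :: "'K \<Rightarrow> int"
  have v: "min (vzero p f) (vzero p h) = enat (nat (\<gamma> p))" for p
    using f h by (simp add: vzero_def \<gamma>_def min_def nat_le_iff le_nat_iff)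
  have set: "{p \<in> A. enat (nat (\<gamma> p)) \<noteq> 0} = {p \<in> A. \<gamma> p \<noteq> 0}"
    by (auto simp: \<gamma>_def enat_0_iff)
  have fin: "finite {p \<in> A. \<gamma> p \<noteq> 0}"
    by (rule finite_subset[OF _ finite_support[OF f]]) (use A in \<open>auto simp: \<gamma>_def\<close>)
  have "ext_sum (\<lambda>p. min (vzero p f) (vzero p h)) A = (\<Sum>p\<in>{p \<in> A. \<gamma> p \<noteq> 0}. enat (nat (\<gamma> p)))"
    unfolding ext_sum_def v set using fin by simp
  also have "\<dots> = enat (\<Sum>p\<in>{p \<in> A. \<gamma> p \<noteq> 0}. nat (\<gamma> p))"
    using fin by (induction rule: finite_induct) (auto simp: zero_enat_def)
  also have "ereal_of_enat \<dots> = ereal (real_of_int (\<Sum>p\<in>{p \<in> A. \<gamma> p \<noteq> 0}. \<gamma> p))"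
    by (auto simp: \<gamma>_def intro!: sum.cong)
  finally show ?thesis by (simp add: \<gamma>_def)
qed

lemma mpoly_val_le: "m \<in> mkeys F \<Longrightarrow> mpoly_val p F \<le> p (mlookup F m)"
  unfolding mpoly_val_def by (intro Min_le) auto

lemma mpoly_height_nonneg: "mpoly_height \<iota> F \<ge> 0"
proof -
  have "(\<Sum>p\<in>{p\<in>places \<iota>. mpoly_val p F < 0}. mpoly_val p F) \<le> 0" by (rule sum_nonpos) auto
  thus ?thesis unfolding mpoly_height_def by linarith
qed

text \<open>A nonconstant coefficient has a pole. This is how the height term absorbs additive
  constants when F or G has nonconstant coefficients.\<close>

lemma mpoly_height_ge_1:
  assumes "\<not> const_coeffs F" shows "mpoly_height \<iota> F \<ge> 1"
proof -
  obtain m where m: "mlookup F m \<notin> range \<iota>" using assms by (auto simp: const_coeffs_def)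
  have mk: "m \<in> mkeys F" using m \<iota>_0 by (metis in_keys_iff rangeI)
  obtain p where p: "p \<in> places \<iota>" "p (mlookup F m) < 0" using ex_pole[of "mlookup F m"] m by (auto simp: transc_iff)
  let ?Z = "{p\<in>places \<iota>. mpoly_val p F < 0}"
  have "?Z \<subseteq> (\<Union>m\<in>mkeys F. {p \<in> places \<iota>. p (mlookup F m) \<noteq> 0})"
  proof
    fix q assume q: "q \<in> ?Z"
    have "mpoly_val q F \<in> (\<lambda>m. q (mlookup F m)) ` mkeys F" unfolding mpoly_val_def using mk by (intro Min_in) auto
    thus "q \<in> (\<Union>m\<in>mkeys F. {p \<in> places \<iota>. p (mlookup F m) \<noteq> 0})" using q by force
  qed
  moreover have "finite (\<Union>m\<in>mkeys F. {p \<in> places \<iota>. p (mlookup F m) \<noteq> 0})"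
    by (auto intro!: finite_support simp: in_keys_iff)
  ultimately have fin: "finite ?Z" using finite_subset by blast
  have pZ: "p \<in> ?Z" using p mpoly_val_le[OF mk, of p] by simp
  have "(\<Sum>p\<in>?Z. mpoly_val p F) = mpoly_val p F + (\<Sum>p\<in>?Z - {p}. mpoly_val p F)" by (rule sum.remove[OF fin pZ])
  moreover have "(\<Sum>p\<in>?Z - {p}. mpoly_val p F) \<le> 0" by (rule sum_nonpos) auto
  ultimately have "(\<Sum>p\<in>?Z. mpoly_val p F) \<le> - 1" using pZ by simp
  thus ?thesis unfolding mpoly_height_def by linarith
qed

end

section \<open>Uniform constants\<close>

context gcd_data
begin

text \<open>Two settings with the same derivation are used. The main estimate runs over S. The
  enlarged S' makes the coefficients of F and G and the basis Br units, as the inequalities for sums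
  of units require.\<close>

lemma gcd_dichotomy:
  assumes FG_box: "mkeys F \<subseteq> mbox n d" "mkeys G \<subseteq> mbox n d"
    and growth: "div_deg e * int ((d + 1)\<^sup>2) \<le> int (ell \<iota> (mult_div r e))" "ell \<iota> (mult_div r e) \<ge> 1"
    and d_large: "8 * n\<^sup>2 * b\<^sup>2 \<le> (d + 1)\<^sup>2"
    and Br: "finite Br" "V.independent Br" "V.span Br = LL (mult_div (Suc r) e)"
      "card Br = ell \<iota> (mult_div (Suc r) e)"
    and ws: "wronskian_setting \<iota> D EE S \<alpha>" and ws': "wronskian_setting \<iota> D EE S' \<alpha>'"
    and L: "real (wronskian_setting.loss_total \<iota> \<alpha>) \<le> L" "real (wronskian_setting.loss_total \<iota> \<alpha>') \<le> L"
    and S: "S \<subseteq> S'" "S \<noteq> {}"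
    and g: "\<And>i. i < n \<Longrightarrow> S_unit \<iota> S (g i)" and gE: "\<And>i. i < n \<Longrightarrow> g i \<in> EE"
    and LE: "LL (mult_div (Suc r) e) \<subseteq> EE"
    and Br_unit: "\<And>x. x \<in> Br \<Longrightarrow> S_unit \<iota> S' x"
    and F_unit: "\<And>m. m \<in> mkeys F \<Longrightarrow> S_unit \<iota> S' (mlookup F m)"
    and G_unit: "\<And>m. m \<in> mkeys G \<Longrightarrow> S_unit \<iota> S' (mlookup G m)"
    and H: "\<And>i. i < n \<Longrightarrow> height \<iota> (g i) \<le> H" "H \<ge> 0"
  defines "K \<equiv> real (ell \<iota> (mult_div (Suc r) e) * (d + 1) ^ n + ((d + 1) ^ n * ell \<iota> (mult_div (Suc r) e))\<^sup>2
      + (card (mkeys F))\<^sup>2 + (card (mkeys G))\<^sup>2)"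
    and "W \<equiv> real (Suc r) * real_of_int (div_deg e) + (\<Sum>\<beta>\<in>Br. \<Sum>\<beta>'\<in>Br. height \<iota> (\<beta>' / \<beta>))
      + 2 * height \<iota> (mlookup F 0) + 2 * height \<iota> (mlookup G 0)"
    and "T \<equiv> 4 * real n * (1 + 8 * (real n)\<^sup>2 * (real b)\<^sup>2) / (real d + 1) * H"
  shows "(\<exists>ms::nat \<Rightarrow> int. (\<exists>i<n. ms i \<noteq> 0) \<and> (\<Sum>i<n. \<bar>ms i\<bar>) \<le> int (n * d) \<and>
      height \<iota> (\<Prod>i<n. g i powi ms i) \<le> K * L + W) \<or>
    (ereal_of_enat (N_S_gcd \<iota> S (mpoly_eval F g) (mpoly_eval G g)) \<le> ereal (T + (K * L + W)) \<and>
     (mlookup F 0 \<noteq> 0 \<or> mlookup G 0 \<noteq> 0 \<longrightarrow>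
       ereal_of_enat (h_gcd \<iota> (mpoly_eval F g) (mpoly_eval G g)) \<le> ereal (T + (K * L + W))))"
proof -
  interpret Wr: wronskian_setting \<iota> D EE S \<alpha> by fact
  interpret Wr': wronskian_setting \<iota> D EE S' \<alpha>' by fact
  define l' where "l' = ell \<iota> (mult_div (Suc r) e)"
  define K1 K2 K3 K4 where "K1 = real (l' * (d + 1) ^ n)" and "K2 = real (((d + 1) ^ n * l')\<^sup>2)"
    and "K3 = real ((card (mkeys F))\<^sup>2)" and "K4 = real ((card (mkeys G))\<^sup>2)"
  define W1 W2 W3 W4 where "W1 = real (Suc r) * real_of_int (div_deg e)"
    and "W2 = (\<Sum>\<beta>\<in>Br. \<Sum>\<beta>'\<in>Br. height \<iota> (\<beta>' / \<beta>))"
    and "W3 = 2 * height \<iota> (mlookup F 0)" and "W4 = 2 * height \<iota> (mlookup G 0)"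
  have L0: "L \<ge> 0" using L(1) by (meson of_nat_0_le_iff order_trans)
  have K: "K = K1 + K2 + K3 + K4" "0 \<le> K1 * L" "0 \<le> K2 * L" "0 \<le> K3 * L" "0 \<le> K4 * L"
    using L0 by (simp_all add: K_def K1_def K2_def K3_def K4_def l'_def)
  have "W1 \<ge> 0" unfolding W1_def using div_deg_nonneg[of e] e_nonneg by simp
  moreover have "W2 \<ge> 0" unfolding W2_def by (intro sum_nonneg height_nonneg)
  moreover have "W3 \<ge> 0" "W4 \<ge> 0" using height_nonneg by (auto simp: W3_def W4_def)
  ultimately have W: "W = W1 + W2 + W3 + W4" "W1 \<ge> 0" "W2 \<ge> 0" "W3 \<ge> 0" "W4 \<ge> 0"
    by (simp_all add: W_def W1_def W2_def W3_def W4_def)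
  have KL: "K * L = K1 * L + K2 * L + K3 * L + K4 * L" by (simp add: K(1) algebra_simps)
  have lossS: "real (k * Wr.loss_total) \<le> real k * L" and lossS': "real (k * Wr'.loss_total) \<le> real k * L" for k
    using L by (simp_all add: mult_left_mono)
  have gS': "S_unit \<iota> S' (g i) \<and> g i \<in> EE" if "i < n" for i using S_unit_mono[OF g[OF that] S(1)] gE[OF that] by blast
  show ?thesis
  \<comment> \<open>A nontrivial relation among the monomials of the box produces the monomial of
    small height; without one, the assumptions of \<open>gcd_setup\<close> hold.\<close>
  proof (cases "\<forall>c. (\<forall>\<mu>\<in>mbox n d. c \<mu> \<in> LL (mult_div (Suc r) e)) \<longrightarrow>
        (\<Sum>\<mu>\<in>mbox n d. c \<mu> * mono_eval g \<mu>) = 0 \<longrightarrow> (\<forall>\<mu>\<in>mbox n d. c \<mu> = 0)")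
    case False
    then obtain c where c: "\<And>\<mu>. \<mu> \<in> mbox n d \<Longrightarrow> c \<mu> \<in> LL (mult_div (Suc r) e)"
      "(\<Sum>\<mu>\<in>mbox n d. c \<mu> * mono_eval g \<mu>) = 0" "\<not> (\<forall>\<mu>\<in>mbox n d. c \<mu> = 0)" by blast
    have BE: "S_unit \<iota> S' \<beta> \<and> \<beta> \<in> EE" if "\<beta> \<in> Br" for \<beta>
      using Br_unit[OF that] LE V.span_base[OF that] Br(3) by blast
    have cs: "c \<mu> \<in> V.span Br" if "\<mu> \<in> mbox n d" for \<mu> using c(1)[OF that] Br(3) by simp
    obtain ms :: "nat \<Rightarrow> int" where ms: "\<exists>i<n. ms i \<noteq> 0" "(\<Sum>i<n. \<bar>ms i\<bar>) \<le> int (n * d)"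
      and h: "height \<iota> (\<Prod>i<n. g i powi ms i) \<le> real (((d + 1) ^ n * card Br)\<^sup>2 * Wr'.loss_total) + W2"
      using Wr'.dependent_monomials[OF gS' Br(1,2) BE cs c(2,3)] unfolding W2_def by blast
    have "real (((d + 1) ^ n * card Br)\<^sup>2 * Wr'.loss_total) \<le> K2 * L"
      using lossS' unfolding K2_def l'_def Br(4) .
    hence "height \<iota> (\<Prod>i<n. g i powi ms i) \<le> K * L + W" using h K W KL by linarith
    thus ?thesis using ms by blast
  next
    case True
    interpret Q: gcd_setup \<iota> D EE S \<alpha> n b F G A B R e g d r
      by unfold_locales (use g gE LE True S(2) FG_box in blast)+
    define Fg Gg where "Fg = mpoly_eval F g" and "Gg = mpoly_eval G g"
    have nz: "Fg \<noteq> 0" "Gg \<noteq> 0" using Q.Fg_nz Q.Gg_nz by (simp_all add: Fg_def Gg_def)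
    have gam: "Q.gam p = min (max 0 (p Fg)) (max 0 (p Gg))" for p by (simp add: Q.gam_def Fg_def Gg_def)
    define M where "M = (\<Sum>p\<in>{p \<in> places \<iota> - S. Q.gam p \<noteq> 0}. Q.gam p)"
    have "real_of_int M \<le> T + W1 + real (l' * (d + 1) ^ n * Wr.loss_total)"
      using Q.gcd_bound[OF H growth d_large] unfolding M_def T_def W1_def l'_def by simp
    also have "\<dots> \<le> T + W1 + K1 * L" using lossS[of "l' * (d + 1) ^ n"] by (simp only: K1_def add_left_mono)
    finally have M: "real_of_int M \<le> T + W1 + K1 * L" .
    \<comment> \<open>Independence of the box also covers the terms of F and of G, so the proximity
      bound needs no further case distinction.\<close>
    have prox: "real_of_int (\<Sum>p\<in>S'. max 0 (p (mpoly_eval P g))) \<le> real ((card (mkeys P))\<^sup>2) * L + 2 * height \<iota> (mlookup P 0)"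
      if P: "P \<in> vars_in {..<n}" "mlookup P 0 \<noteq> 0" "mkeys P \<subseteq> mbox n d" and PL: "\<And>m. mlookup P m \<in> LL e"
        and PS: "\<And>m. m \<in> mkeys P \<Longrightarrow> S_unit \<iota> S' (mlookup P m)" for P
    proof -
      have PL': "mlookup P m \<in> LL (mult_div (Suc r) e)" for m using Q.e_le PL by blast
      have ind: "kindep (mkeys P) (\<lambda>m. mlookup P m * mono_eval g m)"
        unfolding kindep_def
      proof (intro allI impI ballI)
        fix a i assume a: "(\<Sum>i\<in>mkeys P. \<iota> (a i) * (mlookup P i * mono_eval g i)) = 0" and i: "i \<in> mkeys P"
        have "(\<Sum>\<mu>\<in>mbox n d. (\<iota> (a \<mu>) * mlookup P \<mu>) * mono_eval g \<mu>) = (\<Sum>\<mu>\<in>mkeys P. (\<iota> (a \<mu>) * mlookup P \<mu>) * mono_eval g \<mu>)"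
          using P(3) finite_mbox by (intro sum.mono_neutral_right) (auto simp: in_keys_iff)
        hence "(\<Sum>\<mu>\<in>mbox n d. (\<iota> (a \<mu>) * mlookup P \<mu>) * mono_eval g \<mu>) = 0" using a by (simp add: mult.assoc)
        hence "\<forall>\<mu>\<in>mbox n d. \<iota> (a \<mu>) * mlookup P \<mu> = 0" using LL_scale[OF PL'] by (intro Q.indep) auto
        hence "\<iota> (a i) * mlookup P i = 0" using i P(3) by blast
        thus "a i = 0" using i by (simp add: in_keys_iff)
      qed
      have co: "S_unit \<iota> S' (mlookup P m) \<and> mlookup P m \<in> EE" if "m \<in> mkeys P" for m using PS[OF that] PL' LE by blast
      have "(\<Sum>p\<in>S'. max 0 (p (mpoly_eval P g))) \<le> int ((card (mkeys P))\<^sup>2 * Wr'.loss_total) + (\<Sum>p\<in>S'. \<bar>p (mlookup P 0)\<bar>)"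
        by (rule Wr'.proximity_bound[OF P(1,2) co gS' ind])
      hence "real_of_int (\<Sum>p\<in>S'. max 0 (p (mpoly_eval P g))) \<le> real_of_int (int ((card (mkeys P))\<^sup>2 * Wr'.loss_total) + (\<Sum>p\<in>S'. \<bar>p (mlookup P 0)\<bar>))"
        by (simp only: of_int_le_iff)
      also have "\<dots> = real ((card (mkeys P))\<^sup>2 * Wr'.loss_total) + 2 * height \<iota> (mlookup P 0)"
        using sum_abs_S_unit[OF Wr'.S_places PS[of 0]] P(2) by (simp add: in_keys_iff)
      also have "\<dots> \<le> real ((card (mkeys P))\<^sup>2) * L + 2 * height \<iota> (mlookup P 0)" using lossS'[of "(card (mkeys P))\<^sup>2"] by simp
      finally show ?thesis .
    qed
    have "ereal_of_enat (N_S_gcd \<iota> S Fg Gg) = ereal (real_of_int M)"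
      unfolding N_S_gcd_def M_def gam by (rule gcd_ext_sum[OF nz]) auto
    moreover have "ereal_of_enat (h_gcd \<iota> Fg Gg) \<le> ereal (T + (K * L + W))" if 0: "mlookup F 0 \<noteq> 0 \<or> mlookup G 0 \<noteq> 0"
    proof -
      \<comment> \<open>The part of \<open>h_gcd\<close> over S is at most the vanishing of
        whichever of F(g), G(g) comes from a polynomial with nonzero constant term.\<close>
      have "(\<Sum>p\<in>S. Q.gam p) \<le> (\<Sum>p\<in>S'. Q.gam p)"
        using Wr'.S_places(1) S by (intro sum_mono2) (auto simp: gam)
      hence gS: "(\<Sum>p\<in>S. Q.gam p) \<le> (\<Sum>p\<in>S'. max 0 (p Fg))" "(\<Sum>p\<in>S. Q.gam p) \<le> (\<Sum>p\<in>S'. max 0 (p Gg))"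
        by (elim order_trans, intro sum_mono, simp add: gam)+
      have SM: "real_of_int (\<Sum>p\<in>S. Q.gam p) \<le> K3 * L + W3 + (K4 * L + W4)"
        using 0
      proof
        assume F0: "mlookup F 0 \<noteq> 0"
        have "real_of_int (\<Sum>p\<in>S. Q.gam p) \<le> real_of_int (\<Sum>p\<in>S'. max 0 (p Fg))" using gS(1) by (simp only: of_int_le_iff)
        also have "\<dots> \<le> K3 * L + W3" unfolding K3_def W3_def Fg_def
          by (rule prox[OF F_vars F0 FG_box(1) F_coeff F_unit])
        finally show ?thesis using K W by linarith
      next
        assume G0: "mlookup G 0 \<noteq> 0"
        have "real_of_int (\<Sum>p\<in>S. Q.gam p) \<le> real_of_int (\<Sum>p\<in>S'. max 0 (p Gg))" using gS(2) by (simp only: of_int_le_iff)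
        also have "\<dots> \<le> K4 * L + W4" unfolding K4_def W4_def Gg_def
          by (rule prox[OF G_vars G0 FG_box(2) G_coeff G_unit])
        finally show ?thesis using K W by linarith
      qed
      let ?Z = "{p \<in> places \<iota> - S. Q.gam p \<noteq> 0}"
      have finZ: "finite ?Z"
        by (rule finite_subset[OF _ finite_support[OF nz(1)]]) (auto simp: gam)
      have "(\<Sum>p\<in>{p \<in> places \<iota>. Q.gam p \<noteq> 0}. Q.gam p) = (\<Sum>p\<in>?Z \<union> S. Q.gam p)"
        using finZ Wr.S_places by (intro sum.mono_neutral_left) auto
      also have "\<dots> = M + (\<Sum>p\<in>S. Q.gam p)"
        unfolding M_def using finZ Wr.S_places(1) by (intro sum.union_disjoint) auto
      finally have "ereal_of_enat (h_gcd \<iota> Fg Gg) = ereal (real_of_int (M + (\<Sum>p\<in>S. Q.gam p)))"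
        using gcd_ext_sum[OF nz, of "places \<iota>"] unfolding h_gcd_def gam by simp
      also have "real_of_int (M + (\<Sum>p\<in>S. Q.gam p)) = real_of_int M + real_of_int (\<Sum>p\<in>S. Q.gam p)" by simp
      also have "ereal \<dots> \<le> ereal (T + (K * L + W))" unfolding ereal_less_eq using M SM K W KL by linarith
      finally show ?thesis .
    qed
    moreover have "real_of_int M \<le> T + (K * L + W)" using M K W KL by linarith
    ultimately show ?thesis unfolding Fg_def Gg_def by simp
  qed
qed

end

lemma exponents_bounded:
  fixes P :: "'i \<Rightarrow> 'K::zero mpoly_pm"
  assumes "finite I" shows "\<exists>b. \<forall>i\<in>I. \<forall>m\<in>mkeys (P i). \<forall>j. mlookup m j \<le> b"
proof -
  define Z where "Z = (\<Union>i\<in>I. \<Union>m\<in>mkeys (P i). mlookup m ` mkeys m)"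
  have "finite Z" using assms by (simp add: Z_def)
  then obtain b where b: "\<And>x. x \<in> Z \<Longrightarrow> x \<le> b" unfolding finite_nat_set_iff_bounded_le by auto
  have "mlookup m j \<le> b" if "i \<in> I" "m \<in> mkeys (P i)" for i m j
  proof (cases "j \<in> mkeys m")
    case True
    thus ?thesis using that by (intro b) (auto simp: Z_def)
  qed (simp add: in_keys_iff)
  thus ?thesis by blast
qed

context curve
begin

lemma poles_const: "poles (\<iota> c) = (\<lambda>_. 0)"
  by (rule ext) (simp add: poles_def place_const)

lemma height_const: "height \<iota> (\<iota> c) = 0"
  by (simp add: height_eq_poles poles_const div_deg_def)

lemma LL_trivial: "LL (\<lambda>_. 0) = range \<iota>"
proof
  show "LL (\<lambda>_. 0) \<subseteq> range \<iota>" using no_poles_const by (auto simp: LL_iff)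
  show "range \<iota> \<subseteq> LL (\<lambda>_. 0)" by (auto simp: LL_iff vge_def place_const)
qed

lemma kindep_powers:
  assumes "transc x" shows "kindep {..r} (\<lambda>j. x ^ j)" unfolding kindep_def
proof (intro allI impI ballI)
  fix c i assume c: "(\<Sum>j\<le>r. \<iota> (c j) * x ^ j) = 0" and i: "i \<in> {..r}"
  define q where "q = (\<Sum>j\<le>r. monom (c j) j)"
  have "ev x q = 0" using c by (simp add: q_def ev_sum ev_monom)
  hence "q = 0" using assms by (auto simp: transc_def)
  moreover have "coeff q i = c i" using i by (simp add: q_def coeff_sum)
  ultimately show "c i = 0" by simp
qed

lemma power_LL_mult_div:
  assumes "x \<in> LL e" shows "x ^ j \<in> LL (mult_div j e)"
proof (induction j)
  case 0
  show ?case by (auto simp: LL_iff mult_div_def vge_def place_1)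
next
  case (Suc j)
  show ?case using LL_mult_div[OF Suc assms] by (simp add: mult.commute)
qed

text \<open>All choices (eliminants, e, d, r, basis) are made before S and g are known, which makes
  the constants uniform. For constant coefficients e is zero and L((r + 1) e) is k, so the error
  reduces to K L and vanishes with the loss; E need not be all of K then.\<close>

lemma gcd_uniform_bound:
  assumes F: "F \<in> vars_in {..<n}" "F \<noteq> 0" and G: "G \<in> vars_in {..<n}" "G \<noteq> 0"
    and cop: "mpoly_coprime F G" and n: "n \<ge> 1" and \<epsilon>: "\<epsilon> > 0"
  obtains M :: nat and K W Z where "K \<ge> 0" "W \<ge> 0" "finite Z" "Z \<subseteq> places \<iota>"
    "const_coeffs F \<and> const_coeffs G \<Longrightarrow> W = 0 \<and> Z = {}"
    "\<And>D E S \<alpha> \<alpha>' L g H. wronskian_setting \<iota> D E S \<alpha> \<Longrightarrow> wronskian_setting \<iota> D E (S \<union> Z) \<alpha>' \<Longrightarrow>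
      real (wronskian_setting.loss_total \<iota> \<alpha>) \<le> L \<Longrightarrow> real (wronskian_setting.loss_total \<iota> \<alpha>') \<le> L \<Longrightarrow>
      S \<noteq> {} \<Longrightarrow> \<forall>i<n. S_unit \<iota> S (g i) \<and> g i \<in> E \<and> height \<iota> (g i) \<le> H \<Longrightarrow> H \<ge> 0 \<Longrightarrow>
      const_coeffs F \<and> const_coeffs G \<or> E = UNIV \<Longrightarrow>
      (\<exists>ms::nat \<Rightarrow> int. (\<exists>i<n. ms i \<noteq> 0) \<and> (\<Sum>i<n. \<bar>ms i\<bar>) \<le> int M \<and>
        height \<iota> (\<Prod>i<n. g i powi ms i) \<le> K * L + W) \<or>
      (ereal_of_enat (N_S_gcd \<iota> S (mpoly_eval F g) (mpoly_eval G g)) \<le> ereal (\<epsilon> / 2 * H + (K * L + W)) \<and>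
       (mlookup F 0 \<noteq> 0 \<or> mlookup G 0 \<noteq> 0 \<longrightarrow>
         ereal_of_enat (h_gcd \<iota> (mpoly_eval F g) (mpoly_eval G g)) \<le> ereal (\<epsilon> / 2 * H + (K * L + W))))"
proof -
  let ?const = "const_coeffs F \<and> const_coeffs G"
  obtain A B R where ABR: "\<And>i. i < n \<Longrightarrow> A i \<in> vars_in {..<n} \<and> B i \<in> vars_in {..<n} \<and> R i \<in> vars_in ({..<n} - {i}) \<and>
      R i \<noteq> 0 \<and> A i * F + B i * G = R i \<and> (?const \<longrightarrow> const_coeffs (A i) \<and> const_coeffs (B i) \<and> const_coeffs (R i))"
    using elimination_family[OF F(1) G(1) F(2) cop] by blast
  define Ps where "Ps = {F, G} \<union> A ` {..<n} \<union> B ` {..<n} \<union> R ` {..<n}"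
  have Ps: "finite Ps" "F \<in> Ps" "G \<in> Ps" "\<And>i. i < n \<Longrightarrow> A i \<in> Ps \<and> B i \<in> Ps \<and> R i \<in> Ps" by (auto simp: Ps_def)
  obtain b where b: "\<And>P m j. P \<in> Ps \<Longrightarrow> m \<in> mkeys P \<Longrightarrow> mlookup m j \<le> b"
    using exponents_bounded[OF Ps(1), of "\<lambda>P. P"] by blast
  define Cs where "Cs = (\<Union>P\<in>Ps. mlookup P ` mkeys P)"
  have finC: "finite Cs" using Ps(1) by (simp add: Cs_def)
  \<comment> \<open>The sum of the pole divisors of all coefficients of F, G, the cofactors and the
    eliminants.\<close>
  define e where "e p = (\<Sum>x\<in>Cs. poles x p)" for p
  have e_div: "is_divisor \<iota> e" unfolding e_def[abs_def] by (intro is_divisor_sum is_divisor_poles)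
  have e_nonneg: "e p \<ge> 0" for p unfolding e_def by (intro sum_nonneg poles_nonneg)
  have CsL: "x \<in> LL e" if x: "x \<in> Cs" for x unfolding LL_iff
  proof
    fix p assume p: "p \<in> places \<iota>"
    have "poles x p \<le> e p" unfolding e_def using x finC poles_nonneg by (intro member_le_sum) auto
    thus "vge p (- e p) x" using vge_poles[OF p, of x] by (elim vge_mono) simp
  qed
  have PsL: "mlookup P m \<in> LL e" if "P \<in> Ps" for P m
  proof (cases "m \<in> mkeys P")
    case True
    thus ?thesis using that by (intro CsL) (auto simp: Cs_def)
  qed (simp add: in_keys_iff LL_zero)
  have constP: "const_coeffs P" if ?const "P \<in> Ps" for P using that ABR by (auto simp: Ps_def)
  have const_e: "e = (\<lambda>_. 0)" if c: ?const
  proof -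
    have "poles x p = 0" if xC: "x \<in> Cs" for x p
    proof -
      obtain P m where "P \<in> Ps" "x = mlookup P m" using xC unfolding Cs_def by blast
      then obtain c where "x = \<iota> c" using constP[OF c] by (force simp: const_coeffs_def)
      thus ?thesis by (simp add: poles_const)
    qed
    thus ?thesis by (auto simp: e_def)
  qed
  interpret gcd_data \<iota> n b F G A B R e
    by unfold_locales (use n F G ABR Ps b PsL e_div e_nonneg in blast)+
  obtain d0 :: nat where d0: "real d0 \<ge> 8 * real n * (1 + 8 * (real n)\<^sup>2 * (real b)\<^sup>2) / \<epsilon>" using real_arch_simple by blast
  \<comment> \<open>The summand b puts all monomials of F and G into the box, the second makes most
    of the box inner, and d0 brings the main term below \<epsilon> / 2 times the height.\<close>
  define d where "d = b + 8 * n\<^sup>2 * b\<^sup>2 + d0"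
  have "8 * n\<^sup>2 * b\<^sup>2 \<le> (d + 1) ^ 1" by (simp add: d_def)
  also have "\<dots> \<le> (d + 1)\<^sup>2" by (rule power_increasing) auto
  finally have d_large: "8 * n\<^sup>2 * b\<^sup>2 \<le> (d + 1)\<^sup>2" .
  have box: "mkeys P \<subseteq> mbox n d" if "P \<in> Ps" "P \<in> vars_in {..<n}" for P
  proof
    fix m assume m: "m \<in> mkeys P"
    have "mlookup m j \<le> d" for j using b[OF that(1) m, of j] by (simp add: d_def)
    thus "m \<in> mbox n d" using m that(2) by (simp add: mbox_def vars_in_def)
  qed
  have \<epsilon>d: "4 * real n * (1 + 8 * (real n)\<^sup>2 * (real b)\<^sup>2) / (real d + 1) \<le> \<epsilon> / 2"
  proof -
    have "8 * real n * (1 + 8 * (real n)\<^sup>2 * (real b)\<^sup>2) \<le> \<epsilon> * real d0" using d0 \<epsilon> by (simp add: field_simps)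
    also have "\<dots> \<le> \<epsilon> * (real d + 1)" using \<epsilon> by (intro mult_left_mono) (simp_all add: d_def)
    finally show ?thesis by (simp add: field_simps)
  qed
  \<comment> \<open>A nonconstant coefficient x of one of the polynomials has the independent powers
    1, x, ..., x^r in L(r e), so the dimension there exceeds deg e (d + 1)^2. For constant
    coefficients deg e = 0 and the growth condition is trivial.\<close>
  define r where "r = nat (div_deg e * int ((d + 1)\<^sup>2))"
  have er_div: "is_divisor \<iota> (mult_div k e)" for k using is_divisor_mult_div[OF e_div] .
  have deg0: "div_deg e \<ge> 0" using div_deg_nonneg e_nonneg by blast
  have ell1: "ell \<iota> (mult_div r e) \<ge> 1"
  proof -
    have "x ^ 0 \<in> LL (mult_div 0 e)" if "x \<in> LL e" for x using power_LL_mult_div[OF that] .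
    hence "1 \<in> LL (mult_div 0 e)" using LL_zero[of e] by force
    hence "1 \<in> LL (mult_div r e)" using LL_mult_div_mono[of e 0 r] e_nonneg by blast
    moreover have "kindep {0::nat} (\<lambda>_. 1)" by (simp add: kindep_def)
    ultimately have "hasdim (LL (mult_div r e)) 1" using hasdim_family[of "{0::nat}" "\<lambda>_. 1"] by auto
    thus ?thesis by (rule le_ell[OF er_div])
  qed
  have growth: "div_deg e * int ((d + 1)\<^sup>2) \<le> int (ell \<iota> (mult_div r e))"
  proof (cases ?const)
    case True
    have "div_deg e = 0" using const_e[OF True] by (simp add: div_deg_def)
    thus ?thesis by simp
  next
    case False
    then obtain P m where P: "P \<in> Ps" "mlookup P m \<notin> range \<iota>" using Ps by (auto simp: const_coeffs_def)
    have "mlookup P m ^ j \<in> LL (mult_div r e)" if "j \<in> {..r}" for j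
      using power_LL_mult_div[OF PsL[OF P(1)], of m j] LL_mult_div_mono[of e j r] e_nonneg that by auto
    hence "hasdim (LL (mult_div r e)) (card {..r})"
      using P(2) by (intro hasdim_family[of _ "\<lambda>j. mlookup P m ^ j"] kindep_powers) (auto simp: transc_iff)
    hence "card {..r} \<le> ell \<iota> (mult_div r e)" by (rule le_ell[OF er_div])
    thus ?thesis using deg0 by (simp add: r_def)
  qed
  define l where "l = ell \<iota> (mult_div (Suc r) e)"
  obtain Br where Br: "finite Br" "V.independent Br" "Br \<subseteq> LL (mult_div (Suc r) e)" "V.span Br = LL (mult_div (Suc r) e)" "card Br = l"
    using LL_basis[OF er_div, of "Suc r"] unfolding l_def by blast
  have const_L: "LL (mult_div (Suc r) e) = range \<iota>" if ?const
    using const_e[OF that] LL_trivial by (simp add: mult_div_def[abs_def])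
  define U where "U = Br \<union> mlookup F ` mkeys F \<union> mlookup G ` mkeys G"
  have U0: "x \<noteq> 0" if "x \<in> U" for x using that V.dependent_zero Br(2) by (auto simp: U_def in_keys_iff)
  have constU: "x \<in> range \<iota>" if ?const "x \<in> U" for x
    using that Br(3) const_L unfolding U_def const_coeffs_def by blast
  \<comment> \<open>Adjoining these finitely many places to any S turns the coefficients and the
    basis elements into units. For constant data there are none.\<close>
  define Z where "Z = (\<Union>x\<in>U. {p \<in> places \<iota>. p x \<noteq> 0})"
  have Z: "finite Z" "Z \<subseteq> places \<iota>"
    unfolding Z_def using Br(1) finite_support[OF U0] by (auto simp: U_def)
  have UZ: "S_unit \<iota> (S \<union> Z) x" if "x \<in> U" for x S using that U0 by (auto simp: S_unit_def Z_def)
  define K where "K = real (l * (d + 1) ^ n + ((d + 1) ^ n * l)\<^sup>2 + (card (mkeys F))\<^sup>2 + (card (mkeys G))\<^sup>2)"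
  define W where "W = real (Suc r) * real_of_int (div_deg e) + (\<Sum>\<beta>\<in>Br. \<Sum>\<beta>'\<in>Br. height \<iota> (\<beta>' / \<beta>))
      + 2 * height \<iota> (mlookup F 0) + 2 * height \<iota> (mlookup G 0)"
  have W0: "W \<ge> 0" unfolding W_def using deg0 height_nonneg
    by (intro add_nonneg_nonneg sum_nonneg mult_nonneg_nonneg) auto
  have const: "W = 0 \<and> Z = {}" if c: ?const
  proof
    have "height \<iota> (\<beta>' / \<beta>) = 0" if "\<beta> \<in> Br" "\<beta>' \<in> Br" for \<beta> \<beta>'
    proof -
      obtain a a' where "\<beta> = \<iota> a" "\<beta>' = \<iota> a'" using constU[OF c] \<open>\<beta> \<in> Br\<close> \<open>\<beta>' \<in> Br\<close> unfolding U_def by blast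
      hence "\<beta>' / \<beta> = \<iota> (a' / a)" by (simp add: \<iota>_divide)
      thus ?thesis by (simp only: height_const)
    qed
    moreover have "height \<iota> (mlookup F 0) = 0" "height \<iota> (mlookup G 0) = 0"
      using c height_const by (auto simp: const_coeffs_def image_iff) (metis height_const)+
    moreover have "div_deg e = 0" using const_e[OF c] by (simp add: div_deg_def)
    ultimately show "W = 0" by (simp add: W_def)
    have "p x = 0" if "x \<in> U" "p \<in> places \<iota>" for x p using constU[OF c that(1)] place_const[OF that(2)] by auto
    thus "Z = {}" by (auto simp: Z_def)
  qed
  show thesis
  proof (rule that[of K W Z "n * d"])
    fix D E S \<alpha> \<alpha>' and L :: real and g H
    assume ws: "wronskian_setting \<iota> D E S \<alpha>" "wronskian_setting \<iota> D E (S \<union> Z) \<alpha>'"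
      and L: "real (wronskian_setting.loss_total \<iota> \<alpha>) \<le> L" "real (wronskian_setting.loss_total \<iota> \<alpha>') \<le> L"
      and S: "S \<noteq> {}" and g: "\<forall>i<n. S_unit \<iota> S (g i) \<and> g i \<in> E \<and> height \<iota> (g i) \<le> H" and H: "H \<ge> 0"
      and E: "?const \<or> E = UNIV"
    have "range \<iota> \<subseteq> E" using ws(1) unfolding wronskian_setting_def wronskian_setting_axioms_def ksubring_def by blast
    hence LE: "LL (mult_div (Suc r) e) \<subseteq> E" using E const_L by blast
    define T where "T = 4 * real n * (1 + 8 * (real n)\<^sup>2 * (real b)\<^sup>2) / (real d + 1) * H"
    have T: "T \<le> \<epsilon> / 2 * H" unfolding T_def using \<epsilon>d H by (rule mult_right_mono)
    have main: "(\<exists>ms::nat \<Rightarrow> int. (\<exists>i<n. ms i \<noteq> 0) \<and> (\<Sum>i<n. \<bar>ms i\<bar>) \<le> int (n * d) \<and>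
        height \<iota> (\<Prod>i<n. g i powi ms i) \<le> K * L + W) \<or>
      (ereal_of_enat (N_S_gcd \<iota> S (mpoly_eval F g) (mpoly_eval G g)) \<le> ereal (T + (K * L + W)) \<and>
       (mlookup F 0 \<noteq> 0 \<or> mlookup G 0 \<noteq> 0 \<longrightarrow>
         ereal_of_enat (h_gcd \<iota> (mpoly_eval F g) (mpoly_eval G g)) \<le> ereal (T + (K * L + W))))"
      unfolding K_def W_def T_def l_def
    proof (rule gcd_dichotomy[OF _ _ growth ell1 d_large Br(1,2,4) _ ws L _ S])
      show "mkeys F \<subseteq> mbox n d" "mkeys G \<subseteq> mbox n d" using box Ps F G by blast+
      show "card Br = ell \<iota> (mult_div (Suc r) e)" using Br(5) l_def by simp
    qed (use g H LE UZ in \<open>auto simp: U_def\<close>)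
    have "ereal (T + (K * L + W)) \<le> ereal (\<epsilon> / 2 * H + (K * L + W))" using T by simp
    thus "(\<exists>ms::nat \<Rightarrow> int. (\<exists>i<n. ms i \<noteq> 0) \<and> (\<Sum>i<n. \<bar>ms i\<bar>) \<le> int (n * d) \<and>
        height \<iota> (\<Prod>i<n. g i powi ms i) \<le> K * L + W) \<or>
      (ereal_of_enat (N_S_gcd \<iota> S (mpoly_eval F g) (mpoly_eval G g)) \<le> ereal (\<epsilon> / 2 * H + (K * L + W)) \<and>
       (mlookup F 0 \<noteq> 0 \<or> mlookup G 0 \<noteq> 0 \<longrightarrow>
         ereal_of_enat (h_gcd \<iota> (mpoly_eval F g) (mpoly_eval G g)) \<le> ereal (\<epsilon> / 2 * H + (K * L + W))))"
      using main order_trans by blast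
  qed (use W0 Z const in \<open>simp_all add: K_def\<close>)
qed

end

theorem theorem1p4:
  fixes \<iota> :: "'k::field_char_0 \<Rightarrow> 'K::field"
    and n :: nat and F G :: "'K mpoly_pm" and \<epsilon> :: real
  assumes "curve_function_field \<iota>"
    and "in_vars n F" and "in_vars n G"
    and "nonconstant F" and "nonconstant G"
    and "mpoly_coprime F G"
    and "\<epsilon> > 0"
  shows "\<exists>(m::int) (c1::real) c2 c3 c4. c1 > 0 \<and> c2 > 0 \<and> c3 > 0 \<and> c4 > 0 \<and>
    (\<forall>S (g::nat \<Rightarrow> 'K). S \<subseteq> places \<iota> \<longrightarrow> finite S \<longrightarrow> (\<forall>i<n. S_unit \<iota> S (g i)) \<longrightarrow>
      Max ((\<lambda>i. height \<iota> (g i)) ` {..<n}) \<ge>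
        c1 * (mpoly_height \<iota> F + mpoly_height \<iota> G)
        + c2 * max 0 (real_of_int (2 * genus \<iota> - 2 + int (card S))) \<longrightarrow>
      (\<exists>ms::nat \<Rightarrow> int. (\<exists>i<n. ms i \<noteq> 0) \<and> (\<Sum>i<n. \<bar>ms i\<bar>) \<le> 2 * m \<and>
          height \<iota> (\<Prod>i<n. g i powi ms i) \<le>
            c3 * (mpoly_height \<iota> F + mpoly_height \<iota> G)
            + c4 * max 0 (real_of_int (2 * genus \<iota> - 2 + int (card S))))
      \<or> (ereal_of_enat (N_S_gcd \<iota> S (mpoly_eval F g) (mpoly_eval G g))
            \<le> ereal (\<epsilon> * Max ((\<lambda>i. height \<iota> (g i)) ` {..<n})) \<and>
         ((Poly_Mapping.lookup F 0 \<noteq> 0 \<or> Poly_Mapping.lookup G 0 \<noteq> 0) \<longrightarrow>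
           ereal_of_enat (h_gcd \<iota> (mpoly_eval F g) (mpoly_eval G g))
            \<le> ereal (\<epsilon> * Max ((\<lambda>i. height \<iota> (g i)) ` {..<n})))))"
proof -
  interpret curve \<iota> by unfold_locales (rule assms(1))
  let ?const = "const_coeffs F \<and> const_coeffs G"
  have F: "F \<in> vars_in {..<n}" and G: "G \<in> vars_in {..<n}" using assms(2,3) by (simp_all add: in_vars_iff)
  have nz: "F \<noteq> 0" "G \<noteq> 0" using assms(4,5) by (auto simp: nonconstant_def)
  have n: "n \<ge> 1"
  proof (rule ccontr)
    assume "\<not> n \<ge> 1"
    hence "n = 0" by simp
    thus False using assms(2,4) by (auto simp: in_vars_def nonconstant_def)
  qed
  define h where "h = mpoly_height \<iota> F + mpoly_height \<iota> G"
  have h0: "h \<ge> 0" unfolding h_def using mpoly_height_nonneg by (intro add_nonneg_nonneg)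
  obtain M :: nat and K W Z where K: "K \<ge> 0" and W: "W \<ge> 0" and Z: "finite Z" "Z \<subseteq> places \<iota>"
    and constWZ: "?const \<Longrightarrow> W = 0 \<and> Z = {}"
    and bound: "\<And>D E S \<alpha> \<alpha>' L g H. wronskian_setting \<iota> D E S \<alpha> \<Longrightarrow> wronskian_setting \<iota> D E (S \<union> Z) \<alpha>' \<Longrightarrow>
      real (wronskian_setting.loss_total \<iota> \<alpha>) \<le> L \<Longrightarrow> real (wronskian_setting.loss_total \<iota> \<alpha>') \<le> L \<Longrightarrow>
      S \<noteq> {} \<Longrightarrow> (\<forall>i<n. S_unit \<iota> S (g i) \<and> g i \<in> E \<and> height \<iota> (g i) \<le> H) \<Longrightarrow> H \<ge> 0 \<Longrightarrow>
      ?const \<or> E = UNIV \<Longrightarrow>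
      (\<exists>ms::nat \<Rightarrow> int. (\<exists>i<n. ms i \<noteq> 0) \<and> (\<Sum>i<n. \<bar>ms i\<bar>) \<le> int M \<and>
        height \<iota> (\<Prod>i<n. g i powi ms i) \<le> K * L + W) \<or>
      (ereal_of_enat (N_S_gcd \<iota> S (mpoly_eval F g) (mpoly_eval G g)) \<le> ereal (\<epsilon> / 2 * H + (K * L + W)) \<and>
       (mlookup F 0 \<noteq> 0 \<or> mlookup G 0 \<noteq> 0 \<longrightarrow>
         ereal_of_enat (h_gcd \<iota> (mpoly_eval F g) (mpoly_eval G g)) \<le> ereal (\<epsilon> / 2 * H + (K * L + W))))"
    by (rule gcd_uniform_bound[OF F nz(1) G nz(2) assms(6) n assms(7)]) (rule that)
  obtain D a C where gen: "\<And>S. finite S \<Longrightarrow> S \<subseteq> places \<iota> \<Longrightarrow> wronskian_setting \<iota> D UNIV S (loss_fun a S) \<and>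
      wronskian_setting.loss_total \<iota> (loss_fun a S) \<le> C + card S" using general_setting by blast
  \<comment> \<open>Comes from L = C + |S| + |Z| together with |S| \<le> 3 X and 1 \<le> X, so that
    K L + W \<le> c X. The factor in c' below then makes c X at most \<epsilon> / 2 times the
    height.\<close>
  define c where "c = K * (real C + real (card Z) + 3) + W + 1"
  have c0: "c > 0" unfolding c_def using K W by (intro add_nonneg_pos add_nonneg_nonneg mult_nonneg_nonneg) auto
  define c' where "c' = 2 * c / \<epsilon>"
  have c'0: "c' > 0" using c0 assms(7) by (simp add: c'_def)
  \<comment> \<open>The added 1 leaves room for the single exponent 1 used when g 0 has height 0,
    even if M = 0.\<close>
  define m where "m = int M + 1"
  define H where "H g = Max ((\<lambda>i. height \<iota> (g i)) ` {..<n})" for g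
  define Y where "Y S = max 0 (real_of_int (2 * genus \<iota> - 2 + int (card S)))" for S :: "('K \<Rightarrow> int) set"
  have goal: "(\<exists>ms::nat \<Rightarrow> int. (\<exists>i<n. ms i \<noteq> 0) \<and> (\<Sum>i<n. \<bar>ms i\<bar>) \<le> 2 * m \<and>
          height \<iota> (\<Prod>i<n. g i powi ms i) \<le> c * h + c * Y S)
      \<or> (ereal_of_enat (N_S_gcd \<iota> S (mpoly_eval F g) (mpoly_eval G g)) \<le> ereal (\<epsilon> * H g) \<and>
         ((mlookup F 0 \<noteq> 0 \<or> mlookup G 0 \<noteq> 0) \<longrightarrow>
           ereal_of_enat (h_gcd \<iota> (mpoly_eval F g) (mpoly_eval G g)) \<le> ereal (\<epsilon> * H g)))"
    if S: "S \<subseteq> places \<iota>" "finite S" and g: "\<And>i. i < n \<Longrightarrow> S_unit \<iota> S (g i)" and large: "H g \<ge> c' * h + c' * Y S" for S g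
  \<comment> \<open>If g 0 has height 0 it is itself the required monomial. Otherwise its nonzero
    orders, which sum to 0 over S, force S to have at least two points.\<close>
  proof (cases "height \<iota> (g 0) = 0")
    case True
    define ms where "ms i = (if i = 0 then 1 else 0 :: int)" for i :: nat
    have "(\<Prod>i<n. g i powi ms i) = (\<Prod>i\<in>{0}. g i powi ms i)" using n
      by (intro prod.mono_neutral_right) (auto simp: ms_def)
    moreover have "(\<Sum>i<n. \<bar>ms i\<bar>) = (\<Sum>i\<in>{0}. \<bar>ms i\<bar>)" using n
      by (intro sum.mono_neutral_right) (auto simp: ms_def)
    moreover have "0 \<le> c * h + c * Y S" using c0 h0 by (simp add: Y_def)
    ultimately have "(\<exists>i<n. ms i \<noteq> 0) \<and> (\<Sum>i<n. \<bar>ms i\<bar>) \<le> 2 * m \<and> height \<iota> (\<Prod>i<n. g i powi ms i) \<le> c * h + c * Y S"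
      using n True by (auto simp: ms_def m_def intro!: exI[of _ 0])
    thus ?thesis by blast
  next
    case False
    have pf: "(\<Sum>p\<in>S. p (g 0)) = 0" and ab: "real_of_int (\<Sum>p\<in>S. \<bar>p (g 0)\<bar>) = 2 * height \<iota> (g 0)"
      using product_formula_S_unit[OF S(2,1)] sum_abs_S_unit[OF S(2,1)] g n by auto
    have card2: "card S \<ge> 2"
    proof (rule ccontr)
      assume "\<not> card S \<ge> 2"
      hence "card S = 0 \<or> card S = 1" by linarith
      hence "S = {} \<or> (\<exists>p. S = {p})" using S(2) by (auto simp: card_1_singleton_iff)
      thus False using pf ab False by auto
    qed
    define X where "X = h + Y S"
    have X0: "X \<ge> 0" using h0 by (simp add: X_def Y_def)
    have hH: "height \<iota> (g i) \<le> H g" if "i < n" for i unfolding H_def using that by (intro Max_ge) auto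
    have H0: "H g \<ge> 0" using hH[of 0] n height_nonneg[of "g 0"] by linarith
    have "\<exists>D E \<alpha> \<alpha>' L. wronskian_setting \<iota> D E S \<alpha> \<and> wronskian_setting \<iota> D E (S \<union> Z) \<alpha>' \<and>
      real (wronskian_setting.loss_total \<iota> \<alpha>) \<le> L \<and> real (wronskian_setting.loss_total \<iota> \<alpha>') \<le> L \<and>
      (\<forall>i<n. g i \<in> E) \<and> (?const \<or> E = UNIV) \<and> K * L + W \<le> c * X"
    \<comment> \<open>Here both error terms of the theorem can be zero, namely for genus 0, so L and
      W have to be zero as well.\<close>
    proof (cases "?const \<and> card S = 2")
      case True
      have "g 0 \<notin> range \<iota>" using False height_const by auto
      then obtain D E where ws: "wronskian_setting \<iota> D E S (\<lambda>_. 0)" and E: "\<And>f. S_unit \<iota> S f \<Longrightarrow> f \<in> E"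
        using two_point_setting[OF S(1) _ g[of 0]] True n by auto
      have "wronskian_setting.loss_total \<iota> (\<lambda>_. 0) = 0"
        using wronskian_setting.loss_total_def[OF ws] by simp
      moreover have "S \<union> Z = S" "W = 0" using constWZ True by auto
      moreover have "0 \<le> c * X" using c0 X0 by simp
      ultimately show ?thesis using ws E g True
        by (intro exI[of _ D] exI[of _ E] exI[of _ "\<lambda>_. 0"] exI[of _ "0::real"]) simp
    next
      case not2: False
      \<comment> \<open>Either the genus term is at least 1 because |S| \<ge> 3, or some coefficient
        is nonconstant and the height term is at least 1. The factor 3 comes from |S| \<le> Y S + 2
        and X \<ge> 1.\<close>
      have X1: "X \<ge> 1 \<and> real (card S) \<le> 3 * X"
      proof -
        have "real_of_int (int (card S) - 2) \<le> real_of_int (2 * genus \<iota> - 2 + int (card S))"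
          using genus_nonneg unfolding of_int_le_iff by linarith
        hence Y: "Y S \<ge> real (card S) - 2" by (simp add: Y_def)
        have "X \<ge> 1"
        proof (cases ?const)
          case True
          hence "card S \<ge> 3" using not2 card2 by auto
          hence "real (card S) \<ge> 3" by simp
          thus ?thesis using Y h0 by (simp add: X_def)
        next
          case False
          hence "mpoly_height \<iota> F \<ge> 1 \<or> mpoly_height \<iota> G \<ge> 1" using mpoly_height_ge_1 by blast
          hence "h \<ge> 1" unfolding h_def using mpoly_height_nonneg[of F] mpoly_height_nonneg[of G] by linarith
          thus ?thesis by (simp add: X_def Y_def)
        qed
        moreover have "Y S + 2 \<le> 3 * X" using \<open>X \<ge> 1\<close> h0 unfolding X_def by argo
        hence "real (card S) \<le> 3 * X" using Y by argo
        ultimately show ?thesis by blast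
      qed
      define L where "L = real C + real (card S) + real (card Z)"
      have SZ: "finite (S \<union> Z)" "S \<union> Z \<subseteq> places \<iota>" using S Z by auto
      have "card (S \<union> Z) \<le> card S + card Z" by (rule card_Un_le)
      hence "real (C + card S) \<le> L" "real (C + card (S \<union> Z)) \<le> L" by (simp_all add: L_def)
      hence L: "real (wronskian_setting.loss_total \<iota> (loss_fun a S)) \<le> L"
        "real (wronskian_setting.loss_total \<iota> (loss_fun a (S \<union> Z))) \<le> L"
        using gen[OF S(2,1)] gen[OF SZ] of_nat_mono order_trans by blast+
      have "(real C + real (card Z)) * 1 \<le> (real C + real (card Z)) * X" using X1 by (intro mult_left_mono) auto
      hence "L \<le> (real C + real (card Z) + 3) * X" using X1 by (simp add: L_def algebra_simps)
      hence "K * L \<le> K * ((real C + real (card Z) + 3) * X)" using K by (rule mult_left_mono)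
      moreover have "W * 1 \<le> W * X" using X1 W by (intro mult_left_mono) auto
      ultimately have "K * L + W \<le> c * X" using X0 by (simp add: c_def algebra_simps)
      thus ?thesis using gen[OF S(2,1)] gen[OF SZ] L by blast
    qed
    then obtain D E \<alpha> \<alpha>' L where ws: "wronskian_setting \<iota> D E S \<alpha>" "wronskian_setting \<iota> D E (S \<union> Z) \<alpha>'"
      and L: "real (wronskian_setting.loss_total \<iota> \<alpha>) \<le> L" "real (wronskian_setting.loss_total \<iota> \<alpha>') \<le> L"
      and E: "\<forall>i<n. g i \<in> E" "?const \<or> E = UNIV" and KL: "K * L + W \<le> c * X" by blast
    \<comment> \<open>The error term takes at most half of \<epsilon> times the height; the other
      half is the main term of the uniform bound.\<close>
    have "c * X = \<epsilon> / 2 * (c' * X)" using assms(7) by (simp add: c'_def)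
    also have "\<dots> \<le> \<epsilon> / 2 * H g" using large assms(7) by (intro mult_left_mono) (simp_all add: X_def algebra_simps)
    finally have "\<epsilon> / 2 * H g + (K * L + W) \<le> \<epsilon> * H g" using KL by simp
    hence e: "ereal (\<epsilon> / 2 * H g + (K * L + W)) \<le> ereal (\<epsilon> * H g)" by simp
    have KLX: "K * L + W \<le> c * h + c * Y S" using KL by (simp add: X_def algebra_simps)
    have gi: "\<forall>i<n. S_unit \<iota> S (g i) \<and> g i \<in> E \<and> height \<iota> (g i) \<le> H g" using g E(1) hH by blast
    have S_ne: "S \<noteq> {}" using card2 by auto
    from bound[OF ws L S_ne gi H0 E(2)] show ?thesis
    proof
      assume "\<exists>ms::nat \<Rightarrow> int. (\<exists>i<n. ms i \<noteq> 0) \<and> (\<Sum>i<n. \<bar>ms i\<bar>) \<le> int M \<and> height \<iota> (\<Prod>i<n. g i powi ms i) \<le> K * L + W"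
      then obtain ms :: "nat \<Rightarrow> int" where ms: "\<exists>i<n. ms i \<noteq> 0" "(\<Sum>i<n. \<bar>ms i\<bar>) \<le> int M"
        "height \<iota> (\<Prod>i<n. g i powi ms i) \<le> K * L + W" by blast
      have "int M \<le> 2 * m" by (simp add: m_def)
      thus ?thesis using ms(1) order_trans[OF ms(2)] order_trans[OF ms(3) KLX] by blast
    next
      assume "ereal_of_enat (N_S_gcd \<iota> S (mpoly_eval F g) (mpoly_eval G g)) \<le> ereal (\<epsilon> / 2 * H g + (K * L + W)) \<and>
       (mlookup F 0 \<noteq> 0 \<or> mlookup G 0 \<noteq> 0 \<longrightarrow>
         ereal_of_enat (h_gcd \<iota> (mpoly_eval F g) (mpoly_eval G g)) \<le> ereal (\<epsilon> / 2 * H g + (K * L + W)))"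
      thus ?thesis using order_trans[OF _ e] by blast
    qed
  qed
  show ?thesis
    by (rule exI[of _ m], rule exI[of _ c'], rule exI[of _ c'], rule exI[of _ c], rule exI[of _ c])
      (use c0 c'0 goal in \<open>simp add: h_def Y_def H_def\<close>)
qed

end
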